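(* Let $R$ be a commutative local ring with principal nonzero maximal ideal $\mathfrak{m}=(p)$ satisfying $\mathfrak{m}^2=0$, let $\mathscr{C}$ be the category of finitely generated free $R$-modules, let $n\geq3$ be an integer, and let $\Sigma\colon\mathscr{C}\to\mathscr{C}$ be the identity functor. For each unit $u\in R$, let $\mathscr{N}_u$ be the collection of all $n$-$\Sigma$-sequences in $\mathscr{C}$ isomorphic to a direct sum $C_\bullet\oplus F(p)_\bullet$, where $C_\bullet$ is a contractible candidate $n$-angle in $\mathscr{C}$, $F$ is a free module in $\mathscr{C}$, and $F(p)_\bullet$ is the $n$-$\Sigma$-sequence $$F\xrightarrow{up}F\xrightarrow{p}\cdots\xrightarrow{p}F\xrightarrow{p}\Sigma F$$ (first map multiplication by $up$, all other maps multiplication by $p$). Define an equivalence relation on the set of units in $R$ by $u\sim v$ if and only if $up=vp$. Then the assignment $[u]\mapsto\mathscr{N}_u$ is a bijective correspondence between the set of equivalence classes and the set of $n$-angulations of the suspended category $(\mathscr{C},\Sigma)$.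
   Context: Let $\mathscr{C}$ be an additive category with an automorphism $\Sigma\colon\mathscr{C}\to\mathscr{C}$, and let $n\geq 3$ be an integer. An $n$-$\Sigma$-sequence is a sequence $A_\bullet\colon A_1\xrightarrow{\alpha_1}A_2\xrightarrow{\alpha_2}\cdots\xrightarrow{\alpha_{n-1}}A_n\xrightarrow{\alpha_n}\Sigma A_1$ of objects and morphisms in $\mathscr{C}$. Its left rotation is $A_2\xrightarrow{\alpha_2}A_3\to\cdots\xrightarrow{\alpha_n}\Sigma A_1\xrightarrow{(-1)^n\Sigma\alpha_1}\Sigma A_2$. A morphism $\varphi\colon A_\bullet\to B_\bullet$ (where $B_\bullet$ has morphisms $\beta_i$) is a sequence $(\varphi_1,\dots,\varphi_n)$ of morphisms $\varphi_i\colon A_i\to B_i$ with $\varphi_{i+1}\alpha_i=\beta_i\varphi_i$ for $1\le i\le n$, where $\varphi_{n+1}:=\Sigma\varphi_1$; it is an isomorphism if all $\varphi_i$ are. A candidate $n$-angle is an $n$-$\Sigma$-sequence with $\alpha_2\alpha_1=0,\dots,\alpha_n\alpha_{n-1}=0$ and $(\Sigma\alpha_1)\alpha_n=0$. An $n$-$\Sigma$-sequence is contractible if its identity morphism is nullhomotopic, i.e. there are morphisms $\Theta_i\colon A_{i+1}\to A_i$ ($1\le i\le n$, $A_{n+1}:=\Sigma A_1$) with $1_{A_i}=\Theta_i\alpha_i+\alpha_{i-1}\Theta_{i-1}$ for $2\le i\le n$ and $1_{\Sigma A_1}=(\Sigma\Theta_1)(\Sigma\alpha_1)+\alpha_n\Theta_n$.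 A collection $\mathscr{N}$ of $n$-$\Sigma$-sequences is an $n$-angulation of $(\mathscr{C},\Sigma)$ if: (N1) (a) $\mathscr{N}$ is closed under direct sums, direct summands and isomorphisms of $n$-$\Sigma$-sequences; (b) for all $A\in\mathscr{C}$, the sequence $A\xrightarrow{1}A\to0\to\cdots\to0\to\Sigma A$ belongs to $\mathscr{N}$; (c) every morphism in $\mathscr{C}$ is the first morphism of some $n$-$\Sigma$-sequence in $\mathscr{N}$. (N2) An $n$-$\Sigma$-sequence belongs to $\mathscr{N}$ if and only if its left rotation does. (N3) Given $A_\bullet,B_\bullet\in\mathscr{N}$ and morphisms $\varphi_1\colon A_1\to B_1$, $\varphi_2\colon A_2\to B_2$ with $\varphi_2\alpha_1=\beta_1\varphi_1$, there exist $\varphi_3,\dots,\varphi_n$ such that $(\varphi_1,\dots,\varphi_n)$ is a morphism $A_\bullet\to B_\bullet$. (N4) In the situation of (N3), $\varphi_3,\dots,\varphi_n$ can be chosen such that the mapping cone $$A_2\oplus B_1\xrightarrow{\left[\begin{smallmatrix}-\alpha_2&0\\ \varphi_2&\beta_1\end{smallmatrix}\right]}A_3\oplus B_2\xrightarrow{\left[\begin{smallmatrix}-\alpha_3&0\\ \varphi_3&\beta_2\end{smallmatrix}\right]}\cdots\xrightarrow{\left[\begin{smallmatrix}-\alpha_n&0\\ \varphi_n&\beta_{n-1}\end{smallmatrix}\right]}\Sigma A_1\oplus B_n\xrightarrow{\left[\begin{smallmatrix}-\Sigma\alpha_1&0\\ \Sigma\varphi_1&\beta_n\end{smallmatrix}\right]}\Sigma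 A_2\oplus\Sigma B_1$$ belongs to $\mathscr{N}$.
   Formalization: The formal theorem additionally assumes that n is even or 2p = 0; for n odd and 2p ≠ 0 (e.g. R = Z/9, p = 3, n = 3) the collections N_u are not n-angulations, so the statement as written fails there. *)

theory Defs
  imports "HOL-Algebra.Module" "HOL-Algebra.Ideal_Product"
begin

section \<open>Additive categories with a suspension\<close>

text \<open>
  Only the data are recorded here. Arrows carry their domain and codomain, so equality of arrows
  is the equality of the category, and an object is never identified with an isomorphic one.
  \<open>SusOb\<close> and \<open>SusArr\<close> are the two halves of the functor \<open>\<Sigma>\<close>.
\<close>

record ('o, 'a) suspended_cat =
  Ob :: "'o set"
  Arr :: "'a set"
  Dom :: "'a \<Rightarrow> 'o"
  Cod :: "'a \<Rightarrow> 'o"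
  IdArr :: "'o \<Rightarrow> 'a"
  Comp :: "'a \<Rightarrow> 'a \<Rightarrow> 'a"  (infixl "\<bullet>\<index>" 75)
  ZeroArr :: "'o \<Rightarrow> 'o \<Rightarrow> 'a"
  AddArr :: "'a \<Rightarrow> 'a \<Rightarrow> 'a"  (infixl "\<boxplus>\<index>" 65)
  NegArr :: "'a \<Rightarrow> 'a"
  SusOb :: "'o \<Rightarrow> 'o"
  SusArr :: "'a \<Rightarrow> 'a"

definition Hom :: "('o, 'a, 'z) suspended_cat_scheme \<Rightarrow> 'o \<Rightarrow> 'o \<Rightarrow> 'a set"
  where "Hom C X Y = {f \<in> Arr C. Dom C f = X \<and> Cod C f = Y}"

definition iso_arr :: "('o, 'a, 'z) suspended_cat_scheme \<Rightarrow> 'a \<Rightarrow> bool"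
  where "iso_arr C f \<longleftrightarrow> f \<in> Arr C \<and>
    (\<exists>g \<in> Hom C (Cod C f) (Dom C f).
       g \<bullet>\<^bsub>C\<^esub> f = IdArr C (Dom C f) \<and> f \<bullet>\<^bsub>C\<^esub> g = IdArr C (Cod C f))"

definition zero_object :: "('o, 'a, 'z) suspended_cat_scheme \<Rightarrow> 'o \<Rightarrow> bool"
  where "zero_object C Z \<longleftrightarrow> Z \<in> Ob C \<and> IdArr C Z = ZeroArr C Z Z"

text \<open>\<open>P = X \<oplus> Y\<close> with injections \<open>i\<^sub>1, i\<^sub>2\<close> and projections \<open>p\<^sub>1, p\<^sub>2\<close>.\<close>

definition biproduct ::
    "('o, 'a, 'z) suspended_cat_scheme \<Rightarrow> 'o \<Rightarrow> 'o \<Rightarrow> 'o \<Rightarrow> 'a \<Rightarrow> 'a \<Rightarrow> 'a \<Rightarrow> 'a \<Rightarrow> bool"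
  where "biproduct C X Y P i1 i2 p1 p2 \<longleftrightarrow>
    i1 \<in> Hom C X P \<and> i2 \<in> Hom C Y P \<and> p1 \<in> Hom C P X \<and> p2 \<in> Hom C P Y \<and>
    p1 \<bullet>\<^bsub>C\<^esub> i1 = IdArr C X \<and> p2 \<bullet>\<^bsub>C\<^esub> i2 = IdArr C Y \<and>
    p1 \<bullet>\<^bsub>C\<^esub> i2 = ZeroArr C Y X \<and> p2 \<bullet>\<^bsub>C\<^esub> i1 = ZeroArr C X Y \<and>
    (i1 \<bullet>\<^bsub>C\<^esub> p1) \<boxplus>\<^bsub>C\<^esub> (i2 \<bullet>\<^bsub>C\<^esub> p2) = IdArr C P"


section \<open>Sequences\<close>

text \<open>
  An \<open>n\<close>-\<open>\<Sigma>\<close>-sequence is the family of its arrows \<open>\<alpha>\<^sub>1, \<dots>, \<alpha>\<^sub>n\<close>; the objects are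
  \<open>A\<^sub>i = dom \<alpha>\<^sub>i\<close>. The family is undefined outside \<open>{1..n}\<close> so that equality of sequences is
  equality of functions. Every family indexed by \<open>{1..n}\<close> is continued by
  \<open>x\<^bsub>i+n\<^esub> = \<Sigma> x\<^sub>i\<close>; this one rule yields the conventions \<open>A\<^bsub>n+1\<^esub> = \<Sigma> A\<^sub>1\<close>,
  \<open>A\<^bsub>n+2\<^esub> = \<Sigma> A\<^sub>2\<close>, \<open>\<alpha>\<^bsub>n+1\<^esub> = \<Sigma> \<alpha>\<^sub>1\<close>, \<open>\<phi>\<^bsub>n+1\<^esub> = \<Sigma> \<phi>\<^sub>1\<close> and
  \<open>\<Theta>\<^bsub>n+1\<^esub> = \<Sigma> \<Theta>\<^sub>1\<close>, and is never used beyond index \<open>n + 2\<close>.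
\<close>

definition cont :: "('o, 'a, 'z) suspended_cat_scheme \<Rightarrow> nat \<Rightarrow> (nat \<Rightarrow> 'a) \<Rightarrow> nat \<Rightarrow> 'a"
  where "cont C n x i = (if i \<le> n then x i else SusArr C (x (i - n)))"

definition obj :: "('o, 'a, 'z) suspended_cat_scheme \<Rightarrow> nat \<Rightarrow> (nat \<Rightarrow> 'a) \<Rightarrow> nat \<Rightarrow> 'o"
  where "obj C n \<alpha> i = (if i \<le> n then Dom C (\<alpha> i) else SusOb C (Dom C (\<alpha> (i - n))))"

definition n_sequences :: "('o, 'a, 'z) suspended_cat_scheme \<Rightarrow> nat \<Rightarrow> (nat \<Rightarrow> 'a) set"
  where "n_sequences C n =
    {\<alpha> \<in> extensional {1..n}. \<forall>i \<in> {1..n}. \<alpha> i \<in> Hom C (obj C n \<alpha> i) (obj C n \<alpha> (i + 1))}"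

definition left_rotation ::
    "('o, 'a, 'z) suspended_cat_scheme \<Rightarrow> nat \<Rightarrow> (nat \<Rightarrow> 'a) \<Rightarrow> (nat \<Rightarrow> 'a)"
  where "left_rotation C n \<alpha> = (\<lambda>i \<in> {1..n}.
    if i < n then \<alpha> (i + 1)
    else if even n then SusArr C (\<alpha> 1) else NegArr C (SusArr C (\<alpha> 1)))"

definition seq_morphism ::
    "('o, 'a, 'z) suspended_cat_scheme \<Rightarrow> nat \<Rightarrow> (nat \<Rightarrow> 'a) \<Rightarrow> (nat \<Rightarrow> 'a) \<Rightarrow> (nat \<Rightarrow> 'a) \<Rightarrow> bool"
  where "seq_morphism C n \<alpha> \<beta> \<phi> \<longleftrightarrow>
    (\<forall>i \<in> {1..n}. \<phi> i \<in> Hom C (obj C n \<alpha> i) (obj C n \<beta> i)) \<and>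
    (\<forall>i \<in> {1..n}. cont C n \<phi> (i + 1) \<bullet>\<^bsub>C\<^esub> \<alpha> i = \<beta> i \<bullet>\<^bsub>C\<^esub> \<phi> i)"

definition seq_iso ::
    "('o, 'a, 'z) suspended_cat_scheme \<Rightarrow> nat \<Rightarrow> (nat \<Rightarrow> 'a) \<Rightarrow> (nat \<Rightarrow> 'a) \<Rightarrow> bool"
  where "seq_iso C n \<alpha> \<beta> \<longleftrightarrow>
    (\<exists>\<phi>. seq_morphism C n \<alpha> \<beta> \<phi> \<and> (\<forall>i \<in> {1..n}. iso_arr C (\<phi> i)))"

text \<open>The sequence \<open>\<sigma>\<close> is a direct sum of \<open>\<alpha>\<close> and \<open>\<beta>\<close>.\<close>

definition seq_direct_sum ::
    "('o, 'a, 'z) suspended_cat_scheme \<Rightarrow> nat \<Rightarrow> (nat \<Rightarrow> 'a) \<Rightarrow> (nat \<Rightarrow> 'a) \<Rightarrow> (nat \<Rightarrow> 'a) \<Rightarrow> bool"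
  where "seq_direct_sum C n \<alpha> \<beta> \<sigma> \<longleftrightarrow>
    (\<exists>i1 i2 p1 p2.
       seq_morphism C n \<alpha> \<sigma> i1 \<and> seq_morphism C n \<beta> \<sigma> i2 \<and>
       seq_morphism C n \<sigma> \<alpha> p1 \<and> seq_morphism C n \<sigma> \<beta> p2 \<and>
       (\<forall>i \<in> {1..n}. biproduct C (obj C n \<alpha> i) (obj C n \<beta> i) (obj C n \<sigma> i)
                        (i1 i) (i2 i) (p1 i) (p2 i)))"

definition candidate :: "('o, 'a, 'z) suspended_cat_scheme \<Rightarrow> nat \<Rightarrow> (nat \<Rightarrow> 'a) \<Rightarrow> bool"
  where "candidate C n \<alpha> \<longleftrightarrow> \<alpha> \<in> n_sequences C n \<and>
    (\<forall>i \<in> {1..n}. cont C n \<alpha> (i + 1) \<bullet>\<^bsub>C\<^esub> \<alpha> i = ZeroArr C (obj C n \<alpha> i) (obj C n \<alpha> (i + 2)))"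

definition contractible :: "('o, 'a, 'z) suspended_cat_scheme \<Rightarrow> nat \<Rightarrow> (nat \<Rightarrow> 'a) \<Rightarrow> bool"
  where "contractible C n \<alpha> \<longleftrightarrow> \<alpha> \<in> n_sequences C n \<and>
    (\<exists>\<Theta>. (\<forall>i \<in> {1..n}. \<Theta> i \<in> Hom C (obj C n \<alpha> (i + 1)) (obj C n \<alpha> i)) \<and>
         (\<forall>i \<in> {2..n+1}. IdArr C (obj C n \<alpha> i) =
             (cont C n \<Theta> i \<bullet>\<^bsub>C\<^esub> cont C n \<alpha> i) \<boxplus>\<^bsub>C\<^esub> (\<alpha> (i - 1) \<bullet>\<^bsub>C\<^esub> \<Theta> (i - 1))))"

text \<open>\<open>X \<rightarrow> X \<rightarrow> Z \<rightarrow> \<dots> \<rightarrow> Z \<rightarrow> \<Sigma> X\<close> with first arrow the identity, for a zero object \<open>Z\<close>.\<close>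

definition trivial_seq ::
    "('o, 'a, 'z) suspended_cat_scheme \<Rightarrow> nat \<Rightarrow> 'o \<Rightarrow> 'o \<Rightarrow> (nat \<Rightarrow> 'a)"
  where "trivial_seq C n Z X = (\<lambda>i \<in> {1..n}.
    if i = 1 then IdArr C X
    else if i = 2 then ZeroArr C X Z
    else if i < n then ZeroArr C Z Z
    else ZeroArr C Z (SusOb C X))"

text \<open>
  The sequence \<open>\<kappa>\<close> is a mapping cone of \<open>\<phi> : \<alpha> \<rightarrow> \<beta>\<close>. Its objects \<open>K\<^sub>i\<close>, \<open>1 \<le> i \<le> n\<close>, are
  presented as biproducts \<open>A\<^bsub>i+1\<^esub> \<oplus> B\<^sub>i\<close>; the last arrow ends in \<open>\<Sigma> K\<^sub>1\<close>, presented as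
  \<open>\<Sigma> A\<^sub>2 \<oplus> \<Sigma> B\<^sub>1\<close> by the suspended injections. The \<open>i\<close>-th arrow is the sum of the entries
  \<open>-\<alpha>\<^bsub>i+1\<^esub>\<close>, \<open>\<phi>\<^bsub>i+1\<^esub>\<close> and \<open>\<beta>\<^sub>i\<close> of its matrix.
\<close>

definition mapping_cone ::
    "('o, 'a, 'z) suspended_cat_scheme \<Rightarrow> nat \<Rightarrow> (nat \<Rightarrow> 'a) \<Rightarrow> (nat \<Rightarrow> 'a) \<Rightarrow> (nat \<Rightarrow> 'a) \<Rightarrow>
      (nat \<Rightarrow> 'a) \<Rightarrow> bool"
  where "mapping_cone C n \<alpha> \<beta> \<phi> \<kappa> \<longleftrightarrow> \<kappa> \<in> n_sequences C n \<and>
    (\<exists>i1 i2 p1 p2.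
       (\<forall>i \<in> {1..n}. biproduct C (obj C n \<alpha> (i + 1)) (obj C n \<beta> i) (obj C n \<kappa> i)
                        (i1 i) (i2 i) (p1 i) (p2 i)) \<and>
       (\<forall>i \<in> {1..n}. \<kappa> i =
          (cont C n i1 (i + 1) \<bullet>\<^bsub>C\<^esub> NegArr C (cont C n \<alpha> (i + 1)) \<bullet>\<^bsub>C\<^esub> p1 i) \<boxplus>\<^bsub>C\<^esub>
          (cont C n i2 (i + 1) \<bullet>\<^bsub>C\<^esub> cont C n \<phi> (i + 1) \<bullet>\<^bsub>C\<^esub> p1 i) \<boxplus>\<^bsub>C\<^esub>
          (cont C n i2 (i + 1) \<bullet>\<^bsub>C\<^esub> \<beta> i \<bullet>\<^bsub>C\<^esub> p2 i)))"


section \<open>Angulations\<close>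

text \<open>
  Direct sums, zero objects and mapping cones are determined up to isomorphism only. Given
  closure under isomorphisms it makes no difference which representatives are required to belong
  to the collection.
\<close>

definition axiom_N1 ::
    "('o, 'a, 'z) suspended_cat_scheme \<Rightarrow> nat \<Rightarrow> (nat \<Rightarrow> 'a) set \<Rightarrow> bool"
  where "axiom_N1 C n N \<longleftrightarrow>
    (\<forall>\<alpha> \<in> N. \<forall>\<beta> \<in> N. \<forall>\<sigma> \<in> n_sequences C n. seq_direct_sum C n \<alpha> \<beta> \<sigma> \<longrightarrow> \<sigma> \<in> N) \<and>
    (\<forall>\<alpha> \<in> n_sequences C n. \<forall>\<beta> \<in> n_sequences C n. \<forall>\<sigma> \<in> N.
       seq_direct_sum C n \<alpha> \<beta> \<sigma> \<longrightarrow> \<alpha> \<in> N \<and> \<beta> \<in> N) \<and>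
    (\<forall>\<alpha> \<in> N. \<forall>\<beta> \<in> n_sequences C n. seq_iso C n \<alpha> \<beta> \<longrightarrow> \<beta> \<in> N) \<and>
    (\<forall>X \<in> Ob C. \<forall>Z. zero_object C Z \<longrightarrow> trivial_seq C n Z X \<in> N) \<and>
    (\<forall>f \<in> Arr C. \<exists>\<alpha> \<in> N. \<alpha> 1 = f)"

definition axiom_N2 ::
    "('o, 'a, 'z) suspended_cat_scheme \<Rightarrow> nat \<Rightarrow> (nat \<Rightarrow> 'a) set \<Rightarrow> bool"
  where "axiom_N2 C n N \<longleftrightarrow> (\<forall>\<alpha> \<in> n_sequences C n. \<alpha> \<in> N \<longleftrightarrow> left_rotation C n \<alpha> \<in> N)"

definition axiom_N3 ::
    "('o, 'a, 'z) suspended_cat_scheme \<Rightarrow> nat \<Rightarrow> (nat \<Rightarrow> 'a) set \<Rightarrow> bool"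
  where "axiom_N3 C n N \<longleftrightarrow> (\<forall>\<alpha> \<in> N. \<forall>\<beta> \<in> N.
    \<forall>f1 \<in> Hom C (obj C n \<alpha> 1) (obj C n \<beta> 1). \<forall>f2 \<in> Hom C (obj C n \<alpha> 2) (obj C n \<beta> 2).
      f2 \<bullet>\<^bsub>C\<^esub> \<alpha> 1 = \<beta> 1 \<bullet>\<^bsub>C\<^esub> f1 \<longrightarrow>
      (\<exists>\<phi>. seq_morphism C n \<alpha> \<beta> \<phi> \<and> \<phi> 1 = f1 \<and> \<phi> 2 = f2))"

definition axiom_N4 ::
    "('o, 'a, 'z) suspended_cat_scheme \<Rightarrow> nat \<Rightarrow> (nat \<Rightarrow> 'a) set \<Rightarrow> bool"
  where "axiom_N4 C n N \<longleftrightarrow> (\<forall>\<alpha> \<in> N. \<forall>\<beta> \<in> N.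
    \<forall>f1 \<in> Hom C (obj C n \<alpha> 1) (obj C n \<beta> 1). \<forall>f2 \<in> Hom C (obj C n \<alpha> 2) (obj C n \<beta> 2).
      f2 \<bullet>\<^bsub>C\<^esub> \<alpha> 1 = \<beta> 1 \<bullet>\<^bsub>C\<^esub> f1 \<longrightarrow>
      (\<exists>\<phi>. seq_morphism C n \<alpha> \<beta> \<phi> \<and> \<phi> 1 = f1 \<and> \<phi> 2 = f2 \<and>
           (\<exists>\<kappa> \<in> N. mapping_cone C n \<alpha> \<beta> \<phi> \<kappa>)))"

definition n_angulation ::
    "('o, 'a, 'z) suspended_cat_scheme \<Rightarrow> nat \<Rightarrow> (nat \<Rightarrow> 'a) set \<Rightarrow> bool"
  where "n_angulation C n N \<longleftrightarrow> N \<subseteq> n_sequences C n \<and>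
    axiom_N1 C n N \<and> axiom_N2 C n N \<and> axiom_N3 C n N \<and> axiom_N4 C n N"


section \<open>Finitely generated free modules\<close>

text \<open>A finite basis: every element is a linear combination in exactly one way.\<close>

definition finite_basis :: "('a, 'r) ring_scheme \<Rightarrow> ('a, 'm) module \<Rightarrow> 'm set \<Rightarrow> bool"
  where "finite_basis R M B \<longleftrightarrow> finite B \<and> B \<subseteq> carrier M \<and>
    (\<forall>x \<in> carrier M. \<exists>!c. c \<in> B \<rightarrow>\<^sub>E carrier R \<and> x = finsum M (\<lambda>b. c b \<odot>\<^bsub>M\<^esub> b) B)"

definition fg_free_module :: "('a, 'r) ring_scheme \<Rightarrow> ('a, 'm) module \<Rightarrow> bool"
  where "fg_free_module R M \<longleftrightarrow> module R M \<and> (\<exists>B. finite_basis R M B)"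

definition module_hom ::
    "('a, 'r) ring_scheme \<Rightarrow> ('a, 'm) module \<Rightarrow> ('a, 'm) module \<Rightarrow> ('m \<Rightarrow> 'm) set"
  where "module_hom R M N = {f \<in> carrier M \<rightarrow>\<^sub>E carrier N.
    (\<forall>x \<in> carrier M. \<forall>y \<in> carrier M. f (x \<oplus>\<^bsub>M\<^esub> y) = f x \<oplus>\<^bsub>N\<^esub> f y) \<and>
    (\<forall>r \<in> carrier R. \<forall>x \<in> carrier M. f (r \<odot>\<^bsub>M\<^esub> x) = r \<odot>\<^bsub>N\<^esub> f x)}"

type_synonym ('a, 'm) mod_arrow = "('a, 'm) module \<times> ('m \<Rightarrow> 'm) \<times> ('a, 'm) module"

text \<open>
  The suspended category of finitely generated free \<open>R\<close>-modules with elements in the type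
  \<open>'m\<close>, with \<open>\<Sigma>\<close> the identity functor. An arrow is a triple of domain, underlying map and
  codomain. The type \<open>'m\<close> plays the role of a universe; it has to be large enough to
  contain free modules of every finite rank.
\<close>

definition free_mod ::
    "('a, 'r) ring_scheme \<Rightarrow> (('a, 'm) module, ('a, 'm) mod_arrow) suspended_cat"
  where "free_mod R = \<lparr>
    Ob = {M. fg_free_module R M},
    Arr = {(M, f, N). fg_free_module R M \<and> fg_free_module R N \<and> f \<in> module_hom R M N},
    Dom = (\<lambda>(M, f, N). M),
    Cod = (\<lambda>(M, f, N). N),
    IdArr = (\<lambda>M. (M, \<lambda>x \<in> carrier M. x, M)),
    Comp = (\<lambda>(M', g, N') (M, f, N). (M, compose (carrier M) g f, N')),
    ZeroArr = (\<lambda>M N. (M, \<lambda>x \<in> carrier M. \<zero>\<^bsub>N\<^esub>, N)),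
    AddArr = (\<lambda>(M, f, N) (M', g, N'). (M, \<lambda>x \<in> carrier M. f x \<oplus>\<^bsub>N\<^esub> g x, N)),
    NegArr = (\<lambda>(M, f, N). (M, \<lambda>x \<in> carrier M. \<ominus>\<^bsub>N\<^esub> f x, N)),
    SusOb = (\<lambda>M. M),
    SusArr = (\<lambda>f. f)\<rparr>"

definition has_free_modules :: "('a, 'r) ring_scheme \<Rightarrow> 'm itself \<Rightarrow> bool"
  where "has_free_modules R (_ :: 'm itself) \<longleftrightarrow>
    (\<forall>k. \<exists>(M :: ('a, 'm) module) B. module R M \<and> finite_basis R M B \<and> card B = k)"


text \<open>
  The elements of \<open>R\<^sup>k\<close> as functions supported below \<open>k\<close>: the type \<open>nat \<Rightarrow> 'a\<close> is large
  enough for every nonzero ring \<open>R\<close> over \<open>'a\<close>. The ring operations of the record \<open>module\<close> play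
  no role for a module.
\<close>

definition coord_module :: "('a,'r) ring_scheme \<Rightarrow> nat \<Rightarrow> ('a, nat \<Rightarrow> 'a) module" where
 "coord_module R k = \<lparr>carrier = {x. (\<forall>i<k. x i \<in> carrier R) \<and> (\<forall>i\<ge>k. x i = \<zero>\<^bsub>R\<^esub>)},
   mult = undefined, one = undefined, zero = (\<lambda>i. \<zero>\<^bsub>R\<^esub>),
   add = (\<lambda>x y i. x i \<oplus>\<^bsub>R\<^esub> y i), smult = (\<lambda>r x i. r \<otimes>\<^bsub>R\<^esub> x i)\<rparr>"

lemma coord_module_carr: fixes R (structure) shows "cring R \<Longrightarrow> x \<in> carrier (coord_module R k) \<Longrightarrow> x i \<in> carrier R"
proof -
  assume "cring R" then interpret cring R .
  show "x \<in> carrier (coord_module R k) \<Longrightarrow> x i \<in> carrier R" by (cases "i < k") (auto simp: coord_module_def)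
qed

lemma coord_module_module: fixes R (structure) assumes "cring R" shows "module R (coord_module R k)"
proof -
  interpret cring R by fact
  note c = coord_module_carr[OF assms, of _ k]
  have ag: "abelian_group (coord_module R k)"
  proof (rule abelian_groupI)
    fix x y z assume a: "x \<in> carrier (coord_module R k)" "y \<in> carrier (coord_module R k)" "z \<in> carrier (coord_module R k)"
    show "x \<oplus>\<^bsub>coord_module R k\<^esub> y \<oplus>\<^bsub>coord_module R k\<^esub> z = x \<oplus>\<^bsub>coord_module R k\<^esub> (y \<oplus>\<^bsub>coord_module R k\<^esub> z)"
      using c[OF a(1)] c[OF a(2)] c[OF a(3)] by (simp add: coord_module_def a_assoc)
  next
    fix x y assume a: "x \<in> carrier (coord_module R k)" "y \<in> carrier (coord_module R k)"
    show "x \<oplus>\<^bsub>coord_module R k\<^esub> y \<in> carrier (coord_module R k)" using a by (auto simp: coord_module_def)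
    show "x \<oplus>\<^bsub>coord_module R k\<^esub> y = y \<oplus>\<^bsub>coord_module R k\<^esub> x"
      using c[OF a(1)] c[OF a(2)] by (simp add: coord_module_def a_comm)
  next
    show "\<zero>\<^bsub>coord_module R k\<^esub> \<in> carrier (coord_module R k)" by (auto simp: coord_module_def)
  next
    fix x assume a: "x \<in> carrier (coord_module R k)"
    show "\<zero>\<^bsub>coord_module R k\<^esub> \<oplus>\<^bsub>coord_module R k\<^esub> x = x" using c[OF a] by (simp add: coord_module_def)
    show "\<exists>y\<in>carrier (coord_module R k). y \<oplus>\<^bsub>coord_module R k\<^esub> x = \<zero>\<^bsub>coord_module R k\<^esub>"
      using a c[OF a] by (intro bexI[of _ "\<lambda>i. \<ominus>\<^bsub>R\<^esub> x i"]) (auto simp: coord_module_def l_neg)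
  qed
  show ?thesis
  proof (rule moduleI[OF assms ag])
    fix a x assume "a \<in> carrier R" "x \<in> carrier (coord_module R k)"
    then show "a \<odot>\<^bsub>coord_module R k\<^esub> x \<in> carrier (coord_module R k)" by (auto simp: coord_module_def)
  next
    fix a b x assume "a \<in> carrier R" "b \<in> carrier R" "x \<in> carrier (coord_module R k)"
    then show "(a \<oplus> b) \<odot>\<^bsub>coord_module R k\<^esub> x = a \<odot>\<^bsub>coord_module R k\<^esub> x \<oplus>\<^bsub>coord_module R k\<^esub> b \<odot>\<^bsub>coord_module R k\<^esub> x"
      using c[of x] by (simp add: coord_module_def l_distr)
  next
    fix a x y assume "a \<in> carrier R" "x \<in> carrier (coord_module R k)" "y \<in> carrier (coord_module R k)"
    then show "a \<odot>\<^bsub>coord_module R k\<^esub> (x \<oplus>\<^bsub>coord_module R k\<^esub> y) = a \<odot>\<^bsub>coord_module R k\<^esub> x \<oplus>\<^bsub>coord_module R k\<^esub> a \<odot>\<^bsub>coord_module R k\<^esub> y"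
      using c[of x] c[of y] by (simp add: coord_module_def r_distr)
  next
    fix a b x assume "a \<in> carrier R" "b \<in> carrier R" "x \<in> carrier (coord_module R k)"
    then show "(a \<otimes> b) \<odot>\<^bsub>coord_module R k\<^esub> x = a \<odot>\<^bsub>coord_module R k\<^esub> (b \<odot>\<^bsub>coord_module R k\<^esub> x)"
      using c[of x] by (simp add: coord_module_def m_assoc)
  next
    fix x assume "x \<in> carrier (coord_module R k)"
    then show "\<one> \<odot>\<^bsub>coord_module R k\<^esub> x = x"
      using c[of x] by (simp add: coord_module_def)
  qed
qed

lemma coord_module_finsum:
  fixes R (structure)
  assumes "cring R" "finite B" "\<And>b. b \<in> B \<Longrightarrow> f b \<in> carrier (coord_module R k)"
  shows "finsum (coord_module R k) f B i = finsum R (\<lambda>b. f b i) B"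
proof -
  interpret cring R by fact
  interpret M: module R "coord_module R k" by (rule coord_module_module) fact
  show ?thesis using assms(2,3)
  proof (induction rule: finite_induct)
    case empty
    have "finsum (coord_module R k) f {} = \<zero>\<^bsub>coord_module R k\<^esub>" by simp
    then show ?case by (simp add: coord_module_def)
  next
    case (insert b B)
    then have "finsum (coord_module R k) f (insert b B) = f b \<oplus>\<^bsub>coord_module R k\<^esub> finsum (coord_module R k) f B"
      by (intro M.finsum_insert) auto
    moreover have "finsum R (\<lambda>b. f b i) (insert b B) = f b i \<oplus> finsum R (\<lambda>b. f b i) B"
      using insert coord_module_carr[OF assms(1)] by (intro finsum_insert) blast+
    ultimately show ?case using insert by (simp add: coord_module_def)
  qed
qed

lemma coord_module_basis:
  fixes R (structure)
  assumes "cring R" "\<one>\<^bsub>R\<^esub> \<noteq> \<zero>\<^bsub>R\<^esub>"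
  shows "\<exists>B. finite_basis R (coord_module R k) B \<and> card B = k"
proof -
  interpret cring R by fact
  define e where "e j = (\<lambda>i. if i = (j::nat) then \<one>\<^bsub>R\<^esub> else \<zero>\<^bsub>R\<^esub>)" for j
  have inj: "inj e" using assms(2) by (auto simp: inj_def e_def fun_eq_iff split: if_splits)
  let ?B = "e ` {..<k}"
  have eC: "e j \<in> carrier (coord_module R k)" if "j < k" for j using that by (auto simp: coord_module_def e_def)
  interpret M: module R "coord_module R k" by (rule coord_module_module) fact
  have val: "finsum (coord_module R k) (\<lambda>b. c b \<odot>\<^bsub>coord_module R k\<^esub> b) ?B i = (if i < k then c (e i) else \<zero>)"
    if c: "c \<in> ?B \<rightarrow>\<^sub>E carrier R" for c i
  proof -
    have "finsum (coord_module R k) (\<lambda>b. c b \<odot>\<^bsub>coord_module R k\<^esub> b) ?B i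
        = finsum R (\<lambda>b. (c b \<odot>\<^bsub>coord_module R k\<^esub> b) i) ?B"
      using c eC by (intro coord_module_finsum[OF assms(1)]) auto
    also have "\<dots> = finsum R (\<lambda>j. (c (e j) \<odot>\<^bsub>coord_module R k\<^esub> e j) i) {..<k}"
    proof (rule finsum_reindex)
      have "c (e j) \<odot>\<^bsub>coord_module R k\<^esub> e j \<in> carrier (coord_module R k)" if "j < k" for j
        using c eC that by (intro M.smult_closed) auto
      then show "(\<lambda>b. (c b \<odot>\<^bsub>coord_module R k\<^esub> b) i) \<in> ?B \<rightarrow> carrier R"
        using coord_module_carr[OF assms(1)] by blast
    qed (use inj in \<open>auto intro: inj_on_subset\<close>)
    also have "\<dots> = finsum R (\<lambda>j. if i = j then c (e j) else \<zero>) {..<k}"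
      using c by (intro finsum_cong') (auto simp: coord_module_def e_def PiE_iff)
    also have "\<dots> = (if i < k then c (e i) else \<zero>)"
    proof (cases "i < k")
      case True
      then show ?thesis using finsum_singleton[of i "{..<k}" "\<lambda>j. c (e j)"] c by (auto simp: PiE_iff)
    next
      case False
      then have "finsum R (\<lambda>j. if i = j then c (e j) else \<zero>) {..<k} = finsum R (\<lambda>j. \<zero>) {..<k}"
        by (intro finsum_cong') auto
      then show ?thesis using False by simp
    qed
    finally show ?thesis .
  qed
  have "finite_basis R (coord_module R k) ?B" unfolding finite_basis_def
  proof (intro conjI ballI)
    show "?B \<subseteq> carrier (coord_module R k)" using eC by auto
    fix x assume x: "x \<in> carrier (coord_module R k)"
    define c where "c = (\<lambda>b\<in>?B. x (inv_into UNIV e b))"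
    have ce: "c (e j) = x j" if "j < k" for j using that inj by (auto simp: c_def)
    have cP: "c \<in> ?B \<rightarrow>\<^sub>E carrier R" using coord_module_carr[OF assms(1) x] by (auto simp: c_def)
    show "\<exists>!c. c \<in> ?B \<rightarrow>\<^sub>E carrier R \<and> x = finsum (coord_module R k) (\<lambda>b. c b \<odot>\<^bsub>coord_module R k\<^esub> b) ?B"
    proof (rule ex1I[of _ c])
      have "x i = finsum (coord_module R k) (\<lambda>b. c b \<odot>\<^bsub>coord_module R k\<^esub> b) ?B i" for i
        using val[OF cP, of i] ce x by (auto simp: coord_module_def)
      then show "c \<in> ?B \<rightarrow>\<^sub>E carrier R \<and> x = finsum (coord_module R k) (\<lambda>b. c b \<odot>\<^bsub>coord_module R k\<^esub> b) ?B"
        using cP by auto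
    next
      fix d assume d: "d \<in> ?B \<rightarrow>\<^sub>E carrier R \<and> x = finsum (coord_module R k) (\<lambda>b. d b \<odot>\<^bsub>coord_module R k\<^esub> b) ?B"
      show "d = c"
      proof (rule PiE_ext)
        show "d \<in> ?B \<rightarrow>\<^sub>E carrier R" using d by simp
        show "c \<in> ?B \<rightarrow>\<^sub>E carrier R" by (rule cP)
        fix b assume "b \<in> ?B"
        then obtain j where j: "j < k" "b = e j" by auto
        have "x j = d (e j)" using val[of d j] d j by metis
        then show "d b = c b" using ce j by simp
      qed
    qed
  qed auto
  moreover have "card ?B = k" using inj by (simp add: card_image inj_on_subset)
  ultimately show ?thesis by blast
qed

lemma has_free_modules_nat_fun:
  fixes R :: "('a, 'r) ring_scheme"
  assumes "cring R" "\<one>\<^bsub>R\<^esub> \<noteq> \<zero>\<^bsub>R\<^esub>"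
  shows "has_free_modules R TYPE(nat \<Rightarrow> 'a)"
  unfolding has_free_modules_def using coord_module_module[OF assms(1)] coord_module_basis[OF assms] by blast


section \<open>The collections attached to units\<close>

definition local_ring_with_maximal_ideal :: "('a, 'r) ring_scheme \<Rightarrow> 'a set \<Rightarrow> bool"
  where "local_ring_with_maximal_ideal R \<mm> \<longleftrightarrow>
    cring R \<and> maximalideal \<mm> R \<and> (\<forall>J. maximalideal J R \<longrightarrow> J = \<mm>)"

definition scalar_arr :: "'a \<Rightarrow> ('a, 'm) module \<Rightarrow> ('a, 'm) mod_arrow"
  where "scalar_arr r F = (F, \<lambda>x \<in> carrier F. r \<odot>\<^bsub>F\<^esub> x, F)"

text \<open>The sequence \<open>F(p)\<close>, which depends on the unit \<open>u\<close> through its first arrow.\<close>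

definition Fp_seq ::
    "('a, 'r) ring_scheme \<Rightarrow> nat \<Rightarrow> 'a \<Rightarrow> 'a \<Rightarrow> ('a, 'm) module \<Rightarrow> (nat \<Rightarrow> ('a, 'm) mod_arrow)"
  where "Fp_seq R n p u F =
    (\<lambda>i \<in> {1..n}. scalar_arr (if i = 1 then u \<otimes>\<^bsub>R\<^esub> p else p) F)"

definition N_coll ::
    "('a, 'r) ring_scheme \<Rightarrow> nat \<Rightarrow> 'a \<Rightarrow> 'a \<Rightarrow> (nat \<Rightarrow> ('a, 'm) mod_arrow) set"
  where "N_coll R n p u = {\<alpha> \<in> n_sequences (free_mod R) n.
    \<exists>\<gamma> F. \<exists>\<sigma> \<in> n_sequences (free_mod R) n.
      candidate (free_mod R) n \<gamma> \<and> contractible (free_mod R) n \<gamma> \<and> fg_free_module R F \<and>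
      seq_direct_sum (free_mod R) n \<gamma> (Fp_seq R n p u F) \<sigma> \<and> seq_iso (free_mod R) n \<alpha> \<sigma>}"

definition unit_rel :: "('a, 'r) ring_scheme \<Rightarrow> 'a \<Rightarrow> ('a \<times> 'a) set"
  where "unit_rel R p =
    {(u, v). u \<in> Units R \<and> v \<in> Units R \<and> u \<otimes>\<^bsub>R\<^esub> p = v \<otimes>\<^bsub>R\<^esub> p}"

end

theory Submission
 imports Defs
begin

text \<open>
 Write \<open>m = (p)\<close>. As \<open>m\<^sup>2 = 0\<close>, every element of \<open>R\<close> is a unit or a multiple of \<open>p\<close>, and on a
 free module the kernel of multiplication by \<open>p\<close> is its image. So if \<open>A\<close> is a periodic complex of
 free modules and \<open>x\<^sub>0\<close> an element whose image under the differential is a multiple of \<open>p\<close>, then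
 \<open>x\<^sub>0\<close> starts a chain \<open>x\<^sub>0, x\<^sub>1, \<dots>, x\<^sub>n\<close> with \<open>\<alpha> x\<^sub>j = p x\<^bsub>j+1\<^esub>\<close> that goes once around the
 circle of objects; modulo \<open>p\<close> and boundaries each term depends only on the term before it. In
 \<open>F(p)\<close> the chain of \<open>x\<close> is \<open>x, u x, \<dots>, u x\<close>, and in a contractible complex every chain consists
 of boundaries modulo \<open>p\<close>. The proof rests on the converse (\<open>N_coll_eq\<close>): \<open>N\<^sub>u\<close> consists of the
 exact periodic complexes in which \<open>x\<^sub>n\<close> and \<open>u x\<^sub>0\<close> agree modulo \<open>p\<close> and boundaries for every
 chain, which is called having holonomy \<open>u\<close>. For such a complex the homology modulo \<open>p\<close> lifts to a
 direct summand \<open>F(p)\<close>, and the complement is contractible (\<open>sdr_exists\<close>).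

 Exactness and holonomy pass to direct sums, summands and rotations; the sign of a rotation
 matters only for odd \<open>n\<close>, and then \<open>2p = 0\<close>. Every map starts a member of \<open>N\<^sub>u\<close>, because it is a
 direct sum of an isomorphism, of \<open>u p\<close> times an isomorphism and of a zero map
 (\<open>extends_every_map\<close>). For a map of first squares one finds first a morphism between the minimal
 summands \<open>F(p)\<close> and \<open>G(p)\<close> whose cone has the right holonomy (\<open>model_morphism\<close>) and then corrects
 it by a homotopy (\<open>null_homotopy\<close>); the cone keeps holonomy \<open>u\<close> (\<open>cone_holonomy\<close>). So \<open>N\<^sub>u\<close> is an
 \<open>n\<close>-angulation.

 Conversely, let an \<open>n\<close>-angulation be given. Extending maps from elementary contractible sequences
 shows that its members are exact. One of them starts with \<open>p : R \<rightarrow> R\<close>; the chain of \<open>1\<close> in it ends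
 in some \<open>u\<close>, and \<open>u\<close> is a unit by exactness. Every chain of every member is the image of that chain
 under a morphism, up to boundaries, so all members have holonomy \<open>u\<close>
 (\<open>angles_have_common_holonomy\<close>). On the other hand contractible complexes are sums of elementary
 ones, and \<open>F(p)\<close> is a summand of a member that starts with \<open>u p\<close>, so the \<open>n\<close>-angulation contains
 all of \<open>N\<^sub>u\<close> (\<open>angulation_is_N_coll\<close>). Finally \<open>R(p)\<close> with first map \<open>u p\<close> has holonomy \<open>v\<close> only
 if \<open>v p = u p\<close>, so \<open>N\<^sub>u\<close> determines \<open>u p\<close> (\<open>N_coll_determines_class\<close>).
\<close>

abbreviation (input) U :: "('x, 'y) partial_object_scheme \<Rightarrow> 'x set"
 where "U \<equiv> carrier"

section \<open>Modules and their homomorphisms\<close>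

context cring
begin

lemma mod_closed [simp]:
 assumes "module R M"
 shows "\<zero>\<^bsub>M\<^esub> \<in> U M"
  and "x \<in> U M ==> \<ominus>\<^bsub>M\<^esub> x \<in> U M"
  and "x \<in> U M ==> y \<in> U M ==> x \<oplus>\<^bsub>M\<^esub> y \<in> U M"
  and "x \<in> U M ==> y \<in> U M ==> x \<ominus>\<^bsub>M\<^esub> y \<in> U M"
  and "r \<in> U R ==> x \<in> U M ==> r \<odot>\<^bsub>M\<^esub> x \<in> U M"
proof -
 interpret module R M by fact
 show "\<zero>\<^bsub>M\<^esub> \<in> U M"
  and "x \<in> U M ==> \<ominus>\<^bsub>M\<^esub> x \<in> U M"
  and "x \<in> U M ==> y \<in> U M ==> x \<oplus>\<^bsub>M\<^esub> y \<in> U M"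
  and "x \<in> U M ==> y \<in> U M ==> x \<ominus>\<^bsub>M\<^esub> y \<in> U M"
  and "r \<in> U R ==> x \<in> U M ==> r \<odot>\<^bsub>M\<^esub> x \<in> U M"
  by auto
qed

lemma mod_arith:
 assumes "module R M" "x \<in> U M"
 shows mod_l_zero: "\<zero>\<^bsub>M\<^esub> \<oplus>\<^bsub>M\<^esub> x = x"
  and mod_r_zero: "x \<oplus>\<^bsub>M\<^esub> \<zero>\<^bsub>M\<^esub> = x"
  and mod_neg_zero: "\<ominus>\<^bsub>M\<^esub> \<zero>\<^bsub>M\<^esub> = \<zero>\<^bsub>M\<^esub>"
  and mod_neg_neg: "\<ominus>\<^bsub>M\<^esub> (\<ominus>\<^bsub>M\<^esub> x) = x"
  and mod_r_neg: "x \<oplus>\<^bsub>M\<^esub> \<ominus>\<^bsub>M\<^esub> x = \<zero>\<^bsub>M\<^esub>"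
  and mod_l_neg: "\<ominus>\<^bsub>M\<^esub> x \<oplus>\<^bsub>M\<^esub> x = \<zero>\<^bsub>M\<^esub>"
  and mod_r_neg1: "y \<in> U M ==> \<ominus>\<^bsub>M\<^esub> x \<oplus>\<^bsub>M\<^esub> (x \<oplus>\<^bsub>M\<^esub> y) = y"
  and mod_r_neg2: "y \<in> U M ==> x \<oplus>\<^bsub>M\<^esub> (\<ominus>\<^bsub>M\<^esub> x \<oplus>\<^bsub>M\<^esub> y) = y"
  and mod_minus_add: "y \<in> U M ==> \<ominus>\<^bsub>M\<^esub> (x \<oplus>\<^bsub>M\<^esub> y) = \<ominus>\<^bsub>M\<^esub> x \<oplus>\<^bsub>M\<^esub> \<ominus>\<^bsub>M\<^esub> y"
  and mod_assoc: "y \<in> U M ==> z \<in> U M ==> (x \<oplus>\<^bsub>M\<^esub> y) \<oplus>\<^bsub>M\<^esub> z = x \<oplus>\<^bsub>M\<^esub> (y \<oplus>\<^bsub>M\<^esub> z)"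
  and mod_comm: "y \<in> U M ==> x \<oplus>\<^bsub>M\<^esub> y = y \<oplus>\<^bsub>M\<^esub> x"
  and mod_lcomm: "y \<in> U M ==> z \<in> U M ==> x \<oplus>\<^bsub>M\<^esub> (y \<oplus>\<^bsub>M\<^esub> z) = y \<oplus>\<^bsub>M\<^esub> (x \<oplus>\<^bsub>M\<^esub> z)"
  and mod_smult_radd: "r \<in> U R ==> y \<in> U M ==> r \<odot>\<^bsub>M\<^esub> (x \<oplus>\<^bsub>M\<^esub> y) = r \<odot>\<^bsub>M\<^esub> x \<oplus>\<^bsub>M\<^esub> r \<odot>\<^bsub>M\<^esub> y"
  and mod_smult_ladd: "r \<in> U R ==> s \<in> U R ==> (r \<oplus>\<^bsub>R\<^esub> s) \<odot>\<^bsub>M\<^esub> x = r \<odot>\<^bsub>M\<^esub> x \<oplus>\<^bsub>M\<^esub> s \<odot>\<^bsub>M\<^esub> x"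
  and mod_smult_assoc: "r \<in> U R ==> s \<in> U R ==> (r \<otimes>\<^bsub>R\<^esub> s) \<odot>\<^bsub>M\<^esub> x = r \<odot>\<^bsub>M\<^esub> (s \<odot>\<^bsub>M\<^esub> x)"
  and mod_smult_one: "\<one>\<^bsub>R\<^esub> \<odot>\<^bsub>M\<^esub> x = x"
  and mod_smult_zero: "\<zero>\<^bsub>R\<^esub> \<odot>\<^bsub>M\<^esub> x = \<zero>\<^bsub>M\<^esub>"
  and mod_smult_rzero: "r \<in> U R ==> r \<odot>\<^bsub>M\<^esub> \<zero>\<^bsub>M\<^esub> = \<zero>\<^bsub>M\<^esub>"
  and mod_smult_rneg: "r \<in> U R ==> r \<odot>\<^bsub>M\<^esub> (\<ominus>\<^bsub>M\<^esub> x) = \<ominus>\<^bsub>M\<^esub> (r \<odot>\<^bsub>M\<^esub> x)"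
  and mod_smult_lneg: "r \<in> U R ==> (\<ominus>\<^bsub>R\<^esub> r) \<odot>\<^bsub>M\<^esub> x = \<ominus>\<^bsub>M\<^esub> (r \<odot>\<^bsub>M\<^esub> x)"
proof -
 interpret module R M by fact
 note assms(2)[simp]
 show "\<zero>\<^bsub>M\<^esub> \<oplus>\<^bsub>M\<^esub> x = x" "x \<oplus>\<^bsub>M\<^esub> \<zero>\<^bsub>M\<^esub> = x" "\<ominus>\<^bsub>M\<^esub> \<zero>\<^bsub>M\<^esub> = \<zero>\<^bsub>M\<^esub>" "\<ominus>\<^bsub>M\<^esub> (\<ominus>\<^bsub>M\<^esub> x) = x"
  by auto
 show "x \<oplus>\<^bsub>M\<^esub> \<ominus>\<^bsub>M\<^esub> x = \<zero>\<^bsub>M\<^esub>" "\<ominus>\<^bsub>M\<^esub> x \<oplus>\<^bsub>M\<^esub> x = \<zero>\<^bsub>M\<^esub>" by (auto simp: M.r_neg M.l_neg)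
 show "y \<in> U M ==> \<ominus>\<^bsub>M\<^esub> x \<oplus>\<^bsub>M\<^esub> (x \<oplus>\<^bsub>M\<^esub> y) = y"
  "y \<in> U M ==> x \<oplus>\<^bsub>M\<^esub> (\<ominus>\<^bsub>M\<^esub> x \<oplus>\<^bsub>M\<^esub> y) = y" by (auto simp: M.r_neg1 M.r_neg2)
 show "y \<in> U M ==> \<ominus>\<^bsub>M\<^esub> (x \<oplus>\<^bsub>M\<^esub> y) = \<ominus>\<^bsub>M\<^esub> x \<oplus>\<^bsub>M\<^esub> \<ominus>\<^bsub>M\<^esub> y" by (simp add: M.minus_add)
 show "y \<in> U M ==> z \<in> U M ==> (x \<oplus>\<^bsub>M\<^esub> y) \<oplus>\<^bsub>M\<^esub> z = x \<oplus>\<^bsub>M\<^esub> (y \<oplus>\<^bsub>M\<^esub> z)"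
  "y \<in> U M ==> x \<oplus>\<^bsub>M\<^esub> y = y \<oplus>\<^bsub>M\<^esub> x"
  "y \<in> U M ==> z \<in> U M ==> x \<oplus>\<^bsub>M\<^esub> (y \<oplus>\<^bsub>M\<^esub> z) = y \<oplus>\<^bsub>M\<^esub> (x \<oplus>\<^bsub>M\<^esub> z)"
  by (simp_all add: M.a_ac)
 show "r \<in> U R ==> y \<in> U M ==> r \<odot>\<^bsub>M\<^esub> (x \<oplus>\<^bsub>M\<^esub> y) = r \<odot>\<^bsub>M\<^esub> x \<oplus>\<^bsub>M\<^esub> r \<odot>\<^bsub>M\<^esub> y"
  "r \<in> U R ==> s \<in> U R ==> (r \<oplus>\<^bsub>R\<^esub> s) \<odot>\<^bsub>M\<^esub> x = r \<odot>\<^bsub>M\<^esub> x \<oplus>\<^bsub>M\<^esub> s \<odot>\<^bsub>M\<^esub> x"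
  "r \<in> U R ==> s \<in> U R ==> (r \<otimes>\<^bsub>R\<^esub> s) \<odot>\<^bsub>M\<^esub> x = r \<odot>\<^bsub>M\<^esub> (s \<odot>\<^bsub>M\<^esub> x)"
  by (auto simp: smult_r_distr smult_l_distr smult_assoc1)
 show "\<one>\<^bsub>R\<^esub> \<odot>\<^bsub>M\<^esub> x = x" "\<zero>\<^bsub>R\<^esub> \<odot>\<^bsub>M\<^esub> x = \<zero>\<^bsub>M\<^esub>"
  "r \<in> U R ==> r \<odot>\<^bsub>M\<^esub> \<zero>\<^bsub>M\<^esub> = \<zero>\<^bsub>M\<^esub>" by auto
 show "r \<in> U R ==> r \<odot>\<^bsub>M\<^esub> (\<ominus>\<^bsub>M\<^esub> x) = \<ominus>\<^bsub>M\<^esub> (r \<odot>\<^bsub>M\<^esub> x)"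
  "r \<in> U R ==> (\<ominus>\<^bsub>R\<^esub> r) \<odot>\<^bsub>M\<^esub> x = \<ominus>\<^bsub>M\<^esub> (r \<odot>\<^bsub>M\<^esub> x)"
  by (simp_all add: smult_r_minus smult_l_minus)
qed

lemma mod_rzero' [simp]: "module R M ==> r \<in> U R ==> r \<odot>\<^bsub>M\<^esub> \<zero>\<^bsub>M\<^esub> = \<zero>\<^bsub>M\<^esub>"
 by (rule mod_smult_rzero[of M "\<zero>\<^bsub>M\<^esub>"]) auto

lemma mod_neg_zero' [simp]: "module R M ==> \<ominus>\<^bsub>M\<^esub> \<zero>\<^bsub>M\<^esub> = \<zero>\<^bsub>M\<^esub>"
 by (rule mod_neg_zero[of M "\<zero>\<^bsub>M\<^esub>"]) auto

text \<open>
 Sorting the summands of a sum moves a term and its negative apart; these rules cancel such pairs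
 when few terms lie between them, which makes \<open>mod_norm\<close> strong enough for the identities below.
\<close>

lemma mod_cancel_apart:
 assumes M: "module R M" and x: "x \<in> U M" and z: "z \<in> U M"
 shows "x \<oplus>\<^bsub>M\<^esub> (z \<oplus>\<^bsub>M\<^esub> \<ominus>\<^bsub>M\<^esub> x) = z" and "\<ominus>\<^bsub>M\<^esub> x \<oplus>\<^bsub>M\<^esub> (z \<oplus>\<^bsub>M\<^esub> x) = z"
  and "y \<in> U M ==> x \<oplus>\<^bsub>M\<^esub> (z \<oplus>\<^bsub>M\<^esub> (\<ominus>\<^bsub>M\<^esub> x \<oplus>\<^bsub>M\<^esub> y)) = z \<oplus>\<^bsub>M\<^esub> y"
  and "y \<in> U M ==> \<ominus>\<^bsub>M\<^esub> x \<oplus>\<^bsub>M\<^esub> (z \<oplus>\<^bsub>M\<^esub> (x \<oplus>\<^bsub>M\<^esub> y)) = z \<oplus>\<^bsub>M\<^esub> y"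
  and "w \<in> U M ==> x \<oplus>\<^bsub>M\<^esub> (z \<oplus>\<^bsub>M\<^esub> (w \<oplus>\<^bsub>M\<^esub> \<ominus>\<^bsub>M\<^esub> x)) = z \<oplus>\<^bsub>M\<^esub> w"
  and "w \<in> U M ==> \<ominus>\<^bsub>M\<^esub> x \<oplus>\<^bsub>M\<^esub> (z \<oplus>\<^bsub>M\<^esub> (w \<oplus>\<^bsub>M\<^esub> x)) = z \<oplus>\<^bsub>M\<^esub> w"
  and "w \<in> U M ==> y \<in> U M ==> x \<oplus>\<^bsub>M\<^esub> (z \<oplus>\<^bsub>M\<^esub> (w \<oplus>\<^bsub>M\<^esub> (\<ominus>\<^bsub>M\<^esub> x \<oplus>\<^bsub>M\<^esub> y))) = z \<oplus>\<^bsub>M\<^esub> (w \<oplus>\<^bsub>M\<^esub> y)"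
  and "w \<in> U M ==> y \<in> U M ==> \<ominus>\<^bsub>M\<^esub> x \<oplus>\<^bsub>M\<^esub> (z \<oplus>\<^bsub>M\<^esub> (w \<oplus>\<^bsub>M\<^esub> (x \<oplus>\<^bsub>M\<^esub> y))) = z \<oplus>\<^bsub>M\<^esub> (w \<oplus>\<^bsub>M\<^esub> y)"
proof -
 have n: "\<ominus>\<^bsub>M\<^esub> x \<in> U M" using M x by simp
 note l = mod_lcomm[OF M x z] mod_lcomm[OF M n z] mod_lcomm[OF M x] mod_lcomm[OF M n]
 note r = mod_r_neg[OF M x] mod_l_neg[OF M x] mod_r_neg1[OF M x] mod_r_neg2[OF M x] mod_r_zero[OF M]
 show "x \<oplus>\<^bsub>M\<^esub> (z \<oplus>\<^bsub>M\<^esub> \<ominus>\<^bsub>M\<^esub> x) = z" "\<ominus>\<^bsub>M\<^esub> x \<oplus>\<^bsub>M\<^esub> (z \<oplus>\<^bsub>M\<^esub> x) = z"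
  using l(1)[of "\<ominus>\<^bsub>M\<^esub> x"] l(2)[of x] n x z by (simp_all add: r)
 show 3: "x \<oplus>\<^bsub>M\<^esub> (z \<oplus>\<^bsub>M\<^esub> (\<ominus>\<^bsub>M\<^esub> x \<oplus>\<^bsub>M\<^esub> y)) = z \<oplus>\<^bsub>M\<^esub> y"
  and 4: "\<ominus>\<^bsub>M\<^esub> x \<oplus>\<^bsub>M\<^esub> (z \<oplus>\<^bsub>M\<^esub> (x \<oplus>\<^bsub>M\<^esub> y)) = z \<oplus>\<^bsub>M\<^esub> y" if "y \<in> U M" for y
  using l(1)[of "\<ominus>\<^bsub>M\<^esub> x \<oplus>\<^bsub>M\<^esub> y"] l(2)[of "x \<oplus>\<^bsub>M\<^esub> y"] n x z M that by (simp_all add: r)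
 show "x \<oplus>\<^bsub>M\<^esub> (z \<oplus>\<^bsub>M\<^esub> (w \<oplus>\<^bsub>M\<^esub> \<ominus>\<^bsub>M\<^esub> x)) = z \<oplus>\<^bsub>M\<^esub> w"
  "\<ominus>\<^bsub>M\<^esub> x \<oplus>\<^bsub>M\<^esub> (z \<oplus>\<^bsub>M\<^esub> (w \<oplus>\<^bsub>M\<^esub> x)) = z \<oplus>\<^bsub>M\<^esub> w" if w: "w \<in> U M"
  using mod_comm[OF M w n] mod_comm[OF M w x] 3[OF w] 4[OF w] by simp_all
 show "x \<oplus>\<^bsub>M\<^esub> (z \<oplus>\<^bsub>M\<^esub> (w \<oplus>\<^bsub>M\<^esub> (\<ominus>\<^bsub>M\<^esub> x \<oplus>\<^bsub>M\<^esub> y))) = z \<oplus>\<^bsub>M\<^esub> (w \<oplus>\<^bsub>M\<^esub> y)"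
  "\<ominus>\<^bsub>M\<^esub> x \<oplus>\<^bsub>M\<^esub> (z \<oplus>\<^bsub>M\<^esub> (w \<oplus>\<^bsub>M\<^esub> (x \<oplus>\<^bsub>M\<^esub> y))) = z \<oplus>\<^bsub>M\<^esub> (w \<oplus>\<^bsub>M\<^esub> y)"
  if w: "w \<in> U M" and y: "y \<in> U M"
  using mod_lcomm[OF M w n y] mod_lcomm[OF M w x y] 3[of "w \<oplus>\<^bsub>M\<^esub> y"] 4[of "w \<oplus>\<^bsub>M\<^esub> y"] w y M by simp_all
qed

lemmas mod_ac = mod_assoc mod_comm mod_lcomm
lemmas mod_norm = a_minus_def mod_ac mod_r_zero mod_l_zero mod_neg_neg mod_r_neg mod_l_neg mod_r_neg1
 mod_r_neg2 mod_minus_add mod_smult_radd mod_smult_rneg mod_smult_one mod_smult_zero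
 mod_cancel_apart

lemmas module_simprules [algebra module "zero M" "add M" "a_inv M" "a_minus M" "smult M"] =
 mod_closed mod_norm mod_neg_zero mod_smult_rzero

lemma mod_scale_comm:
 "module R M ==> r \<in> U R ==> s \<in> U R ==> x \<in> U M ==>
  r \<odot>\<^bsub>M\<^esub> (s \<odot>\<^bsub>M\<^esub> x) = s \<odot>\<^bsub>M\<^esub> (r \<odot>\<^bsub>M\<^esub> x)"
 using m_comm[of r s]
 by (simp add: mod_smult_assoc[symmetric])

lemma mod_eq_sub_iff:
 assumes "module R M" "x \<in> U M" "y \<in> U M" "z \<in> U M"
 shows "x = y \<oplus>\<^bsub>M\<^esub> z \<longleftrightarrow> x \<ominus>\<^bsub>M\<^esub> y = z"
proof
 assume "x = y \<oplus>\<^bsub>M\<^esub> z"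
 then have "x \<ominus>\<^bsub>M\<^esub> y = (y \<oplus>\<^bsub>M\<^esub> z) \<ominus>\<^bsub>M\<^esub> y" by simp
 also have "\<dots> = z" using assms by algebra
 finally show "x \<ominus>\<^bsub>M\<^esub> y = z" .
next
 assume "x \<ominus>\<^bsub>M\<^esub> y = z"
 then have "y \<oplus>\<^bsub>M\<^esub> z = y \<oplus>\<^bsub>M\<^esub> (x \<ominus>\<^bsub>M\<^esub> y)" by simp
 also have "\<dots> = x" using assms by algebra
 finally show "x = y \<oplus>\<^bsub>M\<^esub> z" by simp
qed

abbreviation (input) Lin where "Lin \<equiv> module_hom R"
abbreviation (input) Free where "Free \<equiv> fg_free_module R"

lemma hom_closed: "f \<in> Lin M N ==> x \<in> U M ==> f x \<in> U N"
 and hom_add: "f \<in> Lin M N ==> x \<in> U M ==> y \<in> U M ==> f (x \<oplus>\<^bsub>M\<^esub> y) = f x \<oplus>\<^bsub>N\<^esub> f y"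
 and hom_smult: "f \<in> Lin M N ==> r \<in> U R ==> x \<in> U M ==> f (r \<odot>\<^bsub>M\<^esub> x) = r \<odot>\<^bsub>N\<^esub> f x"
 by (auto simp: module_hom_def)

lemma hom_zero: "f \<in> Lin M N ==> module R M ==> module R N ==> f \<zero>\<^bsub>M\<^esub> = \<zero>\<^bsub>N\<^esub>"
proof -
 assume f: "f \<in> Lin M N" and M: "module R M" and N: "module R N"
 have "f (\<zero>\<^bsub>R\<^esub> \<odot>\<^bsub>M\<^esub> \<zero>\<^bsub>M\<^esub>) = \<zero>\<^bsub>R\<^esub> \<odot>\<^bsub>N\<^esub> f \<zero>\<^bsub>M\<^esub>" using f M by (intro hom_smult) auto
 then show ?thesis using M N hom_closed[OF f] by (simp add: mod_smult_zero[OF N])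
qed

lemma hom_neg: "f \<in> Lin M N ==> module R M ==> module R N ==> x \<in> U M ==>
  f (\<ominus>\<^bsub>M\<^esub> x) = \<ominus>\<^bsub>N\<^esub> f x"
proof -
 assume f: "f \<in> Lin M N" and M: "module R M" and N: "module R N" and x: "x \<in> U M"
 have "f x \<oplus>\<^bsub>N\<^esub> f (\<ominus>\<^bsub>M\<^esub> x) = \<zero>\<^bsub>N\<^esub>"
  using hom_add[OF f x, of "\<ominus>\<^bsub>M\<^esub> x"] M x hom_zero[OF f M N] by (simp add: mod_r_neg[OF M])
 then have "\<ominus>\<^bsub>N\<^esub> f x \<oplus>\<^bsub>N\<^esub> (f x \<oplus>\<^bsub>N\<^esub> f (\<ominus>\<^bsub>M\<^esub> x)) = \<ominus>\<^bsub>N\<^esub> f x \<oplus>\<^bsub>N\<^esub> \<zero>\<^bsub>N\<^esub>" by simp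
 then show ?thesis using M N x hom_closed[OF f] by (simp add: mod_r_neg1[OF N] mod_r_zero[OF N])
qed

lemma hom_minus: "f \<in> Lin M N ==> module R M ==> module R N ==> x \<in> U M ==> y \<in> U M ==>
  f (x \<ominus>\<^bsub>M\<^esub> y) = f x \<ominus>\<^bsub>N\<^esub> f y"
 by (simp add: a_minus_def hom_neg hom_add)

lemmas homD = hom_closed hom_add hom_smult hom_zero hom_neg hom_minus

lemma hom_eqI: "f \<in> Lin M N ==> g \<in> Lin M N' ==> (\<And>x. x \<in> U M ==> f x = g x) ==> f = g"
 unfolding module_hom_def PiE_def by (intro extensionalityI[of f "U M" g]) auto

lemma homI:
 assumes "\<And>x. x \<in> U M ==> f x \<in> U N"
  and "\<And>x y. x \<in> U M ==> y \<in> U M ==> f (x \<oplus>\<^bsub>M\<^esub> y) = f x \<oplus>\<^bsub>N\<^esub> f y"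
  and "\<And>r x. r \<in> U R ==> x \<in> U M ==> f (r \<odot>\<^bsub>M\<^esub> x) = r \<odot>\<^bsub>N\<^esub> f x"
  and "module R M"
 shows "(\<lambda>x\<in>U M. f x) \<in> Lin M N"
 using assms by (auto simp: module_hom_def)

lemma hom_id: "module R M ==> (\<lambda>x\<in>U M. x) \<in> Lin M M"
 by (rule homI) auto

lemma hom_null: "module R M ==> module R N ==> (\<lambda>x\<in>U M. \<zero>\<^bsub>N\<^esub>) \<in> Lin M N"
 by (rule homI) (auto simp: mod_norm)

lemma hom_scale: "module R M ==> s \<in> U R ==> (\<lambda>x\<in>U M. s \<odot>\<^bsub>M\<^esub> x) \<in> Lin M M"
 by (rule homI) (auto simp: mod_norm mod_scale_comm)

lemma hom_comp: "module R M ==> f \<in> Lin M N ==> g \<in> Lin N K ==>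
  (\<lambda>x\<in>U M. g (f x)) \<in> Lin M K"
 by (rule homI) (auto simp: homD)

lemma hom_sum: "module R M ==> module R N ==> f \<in> Lin M N ==> g \<in> Lin M N ==>
  (\<lambda>x\<in>U M. f x \<oplus>\<^bsub>N\<^esub> g x) \<in> Lin M N"
 by (rule homI) (auto simp: homD mod_norm)

lemma hom_opp: "module R M ==> module R N ==> f \<in> Lin M N ==>
  (\<lambda>x\<in>U M. \<ominus>\<^bsub>N\<^esub> f x) \<in> Lin M N"
 by (rule homI) (auto simp: homD mod_norm)

lemma hom_diff: "module R M ==> module R N ==> f \<in> Lin M N ==> g \<in> Lin M N ==>
  (\<lambda>x\<in>U M. f x \<ominus>\<^bsub>N\<^esub> g x) \<in> Lin M N"
 by (rule homI) (auto simp: homD mod_norm)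

end

locale square_zero_local = cring R for R (structure) +
 fixes p
 assumes p_carr [simp]: "p \<in> U R"
  and p_nonzero: "p \<noteq> \<zero>"
  and p_sq: "p \<otimes> p = \<zero>"
  and unit_or_multiple: "a \<in> U R ==> a \<in> Units R \<or> (\<exists>b\<in>U R. a = p \<otimes> b)"
begin

lemma unit_mult_cancel: "u \<in> Units R ==> x \<in> U R ==> u \<otimes> x = \<zero> ==> x = \<zero>"
proof -
 assume u: "u \<in> Units R" and x: "x \<in> U R" and ux: "u \<otimes> x = \<zero>"
 have "inv u \<otimes> (u \<otimes> x) = x" using u x Units_closed[OF u] by (simp add: m_assoc[symmetric])
 then show "x = \<zero>" using u ux by simp
qed

text \<open>
 A unit multiple of \<open>p\<close> does not vanish, so an annihilator of \<open>p\<close> lies in the maximal ideal.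
\<close>

lemma annihilator_p: "r \<in> U R ==> p \<otimes> r = \<zero> ==> \<exists>b\<in>U R. r = p \<otimes> b"
 using unit_or_multiple[of r] unit_mult_cancel[of r p] p_nonzero by (auto simp: m_comm)

lemma multiple_not_unit: "b \<in> U R ==> p \<otimes> b \<notin> Units R"
proof
 assume b: "b \<in> U R" and u: "p \<otimes> b \<in> Units R"
 have "p \<otimes> b \<otimes> p = p \<otimes> p \<otimes> b" using b by (simp add: m_ac)
 then show False using unit_mult_cancel[OF u p_carr] p_nonzero p_sq b by simp
qed

lemma one_not_multiple: "b \<in> U R ==> \<one> \<noteq> p \<otimes> b"
 using multiple_not_unit Units_one_closed by metis

lemma one_nonzero: "\<one> \<noteq> \<zero>"
 using one_not_multiple[of \<zero>] by simp

end

section \<open>Linear combinations and bases\<close>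

context cring
begin

definition lin :: "('a, 'm) module => 'i set => ('i => 'm) => ('i => 'a) => 'm"
 where "lin M I e c = finsum M (\<lambda>i. c i \<odot>\<^bsub>M\<^esub> e i) I"

lemma lin_closed [simp]:
 assumes "module R M" "e \<in> I \<rightarrow> U M" "c \<in> I \<rightarrow> U R"
 shows "lin M I e c \<in> U M"
proof -
 interpret M: module R M by fact
 show ?thesis unfolding lin_def using assms by (intro M.finsum_closed) auto
qed

lemma lin_cong:
 assumes "module R M" "e \<in> I \<rightarrow> U M" "c \<in> I \<rightarrow> U R"
  and "\<And>i. i \<in> I ==> e' i = e i" "\<And>i. i \<in> I ==> c' i = c i"
 shows "lin M I e' c' = lin M I e c"
proof -
 interpret M: module R M by fact
 show ?thesis unfolding lin_def using assms by (intro M.finsum_cong') (auto simp: Pi_iff)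
qed

lemma lin_empty [simp]: "module R M ==> lin M {} e c = \<zero>\<^bsub>M\<^esub>"
proof -
 assume "module R M"
 then interpret M: module R M .
 show ?thesis by (simp add: lin_def)
qed

lemma lin_insert:
 assumes "module R M" "finite I" "i \<notin> I" "e \<in> insert i I \<rightarrow> U M" "c \<in> insert i I \<rightarrow> U R"
 shows "lin M (insert i I) e c = c i \<odot>\<^bsub>M\<^esub> e i \<oplus>\<^bsub>M\<^esub> lin M I e c"
proof -
 interpret M: module R M by fact
 show ?thesis unfolding lin_def using assms by (intro M.finsum_insert) auto
qed

lemma lin_hom:
 assumes "module R M" "module R N" "h \<in> Lin M N" "finite I"
  "e \<in> I \<rightarrow> U M" "c \<in> I \<rightarrow> U R"
 shows "h (lin M I e c) = lin N I (\<lambda>i. h (e i)) c"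
 using assms(4-)
proof (induction I rule: finite_induct)
 case empty
 then show ?case using assms by (simp add: hom_zero)
next
 case (insert i I)
 have "(\<lambda>i. h (e i)) \<in> insert i I \<rightarrow> U N" using insert.prems hom_closed[OF assms(3)] by auto
 then show ?case
  using insert assms homD[OF assms(3)] by (auto simp: lin_insert)
qed

lemma lin_add:
 assumes "module R M" "finite I" "e \<in> I \<rightarrow> U M" "c \<in> I \<rightarrow> U R" "d \<in> I \<rightarrow> U R"
 shows "lin M I e (\<lambda>i. c i \<oplus> d i) = lin M I e c \<oplus>\<^bsub>M\<^esub> lin M I e d"
 using assms(2-)
proof (induction I rule: finite_induct)
 case empty
 then show ?case using assms by (simp add: mod_norm)
next
 case (insert i I)
 moreover have "(\<lambda>i. c i \<oplus> d i) \<in> insert i I \<rightarrow> U R" using insert by auto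
 ultimately show ?case using assms(1) by (auto simp: lin_insert mod_smult_ladd mod_ac)
qed

lemma lin_scale:
 assumes "module R M" "finite I" "e \<in> I \<rightarrow> U M" "c \<in> I \<rightarrow> U R" "r \<in> U R"
 shows "lin M I e (\<lambda>i. r \<otimes> c i) = r \<odot>\<^bsub>M\<^esub> lin M I e c"
 using assms(2-)
proof (induction I rule: finite_induct)
 case empty
 then show ?case using assms by simp
next
 case (insert i I)
 moreover have "(\<lambda>i. r \<otimes> c i) \<in> insert i I \<rightarrow> U R" using insert by auto
 ultimately show ?case using assms(1) by (auto simp: lin_insert mod_smult_radd mod_smult_assoc)
qed

lemma lin_minus:
 assumes "module R M" "finite I" "e \<in> I \<rightarrow> U M" "c \<in> I \<rightarrow> U R" "d \<in> I \<rightarrow> U R"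
 shows "lin M I e (\<lambda>i. c i \<ominus> d i) = lin M I e c \<ominus>\<^bsub>M\<^esub> lin M I e d"
proof -
 have "lin M I e c = lin M I e (\<lambda>i. d i \<oplus> (c i \<ominus> d i))"
  using assms by (intro lin_cong) (auto simp: minus_eq Pi_iff a_lcomm r_neg)
 also have "\<dots> = lin M I e d \<oplus>\<^bsub>M\<^esub> lin M I e (\<lambda>i. c i \<ominus> d i)"
  using assms by (intro lin_add) auto
 finally have "lin M I e c = lin M I e d \<oplus>\<^bsub>M\<^esub> lin M I e (\<lambda>i. c i \<ominus> d i)" .
 moreover have "(\<lambda>i. c i \<ominus> d i) \<in> I \<rightarrow> U R" using assms by auto
 ultimately show ?thesis using assms by (subst (asm) mod_eq_sub_iff) auto
qed

lemma lin_null: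
 assumes "module R M" "finite I" "e \<in> I \<rightarrow> U M" "\<And>i. i \<in> I ==> c i = \<zero>"
 shows "lin M I e c = \<zero>\<^bsub>M\<^esub>"
 using assms(2-)
proof (induction I rule: finite_induct)
 case (insert i I)
 then have "e i \<in> U M" by auto
 with insert assms(1) show ?case by (auto simp: lin_insert mod_norm)
qed (use assms in simp)

lemma lin_delta:
 assumes "module R M" "finite I" "e \<in> I \<rightarrow> U M" "i \<in> I"
 shows "lin M I e (\<lambda>j. if j = i then \<one> else \<zero>) = e i"
proof -
 have "lin M (insert i (I - {i})) e (\<lambda>j. if j = i then \<one> else \<zero>) =
   \<one> \<odot>\<^bsub>M\<^esub> e i \<oplus>\<^bsub>M\<^esub> lin M (I - {i}) e (\<lambda>j. if j = i then \<one> else \<zero>)"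
  using assms by (subst lin_insert) auto
 also have "lin M (I - {i}) e (\<lambda>j. if j = i then \<one> else \<zero>) = \<zero>\<^bsub>M\<^esub>"
  using assms by (intro lin_null) auto
 also have "\<one> \<odot>\<^bsub>M\<^esub> e i \<oplus>\<^bsub>M\<^esub> \<zero>\<^bsub>M\<^esub> = e i"
  using assms by (auto simp: mod_norm Pi_iff)
 finally show ?thesis using assms by (simp add: insert_absorb)
qed

lemma lin_Plus:
 assumes "module R M" "finite I" "finite J" "e \<in> I \<rightarrow> U M" "f \<in> J \<rightarrow> U M"
  "c \<in> I <+> J \<rightarrow> U R"
 shows "lin M (I <+> J) (case_sum e f) c =
  lin M I e (\<lambda>i. c (Inl i)) \<oplus>\<^bsub>M\<^esub> lin M J f (\<lambda>j. c (Inr j))"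
proof -
 interpret M: module R M by fact
 have "lin M (I <+> J) (case_sum e f) c = lin M (Inl ` I) (case_sum e f) c \<oplus>\<^bsub>M\<^esub> lin M (Inr ` J) (case_sum e f) c"
  unfolding lin_def Plus_def using assms by (intro M.finsum_Un_disjoint) (auto simp: Pi_iff InlI InrI)
 also have "lin M (Inl ` I) (case_sum e f) c = lin M I e (\<lambda>i. c (Inl i))"
  unfolding lin_def using assms by (subst M.finsum_reindex) (auto simp: Pi_iff InlI InrI)
 also have "lin M (Inr ` J) (case_sum e f) c = lin M J f (\<lambda>j. c (Inr j))"
  unfolding lin_def using assms by (subst M.finsum_reindex) (auto simp: Pi_iff InlI InrI)
 finally show ?thesis .
qed

text \<open>
 Bases are families rather than sets: families over a disjoint sum of index sets and images of
 families under a homomorphism need no injectivity argument.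
\<close>

definition basis_family :: "('a, 'm) module => 'i set => ('i => 'm) => bool"
 where "basis_family M I e \<longleftrightarrow> finite I \<and> e \<in> I \<rightarrow> U M \<and>
  (\<forall>x\<in>U M. \<exists>c\<in>I \<rightarrow> U R. x = lin M I e c) \<and>
  (\<forall>c\<in>I \<rightarrow> U R. lin M I e c = \<zero>\<^bsub>M\<^esub> \<longrightarrow> (\<forall>i\<in>I. c i = \<zero>))"

lemma basis_family_unique:
 assumes "module R M" "basis_family M I e" "c \<in> I \<rightarrow> U R" "d \<in> I \<rightarrow> U R"
  "lin M I e c = lin M I e d" "i \<in> I"
 shows "c i = d i"
proof -
 have f: "finite I" "e \<in> I \<rightarrow> U M" using assms(2) by (auto simp: basis_family_def)
 have "lin M I e (\<lambda>i. c i \<ominus> d i) = \<zero>\<^bsub>M\<^esub>"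
  using assms f by (simp add: lin_minus) (simp add: mod_norm)
 moreover have "(\<lambda>i. c i \<ominus> d i) \<in> I \<rightarrow> U R" using assms by auto
 ultimately have "c i \<ominus> d i = \<zero>"
  using assms(2,6) unfolding basis_family_def by blast
 moreover have cd: "c i \<in> U R" "d i \<in> U R" using assms by auto
 moreover have "c i = (c i \<ominus> d i) \<oplus> d i" using cd by algebra
 ultimately show ?thesis by simp
qed

lemma finite_basis_imp_family:
 assumes "module R M" "finite_basis R M B"
 shows "basis_family M B (\<lambda>b. b)"
 unfolding basis_family_def
proof (intro conjI ballI impI)
 show fin: "finite B" and sub: "(\<lambda>b. b) \<in> B \<rightarrow> U M" using assms by (auto simp: finite_basis_def)
 fix x assume "x \<in> U M"
 then show "\<exists>c\<in>B \<rightarrow> U R. x = lin M B (\<lambda>b. b) c"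
  using assms(2) unfolding finite_basis_def lin_def by (elim conjE ballE[of _ _ x]) (auto simp: PiE_def)
next
 fix c i assume c: "c \<in> B \<rightarrow> U R" "lin M B (\<lambda>b. b) c = \<zero>\<^bsub>M\<^esub>" and i: "i \<in> B"
 have fin: "finite B" and sub: "(\<lambda>b. b) \<in> B \<rightarrow> U M" using assms by (auto simp: finite_basis_def)
 let ?c = "restrict c B" and ?z = "\<lambda>b\<in>B. \<zero>"
 have ex1: "\<exists>!c. c \<in> B \<rightarrow>\<^sub>E U R \<and> x = lin M B (\<lambda>b. b) c" if "x \<in> U M" for x
  using assms(2) that unfolding finite_basis_def lin_def by (elim conjE ballE[of _ _ x]) auto
 have "\<exists>!c. c \<in> B \<rightarrow>\<^sub>E U R \<and> \<zero>\<^bsub>M\<^esub> = lin M B (\<lambda>b. b) c"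
  using assms(1) by (intro ex1) auto
 moreover have "lin M B (\<lambda>b. b) ?c = lin M B (\<lambda>b. b) c"
  using assms(1) sub c(1) by (intro lin_cong) auto
 moreover have "lin M B (\<lambda>b. b) ?z = \<zero>\<^bsub>M\<^esub>"
  using assms(1) sub fin by (intro lin_null) auto
 moreover have "?c \<in> B \<rightarrow>\<^sub>E U R" "?z \<in> B \<rightarrow>\<^sub>E U R" using c(1) by auto
 ultimately have "?c = ?z" using c(2) by metis
 then show "c i = \<zero>" using i by (metis restrict_apply')
qed

lemma lin_reindex:
 assumes "module R M" "inj_on e I" "e \<in> I \<rightarrow> U M" "c \<in> e ` I \<rightarrow> U R"
 shows "lin M (e ` I) (\<lambda>b. b) c = lin M I e (\<lambda>i. c (e i))"
proof -
 interpret M: module R M by fact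
 show ?thesis unfolding lin_def using assms by (subst M.finsum_reindex) auto
qed

lemma basis_family_inj:
 assumes "module R M" "basis_family M I e" "\<one> \<noteq> \<zero>"
 shows "inj_on e I"
proof (rule inj_onI, rule ccontr)
 fix i j assume ij: "i \<in> I" "j \<in> I" "e i = e j" "i \<noteq> j"
 have f: "finite I" "e \<in> I \<rightarrow> U M" using assms(2) by (auto simp: basis_family_def)
 have "(if i = i then \<one> else \<zero>) = (if i = j then \<one> else \<zero>)"
  using ij f assms by (intro basis_family_unique[OF assms(1,2)]) (auto simp: lin_delta)
 then show False using ij assms(3) by simp
qed

lemma finite_basisI:
 assumes "module R M" "basis_family M I e" "\<one> \<noteq> \<zero>"
 shows "finite_basis R M (e ` I)"
proof -
 have f: "finite I" "e \<in> I \<rightarrow> U M" using assms(2) by (auto simp: basis_family_def)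
 have inj: "inj_on e I" using basis_family_inj[OF assms] .
 note reindex = lin_reindex[OF assms(1) inj f(2)]
 show ?thesis unfolding finite_basis_def lin_def[symmetric]
 proof (intro conjI ballI ex_ex1I)
  fix x assume "x \<in> U M"
  then obtain c where c: "c \<in> I \<rightarrow> U R" "x = lin M I e c"
   using assms(2) unfolding basis_family_def by blast
  let ?d = "\<lambda>b\<in>e ` I. c (inv_into I e b)"
  have "?d \<in> e ` I \<rightarrow>\<^sub>E U R" using c inj by auto
  moreover have "lin M (e ` I) (\<lambda>b. b) ?d = lin M I e c"
   using c inj assms(1) f by (subst reindex) (auto intro!: lin_cong)
  ultimately show "\<exists>d. d \<in> e ` I \<rightarrow>\<^sub>E U R \<and> x = lin M (e ` I) (\<lambda>b. b) d" using c(2) by metis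
 next
  fix x c d
  assume c: "c \<in> e ` I \<rightarrow>\<^sub>E U R \<and> x = lin M (e ` I) (\<lambda>b. b) c"
   and d: "d \<in> e ` I \<rightarrow>\<^sub>E U R \<and> x = lin M (e ` I) (\<lambda>b. b) d"
  then have "lin M I e (\<lambda>i. c (e i)) = lin M I e (\<lambda>i. d (e i))"
   using reindex[of c] reindex[of d] by (auto simp: PiE_def)
  then have "c (e i) = d (e i)" if "i \<in> I" for i
   using c d that by (intro basis_family_unique[OF assms(1,2), of "\<lambda>i. c (e i)" "\<lambda>i. d (e i)"]) auto
  then show "c = d" using c d by (intro PiE_ext[of c "e ` I" "\<lambda>_. U R" d]) auto
 qed (use f in auto)
qed

lemma linear_extension:
 assumes "module R M" "module R N" "basis_family M I e" "g \<in> I \<rightarrow> U N"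
 shows "\<exists>h\<in>Lin M N. \<forall>i\<in>I. h (e i) = g i"
proof -
 have f: "finite I" "e \<in> I \<rightarrow> U M" using assms(3) by (auto simp: basis_family_def)
 obtain k where k: "\<And>x. x \<in> U M ==> k x \<in> I \<rightarrow> U R" "\<And>x. x \<in> U M ==> x = lin M I e (k x)"
  using assms(3) unfolding basis_family_def by metis
 have uniq: "lin N I g (k x) = lin N I g c" if "c \<in> I \<rightarrow> U R" "x = lin M I e c" for x c
 proof (rule lin_cong)
  have x: "x \<in> U M" using that assms(1) f by auto
  fix i assume "i \<in> I"
  then show "k x i = c i"
   using that k[OF x] by (intro basis_family_unique[OF assms(1,3)]) auto
 qed (use assms that in auto)
 define h where "h = (\<lambda>x\<in>U M. lin N I g (k x))"
 have "h \<in> Lin M N" unfolding h_def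
 proof (rule homI)
  fix x y assume xy: "x \<in> U M" "y \<in> U M"
  have "lin N I g (k (x \<oplus>\<^bsub>M\<^esub> y)) = lin N I g (\<lambda>i. k x i \<oplus> k y i)"
  proof (rule uniq)
   show "(\<lambda>i. k x i \<oplus> k y i) \<in> I \<rightarrow> U R" using k(1)[OF xy(1)] k(1)[OF xy(2)] by auto
   show "x \<oplus>\<^bsub>M\<^esub> y = lin M I e (\<lambda>i. k x i \<oplus> k y i)"
    using k[OF xy(1)] k[OF xy(2)] f assms(1) by (simp add: lin_add)
  qed
  then show "lin N I g (k (x \<oplus>\<^bsub>M\<^esub> y)) = lin N I g (k x) \<oplus>\<^bsub>N\<^esub> lin N I g (k y)"
   using k[OF xy(1)] k[OF xy(2)] f assms by (simp add: lin_add)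
 next
  fix r x assume rx: "r \<in> U R" "x \<in> U M"
  have "lin N I g (k (r \<odot>\<^bsub>M\<^esub> x)) = lin N I g (\<lambda>i. r \<otimes> k x i)"
  proof (rule uniq)
   show "(\<lambda>i. r \<otimes> k x i) \<in> I \<rightarrow> U R" using k(1)[OF rx(2)] rx by auto
   show "r \<odot>\<^bsub>M\<^esub> x = lin M I e (\<lambda>i. r \<otimes> k x i)"
    using k[OF rx(2)] rx f assms(1) by (simp add: lin_scale)
  qed
  then show "lin N I g (k (r \<odot>\<^bsub>M\<^esub> x)) = r \<odot>\<^bsub>N\<^esub> lin N I g (k x)"
   using k[OF rx(2)] rx f assms by (simp add: lin_scale)
 qed (use k assms in auto)
 moreover have "h (e i) = g i" if i: "i \<in> I" for i
 proof -
  have "h (e i) = lin N I g (k (e i))" using i f by (auto simp: h_def)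
  also have "\<dots> = lin N I g (\<lambda>j. if j = i then \<one> else \<zero>)"
   using i f assms(1) by (intro uniq) (auto simp: lin_delta)
  also have "\<dots> = g i" using i f assms by (intro lin_delta) auto
  finally show ?thesis .
 qed
 ultimately show ?thesis by blast
qed

lemma hom_eq_on_basis:
 assumes "module R M" "module R N" "basis_family M I e" "g \<in> Lin M N" "h \<in> Lin M N"
  "\<And>i. i \<in> I ==> g (e i) = h (e i)" "x \<in> U M"
 shows "g x = h x"
proof -
 have f: "finite I" "e \<in> I \<rightarrow> U M" using assms(3) by (auto simp: basis_family_def)
 obtain c where c: "c \<in> I \<rightarrow> U R" "x = lin M I e c"
  using assms(3,7) unfolding basis_family_def by blast
 have "g x = lin N I (\<lambda>i. g (e i)) c" using c f assms by (simp add: lin_hom)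
 also have "\<dots> = lin N I (\<lambda>i. h (e i)) c"
  using c f assms hom_closed[OF assms(5)] by (intro lin_cong) auto
 also have "\<dots> = h x" using c f assms by (simp add: lin_hom)
 finally show ?thesis .
qed

end

section \<open>Free modules and multiplication by p\<close>

context cring
begin

lemma submodD:
 assumes "module R M" "submodule K R M"
 shows "x \<in> K ==> x \<in> U M" "\<zero>\<^bsub>M\<^esub> \<in> K" "x \<in> K ==> \<ominus>\<^bsub>M\<^esub> x \<in> K"
  "x \<in> K ==> y \<in> K ==> x \<oplus>\<^bsub>M\<^esub> y \<in> K" "r \<in> U R ==> x \<in> K ==> r \<odot>\<^bsub>M\<^esub> x \<in> K"
  "x \<in> K ==> y \<in> K ==> x \<ominus>\<^bsub>M\<^esub> y \<in> K"
proof -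
 note E = module.submoduleE[OF assms]
 show "x \<in> K ==> x \<in> U M" "x \<in> K ==> \<ominus>\<^bsub>M\<^esub> x \<in> K"
  "x \<in> K ==> y \<in> K ==> x \<oplus>\<^bsub>M\<^esub> y \<in> K" "r \<in> U R ==> x \<in> K ==> r \<odot>\<^bsub>M\<^esub> x \<in> K"
  "x \<in> K ==> y \<in> K ==> x \<ominus>\<^bsub>M\<^esub> y \<in> K" using E by (auto simp: a_minus_def)
 from E(2) obtain k where "k \<in> K" by auto
 then have "\<zero>\<^bsub>R\<^esub> \<odot>\<^bsub>M\<^esub> k \<in> K" using E(4) by auto
 then show "\<zero>\<^bsub>M\<^esub> \<in> K" using \<open>k \<in> K\<close> E(1) by (simp add: mod_smult_zero[OF assms(1)] subsetD)
qed

lemma submodI: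
 assumes "module R M" "K \<subseteq> U M" "\<zero>\<^bsub>M\<^esub> \<in> K"
  "\<And>x y. x \<in> K ==> y \<in> K ==> x \<oplus>\<^bsub>M\<^esub> y \<in> K"
  "\<And>r x. r \<in> U R ==> x \<in> K ==> r \<odot>\<^bsub>M\<^esub> x \<in> K"
 shows "submodule K R M"
proof (rule module.submoduleI)
 fix x assume x: "x \<in> K"
 have "\<ominus>\<^bsub>M\<^esub> x = (\<ominus>\<^bsub>R\<^esub> \<one>\<^bsub>R\<^esub>) \<odot>\<^bsub>M\<^esub> x"
  using x assms(1,2) by (subst mod_smult_lneg) (auto simp: mod_smult_one)
 then show "\<ominus>\<^bsub>M\<^esub> x \<in> K" using assms(5) x by simp
qed (use assms in auto)

lemma lin_in_submodule:
 assumes "module R M" "submodule K R M" "finite I" "e \<in> I \<rightarrow> K" "c \<in> I \<rightarrow> U R"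
 shows "lin M I e c \<in> K"
 using assms(3-)
proof (induction I rule: finite_induct)
 case (insert i I)
 then have "e \<in> insert i I \<rightarrow> U M" using submodD(1)[OF assms(1,2)] by auto
 with insert show ?case using submodD[OF assms(1,2)] assms(1) by (auto simp: lin_insert)
qed (use assms submodD in auto)

definition multiples :: "'a => ('a, 'm) module => 'm set"
 where "multiples r M = (\<lambda>y. r \<odot>\<^bsub>M\<^esub> y) ` U M"

lemma multiples_submodule:
 assumes "module R M" "r \<in> U R"
 shows "submodule (multiples r M) R M"
proof (rule submodI[OF assms(1)])
 show "\<zero>\<^bsub>M\<^esub> \<in> multiples r M"
  using assms by (auto simp: multiples_def intro!: image_eqI[of _ _ "\<zero>\<^bsub>M\<^esub>"])
 fix x y assume "x \<in> multiples r M" "y \<in> multiples r M"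
 then obtain x' y' where "x' \<in> U M" "x = r \<odot>\<^bsub>M\<^esub> x'" "y' \<in> U M" "y = r \<odot>\<^bsub>M\<^esub> y'"
  by (auto simp: multiples_def)
 then show "x \<oplus>\<^bsub>M\<^esub> y \<in> multiples r M"
  using assms by (auto simp: multiples_def mod_smult_radd intro!: image_eqI[of _ _ "x' \<oplus>\<^bsub>M\<^esub> y'"])
next
 fix s x assume "s \<in> U R" "x \<in> multiples r M"
 then obtain x' where "x' \<in> U M" "x = r \<odot>\<^bsub>M\<^esub> x'"
  by (auto simp: multiples_def)
 then show "s \<odot>\<^bsub>M\<^esub> x \<in> multiples r M"
  using assms \<open>s \<in> U R\<close>
  by (auto simp: multiples_def mod_scale_comm intro!: image_eqI[of _ _ "s \<odot>\<^bsub>M\<^esub> x'"])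
qed (use assms in \<open>auto simp: multiples_def\<close>)

lemma multiples_hom: "f \<in> Lin M N ==> r \<in> U R ==> x \<in> multiples r M ==> f x \<in> multiples r N"
 by (auto simp: multiples_def homD intro!: imageI)

lemma preimage_submodule:
 assumes "module R M" "module R N" "f \<in> Lin M N" "submodule W R N"
 shows "submodule {x \<in> U M. f x \<in> W} R M"
 using assms submodD[OF assms(2,4)] by (intro submodI) (auto simp: homD)

text \<open>
 Lift the images of the basis vectors and extend linearly.
\<close>

lemma basis_projective:
 assumes "module R A" "module R B" "module R C" "basis_family A I e" "h \<in> Lin A B"
  "g \<in> Lin C B" "\<And>a. a \<in> U A ==> \<exists>c\<in>U C. h a = g c"
 shows "\<exists>k\<in>Lin A C. \<forall>a\<in>U A. h a = g (k a)"
proof -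
 have e: "e \<in> I \<rightarrow> U A" using assms(4) by (auto simp: basis_family_def)
 then have "\<forall>i\<in>I. \<exists>c\<in>U C. h (e i) = g c" using assms(7) by auto
 then obtain c where c: "\<And>i. i \<in> I ==> c i \<in> U C" "\<And>i. i \<in> I ==> h (e i) = g (c i)" by metis
 obtain k where k: "k \<in> Lin A C" "\<And>i. i \<in> I ==> k (e i) = c i"
  using linear_extension[OF assms(1,3,4), of c] c by auto
 have "h a = g (k a)" if a: "a \<in> U A" for a
 proof -
  have "h a = (\<lambda>x\<in>U A. g (k x)) a"
  proof (rule hom_eq_on_basis[OF assms(1,2,4,5) _ _ a])
   show "(\<lambda>x\<in>U A. g (k x)) \<in> Lin A B" using hom_comp[OF assms(1) k(1) assms(6)] .
  qed (use c k e in auto)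
  then show ?thesis using a by simp
 qed
 then show ?thesis using k(1) by blast
qed

lemma fg_freeD: "Free M ==> module R M"
 by (simp add: fg_free_module_def)

lemma fg_free_basis:
 assumes "Free M"
 obtains B where "basis_family M B (\<lambda>b. b)"
 using assms finite_basis_imp_family by (auto simp: fg_free_module_def)

lemma projective:
 assumes "Free A" "module R B" "module R C" "h \<in> Lin A B"
  "g \<in> Lin C B" "\<And>a. a \<in> U A ==> \<exists>c\<in>U C. h a = g c"
 obtains k where "k \<in> Lin A C" "\<And>a. a \<in> U A ==> h a = g (k a)"
proof -
 obtain B where "basis_family A B (\<lambda>b. b)" using fg_free_basis assms(1) .
 from basis_projective[OF fg_freeD[OF assms(1)] assms(2,3) this assms(4-6)] that show thesis by blast
qed

lemma projective_scale:
 assumes "Free A" "module R B" "h \<in> Lin A B" "r \<in> U R"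
  "\<And>a. a \<in> U A ==> h a \<in> multiples r B"
 obtains k where "k \<in> Lin A B" "\<And>a. a \<in> U A ==> h a = r \<odot>\<^bsub>B\<^esub> k a"
proof -
 have "\<exists>c\<in>U B. h a = (\<lambda>x\<in>U B. r \<odot>\<^bsub>B\<^esub> x) c" if "a \<in> U A" for a
  using assms(5)[OF that] unfolding multiples_def by auto
 then obtain k where k: "k \<in> Lin A B"
   "\<And>a. a \<in> U A ==> h a = (\<lambda>x\<in>U B. r \<odot>\<^bsub>B\<^esub> x) (k a)"
  using projective[OF assms(1,2,2,3) hom_scale[OF assms(2,4)]] by metis
 then show thesis using that hom_closed[OF k(1)] by auto
qed

end

context square_zero_local
begin

lemma scale_pp [simp]: "module R M ==> x \<in> U M ==> p \<odot>\<^bsub>M\<^esub> (p \<odot>\<^bsub>M\<^esub> x) = \<zero>\<^bsub>M\<^esub>"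
 by (simp add: mod_smult_assoc[symmetric] p_sq mod_smult_zero)

text \<open>
 Free modules have this property, and it passes to kernels of retractions before these are known
 to be free.
\<close>

definition p_exact :: "('a, 'm) module => bool"
 where "p_exact M \<longleftrightarrow> (\<forall>z\<in>U M. p \<odot>\<^bsub>M\<^esub> z = \<zero>\<^bsub>M\<^esub> \<longrightarrow> z \<in> multiples p M)"

lemma basis_p_exact:
 assumes "module R M" "basis_family M I e"
 shows "p_exact M"
 unfolding p_exact_def
proof (intro ballI impI)
 fix z assume z: "z \<in> U M" "p \<odot>\<^bsub>M\<^esub> z = \<zero>\<^bsub>M\<^esub>"
 have f: "finite I" "e \<in> I \<rightarrow> U M" using assms(2) by (auto simp: basis_family_def)
 obtain c where c: "c \<in> I \<rightarrow> U R" "z = lin M I e c"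
  using assms(2) z unfolding basis_family_def by blast
 have "lin M I e (\<lambda>i. p \<otimes> c i) = \<zero>\<^bsub>M\<^esub>" using c f z assms by (simp add: lin_scale)
 moreover have "(\<lambda>i. p \<otimes> c i) \<in> I \<rightarrow> U R" using c by auto
 ultimately have "\<forall>i\<in>I. p \<otimes> c i = \<zero>" using assms(2) unfolding basis_family_def by blast
 then have "\<forall>i\<in>I. \<exists>b\<in>U R. c i = p \<otimes> b" using annihilator_p c(1) by blast
 then obtain b where b: "\<And>i. i \<in> I ==> b i \<in> U R" "\<And>i. i \<in> I ==> c i = p \<otimes> b i" by metis
 have "lin M I e c = lin M I e (\<lambda>i. p \<otimes> b i)"
  using assms f b by (intro lin_cong) auto
 also have "\<dots> = p \<odot>\<^bsub>M\<^esub> lin M I e b" using assms f b by (intro lin_scale) auto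
 finally show "z \<in> multiples p M" using c(2) f b assms(1) by (auto simp: multiples_def)
qed

lemma fg_free_p_exact: "Free M ==> p_exact M"
 using basis_p_exact fg_free_basis fg_freeD by metis

lemma p_annihilated:
 assumes "Free M" "z \<in> U M" "p \<odot>\<^bsub>M\<^esub> z = \<zero>\<^bsub>M\<^esub>"
 obtains y where "y \<in> U M" "z = p \<odot>\<^bsub>M\<^esub> y"
 using fg_free_p_exact[OF assms(1)] assms(2,3) by (auto simp: p_exact_def multiples_def)

text \<open>
 Nakayama's lemma for the nilpotent ideal \<open>(p)\<close>: expanding the error \<open>p y\<close> once more leaves an
 error in \<open>p\<^sup>2 M = 0\<close>. In a linear relation all coefficients are multiples of \<open>p\<close>; by
 \<open>p\<close>-exactness the relation can be divided by \<open>p\<close>, so the quotients are multiples of \<open>p\<close> too.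
\<close>

lemma nakayama_basis:
 assumes M: "module R M" and "p_exact M" and fin: "finite I" and e: "e \<in> I \<rightarrow> U M"
  and span: "\<And>x. x \<in> U M ==> \<exists>c\<in>I \<rightarrow> U R. x \<ominus>\<^bsub>M\<^esub> lin M I e c \<in> multiples p M"
  and indep: "\<And>c i. c \<in> I \<rightarrow> U R ==> lin M I e c \<in> multiples p M ==> i \<in> I ==> c i \<notin> Units R"
 shows "basis_family M I e"
proof -
 have mod_p: "\<exists>c\<in>I \<rightarrow> U R. \<exists>y\<in>U M. x = lin M I e c \<oplus>\<^bsub>M\<^esub> p \<odot>\<^bsub>M\<^esub> y" if x: "x \<in> U M" for x
 proof -
  obtain c where c: "c \<in> I \<rightarrow> U R" "x \<ominus>\<^bsub>M\<^esub> lin M I e c \<in> multiples p M" using span[OF x] by blast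
  then obtain y where y: "y \<in> U M" "x \<ominus>\<^bsub>M\<^esub> lin M I e c = p \<odot>\<^bsub>M\<^esub> y" by (auto simp: multiples_def)
  then have "x = lin M I e c \<oplus>\<^bsub>M\<^esub> p \<odot>\<^bsub>M\<^esub> y" using M x c(1) e by (subst mod_eq_sub_iff) auto
  then show ?thesis using c y by blast
 qed
 have divisible: "\<exists>d\<in>I \<rightarrow> U R. \<forall>i\<in>I. c i = p \<otimes> d i"
  if "c \<in> I \<rightarrow> U R" "lin M I e c \<in> multiples p M" for c
 proof -
  have "\<forall>i\<in>I. \<exists>b\<in>U R. c i = p \<otimes> b" using indep[OF that] unit_or_multiple that(1) by blast
  then obtain b where "\<And>i. i \<in> I ==> b i \<in> U R" "\<And>i. i \<in> I ==> c i = p \<otimes> b i" by metis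
  then show ?thesis by (intro bexI[of _ b]) auto
 qed
 have pd: "lin M I e c = p \<odot>\<^bsub>M\<^esub> lin M I e d" if "d \<in> I \<rightarrow> U R" "\<forall>i\<in>I. c i = p \<otimes> d i" for c d
 proof -
  have "lin M I e c = lin M I e (\<lambda>i. p \<otimes> d i)" using that M e by (intro lin_cong) auto
  then show ?thesis using that M e fin by (simp add: lin_scale)
 qed
 show ?thesis unfolding basis_family_def
 proof (intro conjI ballI impI)
  fix x assume "x \<in> U M"
  then obtain c y where c: "c \<in> I \<rightarrow> U R" "y \<in> U M" "x = lin M I e c \<oplus>\<^bsub>M\<^esub> p \<odot>\<^bsub>M\<^esub> y"
   using mod_p by blast
  obtain d z where d: "d \<in> I \<rightarrow> U R" "z \<in> U M" "y = lin M I e d \<oplus>\<^bsub>M\<^esub> p \<odot>\<^bsub>M\<^esub> z"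
   using mod_p c(2) by blast
  have "p \<odot>\<^bsub>M\<^esub> y = p \<odot>\<^bsub>M\<^esub> lin M I e d"
   unfolding d(3) using d(1,2) M e by (simp add: mod_smult_radd mod_r_zero)
  moreover have "(\<lambda>i. p \<otimes> d i) \<in> I \<rightarrow> U R" using d(1) by auto
  ultimately have "x = lin M I e (\<lambda>i. c i \<oplus> p \<otimes> d i)"
   using c(1,3) d(1) M e fin by (simp add: lin_add lin_scale)
  moreover have "(\<lambda>i. c i \<oplus> p \<otimes> d i) \<in> I \<rightarrow> U R" using c(1) d(1) by (simp add: Pi_iff)
  ultimately show "\<exists>c\<in>I \<rightarrow> U R. x = lin M I e c" by blast
 next
  fix c i assume c: "c \<in> I \<rightarrow> U R" "lin M I e c = \<zero>\<^bsub>M\<^esub>" and i: "i \<in> I"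
  have "\<zero>\<^bsub>M\<^esub> \<in> multiples p M" using submodD(2)[OF M multiples_submodule[OF M]] by simp
  then obtain d where d: "d \<in> I \<rightarrow> U R" "\<forall>i\<in>I. c i = p \<otimes> d i" using divisible c by metis
  then have "p \<odot>\<^bsub>M\<^esub> lin M I e d = \<zero>\<^bsub>M\<^esub>" using pd c(2) by metis
  then have "lin M I e d \<in> multiples p M" using assms(2) d(1) M e by (auto simp: p_exact_def)
  then obtain b where "b \<in> I \<rightarrow> U R" "\<forall>i\<in>I. d i = p \<otimes> b i" using divisible d(1) by blast
  then show "c i = \<zero>" using d i by (auto simp: m_assoc[symmetric] p_sq Pi_iff)
 qed (use fin e in auto)
qed

text \<open>
 When \<open>p M \<subseteq> W\<close>, this is a basis of the vector space \<open>V/W\<close> over the residue field: there a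
 coefficient vanishes iff it is not a unit of \<open>R\<close>.
\<close>

definition rel_basis :: "('a, 'm) module => 'm set => 'm set => 'i set => ('i => 'm) => bool"
 where "rel_basis M V W I e \<longleftrightarrow> finite I \<and> e \<in> I \<rightarrow> V \<and>
  (\<forall>x\<in>V. \<exists>c\<in>I \<rightarrow> U R. x \<ominus>\<^bsub>M\<^esub> lin M I e c \<in> W) \<and>
  (\<forall>c\<in>I \<rightarrow> U R. lin M I e c \<in> W \<longrightarrow> (\<forall>i\<in>I. c i \<notin> Units R))"

text \<open>
 Induction on a finite set that spans \<open>V\<close> modulo \<open>W\<close>. The elements of \<open>V\<close> expressible without the
 last vector \<open>s\<close> of the set form a submodule \<open>V0\<close>, which has a relative basis by induction; if it is
 not all of \<open>V\<close>, one more vector suffices.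
\<close>

lemma rel_basis_exists_aux:
 assumes M: "module R M" and W: "submodule W R M" "multiples p M \<subseteq> W"
 shows "finite S ==> S \<subseteq> U M ==> submodule V R M ==> W \<subseteq> V ==>
  (\<forall>x\<in>V. \<exists>c\<in>S \<rightarrow> U R. x \<ominus>\<^bsub>M\<^esub> lin M S id c \<in> W) ==>
  \<exists>I. rel_basis M V W I id"
proof (induction S arbitrary: V rule: finite_induct)
 case empty
 note W' = submodD[OF M W(1)] and V' = submodD[OF M empty(2)]
 have sub: "V \<subseteq> W"
 proof
  fix x assume x: "x \<in> V"
  then have "x \<ominus>\<^bsub>M\<^esub> \<zero>\<^bsub>M\<^esub> \<in> W" using empty(4) M by auto
  then show "x \<in> W" using V'(1)[OF x] M by (simp add: mod_norm)
 qed
 have diff: "x \<ominus>\<^bsub>M\<^esub> \<zero>\<^bsub>M\<^esub> \<in> W" if "x \<in> V" for x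
  using W'(6)[OF _ W'(2)] sub that by auto
 have "rel_basis M V W {} id"
  unfolding rel_basis_def lin_empty[OF M] using diff by simp
 then show ?case by blast
next
 case (insert s S)
 note W' = submodD[OF M W(1)] and V' = submodD[OF M insert.prems(2)]
 have s: "s \<in> U M" and S: "id \<in> S \<rightarrow> U M" using insert.prems by auto
 define V0 where "V0 = {x \<in> V. \<exists>c\<in>S \<rightarrow> U R. x \<ominus>\<^bsub>M\<^esub> lin M S id c \<in> W}"
 have V0: "submodule V0 R M"
 proof (rule submodI[OF M])
  show "V0 \<subseteq> U M" using V' by (auto simp: V0_def)
  have "lin M S id (\<lambda>_. \<zero>) = \<zero>\<^bsub>M\<^esub>" using M insert.hyps S by (intro lin_null) auto
  then show "\<zero>\<^bsub>M\<^esub> \<in> V0" unfolding V0_def using V' W' M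
   by (auto intro!: bexI[of _ "\<lambda>_. \<zero>"] simp: mod_norm)
 next
  fix x y assume "x \<in> V0" "y \<in> V0"
  then obtain c d where x: "x \<in> V" "c \<in> S \<rightarrow> U R" "x \<ominus>\<^bsub>M\<^esub> lin M S id c \<in> W"
   and y: "y \<in> V" "d \<in> S \<rightarrow> U R" "y \<ominus>\<^bsub>M\<^esub> lin M S id d \<in> W" by (auto simp: V0_def)
  let ?c = "lin M S id c" and ?d = "lin M S id d"
  have mem: "?c \<in> U M" "?d \<in> U M" "x \<in> U M" "y \<in> U M"
   using M x y S V' by auto
  have "(x \<oplus>\<^bsub>M\<^esub> y) \<ominus>\<^bsub>M\<^esub> (?c \<oplus>\<^bsub>M\<^esub> ?d) = (x \<ominus>\<^bsub>M\<^esub> ?c) \<oplus>\<^bsub>M\<^esub> (y \<ominus>\<^bsub>M\<^esub> ?d)" using M mem by algebra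
  then have "(x \<oplus>\<^bsub>M\<^esub> y) \<ominus>\<^bsub>M\<^esub> lin M S id (\<lambda>i. c i \<oplus> d i) \<in> W"
   using x y W' M S insert.hyps by (simp add: lin_add)
  moreover have "(\<lambda>i. c i \<oplus> d i) \<in> S \<rightarrow> U R" using x y by auto
  ultimately show "x \<oplus>\<^bsub>M\<^esub> y \<in> V0" using x y V' by (auto simp: V0_def)
 next
  fix r x assume r: "r \<in> U R" and "x \<in> V0"
  then obtain c where x: "x \<in> V" "c \<in> S \<rightarrow> U R" "x \<ominus>\<^bsub>M\<^esub> lin M S id c \<in> W"
   by (auto simp: V0_def)
  let ?c = "lin M S id c"
  have mem: "?c \<in> U M" "x \<in> U M" using M x S V' by auto
  have "r \<odot>\<^bsub>M\<^esub> x \<ominus>\<^bsub>M\<^esub> r \<odot>\<^bsub>M\<^esub> ?c = r \<odot>\<^bsub>M\<^esub> (x \<ominus>\<^bsub>M\<^esub> ?c)" using M mem r by algebra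
  then have "r \<odot>\<^bsub>M\<^esub> x \<ominus>\<^bsub>M\<^esub> lin M S id (\<lambda>i. r \<otimes> c i) \<in> W"
   using x r W' M S insert.hyps by (simp add: lin_scale)
  moreover have "(\<lambda>i. r \<otimes> c i) \<in> S \<rightarrow> U R" using x r by auto
  ultimately show "r \<odot>\<^bsub>M\<^esub> x \<in> V0" using x V' r by (auto simp: V0_def)
 qed
 have WV0: "W \<subseteq> V0"
 proof
  fix w assume w: "w \<in> W"
  have "lin M S id (\<lambda>_. \<zero>) = \<zero>\<^bsub>M\<^esub>" using M insert.hyps S by (intro lin_null) auto
  moreover have "w \<ominus>\<^bsub>M\<^esub> \<zero>\<^bsub>M\<^esub> = w" using M W'(1)[OF w] by (simp add: mod_norm)
  ultimately show "w \<in> V0" unfolding V0_def using insert.prems(3) w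
   by (auto intro!: bexI[of _ "\<lambda>_. \<zero>"])
 qed
 obtain I where I: "rel_basis M V0 W I id"
 proof -
  have "\<forall>x\<in>V0. \<exists>c\<in>S \<rightarrow> U R. x \<ominus>\<^bsub>M\<^esub> lin M S id c \<in> W" by (simp add: V0_def)
  from insert.IH[OF _ V0 WV0 this] insert.prems(1) that show thesis by blast
 qed
 have I': "finite I" "I \<subseteq> V0" using I by (auto simp: rel_basis_def)
 have IM: "id \<in> I \<rightarrow> U M" using I' submodD(1)[OF M V0] by auto
 show ?case
 proof (cases "V \<subseteq> V0")
  case True
  then have "V = V0" by (auto simp: V0_def)
  then show ?thesis using I by blast
 next
  case False
  \<comment> \<open>A vector outside \<open>V0\<close> has a unit as coefficient at \<open>s\<close>, so it spans \<open>V\<close> modulo \<open>V0\<close>.\<close>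
  then obtain v where v: "v \<in> V" "v \<notin> V0" by blast
  have vM: "v \<in> U M" using v V' by blast
  have coeff: "\<exists>a\<in>U R. \<exists>y\<in>U M. x = a \<odot>\<^bsub>M\<^esub> s \<oplus>\<^bsub>M\<^esub> y \<and> (\<exists>c\<in>S \<rightarrow> U R. y \<ominus>\<^bsub>M\<^esub> lin M S id c \<in> W)"
   if x: "x \<in> V" for x
  proof -
   obtain c where c: "c \<in> insert s S \<rightarrow> U R" "x \<ominus>\<^bsub>M\<^esub> lin M (insert s S) id c \<in> W"
    using insert.prems(4) x by blast
   let ?y = "lin M S id c"
   have mem: "?y \<in> U M" "x \<in> U M" "c s \<odot>\<^bsub>M\<^esub> s \<in> U M" using M x c S V' s by auto
   have "lin M (insert s S) id c = c s \<odot>\<^bsub>M\<^esub> s \<oplus>\<^bsub>M\<^esub> ?y"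
    using lin_insert[OF M insert.hyps, of id c] s S c(1) by auto
   with c have w: "x \<ominus>\<^bsub>M\<^esub> (c s \<odot>\<^bsub>M\<^esub> s \<oplus>\<^bsub>M\<^esub> ?y) \<in> W" by simp
   have "x = c s \<odot>\<^bsub>M\<^esub> s \<oplus>\<^bsub>M\<^esub> (x \<ominus>\<^bsub>M\<^esub> c s \<odot>\<^bsub>M\<^esub> s)" using M mem by algebra
   moreover have "(x \<ominus>\<^bsub>M\<^esub> c s \<odot>\<^bsub>M\<^esub> s) \<ominus>\<^bsub>M\<^esub> ?y = x \<ominus>\<^bsub>M\<^esub> (c s \<odot>\<^bsub>M\<^esub> s \<oplus>\<^bsub>M\<^esub> ?y)" using M mem by algebra
   ultimately show ?thesis using w c(1) M mem
    by (intro bexI[of _ "c s"] bexI[of _ "x \<ominus>\<^bsub>M\<^esub> c s \<odot>\<^bsub>M\<^esub> s"] conjI bexI[of _ c]) auto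
  qed
  obtain a y cy where a: "a \<in> U R" "y \<in> U M" "v = a \<odot>\<^bsub>M\<^esub> s \<oplus>\<^bsub>M\<^esub> y"
   "cy \<in> S \<rightarrow> U R" "y \<ominus>\<^bsub>M\<^esub> lin M S id cy \<in> W" using coeff[OF v(1)] by blast
  have "a \<in> Units R"
  proof (rule ccontr)
   assume "a \<notin> Units R"
   then obtain b where b: "b \<in> U R" "a = p \<otimes> b" using unit_or_multiple a(1) by blast
   then have "a \<odot>\<^bsub>M\<^esub> s \<in> multiples p M" using M s by (auto simp: multiples_def mod_smult_assoc)
   then have "a \<odot>\<^bsub>M\<^esub> s \<in> W" using W(2) by blast
   moreover have "v \<ominus>\<^bsub>M\<^esub> lin M S id cy = a \<odot>\<^bsub>M\<^esub> s \<oplus>\<^bsub>M\<^esub> (y \<ominus>\<^bsub>M\<^esub> lin M S id cy)"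
    unfolding a(3) using M a(1,2,4) S s lin_closed[OF M S a(4)] by algebra
   ultimately have "v \<ominus>\<^bsub>M\<^esub> lin M S id cy \<in> W" using W'(4)[OF _ a(5)] by simp
   then show False using v a(4) by (auto simp: V0_def)
  qed
  have span: "\<exists>r\<in>U R. x \<ominus>\<^bsub>M\<^esub> r \<odot>\<^bsub>M\<^esub> v \<in> V0" if x: "x \<in> V" for x
  proof -
   obtain b z cz where b: "b \<in> U R" "z \<in> U M" "x = b \<odot>\<^bsub>M\<^esub> s \<oplus>\<^bsub>M\<^esub> z"
    "cz \<in> S \<rightarrow> U R" "z \<ominus>\<^bsub>M\<^esub> lin M S id cz \<in> W" using coeff[OF x] by blast
   define r where "r = b \<otimes> inv a"
   have r: "r \<in> U R" using b \<open>a \<in> Units R\<close> by (simp add: r_def)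
   have "r \<otimes> a = b" using b \<open>a \<in> Units R\<close> a(1) by (simp add: r_def m_assoc)
   then have rv: "r \<odot>\<^bsub>M\<^esub> v = b \<odot>\<^bsub>M\<^esub> s \<oplus>\<^bsub>M\<^esub> r \<odot>\<^bsub>M\<^esub> y"
    using M a r s by (simp add: mod_smult_radd mod_smult_assoc[symmetric])
   let ?y = "lin M S id cy" and ?z = "lin M S id cz"
   have mem: "?y \<in> U M" "?z \<in> U M" "b \<odot>\<^bsub>M\<^esub> s \<in> U M" using M S a b s by auto
   have "(x \<ominus>\<^bsub>M\<^esub> r \<odot>\<^bsub>M\<^esub> v) \<ominus>\<^bsub>M\<^esub> (?z \<ominus>\<^bsub>M\<^esub> r \<odot>\<^bsub>M\<^esub> ?y) = (z \<ominus>\<^bsub>M\<^esub> ?z) \<ominus>\<^bsub>M\<^esub> r \<odot>\<^bsub>M\<^esub> (y \<ominus>\<^bsub>M\<^esub> ?y)"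
    unfolding rv b(3) using M mem a(2) b(2) r by algebra
   moreover have "?z \<ominus>\<^bsub>M\<^esub> r \<odot>\<^bsub>M\<^esub> ?y = lin M S id (\<lambda>i. cz i \<ominus> r \<otimes> cy i)"
   proof -
    have "(\<lambda>i. r \<otimes> cy i) \<in> S \<rightarrow> U R" using a(4) r by auto
    from lin_minus[OF M insert.hyps(1) S b(4) this] lin_scale[OF M insert.hyps(1) S a(4) r]
    show ?thesis by simp
   qed
   ultimately have "(x \<ominus>\<^bsub>M\<^esub> r \<odot>\<^bsub>M\<^esub> v) \<ominus>\<^bsub>M\<^esub> lin M S id (\<lambda>i. cz i \<ominus> r \<otimes> cy i) \<in> W"
    using W'(6)[OF b(5) W'(5)[OF r a(5)]] by simp
   moreover have "(\<lambda>i. cz i \<ominus> r \<otimes> cy i) \<in> S \<rightarrow> U R" using a(4) b(4) r by auto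
   ultimately show ?thesis using V'(6)[OF x V'(5)[OF r v(1)]] r unfolding V0_def by blast
  qed
  have "v \<notin> I" using v I' by auto
  have vI: "id \<in> insert v I \<rightarrow> U M" using IM vM by auto
  have "rel_basis M V W (insert v I) id"
   unfolding rel_basis_def
  proof (intro conjI ballI impI)
   show "finite (insert v I)" "id \<in> insert v I \<rightarrow> V" using I' v by (auto simp: V0_def)
   fix x assume x: "x \<in> V"
   have xM: "x \<in> U M" using x V' by blast
   obtain r where r: "r \<in> U R" "x \<ominus>\<^bsub>M\<^esub> r \<odot>\<^bsub>M\<^esub> v \<in> V0" using span[OF x] by blast
   obtain c where c: "c \<in> I \<rightarrow> U R" "(x \<ominus>\<^bsub>M\<^esub> r \<odot>\<^bsub>M\<^esub> v) \<ominus>\<^bsub>M\<^esub> lin M I id c \<in> W"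
    using I r(2) unfolding rel_basis_def by blast
   have cv: "c(v := r) \<in> insert v I \<rightarrow> U R" using c r by auto
   have "lin M (insert v I) id (c(v := r)) = r \<odot>\<^bsub>M\<^esub> v \<oplus>\<^bsub>M\<^esub> lin M I id (c(v := r))"
    using M I' \<open>v \<notin> I\<close> vI cv by (subst lin_insert) auto
   also have "lin M I id (c(v := r)) = lin M I id c"
    using M IM c \<open>v \<notin> I\<close> by (intro lin_cong) auto
   finally have "x \<ominus>\<^bsub>M\<^esub> lin M (insert v I) id (c(v := r)) = (x \<ominus>\<^bsub>M\<^esub> r \<odot>\<^bsub>M\<^esub> v) \<ominus>\<^bsub>M\<^esub> lin M I id c"
    using M xM vM r lin_closed[OF M IM c(1)] by algebra
   then show "\<exists>c\<in>insert v I \<rightarrow> U R. x \<ominus>\<^bsub>M\<^esub> lin M (insert v I) id c \<in> W"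
    using cv c(2) by metis
  next
   fix c i assume c: "c \<in> insert v I \<rightarrow> U R" "lin M (insert v I) id c \<in> W" and i: "i \<in> insert v I"
   have cv: "c v \<in> U R" and cI: "c \<in> I \<rightarrow> U R" using c by auto
   have LV: "lin M I id c \<in> V0" using I'(2) by (intro lin_in_submodule[OF M V0 I'(1) _ cI]) auto
   have LM: "lin M I id c \<in> U M" using submodD(1)[OF M V0 LV] .
   have eq: "lin M (insert v I) id c = c v \<odot>\<^bsub>M\<^esub> v \<oplus>\<^bsub>M\<^esub> lin M I id c"
    using lin_insert[OF M I'(1) \<open>v \<notin> I\<close> vI c(1)] by simp
   have "c v \<odot>\<^bsub>M\<^esub> v = lin M (insert v I) id c \<ominus>\<^bsub>M\<^esub> lin M I id c"
    unfolding eq using M LM vM cv mod_closed(5)[OF M cv vM] by algebra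
   then have cvV: "c v \<odot>\<^bsub>M\<^esub> v \<in> V0" using submodD(6)[OF M V0] WV0 c LV by auto
   have nonunit: "c v \<notin> Units R"
   proof
    assume u: "c v \<in> Units R"
    then have "inv (c v) \<odot>\<^bsub>M\<^esub> (c v \<odot>\<^bsub>M\<^esub> v) \<in> V0" using submodD(5)[OF M V0] cvV by simp
    then show False using u v vM M cv by (simp add: mod_smult_assoc[symmetric] mod_smult_one)
   qed
   then obtain b where b: "b \<in> U R" "c v = p \<otimes> b" using unit_or_multiple cv by blast
   then have "c v \<odot>\<^bsub>M\<^esub> v \<in> multiples p M" using M vM by (auto simp: multiples_def mod_smult_assoc)
   then have "c v \<odot>\<^bsub>M\<^esub> v \<in> W" using W(2) by blast
   moreover have "lin M I id c = lin M (insert v I) id c \<ominus>\<^bsub>M\<^esub> c v \<odot>\<^bsub>M\<^esub> v"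
    unfolding eq using M LM vM cv mod_closed(5)[OF M cv vM] by algebra
   ultimately have "lin M I id c \<in> W" using W'(6) c(2) by simp
   then have "\<forall>i\<in>I. c i \<notin> Units R" using I cI unfolding rel_basis_def by blast
   then show "c i \<notin> Units R" using nonunit i by auto
  qed
  then show ?thesis by blast
 qed
qed

end

section \<open>Splitting modulo p\<close>

context square_zero_local
begin

lemma rel_basis_exists:
 fixes M :: "('a, 'm) module"
 assumes "Free M" "submodule V R M" "submodule W R M" "multiples p M \<subseteq> W" "W \<subseteq> V"
 obtains I :: "'m set" and e :: "'m => 'm" where "rel_basis M V W I e"
proof -
 note M = fg_freeD[OF assms(1)]
 obtain B where B: "basis_family M B (\<lambda>b. b)" using fg_free_basis[OF assms(1)] .
 then have Bf: "finite B" "B \<subseteq> U M" "id \<in> B \<rightarrow> U M" by (auto simp: basis_family_def)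
 have "\<exists>c\<in>B \<rightarrow> U R. x \<ominus>\<^bsub>M\<^esub> lin M B id c \<in> W" if "x \<in> V" for x
 proof -
  have x: "x \<in> U M" using submodD(1)[OF M assms(2) that] .
  then obtain c where c: "c \<in> B \<rightarrow> U R" "x = lin M B (\<lambda>b. b) c"
   using B unfolding basis_family_def by blast
  then have "x \<ominus>\<^bsub>M\<^esub> lin M B id c = \<zero>\<^bsub>M\<^esub>" using x M by (simp add: id_def mod_norm)
  then show ?thesis using c(1) submodD(2)[OF M assms(3)] by (intro bexI[of _ c]) auto
 qed
 from rel_basis_exists_aux[OF M assms(3,4) Bf(1,2) assms(2,5)] this that show thesis by blast
qed

lemma rel_basis_tower:
 assumes M: "module R M" and V0: "submodule V0 R M" "multiples p M \<subseteq> V0" and V1: "submodule V1 R M" "V0 \<subseteq> V1"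
  and V2: "submodule V2 R M" "V1 \<subseteq> V2"
  and e: "rel_basis M V1 V0 I e" and f: "rel_basis M V2 V1 J f"
 shows "rel_basis M V2 V0 (I <+> J) (case_sum e f)"
proof -
 have I: "finite I" "e \<in> I \<rightarrow> V1" and J: "finite J" "f \<in> J \<rightarrow> V2"
  using e f by (auto simp: rel_basis_def)
 have eM: "e \<in> I \<rightarrow> U M" using I V1 submodD(1)[OF M V1(1)] by auto
 have fM: "f \<in> J \<rightarrow> U M" using J submodD(1)[OF M V2(1)] by auto
 note split = lin_Plus[OF M I(1) J(1) eM fM]
 show ?thesis unfolding rel_basis_def
 proof (intro conjI ballI impI)
  show "finite (I <+> J)" using I J by simp
  show "case_sum e f \<in> I <+> J \<rightarrow> V2" using I J V2 by auto
  fix x assume x: "x \<in> V2"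
  have xM: "x \<in> U M" using submodD(1)[OF M V2(1) x] .
  obtain d where d: "d \<in> J \<rightarrow> U R" "x \<ominus>\<^bsub>M\<^esub> lin M J f d \<in> V1"
   using f x unfolding rel_basis_def by blast
  obtain c where c: "c \<in> I \<rightarrow> U R" "(x \<ominus>\<^bsub>M\<^esub> lin M J f d) \<ominus>\<^bsub>M\<^esub> lin M I e c \<in> V0"
   using e d(2) unfolding rel_basis_def by blast
  have cd: "case_sum c d \<in> I <+> J \<rightarrow> U R" using c(1) d(1) by auto
  have "lin M (I <+> J) (case_sum e f) (case_sum c d) = lin M I e c \<oplus>\<^bsub>M\<^esub> lin M J f d"
   using split[OF cd] by simp
  moreover have "x \<ominus>\<^bsub>M\<^esub> (lin M I e c \<oplus>\<^bsub>M\<^esub> lin M J f d) = (x \<ominus>\<^bsub>M\<^esub> lin M J f d) \<ominus>\<^bsub>M\<^esub> lin M I e c"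
   using M xM lin_closed[OF M eM c(1)] lin_closed[OF M fM d(1)] by algebra
  ultimately show "\<exists>c\<in>I <+> J \<rightarrow> U R. x \<ominus>\<^bsub>M\<^esub> lin M (I <+> J) (case_sum e f) c \<in> V0"
   using cd c(2) by metis
 next
  fix c k assume c: "c \<in> I <+> J \<rightarrow> U R" "lin M (I <+> J) (case_sum e f) c \<in> V0" and k: "k \<in> I <+> J"
  have cI: "(\<lambda>i. c (Inl i)) \<in> I \<rightarrow> U R" and cJ: "(\<lambda>j. c (Inr j)) \<in> J \<rightarrow> U R" using c(1) by auto
  define x where "x = lin M I e (\<lambda>i. c (Inl i))"
  define y where "y = lin M J f (\<lambda>j. c (Inr j))"
  have x: "x \<in> V1" unfolding x_def by (rule lin_in_submodule[OF M V1(1) I cI])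
  have xM: "x \<in> U M" and yM: "y \<in> U M"
   using lin_closed[OF M eM cI] lin_closed[OF M fM cJ] by (simp_all add: x_def y_def)
  have xy: "x \<oplus>\<^bsub>M\<^esub> y \<in> V0" using c(2) split[OF c(1)] by (simp add: x_def y_def)
  have "(x \<oplus>\<^bsub>M\<^esub> y) \<ominus>\<^bsub>M\<^esub> x = y" using M xM yM by algebra
  moreover have "(x \<oplus>\<^bsub>M\<^esub> y) \<ominus>\<^bsub>M\<^esub> x \<in> V1" using submodD(6)[OF M V1(1) _ x] xy V1(2) by auto
  ultimately have "y \<in> V1" by simp
  then have nJ: "\<forall>j\<in>J. c (Inr j) \<notin> Units R" using f cJ unfolding rel_basis_def y_def by blast
  then have "\<forall>j\<in>J. \<exists>b\<in>U R. c (Inr j) = p \<otimes> b" using unit_or_multiple cJ by blast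
  then obtain b where b: "\<And>j. j \<in> J ==> b j \<in> U R" "\<And>j. j \<in> J ==> c (Inr j) = p \<otimes> b j" by metis
  have "y = lin M J f (\<lambda>j. p \<otimes> b j)" unfolding y_def using M fM b by (intro lin_cong) auto
  also have "\<dots> = p \<odot>\<^bsub>M\<^esub> lin M J f b" using M fM b J by (intro lin_scale) auto
  finally have "y \<in> V0" using V0(2) M fM b by (auto simp: multiples_def Pi_iff)
  moreover have "(x \<oplus>\<^bsub>M\<^esub> y) \<ominus>\<^bsub>M\<^esub> y = x" using M xM yM by algebra
  ultimately have "x \<in> V0" using submodD(6)[OF M V0(1) xy, of y] by simp
  then have "\<forall>i\<in>I. c (Inl i) \<notin> Units R" using e cI unfolding rel_basis_def x_def by blast
  then show "c k \<notin> Units R" using nJ k by auto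
 qed
qed

lemma rel_basis_imp_basis:
 assumes "Free M" "rel_basis M (U M) (multiples p M) I e"
 shows "basis_family M I e"
 using assms(2) by (intro nakayama_basis fg_freeD[OF assms(1)] fg_free_p_exact[OF assms(1)])
  (auto simp: rel_basis_def)

text \<open>
 Projective modules are free here: the kernel of the retraction is \<open>p\<close>-exact, so a relative basis
 of it modulo \<open>p\<close> is a basis.
\<close>

lemma retract_complement:
 fixes A X :: "('a, 'm) module"
 assumes A: "Free A" and X: "module R X"
  and s: "s \<in> Lin X A" and r: "r \<in> Lin A X"
  and rs: "\<And>x. x \<in> U X ==> r (s x) = x"
 defines "K \<equiv> A\<lparr>carrier := {a \<in> U A. r a = \<zero>\<^bsub>X\<^esub>}\<rparr>"
 shows "Free K"
  and "(\<lambda>x\<in>U K. x) \<in> Lin K A"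
  and "(\<lambda>a\<in>U A. a \<ominus>\<^bsub>A\<^esub> s (r a)) \<in> Lin A K"
proof -
 note AM = fg_freeD[OF A] note sD = homD[OF s] note rD = homD[OF r]
 have Ksub: "submodule {a \<in> U A. r a = \<zero>\<^bsub>X\<^esub>} R A"
  using AM X by (intro submodI) (auto simp: rD mod_norm)
 have K: "module R K" unfolding K_def by (rule submodule.submodule_is_module[OF Ksub AM])
 have Kc: "U K = {a \<in> U A. r a = \<zero>\<^bsub>X\<^esub>}" and Kop: "add K = add A" "smult K = smult A" "zero K = zero A"
  by (simp_all add: K_def)
 show incl: "(\<lambda>x\<in>U K. x) \<in> Lin K A"
  using K by (intro homI) (auto simp: Kc Kop)
 have rk: "r (a \<ominus>\<^bsub>A\<^esub> s (r a)) = \<zero>\<^bsub>X\<^esub>" if "a \<in> U A" for a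
  using that AM X by (simp add: sD rD rs) (simp add: mod_norm rD)
 show k: "(\<lambda>a\<in>U A. a \<ominus>\<^bsub>A\<^esub> s (r a)) \<in> Lin A K"
 proof (rule homI)
  fix x y assume "x \<in> U A" "y \<in> U A"
  then show "x \<oplus>\<^bsub>A\<^esub> y \<ominus>\<^bsub>A\<^esub> s (r (x \<oplus>\<^bsub>A\<^esub> y)) = x \<ominus>\<^bsub>A\<^esub> s (r x) \<oplus>\<^bsub>K\<^esub> (y \<ominus>\<^bsub>A\<^esub> s (r y))"
   using AM X by (simp add: Kop sD rD) (simp add: mod_norm rD sD)
 next
  fix c x assume "c \<in> U R" "x \<in> U A"
  then show "c \<odot>\<^bsub>A\<^esub> x \<ominus>\<^bsub>A\<^esub> s (r (c \<odot>\<^bsub>A\<^esub> x)) = c \<odot>\<^bsub>K\<^esub> (x \<ominus>\<^bsub>A\<^esub> s (r x))"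
   using AM X by (simp add: Kop sD rD) (simp add: mod_norm rD sD)
 qed (use AM X rk in \<open>auto simp: Kc sD rD\<close>)
 define \<kappa> where "\<kappa> = (\<lambda>a\<in>U A. a \<ominus>\<^bsub>A\<^esub> s (r a))"
 have \<kappa>: "\<kappa> \<in> Lin A K" using k by (simp add: \<kappa>_def)
 note \<kappa>D = homD[OF \<kappa>]
 have \<kappa>K: "\<kappa> a = a" if "a \<in> U K" for a
  using that AM X by (simp add: \<kappa>_def Kc sD) (simp add: mod_norm)
 have \<kappa>val: "a = \<kappa> a \<oplus>\<^bsub>A\<^esub> s (r a)" if "a \<in> U A" for a
  using that AM X by (simp add: \<kappa>_def) (metis hom_closed[OF s] hom_closed[OF r] mod_closed(4) mod_comm mod_eq_sub_iff)
 have pK: "multiples p K \<subseteq> multiples p A" by (auto simp: multiples_def Kc Kop)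
 let ?V = "{a \<in> U A. r a \<in> multiples p X}"
 have V: "submodule ?V R A" using preimage_submodule[OF AM X r multiples_submodule[OF X p_carr]] .
 have pV: "multiples p A \<subseteq> ?V" using multiples_hom[OF r p_carr] AM by (auto simp: multiples_def)
 have VV: "a \<ominus>\<^bsub>A\<^esub> \<kappa> a \<in> multiples p A" if "a \<in> ?V" for a
 proof -
  have a: "a \<in> U A" using that by simp
  have "a \<ominus>\<^bsub>A\<^esub> \<kappa> a = s (r a)"
   using AM a \<kappa>val[OF a] \<kappa>D(1)[OF a] sD(1)[OF rD(1)[OF a]] by (subst mod_eq_sub_iff[symmetric]) (auto simp: Kc)
  then show ?thesis using that multiples_hom[OF s p_carr] by auto
 qed
 obtain I :: "'m set" and e where e: "rel_basis A ?V (multiples p A) I e"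
  using rel_basis_exists[OF A V multiples_submodule[OF AM p_carr] order_refl pV] .
 then have I: "finite I" "e \<in> I \<rightarrow> ?V" by (auto simp: rel_basis_def)
 then have eA: "e \<in> I \<rightarrow> U A" by auto
 have \<kappa>lin: "\<kappa> (lin A I e c) = lin K I (\<lambda>i. \<kappa> (e i)) c" if "c \<in> I \<rightarrow> U R" for c
  using lin_hom[OF AM K \<kappa> I(1) eA that] .
 have "basis_family K I (\<lambda>i. \<kappa> (e i))"
 proof (rule nakayama_basis[OF K _ I(1)])
  show "p_exact K" unfolding p_exact_def
  proof (intro ballI impI)
   fix z assume z: "z \<in> U K" "p \<odot>\<^bsub>K\<^esub> z = \<zero>\<^bsub>K\<^esub>"
   then obtain w where w: "w \<in> U A" "z = p \<odot>\<^bsub>A\<^esub> w"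
    using p_annihilated[OF A, of z] by (auto simp: Kc Kop)
   have "z = \<kappa> z" using \<kappa>K z by simp
   also have "\<dots> = p \<odot>\<^bsub>K\<^esub> \<kappa> w" using w by (simp add: \<kappa>D)
   finally show "z \<in> multiples p K" using \<kappa>D(1)[OF w(1)] by (auto simp: multiples_def)
  qed
  show "(\<lambda>i. \<kappa> (e i)) \<in> I \<rightarrow> U K" using \<kappa>D(1) eA by auto
  fix x assume x: "x \<in> U K"
  have "\<zero>\<^bsub>X\<^esub> \<in> multiples p X" using submodD(2)[OF X multiples_submodule[OF X p_carr]] .
  then have xV: "x \<in> ?V" using x by (auto simp: Kc)
  then obtain c where c: "c \<in> I \<rightarrow> U R" "x \<ominus>\<^bsub>A\<^esub> lin A I e c \<in> multiples p A"
   using e unfolding rel_basis_def by blast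
  have "\<kappa> (x \<ominus>\<^bsub>A\<^esub> lin A I e c) = x \<ominus>\<^bsub>K\<^esub> lin K I (\<lambda>i. \<kappa> (e i)) c"
   using AM K xV eA c(1) by (simp add: \<kappa>D(6) \<kappa>lin \<kappa>K[OF x])
  then show "\<exists>c\<in>I \<rightarrow> U R. x \<ominus>\<^bsub>K\<^esub> lin K I (\<lambda>i. \<kappa> (e i)) c \<in> multiples p K"
   using c multiples_hom[OF \<kappa> p_carr] by metis
 next
  fix c i assume c: "c \<in> I \<rightarrow> U R" "lin K I (\<lambda>i. \<kappa> (e i)) c \<in> multiples p K" and i: "i \<in> I"
  let ?v = "lin A I e c"
  have v: "?v \<in> ?V" using lin_in_submodule[OF AM V I(1,2) c(1)] .
  then have vA: "?v \<in> U A" by simp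
  have "\<kappa> ?v \<in> multiples p A" using c(2) pK by (auto simp: \<kappa>lin[OF c(1)])
  moreover have "?v = (?v \<ominus>\<^bsub>A\<^esub> \<kappa> ?v) \<oplus>\<^bsub>A\<^esub> \<kappa> ?v"
   using AM vA \<kappa>D(1)[OF vA] by (simp add: mod_norm Kc)
  ultimately have "?v \<in> multiples p A"
   using submodD(4)[OF AM multiples_submodule[OF AM p_carr] VV[OF v]] by metis
  then show "c i \<notin> Units R" using e c(1) i unfolding rel_basis_def by blast
 qed
 then have "finite_basis R K ((\<lambda>i. \<kappa> (e i)) ` I)" by (rule finite_basisI[OF K _ one_nonzero])
 then show "Free K" using K by (auto simp: fg_free_module_def)
qed

end

locale free_module_universe = square_zero_local R p
 for R :: "('a, 'r) ring_scheme" (structure) and p +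
 fixes universe :: "'m itself"
 assumes has_free: "has_free_modules R universe"
begin

lemma free_of_rank:
 assumes "finite (I :: 'i set)"
 obtains X :: "('a, 'm) module" and e :: "'i => 'm" where "Free X" "basis_family X I e"
proof -
 obtain X :: "('a, 'm) module" and B where X: "module R X" "finite_basis R X B" "card B = card I"
  using has_free unfolding has_free_modules_def by blast
 have B: "finite B" "B \<subseteq> U X" "basis_family X B (\<lambda>b. b)"
  using X finite_basis_imp_family by (auto simp: finite_basis_def)
 obtain e where e: "bij_betw e I B" using assms B X(3) by (metis finite_same_card_bij)
 have eI: "e \<in> I \<rightarrow> U X" using e B(2) by (auto simp: bij_betw_def)
 have inj: "inj_on e I" and im: "e ` I = B" using e by (auto simp: bij_betw_def)
 have lin: "lin X B (\<lambda>b. b) c = lin X I e (\<lambda>i. c (e i))" if "c \<in> B \<rightarrow> U R" for c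
  using lin_reindex[OF X(1) inj eI, of c] that im by simp
 have "basis_family X I e" unfolding basis_family_def
 proof (intro conjI ballI impI)
  fix x assume "x \<in> U X"
  then obtain c where "c \<in> B \<rightarrow> U R" "x = lin X B (\<lambda>b. b) c"
   using B(3) unfolding basis_family_def by blast
  then show "\<exists>c\<in>I \<rightarrow> U R. x = lin X I e c"
   using lin im by (intro bexI[of _ "\<lambda>i. c (e i)"]) auto
 next
  fix c i assume c: "c \<in> I \<rightarrow> U R" "lin X I e c = \<zero>\<^bsub>X\<^esub>" and i: "i \<in> I"
  let ?c = "\<lambda>b. c (inv_into I e b)"
  have c': "?c \<in> B \<rightarrow> U R" using c im inj by auto
  have "lin X B (\<lambda>b. b) ?c = lin X I e c"
   unfolding lin[OF c'] using X(1) eI c inj by (intro lin_cong) auto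
  then have "?c (e i) = \<zero>" using B(3) c' c(2) i im unfolding basis_family_def by (metis imageI)
  then show "c i = \<zero>" using inj i by simp
 qed (use assms eI in auto)
 then show thesis using that X by (auto simp: fg_free_module_def)
qed

text \<open>
 A homomorphism of free modules is, modulo \<open>p\<close>, an isomorphism between direct summands and zero on
 a complement. A basis of the domain modulo the kernel modulo \<open>p\<close> is mapped to a relative basis,
 and this is completed to a basis of the codomain.
\<close>

lemma rank_factorization:
 fixes A B :: "('a, 'm) module"
 assumes A: "Free A" and B: "Free B" and f: "f \<in> Lin A B"
 obtains X :: "('a, 'm) module" and s t where "Free X"
  "s \<in> Lin X A" "t \<in> Lin B X" "\<And>x. x \<in> U X ==> t (f (s x)) = x"
  "\<And>a. a \<in> U A ==> f a \<ominus>\<^bsub>B\<^esub> f (s (t (f a))) \<in> multiples p B"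
proof -
 note AM = fg_freeD[OF A] and BM = fg_freeD[OF B] and fD = homD[OF f]
 note pA = multiples_submodule[OF AM p_carr] and pB = multiples_submodule[OF BM p_carr]
 let ?K = "{a \<in> U A. f a \<in> multiples p B}"
 have K: "submodule ?K R A" using preimage_submodule[OF AM BM f pB] .
 have pK: "multiples p A \<subseteq> ?K" using multiples_hom[OF f p_carr] submodD(1)[OF AM pA] by auto
 obtain I :: "'m set" and e where e: "rel_basis A (U A) ?K I e"
  using rel_basis_exists[OF A module.carrier_is_submodule[OF AM] K pK] by auto
 have I: "finite I" "e \<in> I \<rightarrow> U A" using e by (auto simp: rel_basis_def)
 define V where "V = {f a \<oplus>\<^bsub>B\<^esub> b |a b. a \<in> U A \<and> b \<in> multiples p B}"
 note pB' = submodD[OF BM pB]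
 have VI: "f a \<oplus>\<^bsub>B\<^esub> b \<in> V" if "a \<in> U A" "b \<in> multiples p B" for a b
  using that by (auto simp: V_def)
 have V: "submodule V R B"
 proof (rule submodI[OF BM])
  show "V \<subseteq> U B" using pB'(1) BM fD by (auto simp: V_def)
  have "\<zero>\<^bsub>B\<^esub> = f \<zero>\<^bsub>A\<^esub> \<oplus>\<^bsub>B\<^esub> \<zero>\<^bsub>B\<^esub>" using AM BM by (simp add: fD mod_norm)
  then show "\<zero>\<^bsub>B\<^esub> \<in> V" using VI[of "\<zero>\<^bsub>A\<^esub>" "\<zero>\<^bsub>B\<^esub>"] pB'(2) AM by simp
 next
  fix x y assume "x \<in> V" "y \<in> V"
  then obtain a b a' b' where x: "a \<in> U A" "b \<in> multiples p B" "x = f a \<oplus>\<^bsub>B\<^esub> b"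
   and y: "a' \<in> U A" "b' \<in> multiples p B" "y = f a' \<oplus>\<^bsub>B\<^esub> b'" by (auto simp: V_def)
  have "x \<oplus>\<^bsub>B\<^esub> y = f (a \<oplus>\<^bsub>A\<^esub> a') \<oplus>\<^bsub>B\<^esub> (b \<oplus>\<^bsub>B\<^esub> b')"
   using x y AM BM pB'(1) by (simp add: fD) (simp add: mod_norm fD)
  then show "x \<oplus>\<^bsub>B\<^esub> y \<in> V" using VI[of "a \<oplus>\<^bsub>A\<^esub> a'" "b \<oplus>\<^bsub>B\<^esub> b'"] x(1,2) y(1,2) pB'(4) AM by simp
 next
  fix c x assume c: "c \<in> U R" and "x \<in> V"
  then obtain a b where x: "a \<in> U A" "b \<in> multiples p B" "x = f a \<oplus>\<^bsub>B\<^esub> b" by (auto simp: V_def)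
  have "c \<odot>\<^bsub>B\<^esub> x = f (c \<odot>\<^bsub>A\<^esub> a) \<oplus>\<^bsub>B\<^esub> c \<odot>\<^bsub>B\<^esub> b"
   using x c AM BM pB'(1) by (simp add: fD mod_smult_radd)
  then show "c \<odot>\<^bsub>B\<^esub> x \<in> V" using VI[of "c \<odot>\<^bsub>A\<^esub> a" "c \<odot>\<^bsub>B\<^esub> b"] x(1,2) c pB'(5) AM by simp
 qed
 have pV: "multiples p B \<subseteq> V"
 proof
  fix b assume b: "b \<in> multiples p B"
  then have "b = f \<zero>\<^bsub>A\<^esub> \<oplus>\<^bsub>B\<^esub> b" using AM BM pB'(1) by (simp add: fD mod_norm)
  then show "b \<in> V" using VI[of "\<zero>\<^bsub>A\<^esub>" b] b AM by simp
 qed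
 have fe: "rel_basis B V (multiples p B) I (\<lambda>i. f (e i))"
  unfolding rel_basis_def
 proof (intro conjI ballI impI)
  show "finite I" by fact
  show "(\<lambda>i. f (e i)) \<in> I \<rightarrow> V"
  proof
   fix i assume "i \<in> I"
   then have ei: "e i \<in> U A" using I by auto
   then have "f (e i) = f (e i) \<oplus>\<^bsub>B\<^esub> \<zero>\<^bsub>B\<^esub>" using BM by (simp add: fD mod_norm)
   then show "f (e i) \<in> V" using VI[OF ei pB'(2)] by simp
  qed
  fix x assume "x \<in> V"
  then obtain a b where x: "a \<in> U A" "b \<in> multiples p B" "x = f a \<oplus>\<^bsub>B\<^esub> b" by (auto simp: V_def)
  obtain c where c: "c \<in> I \<rightarrow> U R" "a \<ominus>\<^bsub>A\<^esub> lin A I e c \<in> ?K" using e x(1) unfolding rel_basis_def by blast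
  have l: "lin A I e c \<in> U A" using AM I c by auto
  have "x \<ominus>\<^bsub>B\<^esub> f (lin A I e c) = f (a \<ominus>\<^bsub>A\<^esub> lin A I e c) \<oplus>\<^bsub>B\<^esub> b"
   unfolding x(3) using x(1,2) l AM BM pB'(1) by (simp add: fD) (simp add: mod_norm fD)
  also have "\<dots> \<in> multiples p B" using c(2) x(2) pB'(4) by auto
  finally show "\<exists>c\<in>I \<rightarrow> U R. x \<ominus>\<^bsub>B\<^esub> lin B I (\<lambda>i. f (e i)) c \<in> multiples p B"
   using c(1) lin_hom[OF AM BM f I c(1)] by auto
 next
  fix c i assume c: "c \<in> I \<rightarrow> U R" "lin B I (\<lambda>i. f (e i)) c \<in> multiples p B" and i: "i \<in> I"
  then have "lin A I e c \<in> ?K" using lin_hom[OF AM BM f I c(1)] lin_closed[OF AM I(2) c(1)] by simp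
  then show "c i \<notin> Units R" using e c(1) i unfolding rel_basis_def by blast
 qed
 obtain J :: "'m set" and g where g: "rel_basis B (U B) V J g"
  using rel_basis_exists[OF B module.carrier_is_submodule[OF BM] V pV] submodD(1)[OF BM V] by auto
 have J: "finite J" "g \<in> J \<rightarrow> U B" using g by (auto simp: rel_basis_def)
 have basB: "basis_family B (I <+> J) (case_sum (\<lambda>i. f (e i)) g)"
  using rel_basis_tower[OF BM pB order_refl V pV module.carrier_is_submodule[OF BM] _ fe g]
   submodD(1)[OF BM V] by (intro rel_basis_imp_basis[OF B]) auto
 obtain X :: "('a, 'm) module" and x where X: "Free X" "basis_family X I x"
  using free_of_rank[OF I(1)] .
 note XM = fg_freeD[OF X(1)]
 have xX: "x \<in> I \<rightarrow> U X" using X(2) by (simp add: basis_family_def)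
 obtain s where s: "s \<in> Lin X A" "\<And>i. i \<in> I ==> s (x i) = e i"
  using linear_extension[OF XM AM X(2) I(2)] by blast
 have "case_sum x (\<lambda>_. \<zero>\<^bsub>X\<^esub>) \<in> I <+> J \<rightarrow> U X" using xX XM by auto
 from linear_extension[OF BM XM basB this]
 obtain t where t: "t \<in> Lin B X"
  "\<And>k. k \<in> I <+> J ==> t (case_sum (\<lambda>i. f (e i)) g k) = case_sum x (\<lambda>_. \<zero>\<^bsub>X\<^esub>) k" by blast
 have tfe: "t (f (e i)) = x i" if "i \<in> I" for i using t(2)[of "Inl i"] that by auto
 have tf: "(\<lambda>a\<in>U A. t (f a)) \<in> Lin A X" using hom_comp[OF AM f t(1)] .
 have stf: "(\<lambda>a\<in>U A. s (t (f a))) \<in> Lin A A" using hom_comp[OF AM tf s(1)] by (simp cong: restrict_cong)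
 have tfs: "t (f (s y)) = y" if y: "y \<in> U X" for y
 proof -
  have h: "(\<lambda>y\<in>U X. t (f (s y))) \<in> Lin X X"
   using hom_comp[OF XM s(1) tf] homD(1)[OF s(1)] by (simp cong: restrict_cong)
  have "(\<lambda>y\<in>U X. t (f (s y))) y = (\<lambda>y\<in>U X. y) y"
   using xX s(2) tfe by (intro hom_eq_on_basis[OF XM XM X(2) h hom_id[OF XM] _ y]) (auto simp: Pi_iff)
  then show ?thesis using y by simp
 qed
 moreover have "f a \<ominus>\<^bsub>B\<^esub> f (s (t (f a))) \<in> multiples p B" if a: "a \<in> U A" for a
 proof -
  obtain c where c: "c \<in> I \<rightarrow> U R" "a \<ominus>\<^bsub>A\<^esub> lin A I e c \<in> ?K" using e a unfolding rel_basis_def by blast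
  let ?l = "lin A I e c" and ?k = "a \<ominus>\<^bsub>A\<^esub> lin A I e c"
  have l: "?l \<in> U A" using AM I c by auto
  have k: "?k \<in> U A" "f ?k \<in> multiples p B" using c(2) by auto
  have "s (t (f ?l)) = lin A I (\<lambda>i. (\<lambda>a\<in>U A. s (t (f a))) (e i)) c"
   using lin_hom[OF AM AM stf I c(1)] l by simp
  also have "\<dots> = ?l" using AM I c(1) s(2) tfe by (intro lin_cong) auto
  finally have stl: "s (t (f ?l)) = ?l" .
  note sD = homD[OF s(1)] and tD = homD[OF t(1)]
  have "f a = f ?k \<oplus>\<^bsub>B\<^esub> f ?l"
  proof -
   have "a = ?k \<oplus>\<^bsub>A\<^esub> ?l" using AM a l by (simp add: mod_norm)
   then show ?thesis using fD(2)[OF k(1) l] by simp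
  qed
  then have "f a \<ominus>\<^bsub>B\<^esub> f (s (t (f a))) = (f ?k \<oplus>\<^bsub>B\<^esub> f ?l) \<ominus>\<^bsub>B\<^esub> (f (s (t (f ?k))) \<oplus>\<^bsub>B\<^esub> f ?l)"
   using AM BM XM l k(1) stl by (simp add: fD tD sD)
  also have "\<dots> = f ?k \<ominus>\<^bsub>B\<^esub> f (s (t (f ?k)))"
   using BM k(1) l by (simp add: mod_norm fD(1) sD(1) tD(1))
  also have "\<dots> \<in> multiples p B"
   using k multiples_hom[OF f p_carr multiples_hom[OF s(1) p_carr multiples_hom[OF t(1) p_carr k(2)]]] pB'(6)
   by auto
  finally show ?thesis .
 qed
 ultimately show thesis using that X(1) s(1) t(1) by blast
qed

end

section \<open>Sequences as periodic families\<close>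

text \<open>
 The representative of \<open>i\<close> modulo \<open>n\<close> in \<open>{1..n}\<close>.
\<close>

definition cyc_index :: "nat => nat => nat"
 where "cyc_index n i = (i + n - 1) mod n + 1"

lemma cyc_index_range: "0 < n ==> cyc_index n i \<in> {1..n}"
 by (auto simp: cyc_index_def Suc_le_eq)

lemma cyc_index_self: "i \<in> {1..n} ==> cyc_index n i = i"
 by (cases i) (auto simp: cyc_index_def)

lemma cyc_index_add [simp]: "0 < n ==> cyc_index n (i + n) = cyc_index n i"
proof -
 assume "0 < n"
 then have "i + n + n - 1 = (i + n - 1) + n" by simp
 then show ?thesis by (simp only: cyc_index_def mod_add_self2)
qed

lemma periodic_mult: "(\<And>i. f (i + n) = f i) ==> f (i + n * q) = f (i::nat)"
proof (induction q)
 case (Suc q)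
 have "f (i + n * Suc q) = f ((i + n * q) + n)" by (simp add: algebra_simps)
 then show ?case using Suc by simp
qed simp

lemma periodic_cyc_index:
 assumes "0 < n" "\<And>i. f (i + n) = f i"
 shows "f (cyc_index n i) = f i"
proof -
 have "i + n = cyc_index n i + n * ((i + n - 1) div n)"
  using assms(1) mod_div_mult_eq[of "i + n - 1" n] by (simp add: cyc_index_def mult.commute)
 then show ?thesis using periodic_mult[of f n "cyc_index n i" "(i + n - 1) div n"] assms(2) by metis
qed

lemma periodic_cyc_index_Suc:
 assumes "0 < n" "\<And>i. f (i + n) = f i"
 shows "f (Suc (cyc_index n i)) = f (Suc i)" and "f (Suc (Suc (cyc_index n i))) = f (Suc (Suc i))"
 using periodic_cyc_index[of n "\<lambda>i. f (Suc i)" i] periodic_cyc_index[of n "\<lambda>i. f (Suc (Suc i))" i] assms(1)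
  assms(2)[of "Suc _"] assms(2)[of "Suc (Suc _)"] by simp_all

lemma restrict_eq_iff: "(\<lambda>x\<in>A. F x) = (\<lambda>x\<in>A. G x) \<longleftrightarrow> (\<forall>x\<in>A. F x = G x)"
 by (auto simp: fun_eq_iff)

lemma free_mod_simps [simp]:
 "Ob (free_mod R) = {M. fg_free_module R M}"
 "Arr (free_mod R) = {(M, f, N). fg_free_module R M \<and> fg_free_module R N \<and> f \<in> module_hom R M N}"
 "Dom (free_mod R) (M, f, N) = M" "Cod (free_mod R) (M, f, N) = N"
 "IdArr (free_mod R) M = (M, \<lambda>x \<in> U M. x, M)"
 "Comp (free_mod R) (M', g, N') (M, f, N) = (M, \<lambda>x \<in> U M. g (f x), N')"
 "ZeroArr (free_mod R) M N = (M, \<lambda>x \<in> U M. \<zero>\<^bsub>N\<^esub>, N)"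
 "AddArr (free_mod R) (M, f, N) (M', g', N'') = (M, \<lambda>x \<in> U M. f x \<oplus>\<^bsub>N\<^esub> g' x, N)"
 "NegArr (free_mod R) (M, f, N) = (M, \<lambda>x \<in> U M. \<ominus>\<^bsub>N\<^esub> f x, N)"
 "SusOb (free_mod R) M = M" "SusArr (free_mod R) x = x"
 by (simp_all add: free_mod_def compose_def)

lemma Hom_free_mod: "Hom (free_mod R) M N =
  {(M, f, N) |f. fg_free_module R M \<and> fg_free_module R N \<and> f \<in> module_hom R M N}"
 by (auto simp: Hom_def)

lemma Hom_free_mod_triple [simp]: "(M', f, N') \<in> Hom (free_mod R) M N \<longleftrightarrow>
  M' = M \<and> N' = N \<and> fg_free_module R M \<and> fg_free_module R N \<and> f \<in> module_hom R M N"
 by (auto simp: Hom_free_mod)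

context cring
begin

text \<open>Fixed positions are written as successors, the form to which simplification brings \<open>1\<close>.\<close>

abbreviation (input) S1 where "S1 \<equiv> Suc 0"
abbreviation (input) S2 where "S2 \<equiv> Suc (Suc 0)"
abbreviation (input) S3 where "S3 \<equiv> Suc (Suc (Suc 0))"

definition bip :: "('a, 'm) module => ('a, 'm) module => ('a, 'm) module =>
  ('m => 'm) => ('m => 'm) => ('m => 'm) => ('m => 'm) => bool"
 where "bip X Y P i1 i2 p1 p2 \<longleftrightarrow>
  i1 \<in> module_hom R X P \<and> i2 \<in> module_hom R Y P \<and> p1 \<in> module_hom R P X \<and> p2 \<in> module_hom R P Y \<and>
  (\<forall>x\<in>U X. p1 (i1 x) = x \<and> p2 (i1 x) = \<zero>\<^bsub>Y\<^esub>) \<and>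
  (\<forall>y\<in>U Y. p2 (i2 y) = y \<and> p1 (i2 y) = \<zero>\<^bsub>X\<^esub>) \<and>
  (\<forall>z\<in>U P. i1 (p1 z) \<oplus>\<^bsub>P\<^esub> i2 (p2 z) = z)"

lemma biproduct_iff:
 assumes "fg_free_module R X" "fg_free_module R Y" "fg_free_module R P"
 shows "biproduct (free_mod R) X Y P (X, i1, P) (Y, i2, P) (P, p1, X) (P, p2, Y) \<longleftrightarrow> bip X Y P i1 i2 p1 p2"
 using assms by (auto simp: biproduct_def bip_def restrict_eq_iff)

end

text \<open>
 Rotation introduces a sign for odd \<open>n\<close>; the parity assumption makes it invisible after
 multiplication by \<open>p\<close>.
\<close>

locale angulation_setting = free_module_universe R p universe
 for R :: "('a, 'r) ring_scheme" (structure) and p and universe :: "'m itself" +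
 fixes n :: nat
 assumes n_ge: "3 \<le> n"
  and parity: "even n \<or> p \<oplus> p = \<zero>"
begin

lemma n_pos [simp]: "0 < n" and n_nz [simp]: "n \<noteq> 0"
 using n_ge by auto

text \<open>
 Since \<open>\<Sigma>\<close> is the identity, a sequence is the same as an \<open>n\<close>-periodic family of modules and maps.
 In this form rotation is a shift of the index, and statements about all positions need no
 separate treatment of the last arrow. Index \<open>0\<close> stands for \<open>n\<close>.
\<close>

definition cseq :: "(nat => ('a, 'm) module) => (nat => 'm => 'm) => bool"
 where "cseq M a \<longleftrightarrow> (\<forall>i. Free (M i) \<and> a i \<in> Lin (M i) (M (Suc i)) \<and>
  M (i + n) = M i \<and> a (i + n) = a i)"

definition mk :: "(nat => ('a, 'm) module) => (nat => 'm => 'm) => nat => ('a, 'm) mod_arrow"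
 where "mk M a = (\<lambda>i\<in>{1..n}. (M i, a i, M (Suc i)))"

definition cmor :: "(nat => ('a, 'm) module) => (nat => 'm => 'm) => (nat => ('a, 'm) module) =>
  (nat => 'm => 'm) => (nat => 'm => 'm) => bool"
 where "cmor M a N b f \<longleftrightarrow> (\<forall>i. f i \<in> Lin (M i) (N i) \<and> f (i + n) = f i \<and>
  (\<forall>x\<in>U (M i). f (Suc i) (a i x) = b i (f i x)))"

abbreviation C :: "(('a, 'm) module, ('a, 'm) mod_arrow) suspended_cat"
 where "C \<equiv> free_mod R"

abbreviation (input) cyc where "cyc \<equiv> cyc_index n"

lemma cseqD:
 assumes "cseq M a"
 shows "Free (M i)" "module R (M i)" "a i \<in> Lin (M i) (M (Suc i))"
  "M (i + n) = M i" "a (i + n) = a i" "M (Suc (i + n)) = M (Suc i)" "M n = M 0" "M (Suc n) = M S1"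
 using assms fg_freeD[of "M i"] unfolding cseq_def
 by (auto dest: spec[of _ "Suc i"] simp flip: add_Suc simp: spec[of _ "0::nat"] dest: spec[of _ 0] spec[of _ S1])
  (metis add_0 add_Suc)+

lemma cmorD:
 assumes "cmor M a N b f"
 shows "f i \<in> Lin (M i) (N i)" "f (i + n) = f i"
  "x \<in> U (M i) ==> f (Suc i) (a i x) = b i (f i x)"
 using assms by (auto simp: cmor_def)

lemma obj_mk:
 assumes "cseq M a" "i \<in> {1..n + 2}"
 shows "obj C n (mk M a) i = M i"
proof (cases "i \<le> n")
 case True
 then show ?thesis using assms by (simp add: obj_def mk_def)
next
 case False
 then have "i - n \<in> {1..n}" using assms(2) n_ge by auto
 then have "obj C n (mk M a) i = M (i - n)" using False by (simp add: obj_def mk_def)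
 also have "\<dots> = M i" using cseqD(4)[OF assms(1), of "i - n"] False by simp
 finally show ?thesis .
qed

lemma cont_eq:
 assumes "i \<in> {1..n + 2}" "\<And>i. i \<in> {1..n} ==> \<phi> i = g i" "\<And>i. g (i + n) = g i"
 shows "cont C n \<phi> i = g i"
proof (cases "i \<le> n")
 case False
 then have "i - n \<in> {1..n}" using assms(1) n_ge by auto
 then have "cont C n \<phi> i = g (i - n)" using False assms(2) by (simp add: cont_def)
 also have "\<dots> = g i" using assms(3)[of "i - n"] False by simp
 finally show ?thesis .
qed (use assms in \<open>simp add: cont_def\<close>)

lemma mk_eq: "i \<in> {1..n} ==> mk M a i = (M i, a i, M (Suc i))"
 by (simp add: mk_def)

lemma cont_mk:
 assumes "cseq M a" "i \<in> {1..n + 2}"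
 shows "cont C n (mk M a) i = (M i, a i, M (Suc i))"
 using assms cseqD[OF assms(1)] by (intro cont_eq) (auto simp: mk_eq)

lemma mk_in_n_sequences:
 assumes "cseq M a"
 shows "mk M a \<in> n_sequences C n"
 unfolding n_sequences_def
proof (intro CollectI conjI ballI)
 show "mk M a \<in> extensional {1..n}" by (simp add: mk_def)
 fix i assume i: "i \<in> {1..n}"
 then have "obj C n (mk M a) i = M i" "obj C n (mk M a) (i + 1) = M (Suc i)"
  using assms by (auto simp: obj_mk)
 then show "mk M a i \<in> Hom C (obj C n (mk M a) i) (obj C n (mk M a) (i + 1))"
  using i cseqD[OF assms] by (simp add: mk_eq)
qed

lemma n_sequences_mk:
 assumes "\<alpha> \<in> n_sequences C n"
 obtains M a where "cseq M a" "\<alpha> = mk M a"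
proof -
 define M where "M i = Dom C (\<alpha> (cyc i))" for i
 define a where "a i = fst (snd (\<alpha> (cyc i)))" for i
 have M_per: "M (i + n) = M i" for i by (simp add: M_def)
 have H: "\<alpha> i \<in> Hom C (M i) (M (Suc i))" if i: "i \<in> {1..n}" for i
 proof -
  have "obj C n \<alpha> i = M i" using i by (simp add: obj_def M_def cyc_index_self)
  moreover have "obj C n \<alpha> (i + 1) = M (Suc i)"
  proof (cases "i = n")
   case True
   then show ?thesis using n_ge M_per[of 1] by (simp add: obj_def M_def cyc_index_self)
  next
   case False
   then show ?thesis using i by (simp add: obj_def M_def cyc_index_self)
  qed
  moreover have "\<alpha> i \<in> Hom C (obj C n \<alpha> i) (obj C n \<alpha> (i + 1))"
   using assms i unfolding n_sequences_def by blast
  ultimately show ?thesis by simp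
 qed
 have \<alpha>: "\<alpha> i = (M i, a i, M (Suc i))" if "i \<in> {1..n}" for i
  using H[OF that] that by (auto simp: Hom_free_mod a_def cyc_index_self)
 have "cseq M a" unfolding cseq_def
 proof (intro allI conjI)
  fix i
  let ?j = "cyc i"
  have j: "?j \<in> {1..n}" by (rule cyc_index_range[OF n_pos])
  have "M ?j = M i" "M (Suc ?j) = M (Suc i)" "a ?j = a i"
   using periodic_cyc_index[of n M i] periodic_cyc_index_Suc(1)[of n M i] M_per
   by (auto simp: a_def cyc_index_self[OF j])
  then show "Free (M i)" "a i \<in> Lin (M i) (M (Suc i))"
   using H[OF j] \<alpha>[OF j] by auto
  show "M (i + n) = M i" "a (i + n) = a i" by (simp_all add: M_per a_def)
 qed
 moreover have "\<alpha> = mk M a"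
 proof
  fix i show "\<alpha> i = mk M a i"
   using \<alpha> assms by (cases "i \<in> {1..n}") (auto simp: mk_def n_sequences_def extensional_def)
 qed
 ultimately show thesis using that by blast
qed

lemma all_periodic:
 assumes "\<And>i. P (cyc i) \<longleftrightarrow> P i" "\<And>i. i \<in> {1..n} ==> P i"
 shows "P i"
 using assms cyc_index_range[of n i] by auto

lemma seq_morphism_mk:
 assumes M: "cseq M a" and N: "cseq N b"
 shows "seq_morphism C n (mk M a) (mk N b) \<phi> \<longleftrightarrow>
  (\<exists>f. cmor M a N b f \<and> (\<forall>i\<in>{1..n}. \<phi> i = (M i, f i, N i)))"
proof
 assume L: "seq_morphism C n (mk M a) (mk N b) \<phi>"
 define f where "f i = fst (snd (\<phi> (cyc i)))" for i
 have per: "f (i + n) = f i" for i by (simp add: f_def)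
 have H: "\<phi> i \<in> Hom C (M i) (N i)" if "i \<in> {1..n}" for i
  using L that M N by (auto simp: seq_morphism_def obj_mk)
 have \<phi>: "\<phi> i = (M i, f i, N i)" if "i \<in> {1..n}" for i
  using H[OF that] that by (auto simp: Hom_free_mod f_def cyc_index_self)
 have c: "cont C n \<phi> i = (M i, f i, N i)" if "i \<in> {1..n+2}" for i
  using that \<phi> per cseqD(4)[OF M] cseqD(4)[OF N] by (intro cont_eq) auto
 have sq: "\<forall>x\<in>U (M i). f (Suc i) (a i x) = b i (f i x)" if i: "i \<in> {1..n}" for i
 proof -
  have "cont C n \<phi> (i + 1) \<bullet>\<^bsub>C\<^esub> mk M a i = mk N b i \<bullet>\<^bsub>C\<^esub> \<phi> i"
   using L i by (simp add: seq_morphism_def)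
  then show ?thesis using i c[of "i + 1"] \<phi>[OF i] by (simp add: mk_eq restrict_eq_iff)
 qed
 have "cmor M a N b f" unfolding cmor_def
 proof (rule allI, rule all_periodic)
  fix i
  note pc = periodic_cyc_index[of n _ i] and pS = periodic_cyc_index_Suc(1)[of n _ i]
  show "(f (cyc i) \<in> Lin (M (cyc i)) (N (cyc i)) \<and>
    f (cyc i + n) = f (cyc i) \<and>
    (\<forall>x\<in>U (M (cyc i)). f (Suc (cyc i)) (a (cyc i) x) = b (cyc i) (f (cyc i) x))) =
   (f i \<in> Lin (M i) (N i) \<and> f (i + n) = f i \<and>
    (\<forall>x\<in>U (M i). f (Suc i) (a i x) = b i (f i x)))"
   using pc[of f] pc[of M] pc[of N] pc[of a] pc[of b] pS[of f] per cseqD(4,5)[OF M] cseqD(4,5)[OF N] by simp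
 next
  fix i assume i: "i \<in> {1..n}"
  then show "f i \<in> Lin (M i) (N i) \<and> f (i + n) = f i \<and>
    (\<forall>x\<in>U (M i). f (Suc i) (a i x) = b i (f i x))"
   using H[OF i] \<phi>[OF i] per sq[OF i] by auto
 qed
 then show "\<exists>f. cmor M a N b f \<and> (\<forall>i\<in>{1..n}. \<phi> i = (M i, f i, N i))" using \<phi> by blast
next
 assume "\<exists>f. cmor M a N b f \<and> (\<forall>i\<in>{1..n}. \<phi> i = (M i, f i, N i))"
 then obtain f where f: "cmor M a N b f" and \<phi>: "\<And>i. i \<in> {1..n} ==> \<phi> i = (M i, f i, N i)" by blast
 have c: "cont C n \<phi> i = (M i, f i, N i)" if "i \<in> {1..n+2}" for i
  using that \<phi> cmorD(2)[OF f] cseqD(4)[OF M] cseqD(4)[OF N] by (intro cont_eq) auto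
 show "seq_morphism C n (mk M a) (mk N b) \<phi>"
  unfolding seq_morphism_def
 proof (intro conjI ballI)
  fix i assume i: "i \<in> {1..n}"
  show "\<phi> i \<in> Hom C (obj C n (mk M a) i) (obj C n (mk N b) i)"
   using i M N \<phi> cmorD(1)[OF f] cseqD(1)[OF M] cseqD(1)[OF N] by (simp add: obj_mk)
  show "cont C n \<phi> (i + 1) \<bullet>\<^bsub>C\<^esub> mk M a i = mk N b i \<bullet>\<^bsub>C\<^esub> \<phi> i"
   using i c[of "i + 1"] \<phi>[OF i] cmorD(3)[OF f] by (simp add: mk_eq restrict_eq_iff)
 qed
qed

lemma seq_direct_sum_mk:
 assumes M: "cseq M a" and N: "cseq N b" and P: "cseq P c"
 shows "seq_direct_sum C n (mk M a) (mk N b) (mk P c) \<longleftrightarrow>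
  (\<exists>i1 i2 p1 p2. cmor M a P c i1 \<and> cmor N b P c i2 \<and> cmor P c M a p1 \<and> cmor P c N b p2 \<and>
   (\<forall>i. bip (M i) (N i) (P i) (i1 i) (i2 i) (p1 i) (p2 i)))"
proof
 assume "seq_direct_sum C n (mk M a) (mk N b) (mk P c)"
 then obtain i1 i2 p1 p2 where
  mor: "seq_morphism C n (mk M a) (mk P c) i1" "seq_morphism C n (mk N b) (mk P c) i2"
   "seq_morphism C n (mk P c) (mk M a) p1" "seq_morphism C n (mk P c) (mk N b) p2" and
  bp: "\<And>i. i \<in> {1..n} ==> biproduct C (obj C n (mk M a) i) (obj C n (mk N b) i) (obj C n (mk P c) i)
     (i1 i) (i2 i) (p1 i) (p2 i)"
  by (auto simp: seq_direct_sum_def)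
 obtain f1 where f1: "cmor M a P c f1" "\<And>i. i \<in> {1..n} ==> i1 i = (M i, f1 i, P i)"
  using mor(1) M N P by (auto simp: seq_morphism_mk)
 obtain f2 where f2: "cmor N b P c f2" "\<And>i. i \<in> {1..n} ==> i2 i = (N i, f2 i, P i)"
  using mor(2) M N P by (auto simp: seq_morphism_mk)
 obtain g1 where g1: "cmor P c M a g1" "\<And>i. i \<in> {1..n} ==> p1 i = (P i, g1 i, M i)"
  using mor(3) M N P by (auto simp: seq_morphism_mk)
 obtain g2 where g2: "cmor P c N b g2" "\<And>i. i \<in> {1..n} ==> p2 i = (P i, g2 i, N i)"
  using mor(4) M N P by (auto simp: seq_morphism_mk)
 have "bip (M i) (N i) (P i) (f1 i) (f2 i) (g1 i) (g2 i)" for i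
 proof (rule all_periodic)
  fix i
  note pc = periodic_cyc_index[of n _ i]
  show "bip (M (cyc i)) (N (cyc i)) (P (cyc i)) (f1 (cyc i)) (f2 (cyc i)) (g1 (cyc i)) (g2 (cyc i)) =
   bip (M i) (N i) (P i) (f1 i) (f2 i) (g1 i) (g2 i)"
   using pc[of M] pc[of N] pc[of P] pc[of f1] pc[of f2] pc[of g1] pc[of g2]
    cseqD(4)[OF M] cseqD(4)[OF N] cseqD(4)[OF P] cmorD(2)[OF f1(1)] cmorD(2)[OF f2(1)] cmorD(2)[OF g1(1)] cmorD(2)[OF g2(1)] by simp
 next
  fix i assume i: "i \<in> {1..n}"
  then show "bip (M i) (N i) (P i) (f1 i) (f2 i) (g1 i) (g2 i)"
   using bp[OF i] f1(2)[OF i] f2(2)[OF i] g1(2)[OF i] g2(2)[OF i] M N P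
   by (simp add: obj_mk biproduct_iff cseqD(1))
 qed
 then show "\<exists>i1 i2 p1 p2. cmor M a P c i1 \<and> cmor N b P c i2 \<and> cmor P c M a p1 \<and> cmor P c N b p2 \<and>
   (\<forall>i. bip (M i) (N i) (P i) (i1 i) (i2 i) (p1 i) (p2 i))"
  using f1 f2 g1 g2 by blast
next
 assume "\<exists>i1 i2 p1 p2. cmor M a P c i1 \<and> cmor N b P c i2 \<and> cmor P c M a p1 \<and> cmor P c N b p2 \<and>
   (\<forall>i. bip (M i) (N i) (P i) (i1 i) (i2 i) (p1 i) (p2 i))"
 then obtain i1 i2 p1 p2 where mor: "cmor M a P c i1" "cmor N b P c i2" "cmor P c M a p1" "cmor P c N b p2"
  and bp: "\<And>i. bip (M i) (N i) (P i) (i1 i) (i2 i) (p1 i) (p2 i)" by blast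
 show "seq_direct_sum C n (mk M a) (mk N b) (mk P c)" unfolding seq_direct_sum_def
 proof (intro exI conjI ballI)
  show "seq_morphism C n (mk M a) (mk P c) (\<lambda>i. (M i, i1 i, P i))" using mor M P by (auto simp: seq_morphism_mk)
  show "seq_morphism C n (mk N b) (mk P c) (\<lambda>i. (N i, i2 i, P i))" using mor N P by (auto simp: seq_morphism_mk)
  show "seq_morphism C n (mk P c) (mk M a) (\<lambda>i. (P i, p1 i, M i))" using mor M P by (auto simp: seq_morphism_mk)
  show "seq_morphism C n (mk P c) (mk N b) (\<lambda>i. (P i, p2 i, N i))" using mor N P by (auto simp: seq_morphism_mk)
  fix i assume "i \<in> {1..n}"
  then show "biproduct C (obj C n (mk M a) i) (obj C n (mk N b) i) (obj C n (mk P c) i)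
    (M i, i1 i, P i) (N i, i2 i, P i) (P i, p1 i, M i) (P i, p2 i, N i)"
   using bp M N P by (simp add: obj_mk biproduct_iff cseqD(1))
 qed
qed

lemma iso_arr_iff:
 assumes "Free M" "Free N" "f \<in> Lin M N"
 shows "iso_arr C (M, f, N) \<longleftrightarrow> (\<exists>g\<in>Lin N M. (\<forall>x\<in>U M. g (f x) = x) \<and> (\<forall>y\<in>U N. f (g y) = y))"
 using assms unfolding iso_arr_def by (auto simp: Hom_free_mod restrict_eq_iff)

lemma inverse_cmor:
 assumes M: "cseq M a" and N: "cseq N b" and f: "cmor M a N b f"
  and inv: "\<And>i. i \<in> {1..n} ==> \<exists>g\<in>Lin (N i) (M i). (\<forall>x\<in>U (M i). g (f i x) = x) \<and> (\<forall>y\<in>U (N i). f i (g y) = y)"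
 obtains g where "cmor N b M a g" "\<And>i x. x \<in> U (M i) ==> g i (f i x) = x"
  "\<And>i y. y \<in> U (N i) ==> f i (g i y) = y"
proof -
 obtain g0 where g0: "\<And>i. i \<in> {1..n} ==> g0 i \<in> Lin (N i) (M i) \<and> (\<forall>x\<in>U (M i). g0 i (f i x) = x) \<and> (\<forall>y\<in>U (N i). f i (g0 i y) = y)"
  using inv by metis
 define g where "g i = g0 (cyc i)" for i
 have per: "g (i + n) = g i" for i by (simp add: g_def)
 have g: "g i \<in> Lin (N i) (M i) \<and> (\<forall>x\<in>U (M i). g i (f i x) = x) \<and> (\<forall>y\<in>U (N i). f i (g i y) = y)" for i
  using g0[OF cyc_index_range[OF n_pos, of i]] periodic_cyc_index[of n M i] periodic_cyc_index[of n N i] periodic_cyc_index[of n f i]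
   cseqD(4)[OF M] cseqD(4)[OF N] cmorD(2)[OF f] by (simp add: g_def)
 have "cmor N b M a g" unfolding cmor_def
 proof (intro allI conjI ballI)
  fix i y assume y: "y \<in> U (N i)"
  have gy: "g i y \<in> U (M i)" using hom_closed[OF conjunct1[OF g[of i]] y] .
  have "b i y = f (Suc i) (a i (g i y))" using cmorD(3)[OF f gy] g y by simp
  then show "g (Suc i) (b i y) = a i (g i y)" using g hom_closed[OF cseqD(3)[OF M] gy] by simp
 qed (use g per in auto)
 then show thesis using that[of g] g by simp
qed

lemma seq_iso_mkD:
 assumes M: "cseq M a" and N: "cseq N b" and "seq_iso C n (mk M a) (mk N b)"
 obtains f g where "cmor M a N b f" "cmor N b M a g" "\<And>i x. x \<in> U (M i) ==> g i (f i x) = x"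
  "\<And>i y. y \<in> U (N i) ==> f i (g i y) = y"
proof -
 obtain \<phi> where \<phi>: "seq_morphism C n (mk M a) (mk N b) \<phi>" "\<And>i. i \<in> {1..n} ==> iso_arr C (\<phi> i)"
  using assms(3) by (auto simp: seq_iso_def)
 obtain f where f: "cmor M a N b f" "\<And>i. i \<in> {1..n} ==> \<phi> i = (M i, f i, N i)"
  using \<phi>(1) seq_morphism_mk[OF M N] by auto
 have inv: "\<exists>g\<in>Lin (N i) (M i). (\<forall>x\<in>U (M i). g (f i x) = x) \<and> (\<forall>y\<in>U (N i). f i (g y) = y)"
  if "i \<in> {1..n}" for i
  using \<phi>(2)[OF that] f(2)[OF that] iso_arr_iff[OF cseqD(1)[OF M] cseqD(1)[OF N] cmorD(1)[OF f(1)]] by simp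
 show thesis by (rule inverse_cmor[OF M N f(1) inv], assumption) (rule that[OF f(1)])
qed

lemma seq_iso_refl:
 assumes M: "cseq M a"
 shows "seq_iso C n (mk M a) (mk M a)"
proof -
 let ?\<phi> = "\<lambda>i. (M i, \<lambda>x\<in>U (M i). x, M i)"
 have "cmor M a M a (\<lambda>i. \<lambda>x\<in>U (M i). x)"
  unfolding cmor_def using cseqD[OF M] hom_closed[OF cseqD(3)[OF M]] by (auto intro!: hom_id)
 then have "seq_morphism C n (mk M a) (mk M a) ?\<phi>" using seq_morphism_mk[OF M M] by auto
 moreover have "iso_arr C (?\<phi> i)" for i
  using cseqD(1,2)[OF M] by (subst iso_arr_iff) (auto intro!: hom_id bexI[of _ "\<lambda>x\<in>U (M i). x"])
 ultimately show ?thesis unfolding seq_iso_def by blast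
qed

definition null_composites :: "(nat => ('a, 'm) module) => (nat => 'm => 'm) => bool"
 where "null_composites M a \<longleftrightarrow> (\<forall>i. \<forall>x\<in>U (M i). a (Suc i) (a i x) = \<zero>\<^bsub>M (Suc (Suc i))\<^esub>)"

lemma candidate_mk:
 assumes M: "cseq M a"
 shows "candidate C n (mk M a) \<longleftrightarrow> null_composites M a"
proof -
 have "candidate C n (mk M a) \<longleftrightarrow> (\<forall>i\<in>{1..n}. \<forall>x\<in>U (M i). a (Suc i) (a i x) = \<zero>\<^bsub>M (Suc (Suc i))\<^esub>)"
  using M cseqD[OF M] unfolding candidate_def
  by (auto simp: mk_in_n_sequences cont_mk obj_mk mk_eq restrict_eq_iff)
 also have "\<dots> \<longleftrightarrow> null_composites M a"
 proof
  assume L: "\<forall>i\<in>{1..n}. \<forall>x\<in>U (M i). a (Suc i) (a i x) = \<zero>\<^bsub>M (Suc (Suc i))\<^esub>"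
  have "\<forall>x\<in>U (M i). a (Suc i) (a i x) = \<zero>\<^bsub>M (Suc (Suc i))\<^esub>" for i
  proof (rule all_periodic[where P = "\<lambda>i. \<forall>x\<in>U (M i). a (Suc i) (a i x) = \<zero>\<^bsub>M (Suc (Suc i))\<^esub>"])
   fix i
   show "(\<forall>x\<in>U (M (cyc i)). a (Suc (cyc i)) (a (cyc i) x) = \<zero>\<^bsub>M (Suc (Suc (cyc i)))\<^esub>) =
    (\<forall>x\<in>U (M i). a (Suc i) (a i x) = \<zero>\<^bsub>M (Suc (Suc i))\<^esub>)"
    using periodic_cyc_index[of n M i] periodic_cyc_index[of n a i] periodic_cyc_index_Suc[of n M i]
     periodic_cyc_index_Suc[of n a i] cseqD(4,5)[OF M] by simp
  qed (rule bspec[OF L])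
  then show "null_composites M a" by (simp add: null_composites_def)
 qed (simp add: null_composites_def)
 finally show ?thesis .
qed

definition contraction :: "(nat => ('a, 'm) module) => (nat => 'm => 'm) => (nat => 'm => 'm) => bool"
 where "contraction M a \<theta> \<longleftrightarrow> (\<forall>i. \<theta> i \<in> Lin (M (Suc i)) (M i) \<and> \<theta> (i + n) = \<theta> i \<and>
  (\<forall>x\<in>U (M (Suc i)). x = \<theta> (Suc i) (a (Suc i) x) \<oplus>\<^bsub>M (Suc i)\<^esub> a i (\<theta> i x)))"

lemma contractible_mk:
 assumes M: "cseq M a"
 shows "contractible C n (mk M a) \<longleftrightarrow> (\<exists>\<theta>. contraction M a \<theta>)"
proof
 assume "contractible C n (mk M a)"
 then obtain \<Theta> where \<Theta>: "\<And>i. i \<in> {1..n} ==> \<Theta> i \<in> Hom C (obj C n (mk M a) (i + 1)) (obj C n (mk M a) i)"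
  and eq: "\<And>i. i \<in> {2..n+1} ==> IdArr C (obj C n (mk M a) i) =
       (cont C n \<Theta> i \<bullet>\<^bsub>C\<^esub> cont C n (mk M a) i) \<boxplus>\<^bsub>C\<^esub> (mk M a (i - 1) \<bullet>\<^bsub>C\<^esub> \<Theta> (i - 1))"
  using that unfolding contractible_def by blast
 define \<theta> where "\<theta> i = fst (snd (\<Theta> (cyc i)))" for i
 have per: "\<theta> (i + n) = \<theta> i" for i by (simp add: \<theta>_def)
 have H: "\<Theta> i \<in> Hom C (M (Suc i)) (M i)" if "i \<in> {1..n}" for i
  using \<Theta>[OF that] that M by (simp add: obj_mk)
 have \<Theta>': "\<Theta> i = (M (Suc i), \<theta> i, M i)" if "i \<in> {1..n}" for i
  using H[OF that] that by (auto simp: Hom_free_mod \<theta>_def cyc_index_self)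
 have c: "cont C n \<Theta> i = (M (Suc i), \<theta> i, M i)" if "i \<in> {1..n+2}" for i
  using that \<Theta>' per cseqD(4,6)[OF M] by (intro cont_eq) auto
 have sq: "\<forall>x\<in>U (M (Suc i)). x = \<theta> (Suc i) (a (Suc i) x) \<oplus>\<^bsub>M (Suc i)\<^esub> a i (\<theta> i x)" if i: "i \<in> {1..n}" for i
 proof -
  have "IdArr C (M (Suc i)) = (cont C n \<Theta> (Suc i) \<bullet>\<^bsub>C\<^esub> cont C n (mk M a) (Suc i)) \<boxplus>\<^bsub>C\<^esub> (mk M a i \<bullet>\<^bsub>C\<^esub> \<Theta> i)"
   using eq[of "Suc i"] i M by (simp add: obj_mk)
  then show ?thesis using i c[of "Suc i"] \<Theta>'[OF i] M by (simp add: mk_eq cont_mk restrict_eq_iff)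
 qed
 have "contraction M a \<theta>" unfolding contraction_def
 proof (rule allI, rule all_periodic)
  fix i
  show "(\<theta> (cyc i) \<in> Lin (M (Suc (cyc i))) (M (cyc i)) \<and> \<theta> (cyc i + n) = \<theta> (cyc i) \<and>
    (\<forall>x\<in>U (M (Suc (cyc i))). x = \<theta> (Suc (cyc i)) (a (Suc (cyc i)) x) \<oplus>\<^bsub>M (Suc (cyc i))\<^esub> a (cyc i) (\<theta> (cyc i) x))) =
   (\<theta> i \<in> Lin (M (Suc i)) (M i) \<and> \<theta> (i + n) = \<theta> i \<and>
    (\<forall>x\<in>U (M (Suc i)). x = \<theta> (Suc i) (a (Suc i) x) \<oplus>\<^bsub>M (Suc i)\<^esub> a i (\<theta> i x)))"
   using periodic_cyc_index[of n M i] periodic_cyc_index[of n a i] periodic_cyc_index[of n \<theta> i] periodic_cyc_index_Suc(1)[of n M i]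
    periodic_cyc_index_Suc(1)[of n a i] periodic_cyc_index_Suc(1)[of n \<theta> i] cseqD(4,5)[OF M] per by simp
 next
  fix i assume i: "i \<in> {1..n}"
  show "\<theta> i \<in> Lin (M (Suc i)) (M i) \<and> \<theta> (i + n) = \<theta> i \<and>
    (\<forall>x\<in>U (M (Suc i)). x = \<theta> (Suc i) (a (Suc i) x) \<oplus>\<^bsub>M (Suc i)\<^esub> a i (\<theta> i x))"
   using H[OF i] \<Theta>'[OF i] per sq[OF i] by simp
 qed
 then show "\<exists>\<theta>. contraction M a \<theta>" by blast
next
 assume "\<exists>\<theta>. contraction M a \<theta>"
 then obtain \<theta> where \<theta>: "contraction M a \<theta>" by blast
 then have \<theta>D: "\<theta> i \<in> Lin (M (Suc i)) (M i)" "\<theta> (i + n) = \<theta> i"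
  "\<forall>x\<in>U (M (Suc i)). x = \<theta> (Suc i) (a (Suc i) x) \<oplus>\<^bsub>M (Suc i)\<^esub> a i (\<theta> i x)" for i
  by (auto simp: contraction_def)
 let ?\<Theta> = "\<lambda>i. (M (Suc i), \<theta> i, M i)"
 have c: "cont C n ?\<Theta> i = (M (Suc i), \<theta> i, M i)" if "i \<in> {1..n+2}" for i
  using that \<theta>D(2) cseqD(4,6)[OF M] by (intro cont_eq) auto
 show "contractible C n (mk M a)" unfolding contractible_def
 proof (intro conjI exI ballI)
  show "mk M a \<in> n_sequences C n" using M by (rule mk_in_n_sequences)
  fix i assume "i \<in> {1..n}"
  then show "?\<Theta> i \<in> Hom C (obj C n (mk M a) (i + 1)) (obj C n (mk M a) i)"
   using M \<theta>D(1) by (simp add: obj_mk cseqD(1))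
 next
  fix i assume i: "i \<in> {2..n + 1}"
  then obtain j where j: "i = Suc j" "j \<in> {1..n}" by (cases i) auto
  show "IdArr C (obj C n (mk M a) i) =
       (cont C n ?\<Theta> i \<bullet>\<^bsub>C\<^esub> cont C n (mk M a) i) \<boxplus>\<^bsub>C\<^esub> (mk M a (i - 1) \<bullet>\<^bsub>C\<^esub> ?\<Theta> (i - 1))"
   using j M c[of "Suc j"] \<theta>D(3)[of j] by (simp add: obj_mk mk_eq cont_mk restrict_eq_iff)
 qed
qed

lemma Fp_seq_mk: "Fp_seq R n p u F = mk (\<lambda>_. F) (\<lambda>i. \<lambda>x\<in>U F. (if cyc i = 1 then u \<otimes> p else p) \<odot>\<^bsub>F\<^esub> x)"
 by (auto simp: Fp_seq_def mk_def scalar_arr_def cyc_index_self intro!: restrict_ext)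

lemma Fp_cseq: "u \<in> U R ==> Free F ==>
  cseq (\<lambda>_. F) (\<lambda>i. \<lambda>x\<in>U F. (if cyc i = 1 then u \<otimes> p else p) \<odot>\<^bsub>F\<^esub> x)"
 unfolding cseq_def using fg_freeD[of F] by (auto intro!: hom_scale)

end

section \<open>Exactness and holonomy\<close>

context angulation_setting
begin

text \<open>
 Boundaries modulo \<open>p\<close>. The homology modulo \<open>p\<close> at a position is formed by the elements with
 differential in \<open>p M\<close>, modulo these.
\<close>

definition bnd :: "(nat => ('a, 'm) module) => (nat => 'm => 'm) => nat => 'm set"
 where "bnd M a i = {a i y \<oplus>\<^bsub>M (Suc i)\<^esub> p \<odot>\<^bsub>M (Suc i)\<^esub> w |y w. y \<in> U (M i) \<and> w \<in> U (M (Suc i))}"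

definition exact_seq :: "(nat => ('a, 'm) module) => (nat => 'm => 'm) => bool"
 where "exact_seq M a \<longleftrightarrow> (\<forall>i. \<forall>x\<in>U (M (Suc i)). a (Suc i) x = \<zero>\<^bsub>M (Suc (Suc i))\<^esub> \<longrightarrow> (\<exists>y\<in>U (M i). x = a i y))"

text \<open>
 A chain follows a class of homology modulo \<open>p\<close> once around the circle: the differential of each
 term is \<open>p\<close> times the next term.
\<close>

definition chain :: "(nat => ('a, 'm) module) => (nat => 'm => 'm) => nat => (nat => 'm) => bool"
 where "chain M a s x \<longleftrightarrow> (\<forall>j\<le>n. x j \<in> U (M (s + j))) \<and>
  (\<forall>j<n. a (s + j) (x j) = p \<odot>\<^bsub>M (Suc (s + j))\<^esub> x (Suc j))"

text \<open>
 Going once around the circle acts on the homology modulo \<open>p\<close> as multiplication by \<open>u\<close>. By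
 \<open>holonomy_Suc\<close> and \<open>holonomy_pred\<close> it does not matter where one starts.
\<close>

definition holonomy :: "'a => (nat => ('a, 'm) module) => (nat => 'm => 'm) => nat => bool"
 where "holonomy u M a s \<longleftrightarrow>
  (\<forall>x. chain M a (Suc s) x \<longrightarrow> x n \<ominus>\<^bsub>M (Suc s)\<^esub> u \<odot>\<^bsub>M (Suc s)\<^esub> x 0 \<in> bnd M a s)"

text \<open>
 The intrinsic description of the members of \<open>N\<^sub>u\<close>; see \<open>N_coll_eq\<close>.
\<close>

definition in_class :: "'a => (nat => ('a, 'm) module) => (nat => 'm => 'm) => bool"
 where "in_class u M a \<longleftrightarrow> cseq M a \<and> null_composites M a \<and> exact_seq M a \<and> holonomy u M a 0"

lemma null_compositesD: "null_composites M a ==> x \<in> U (M i) ==> a (Suc i) (a i x) = \<zero>\<^bsub>M (Suc (Suc i))\<^esub>"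
 by (auto simp: null_composites_def)

lemma exact_seqE:
 assumes "exact_seq M a" "x \<in> U (M (Suc i))" "a (Suc i) x = \<zero>\<^bsub>M (Suc (Suc i))\<^esub>"
 obtains y where "y \<in> U (M i)" "x = a i y"
 using assms by (auto simp: exact_seq_def)

lemma bndI: "y \<in> U (M i) ==> w \<in> U (M (Suc i)) ==>
  a i y \<oplus>\<^bsub>M (Suc i)\<^esub> p \<odot>\<^bsub>M (Suc i)\<^esub> w \<in> bnd M a i"
 by (auto simp: bnd_def)

lemma bndE:
 assumes "x \<in> bnd M a i"
 obtains y w where "y \<in> U (M i)" "w \<in> U (M (Suc i))"
  "x = a i y \<oplus>\<^bsub>M (Suc i)\<^esub> p \<odot>\<^bsub>M (Suc i)\<^esub> w"
 using assms by (auto simp: bnd_def)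

lemma bnd_p: "cseq M a ==> w \<in> U (M (Suc i)) ==> p \<odot>\<^bsub>M (Suc i)\<^esub> w \<in> bnd M a i"
proof -
 assume M: "cseq M a" and w: "w \<in> U (M (Suc i))"
 note MD = cseqD[OF M]
 have "p \<odot>\<^bsub>M (Suc i)\<^esub> w = a i \<zero>\<^bsub>M i\<^esub> \<oplus>\<^bsub>M (Suc i)\<^esub> p \<odot>\<^bsub>M (Suc i)\<^esub> w"
  using w MD(2) by (simp add: hom_zero[OF MD(3)] mod_norm)
 then show ?thesis using bndI[of "\<zero>\<^bsub>M i\<^esub>" M i w a] w MD(2) by simp
qed

lemma bnd_submodule:
 assumes "cseq M a"
 shows "submodule (bnd M a i) R (M (Suc i))"
proof -
 note MD = cseqD[OF assms] and aD = homD[OF cseqD(3)[OF assms, of i]]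
 show ?thesis
 proof (rule submodI[OF MD(2)])
  show "bnd M a i \<subseteq> U (M (Suc i))" using MD(2) aD by (auto simp: bnd_def)
  show "\<zero>\<^bsub>M (Suc i)\<^esub> \<in> bnd M a i"
   using bnd_p[OF assms, of "\<zero>\<^bsub>M (Suc i)\<^esub>" i] MD(2) by simp
  fix x y assume "x \<in> bnd M a i" "y \<in> bnd M a i"
  then obtain v w v' w' where x: "v \<in> U (M i)" "w \<in> U (M (Suc i))"
   "x = a i v \<oplus>\<^bsub>M (Suc i)\<^esub> p \<odot>\<^bsub>M (Suc i)\<^esub> w"
   and y: "v' \<in> U (M i)" "w' \<in> U (M (Suc i))" "y = a i v' \<oplus>\<^bsub>M (Suc i)\<^esub> p \<odot>\<^bsub>M (Suc i)\<^esub> w'"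
   by (auto elim!: bndE)
  have "x \<oplus>\<^bsub>M (Suc i)\<^esub> y = a i (v \<oplus>\<^bsub>M i\<^esub> v') \<oplus>\<^bsub>M (Suc i)\<^esub> p \<odot>\<^bsub>M (Suc i)\<^esub> (w \<oplus>\<^bsub>M (Suc i)\<^esub> w')"
   unfolding x(3) y(3) using x(1,2) y(1,2) MD(2) by (simp add: aD) (simp add: mod_norm aD)
  then show "x \<oplus>\<^bsub>M (Suc i)\<^esub> y \<in> bnd M a i"
   using bndI[of "v \<oplus>\<^bsub>M i\<^esub> v'" M i "w \<oplus>\<^bsub>M (Suc i)\<^esub> w'" a] x y MD(2) by simp
 next
  fix r x assume r: "r \<in> U R" and "x \<in> bnd M a i"
  then obtain v w where x: "v \<in> U (M i)" "w \<in> U (M (Suc i))"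
   "x = a i v \<oplus>\<^bsub>M (Suc i)\<^esub> p \<odot>\<^bsub>M (Suc i)\<^esub> w" by (auto elim!: bndE)
  have "r \<odot>\<^bsub>M (Suc i)\<^esub> x = a i (r \<odot>\<^bsub>M i\<^esub> v) \<oplus>\<^bsub>M (Suc i)\<^esub> p \<odot>\<^bsub>M (Suc i)\<^esub> (r \<odot>\<^bsub>M (Suc i)\<^esub> w)"
   unfolding x(3) using x(1,2) r MD(2) by (simp add: aD mod_smult_radd mod_scale_comm)
  then show "r \<odot>\<^bsub>M (Suc i)\<^esub> x \<in> bnd M a i"
   using bndI[of "r \<odot>\<^bsub>M i\<^esub> v" M i "r \<odot>\<^bsub>M (Suc i)\<^esub> w" a] x r MD(2) by simp
 qed
qed

lemma bndD:
 assumes "cseq M a"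
 shows "x \<in> bnd M a i ==> x \<in> U (M (Suc i))" "\<zero>\<^bsub>M (Suc i)\<^esub> \<in> bnd M a i"
  "x \<in> bnd M a i ==> \<ominus>\<^bsub>M (Suc i)\<^esub> x \<in> bnd M a i"
  "x \<in> bnd M a i ==> y \<in> bnd M a i ==> x \<oplus>\<^bsub>M (Suc i)\<^esub> y \<in> bnd M a i"
  "r \<in> U R ==> x \<in> bnd M a i ==> r \<odot>\<^bsub>M (Suc i)\<^esub> x \<in> bnd M a i"
  "x \<in> bnd M a i ==> y \<in> bnd M a i ==> x \<ominus>\<^bsub>M (Suc i)\<^esub> y \<in> bnd M a i"
 by (fact submodD[OF cseqD(2)[OF assms] bnd_submodule[OF assms]])+

lemma bnd_im: "cseq M a ==> y \<in> U (M i) ==> a i y \<in> bnd M a i"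
proof -
 assume M: "cseq M a" and y: "y \<in> U (M i)"
 note MD = cseqD[OF M]
 have "a i y = a i y \<oplus>\<^bsub>M (Suc i)\<^esub> p \<odot>\<^bsub>M (Suc i)\<^esub> \<zero>\<^bsub>M (Suc i)\<^esub>"
  using y MD(2) hom_closed[OF MD(3)] by (simp add: mod_norm)
 then show ?thesis using bndI[of y M i "\<zero>\<^bsub>M (Suc i)\<^esub>" a] y MD(2) by simp
qed

lemma bnd_cmor:
 assumes M: "cseq M a" and N: "cseq N b" and f: "cmor M a N b f" and x: "x \<in> bnd M a i"
 shows "f (Suc i) x \<in> bnd N b i"
proof -
 obtain y w where y: "y \<in> U (M i)" "w \<in> U (M (Suc i))"
  "x = a i y \<oplus>\<^bsub>M (Suc i)\<^esub> p \<odot>\<^bsub>M (Suc i)\<^esub> w" using x by (rule bndE)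
 have "f (Suc i) x = b i (f i y) \<oplus>\<^bsub>N (Suc i)\<^esub> p \<odot>\<^bsub>N (Suc i)\<^esub> f (Suc i) w"
  unfolding y(3) using y(1,2) cseqD(2)[OF M] hom_closed[OF cseqD(3)[OF M] y(1)]
  by (simp add: homD[OF cmorD(1)[OF f]] cmorD(3)[OF f])
 then show ?thesis
  using bndI[of "f i y" N i "f (Suc i) w" b] y hom_closed[OF cmorD(1)[OF f]] by simp
qed

text \<open>
 Hence the next term of a chain is unique modulo \<open>p\<close> and boundaries.
\<close>

lemma step_bnd:
 assumes M: "cseq M a" and nc: "null_composites M a"
  and x: "x \<in> bnd M a i" "x' \<in> U (M (Suc (Suc i)))"
  and e: "a (Suc i) x = p \<odot>\<^bsub>M (Suc (Suc i))\<^esub> x'"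
 shows "x' \<in> bnd M a (Suc i)"
proof -
 note MD = cseqD[OF M] and aD = homD[OF cseqD(3)[OF M]]
 obtain y w where y: "y \<in> U (M i)" "w \<in> U (M (Suc i))"
  "x = a i y \<oplus>\<^bsub>M (Suc i)\<^esub> p \<odot>\<^bsub>M (Suc i)\<^esub> w" using x(1) by (rule bndE)
 have aw: "a (Suc i) w \<in> U (M (Suc (Suc i)))" using aD(1) y by simp
 have "a (Suc i) x = p \<odot>\<^bsub>M (Suc (Suc i))\<^esub> a (Suc i) w"
  unfolding y(3) using y(1,2) MD(2) aw by (simp add: aD null_compositesD[OF nc] mod_norm)
 then have "p \<odot>\<^bsub>M (Suc (Suc i))\<^esub> (x' \<ominus>\<^bsub>M (Suc (Suc i))\<^esub> a (Suc i) w) = \<zero>\<^bsub>M (Suc (Suc i))\<^esub>"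
  using e x(2) aw MD(2) by (simp add: mod_norm)
 then obtain z where z: "z \<in> U (M (Suc (Suc i)))"
  "x' \<ominus>\<^bsub>M (Suc (Suc i))\<^esub> a (Suc i) w = p \<odot>\<^bsub>M (Suc (Suc i))\<^esub> z"
  using p_annihilated[OF MD(1)] x(2) aw MD(2) by (metis mod_closed(4))
 then have "x' = a (Suc i) w \<oplus>\<^bsub>M (Suc (Suc i))\<^esub> p \<odot>\<^bsub>M (Suc (Suc i))\<^esub> z"
  using x(2) aw MD(2) by (subst mod_eq_sub_iff) auto
 then show ?thesis using bndI[of w M "Suc i" z a] y z by simp
qed

text \<open>
 Hence, for an exact complex, a term of a chain determines the term before it up to \<open>p\<close> and
 boundaries.
\<close>

lemma step_bnd_back:
 assumes M: "cseq M a" and ex: "exact_seq M a"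
  and x: "x \<in> U (M (Suc i))" "x' \<in> bnd M a (Suc i)"
  and e: "a (Suc i) x = p \<odot>\<^bsub>M (Suc (Suc i))\<^esub> x'"
 shows "x \<in> bnd M a i"
proof -
 note MD = cseqD[OF M] and aD = homD[OF cseqD(3)[OF M]]
 obtain y w where y: "y \<in> U (M (Suc i))" "w \<in> U (M (Suc (Suc i)))"
  "x' = a (Suc i) y \<oplus>\<^bsub>M (Suc (Suc i))\<^esub> p \<odot>\<^bsub>M (Suc (Suc i))\<^esub> w" using x(2) by (rule bndE)
 have ay: "a (Suc i) y \<in> U (M (Suc (Suc i)))" using aD(1) y by simp
 have "a (Suc i) x = p \<odot>\<^bsub>M (Suc (Suc i))\<^esub> a (Suc i) y"
  unfolding e y(3) using y(1,2) MD(2) ay by (simp add: mod_smult_radd mod_r_zero)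
 then have "a (Suc i) (x \<ominus>\<^bsub>M (Suc i)\<^esub> p \<odot>\<^bsub>M (Suc i)\<^esub> y) = \<zero>\<^bsub>M (Suc (Suc i))\<^esub>"
  using x(1) y(1) MD(2) by (simp add: aD) (simp add: mod_norm aD(1))
 then obtain z where z: "z \<in> U (M i)" "x \<ominus>\<^bsub>M (Suc i)\<^esub> p \<odot>\<^bsub>M (Suc i)\<^esub> y = a i z"
  using exact_seqE[OF ex] x(1) y(1) MD(2) by (metis mod_closed(4,5) p_carr)
 then have "x = p \<odot>\<^bsub>M (Suc i)\<^esub> y \<oplus>\<^bsub>M (Suc i)\<^esub> a i z"
  using x(1) y(1) MD(2) aD(1) by (subst mod_eq_sub_iff) auto
 then have "x = a i z \<oplus>\<^bsub>M (Suc i)\<^esub> p \<odot>\<^bsub>M (Suc i)\<^esub> y"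
  using mod_comm[OF MD(2), of "a i z" "Suc i" "p \<odot>\<^bsub>M (Suc i)\<^esub> y"] y(1) z(1) MD(2) aD(1) by simp
 then show ?thesis using bndI[OF z(1) y(1), of a] by simp
qed

text \<open>
 A chain never stops: \<open>p\<close> annihilates the differential of \<open>x'\<close>, which is therefore a multiple
 of \<open>p\<close>.
\<close>

lemma p_image_cycle:
 assumes M: "cseq M a" and nc: "null_composites M a"
  and x: "x \<in> U (M i)" "x' \<in> U (M (Suc i))"
  and e: "a i x = p \<odot>\<^bsub>M (Suc i)\<^esub> x'"
 obtains y where "y \<in> U (M (Suc (Suc i)))" "a (Suc i) x' = p \<odot>\<^bsub>M (Suc (Suc i))\<^esub> y"
proof -
 note MD = cseqD[OF M] and aD = homD[OF cseqD(3)[OF M]]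
 have "p \<odot>\<^bsub>M (Suc (Suc i))\<^esub> a (Suc i) x' = a (Suc i) (a i x)"
  using x e MD(2) by (simp add: aD)
 also have "\<dots> = \<zero>\<^bsub>M (Suc (Suc i))\<^esub>" using null_compositesD[OF nc x(1)] .
 finally show thesis using p_annihilated[OF MD(1)] aD(1)[OF x(2)] that by metis
qed

lemma chainD:
 assumes "chain M a s x"
 shows "j \<le> n ==> x j \<in> U (M (s + j))" "j < n ==> x (Suc j) \<in> U (M (Suc (s + j)))"
  "j < n ==> a (s + j) (x j) = p \<odot>\<^bsub>M (Suc (s + j))\<^esub> x (Suc j)"
proof -
 show "j \<le> n ==> x j \<in> U (M (s + j))" "j < n ==> a (s + j) (x j) = p \<odot>\<^bsub>M (Suc (s + j))\<^esub> x (Suc j)"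
  using assms by (auto simp: chain_def)
 assume "j < n"
 then have "Suc j \<le> n" by simp
 then have "x (Suc j) \<in> U (M (s + Suc j))" using assms unfolding chain_def by blast
 then show "x (Suc j) \<in> U (M (Suc (s + j)))" by simp
qed

lemma chain_first:
 assumes "chain M a s x"
 shows "x 0 \<in> U (M s)" "x S1 \<in> U (M (Suc s))" "a s (x 0) = p \<odot>\<^bsub>M (Suc s)\<^esub> x S1"
 using chainD[OF assms, of 0] by simp_all

lemma chain_last:
 assumes "chain M a s x"
 shows "x (n - 1) \<in> U (M (s + (n - 1)))" "x n \<in> U (M (Suc (s + (n - 1))))"
  "a (s + (n - 1)) (x (n - 1)) = p \<odot>\<^bsub>M (Suc (s + (n - 1)))\<^esub> x n"
proof -
 have "n - 1 < n" "Suc (n - 1) = n" using n_ge by auto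
 then show "x (n - 1) \<in> U (M (s + (n - 1)))" "x n \<in> U (M (Suc (s + (n - 1))))"
  "a (s + (n - 1)) (x (n - 1)) = p \<odot>\<^bsub>M (Suc (s + (n - 1)))\<^esub> x n"
  using chainD[OF assms, of "n - 1"] by auto
qed

lemma chain_end:
 assumes M: "cseq M a" and nc: "null_composites M a" and x: "chain M a s x"
 obtains y where "y \<in> U (M (Suc s))" "a s (x n) = p \<odot>\<^bsub>M (Suc s)\<^esub> y"
proof -
 note MD = cseqD[OF M]
 have e: "Suc (s + (n - 1)) = s + n" using n_ge by simp
 obtain y where "y \<in> U (M (Suc (s + n)))" "a (s + n) (x n) = p \<odot>\<^bsub>M (Suc (s + n))\<^esub> y"
  using p_image_cycle[OF M nc chain_last[OF x]] unfolding e by blast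
 then show thesis using that MD(5,6) by simp
qed

lemma chain_bnd:
 assumes M: "cseq M a" and nc: "null_composites M a" and x: "chain M a (Suc s) x" "x 0 \<in> bnd M a s"
 shows "j \<le> n ==> x j \<in> bnd M a (s + j)"
proof (induction j)
 case (Suc j)
 then show ?case
  using step_bnd[OF M nc, of "x j" "s + j" "x (Suc j)"] chainD[OF x(1), of j] by simp
qed (use x in simp)

lemma chain_bnd_back:
 assumes M: "cseq M a" and ex: "exact_seq M a" and x: "chain M a (Suc s) x" "x n \<in> bnd M a (s + n)"
 shows "j \<le> n ==> x (n - j) \<in> bnd M a (s + (n - j))"
proof (induction j)
 case (Suc j)
 then have "n - j = Suc (n - Suc j)" by simp
 then show ?case
  using step_bnd_back[OF M ex, of "x (n - Suc j)" "s + (n - Suc j)" "x (n - j)"] Suc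
   chainD[OF x(1), of "n - Suc j"] by simp
qed (use x in simp)

lemma chain_diff:
 assumes M: "cseq M a" and x: "chain M a s x" and y: "chain M a s y"
 shows "chain M a s (\<lambda>j. x j \<ominus>\<^bsub>M (s + j)\<^esub> y j)"
 unfolding chain_def
proof (intro conjI allI impI)
 note MD = cseqD[OF M] and aD = homD[OF cseqD(3)[OF M]]
 fix j
 show "j \<le> n ==> x j \<ominus>\<^bsub>M (s + j)\<^esub> y j \<in> U (M (s + j))"
  using chainD(1)[OF x] chainD(1)[OF y] MD(2) by simp
 assume j: "j < n"
 note m = chainD(1)[OF x less_imp_le[OF j]] chainD(2,3)[OF x j]
  chainD(1)[OF y less_imp_le[OF j]] chainD(2,3)[OF y j]
 then show "a (s + j) (x j \<ominus>\<^bsub>M (s + j)\<^esub> y j) = p \<odot>\<^bsub>M (Suc (s + j))\<^esub> (x (Suc j) \<ominus>\<^bsub>M (s + Suc j)\<^esub> y (Suc j))"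
  using MD(2) by (simp add: aD) (simp add: mod_norm)
qed

text \<open>
 A chain is prolonged to the left by exactness, as \<open>p x\<^sub>0\<close> is a cycle. The differential maps the
 defect of the longer chain to \<open>p\<close> times the defect of the given one.
\<close>

lemma holonomy_Suc:
 assumes M: "cseq M a" and nc: "null_composites M a" and ex: "exact_seq M a" and u: "u \<in> U R"
  and hol: "holonomy u M a s"
 shows "holonomy u M a (Suc s)"
 unfolding holonomy_def
proof (intro allI impI)
 note MD = cseqD[OF M] and aD = homD[OF cseqD(3)[OF M]]
 fix x assume x: "chain M a (Suc (Suc s)) x"
 note x0 = chain_first[OF x]
 have "a (Suc (Suc s)) (p \<odot>\<^bsub>M (Suc (Suc s))\<^esub> x 0) = \<zero>\<^bsub>M (Suc (Suc (Suc s)))\<^esub>"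
  using x0 MD(2) by (simp add: aD)
 then obtain y where y: "y \<in> U (M (Suc s))" "p \<odot>\<^bsub>M (Suc (Suc s))\<^esub> x 0 = a (Suc s) y"
  using exact_seqE[OF ex] x0(1) MD(2) by (metis mod_closed(5) p_carr)
 define z where "z = (\<lambda>j. case j of 0 => y | Suc j => x j)"
 have "chain M a (Suc s) z" unfolding chain_def
 proof (intro conjI allI impI)
  fix j show "j \<le> n ==> z j \<in> U (M (Suc s + j))"
   using chainD(1)[OF x, of "j - 1"] y by (cases j) (auto simp: z_def)
  show "j < n ==> a (Suc s + j) (z j) = p \<odot>\<^bsub>M (Suc (Suc s + j))\<^esub> z (Suc j)"
   using chainD(3)[OF x, of "j - 1"] y by (cases j) (auto simp: z_def)
 qed
 then have "z n \<ominus>\<^bsub>M (Suc s)\<^esub> u \<odot>\<^bsub>M (Suc s)\<^esub> z 0 \<in> bnd M a s"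
  using hol by (auto simp: holonomy_def)
 then have b: "x (n - 1) \<ominus>\<^bsub>M (Suc s)\<^esub> u \<odot>\<^bsub>M (Suc s)\<^esub> y \<in> bnd M a s"
  using n_pos by (cases n) (auto simp: z_def)
 have idx: "Suc (Suc s) + (n - 1) = Suc s + n" using n_ge by simp
 have x': "x (n - 1) \<in> U (M (Suc s))" "x n \<in> U (M (Suc (Suc s)))"
  "a (Suc s) (x (n - 1)) = p \<odot>\<^bsub>M (Suc (Suc s))\<^esub> x n"
  using chain_last[OF x, unfolded idx] MD(4)[of "Suc s"] MD(5)[of "Suc s"] MD(6)[of "Suc s"] by simp_all
 have "a (Suc s) (x (n - 1) \<ominus>\<^bsub>M (Suc s)\<^esub> u \<odot>\<^bsub>M (Suc s)\<^esub> y) =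
   p \<odot>\<^bsub>M (Suc (Suc s))\<^esub> x n \<ominus>\<^bsub>M (Suc (Suc s))\<^esub> u \<odot>\<^bsub>M (Suc (Suc s))\<^esub> (p \<odot>\<^bsub>M (Suc (Suc s))\<^esub> x 0)"
  using x' y u MD(2) by (simp add: aD)
 also have "\<dots> = p \<odot>\<^bsub>M (Suc (Suc s))\<^esub> (x n \<ominus>\<^bsub>M (Suc (Suc s))\<^esub> u \<odot>\<^bsub>M (Suc (Suc s))\<^esub> x 0)"
  using x' x0 u MD(2) by (simp add: mod_norm mod_scale_comm[of _ u p])
 finally show "x n \<ominus>\<^bsub>M (Suc (Suc s))\<^esub> u \<odot>\<^bsub>M (Suc (Suc s))\<^esub> x 0 \<in> bnd M a (Suc s)"
  using step_bnd[OF M nc b] x' x0 u MD(2) by simp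
qed

text \<open>
 Dual to the previous argument: the chain is prolonged to the right and the defect is traced back
 through the differential.
\<close>

lemma holonomy_pred:
 assumes M: "cseq M a" and nc: "null_composites M a" and ex: "exact_seq M a" and u: "u \<in> U R"
  and hol: "holonomy u M a (Suc s)"
 shows "holonomy u M a s"
 unfolding holonomy_def
proof (intro allI impI)
 note MD = cseqD[OF M] and aD = homD[OF cseqD(3)[OF M]]
 fix x assume x: "chain M a (Suc s) x"
 obtain y where y: "y \<in> U (M (Suc (Suc s)))" "a (Suc s) (x n) = p \<odot>\<^bsub>M (Suc (Suc s))\<^esub> y"
  using chain_end[OF M nc x] .
 have per: "M (s + n) = M s" "M (Suc (s + n)) = M (Suc s)" "M (Suc (Suc (s + n))) = M (Suc (Suc s))" "a (Suc (s + n)) = a (Suc s)"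
  using MD(4)[of s] MD(4)[of "Suc s"] MD(4)[of "Suc (Suc s)"] MD(5)[of "Suc s"] by simp_all
 define z where "z j = (if j < n then x (Suc j) else y)" for j
 have xn: "x n \<in> U (M (Suc s))" using chainD(1)[OF x, of n] per by simp
 note x0 = chain_first[OF x]
 have "chain M a (Suc (Suc s)) z" unfolding chain_def
 proof (intro conjI allI impI)
  fix j show "j \<le> n ==> z j \<in> U (M (Suc (Suc s) + j))"
   using chainD(2)[OF x, of j] y per by (cases "j = n") (auto simp: z_def)
  assume j: "j < n"
  show "a (Suc (Suc s) + j) (z j) = p \<odot>\<^bsub>M (Suc (Suc (Suc s) + j))\<^esub> z (Suc j)"
  proof (cases "Suc j = n")
   case True
   then have "Suc (Suc s) + j = Suc (s + n)" by simp
   then show ?thesis using True y per by (simp only: z_def) simp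
  next
   case False
   then show ?thesis using chainD(3)[OF x, of "Suc j"] j by (simp add: z_def)
  qed
 qed
 then have "z n \<ominus>\<^bsub>M (Suc (Suc s))\<^esub> u \<odot>\<^bsub>M (Suc (Suc s))\<^esub> z 0 \<in> bnd M a (Suc s)"
  using hol by (auto simp: holonomy_def)
 then have b: "y \<ominus>\<^bsub>M (Suc (Suc s))\<^esub> u \<odot>\<^bsub>M (Suc (Suc s))\<^esub> x S1 \<in> bnd M a (Suc s)"
  by (simp add: z_def)
 have "a (Suc s) (x n \<ominus>\<^bsub>M (Suc s)\<^esub> u \<odot>\<^bsub>M (Suc s)\<^esub> x 0) =
   p \<odot>\<^bsub>M (Suc (Suc s))\<^esub> y \<ominus>\<^bsub>M (Suc (Suc s))\<^esub> u \<odot>\<^bsub>M (Suc (Suc s))\<^esub> (p \<odot>\<^bsub>M (Suc (Suc s))\<^esub> x S1)"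
  using xn x0 y u MD(2) by (simp add: aD)
 also have "\<dots> = p \<odot>\<^bsub>M (Suc (Suc s))\<^esub> (y \<ominus>\<^bsub>M (Suc (Suc s))\<^esub> u \<odot>\<^bsub>M (Suc (Suc s))\<^esub> x S1)"
  using y x0 u MD(2) by (simp add: mod_norm mod_scale_comm[of _ u p])
 finally show "x n \<ominus>\<^bsub>M (Suc s)\<^esub> u \<odot>\<^bsub>M (Suc s)\<^esub> x 0 \<in> bnd M a s"
  using step_bnd_back[OF M ex _ b] xn x0 u MD(2) by simp
qed

text \<open>
 The relation between a shifted sequence and its rotation. A change of sign does not affect
 chains when \<open>2p = 0\<close>.
\<close>

definition same_up_to_sign :: "(nat => ('a, 'm) module) => (nat => 'm => 'm) => (nat => 'm => 'm) => bool"
 where "same_up_to_sign M a b \<longleftrightarrow> (\<forall>i. (\<forall>x\<in>U (M i). b i x = a i x) \<or>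
  (p \<oplus> p = \<zero> \<and> (\<forall>x\<in>U (M i). b i x = \<ominus>\<^bsub>M (Suc i)\<^esub> a i x)))"

lemma p_neg:
 assumes "p \<oplus> p = \<zero>" "module R M" "x \<in> U M"
 shows "\<ominus>\<^bsub>M\<^esub> (p \<odot>\<^bsub>M\<^esub> x) = p \<odot>\<^bsub>M\<^esub> x"
proof -
 have "p \<odot>\<^bsub>M\<^esub> x \<oplus>\<^bsub>M\<^esub> p \<odot>\<^bsub>M\<^esub> x = \<zero>\<^bsub>M\<^esub>"
  using assms by (simp add: mod_smult_ladd[symmetric] mod_smult_zero)
 then have "\<ominus>\<^bsub>M\<^esub> (p \<odot>\<^bsub>M\<^esub> x) \<oplus>\<^bsub>M\<^esub> (p \<odot>\<^bsub>M\<^esub> x \<oplus>\<^bsub>M\<^esub> p \<odot>\<^bsub>M\<^esub> x) = \<ominus>\<^bsub>M\<^esub> (p \<odot>\<^bsub>M\<^esub> x) \<oplus>\<^bsub>M\<^esub> \<zero>\<^bsub>M\<^esub>" by simp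
 then show ?thesis using assms by (simp add: mod_r_neg1 mod_r_zero)
qed

lemma sign_sym:
 assumes M: "cseq M a" and s: "same_up_to_sign M a b"
 shows "same_up_to_sign M b a"
 using s cseqD(2)[OF M] hom_closed[OF cseqD(3)[OF M]] unfolding same_up_to_sign_def
 by (metis mod_neg_neg)

lemma sign_bnd_subset:
 assumes M: "cseq M a" and N: "cseq M b" and s: "same_up_to_sign M a b"
 shows "bnd M b i \<subseteq> bnd M a i"
proof
 fix x assume "x \<in> bnd M b i"
 then obtain y w where y: "y \<in> U (M i)" "w \<in> U (M (Suc i))"
  "x = b i y \<oplus>\<^bsub>M (Suc i)\<^esub> p \<odot>\<^bsub>M (Suc i)\<^esub> w" by (rule bndE)
 have "b i y = a i y \<or> b i y = a i (\<ominus>\<^bsub>M i\<^esub> y)"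
  using s y(1) cseqD(2)[OF M] unfolding same_up_to_sign_def by (auto simp: hom_neg[OF cseqD(3)[OF M]])
 then show "x \<in> bnd M a i" using y bndI cseqD(2)[OF M] by (metis mod_closed(2))
qed

lemma sign_chain:
 assumes M: "cseq M a" and s: "same_up_to_sign M a b" and x: "chain M b i x"
 shows "chain M a i x"
 unfolding chain_def
proof (intro conjI allI impI)
 fix j show "j \<le> n ==> x j \<in> U (M (i + j))" by (rule chainD(1)[OF x])
 assume j: "j < n"
 note m = chainD(1)[OF x less_imp_le[OF j]] chainD(2)[OF x j] and e = chainD(3)[OF x j]
 consider "b (i + j) (x j) = a (i + j) (x j)" | "p \<oplus> p = \<zero>" "b (i + j) (x j) = \<ominus>\<^bsub>M (Suc (i + j))\<^esub> a (i + j) (x j)"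
  using s m(1) unfolding same_up_to_sign_def by blast
 then show "a (i + j) (x j) = p \<odot>\<^bsub>M (Suc (i + j))\<^esub> x (Suc j)"
 proof cases
  case 2
  have am: "a (i + j) (x j) \<in> U (M (Suc (i + j)))" using hom_closed[OF cseqD(3)[OF M] m(1)] .
  have "a (i + j) (x j) = \<ominus>\<^bsub>M (Suc (i + j))\<^esub> (p \<odot>\<^bsub>M (Suc (i + j))\<^esub> x (Suc j))"
   using 2(2) e am cseqD(2)[OF M] by (metis mod_neg_neg)
  then show ?thesis using p_neg[OF 2(1) cseqD(2)[OF M] m(2)] by simp
 qed (use e in simp)
qed

lemma in_class_sign:
 assumes c: "in_class u M a" and b: "cseq M b" and s: "same_up_to_sign M a b"
 shows "in_class u M b"
proof -
 have M: "cseq M a" and nc: "null_composites M a" and ex: "exact_seq M a" and hol: "holonomy u M a 0"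
  using c by (auto simp: in_class_def)
 note MD = cseqD[OF M] and aD = homD[OF cseqD(3)[OF M]]
 have val: "b i x = a i x \<or> b i x = \<ominus>\<^bsub>M (Suc i)\<^esub> a i x" if "x \<in> U (M i)" for i x
  using s that unfolding same_up_to_sign_def by blast
 have "null_composites M b" unfolding null_composites_def
 proof (intro allI ballI)
  fix i x assume x: "x \<in> U (M i)"
  have ax: "a i x \<in> U (M (Suc i))" using aD(1) x .
  have "a (Suc i) (b i x) = \<zero>\<^bsub>M (Suc (Suc i))\<^esub>"
   using val[OF x] ax x MD(2) by (auto simp: aD null_compositesD[OF nc])
  then show "b (Suc i) (b i x) = \<zero>\<^bsub>M (Suc (Suc i))\<^esub>"
   using val[OF hom_closed[OF cseqD(3)[OF b] x]] MD(2) by auto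
 qed
 moreover have "exact_seq M b" unfolding exact_seq_def
 proof (intro allI ballI impI)
  fix i x assume x: "x \<in> U (M (Suc i))" and e: "b (Suc i) x = \<zero>\<^bsub>M (Suc (Suc i))\<^esub>"
  have "a (Suc i) x = \<zero>\<^bsub>M (Suc (Suc i))\<^esub>"
   using val[OF x] e aD(1)[OF x] MD(2) by (metis mod_neg_neg mod_neg_zero')
  then obtain y where y: "y \<in> U (M i)" "x = a i y" using exact_seqE[OF ex x] by blast
  then have "x = b i y \<or> x = b i (\<ominus>\<^bsub>M i\<^esub> y)"
   using val[OF y(1)] aD(1)[OF y(1)] MD(2) by (auto simp: hom_neg[OF cseqD(3)[OF b]] mod_neg_neg)
  then show "\<exists>y\<in>U (M i). x = b i y" using y(1) MD(2) by (metis mod_closed(2))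
 qed
 moreover have "holonomy u M b 0"
  using hol sign_chain[OF M s] sign_bnd_subset[OF b M sign_sym[OF M s]] unfolding holonomy_def by blast
 ultimately show ?thesis using b by (simp add: in_class_def)
qed

definition rot_maps :: "(nat => ('a, 'm) module) => (nat => 'm => 'm) => nat => 'm => 'm"
 where "rot_maps M a i = (if odd n \<and> n dvd i then \<lambda>x\<in>U (M (Suc i)). \<ominus>\<^bsub>M (Suc (Suc i))\<^esub> a (Suc i) x else a (Suc i))"

lemma rot_cseq:
 assumes "cseq M a"
 shows "cseq (\<lambda>i. M (Suc i)) (rot_maps M a)" and "cseq (\<lambda>i. M (Suc i)) (\<lambda>i. a (Suc i))"
proof -
 note MD = cseqD[OF assms]
 have per: "M (Suc (i + n)) = M (Suc i)" "M (Suc (Suc (i + n))) = M (Suc (Suc i))" "a (Suc (i + n)) = a (Suc i)" for i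
  using MD(4)[of "Suc i"] MD(4)[of "Suc (Suc i)"] MD(5)[of "Suc i"] by simp_all
 show "cseq (\<lambda>i. M (Suc i)) (rot_maps M a)" "cseq (\<lambda>i. M (Suc i)) (\<lambda>i. a (Suc i))"
  unfolding cseq_def rot_maps_def using per MD(1,2,3) by (auto intro!: hom_opp)
qed

lemma left_rotation_mk:
 assumes "cseq M a"
 shows "left_rotation C n (mk M a) = mk (\<lambda>i. M (Suc i)) (rot_maps M a)"
proof
 note MD = cseqD[OF assms]
 fix i
 show "left_rotation C n (mk M a) i = mk (\<lambda>i. M (Suc i)) (rot_maps M a) i"
 proof (cases "i \<in> {1..n}")
  case True
  consider "i < n" | "i = n" using True by fastforce
  then show ?thesis
  proof cases
   case 1
   then have "\<not> n dvd i" using True by (auto dest: dvd_imp_le)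
   then show ?thesis using True 1 by (simp add: left_rotation_def mk_def rot_maps_def)
  next
   case 2
   have "M (Suc n) = M S1" "M (Suc (Suc n)) = M S2" "a (Suc n) = a S1"
    using MD(4)[of S1] MD(4)[of S2] MD(5)[of S1] by simp_all
   then show ?thesis using 2 n_ge by (simp add: left_rotation_def mk_def rot_maps_def)
  qed
 next
  case False
  then show ?thesis unfolding left_rotation_def mk_def by (simp only: restrict_apply if_False)
 qed
qed

lemma rot_sign:
 "same_up_to_sign (\<lambda>i. M (Suc i)) (\<lambda>i. a (Suc i)) (rot_maps M a)"
 using parity by (auto simp: same_up_to_sign_def rot_maps_def)

lemma exact_shift:
 assumes M: "cseq M a"
 shows "null_composites (\<lambda>i. M (Suc i)) (\<lambda>i. a (Suc i)) = null_composites M a"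
  and "exact_seq (\<lambda>i. M (Suc i)) (\<lambda>i. a (Suc i)) = exact_seq M a"
proof -
 note MD = cseqD[OF M]
 have k: "\<exists>k. Suc k = i + n" for i using n_ge by (intro exI[of _ "i + n - 1"]) simp
 have per: "M (Suc (i + n)) = M (Suc i)" "M (Suc (Suc (i + n))) = M (Suc (Suc i))" "a (Suc (i + n)) = a (Suc i)" for i
  using MD(4)[of "Suc i"] MD(4)[of "Suc (Suc i)"] MD(5)[of "Suc i"] by simp_all
 show "null_composites (\<lambda>i. M (Suc i)) (\<lambda>i. a (Suc i)) = null_composites M a"
 proof
  assume L: "null_composites (\<lambda>i. M (Suc i)) (\<lambda>i. a (Suc i))"
  show "null_composites M a" unfolding null_composites_def
  proof
   fix i
   obtain k where "Suc k = i + n" using k by blast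
   then show "\<forall>x\<in>U (M i). a (Suc i) (a i x) = \<zero>\<^bsub>M (Suc (Suc i))\<^esub>"
    using L[unfolded null_composites_def, rule_format, of _ k] MD(4,5)[of i] per by auto
  qed
 qed (simp add: null_composites_def)
 show "exact_seq (\<lambda>i. M (Suc i)) (\<lambda>i. a (Suc i)) = exact_seq M a"
 proof
  assume L: "exact_seq (\<lambda>i. M (Suc i)) (\<lambda>i. a (Suc i))"
  show "exact_seq M a" unfolding exact_seq_def
  proof
   fix i
   obtain k where "Suc k = i + n" using k by blast
   then show "\<forall>x\<in>U (M (Suc i)). a (Suc i) x = \<zero>\<^bsub>M (Suc (Suc i))\<^esub> \<longrightarrow> (\<exists>y\<in>U (M i). x = a i y)"
    using L[unfolded exact_seq_def, rule_format, of _ k] MD(4,5)[of i] per by auto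
  qed
 qed (simp add: exact_seq_def)
qed

lemma holonomy_shift: "holonomy u (\<lambda>i. M (Suc i)) (\<lambda>i. a (Suc i)) s = holonomy u M a (Suc s)"
 by (simp add: holonomy_def chain_def bnd_def)

lemma in_class_rotation:
 assumes M: "cseq M a" and u: "u \<in> U R"
 shows "in_class u M a \<longleftrightarrow> in_class u (\<lambda>i. M (Suc i)) (rot_maps M a)"
proof -
 note c = rot_cseq[OF M]
 have "in_class u M a \<longleftrightarrow> in_class u (\<lambda>i. M (Suc i)) (\<lambda>i. a (Suc i))"
  unfolding in_class_def exact_shift[OF M] holonomy_shift
  using M c holonomy_Suc[OF M _ _ u] holonomy_pred[OF M _ _ u] by blast
 also have "\<dots> \<longleftrightarrow> in_class u (\<lambda>i. M (Suc i)) (rot_maps M a)"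
  using in_class_sign[OF _ c(1) rot_sign] in_class_sign[OF _ c(2) sign_sym[OF c(2) rot_sign]] by blast
 finally show ?thesis .
qed

lemma chain_cmor:
 assumes M: "cseq M a" and N: "cseq N b" and f: "cmor M a N b f" and x: "chain M a s x"
 shows "chain N b s (\<lambda>j. f (s + j) (x j))"
 unfolding chain_def
proof (intro conjI allI impI)
 note fD = homD[OF cmorD(1)[OF f]]
 fix j
 show "j \<le> n ==> f (s + j) (x j) \<in> U (N (s + j))" using chainD(1)[OF x] fD(1) by simp
 assume j: "j < n"
 note m = chainD(1)[OF x less_imp_le[OF j]] chainD(2)[OF x j] and e = chainD(3)[OF x j]
 have "b (s + j) (f (s + j) (x j)) = f (Suc (s + j)) (a (s + j) (x j))" using cmorD(3)[OF f m(1)] by simp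
 also have "\<dots> = p \<odot>\<^bsub>N (Suc (s + j))\<^esub> f (Suc (s + j)) (x (Suc j))" using e m(2) by (simp add: fD)
 finally show "b (s + j) (f (s + j) (x j)) = p \<odot>\<^bsub>N (Suc (s + j))\<^esub> f (s + Suc j) (x (Suc j))" by simp
qed

text \<open>
 A morphism carries chains to chains, so the defect of a chain is mapped to a boundary.
\<close>

lemma holonomy_cmor:
 assumes M: "cseq M a" and N: "cseq N b" and f: "cmor M a N b f" and u: "u \<in> U R"
  and hol: "holonomy u N b s" and x: "chain M a (Suc s) x"
 shows "f (Suc s) (x n \<ominus>\<^bsub>M (Suc s)\<^esub> u \<odot>\<^bsub>M (Suc s)\<^esub> x 0) \<in> bnd N b s"
proof -
 note fD = homD[OF cmorD(1)[OF f]] and MD = cseqD[OF M]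
 have per: "M (Suc (s + n)) = M (Suc s)" "f (Suc (s + n)) = f (Suc s)"
  using MD(4)[of "Suc s"] cmorD(2)[OF f, of "Suc s"] by simp_all
 have m: "x 0 \<in> U (M (Suc s))" "x n \<in> U (M (Suc s))"
  using chainD(1)[OF x, of 0] chainD(1)[OF x, of n] per by simp_all
 have "f (Suc s + n) (x n) \<ominus>\<^bsub>N (Suc s)\<^esub> u \<odot>\<^bsub>N (Suc s)\<^esub> f (Suc s + 0) (x 0) \<in> bnd N b s"
  using hol chain_cmor[OF M N f x] unfolding holonomy_def by blast
 then show ?thesis using per m u MD(2) cseqD(2)[OF N] by (simp add: fD)
qed

lemma in_class_retract:
 assumes c: "in_class u M a" and u: "u \<in> U R" and N: "cseq N b"
  and i: "cmor N b M a i" and q: "cmor M a N b q" and qi: "\<And>k x. x \<in> U (N k) ==> q k (i k x) = x"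
 shows "in_class u N b"
proof -
 have M: "cseq M a" and nc: "null_composites M a" and ex: "exact_seq M a" and hol: "holonomy u M a 0"
  using c by (auto simp: in_class_def)
 note MD = cseqD[OF M] and ND = cseqD[OF N] and iD = homD[OF cmorD(1)[OF i]] and qD = homD[OF cmorD(1)[OF q]]
 have bN: "b k x \<in> U (N (Suc k))" if "x \<in> U (N k)" for k x using hom_closed[OF ND(3) that] .
 have "null_composites N b" unfolding null_composites_def
 proof (intro allI ballI)
  fix k x assume x: "x \<in> U (N k)"
  have "i (Suc (Suc k)) (b (Suc k) (b k x)) = \<zero>\<^bsub>M (Suc (Suc k))\<^esub>"
   using x bN[OF x] iD(1)[OF x] by (simp add: cmorD(3)[OF i] null_compositesD[OF nc])
  then have "q (Suc (Suc k)) (i (Suc (Suc k)) (b (Suc k) (b k x))) = \<zero>\<^bsub>N (Suc (Suc k))\<^esub>"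
   using MD(2) ND(2) by (simp add: qD)
  then show "b (Suc k) (b k x) = \<zero>\<^bsub>N (Suc (Suc k))\<^esub>" using qi bN x by simp
 qed
 moreover have "exact_seq N b" unfolding exact_seq_def
 proof (intro allI ballI impI)
  fix k x assume x: "x \<in> U (N (Suc k))" and e: "b (Suc k) x = \<zero>\<^bsub>N (Suc (Suc k))\<^esub>"
  have "a (Suc k) (i (Suc k) x) = \<zero>\<^bsub>M (Suc (Suc k))\<^esub>"
   using e MD(2) ND(2) cmorD(3)[OF i x] by (simp add: iD)
  then obtain y where y: "y \<in> U (M k)" "i (Suc k) x = a k y" using exact_seqE[OF ex iD(1)[OF x]] by blast
  then have "x = b k (q k y)" using qi[OF x] cmorD(3)[OF q y(1)] by simp
  then show "\<exists>y\<in>U (N k). x = b k y" using qD(1)[OF y(1)] by blast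
 qed
 moreover have "holonomy u N b 0" unfolding holonomy_def
 proof (intro allI impI)
  fix x assume x: "chain N b S1 x"
  have m: "x 0 \<in> U (N S1)" "x n \<in> U (N S1)"
   using chainD(1)[OF x, of 0] chainD(1)[OF x, of n] ND(8) by simp_all
  then have mem: "x n \<ominus>\<^bsub>N S1\<^esub> u \<odot>\<^bsub>N S1\<^esub> x 0 \<in> U (N S1)" using u ND(2) by simp
  have "q S1 (i S1 (x n \<ominus>\<^bsub>N S1\<^esub> u \<odot>\<^bsub>N S1\<^esub> x 0)) \<in> bnd N b 0"
   using bnd_cmor[OF M N q holonomy_cmor[OF N M i u hol x]] .
  then show "x n \<ominus>\<^bsub>N S1\<^esub> u \<odot>\<^bsub>N S1\<^esub> x 0 \<in> bnd N b 0" using qi[OF mem] by simp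
 qed
 ultimately show ?thesis using N by (simp add: in_class_def)
qed

lemma in_class_direct_sum:
 assumes cM: "in_class u M a" and cN: "in_class u N b" and u: "u \<in> U R" and P: "cseq P c"
  and i1: "cmor M a P c i1" and i2: "cmor N b P c i2" and p1: "cmor P c M a p1" and p2: "cmor P c N b p2"
  and bp: "\<And>k. bip (M k) (N k) (P k) (i1 k) (i2 k) (p1 k) (p2 k)"
 shows "in_class u P c"
proof -
 have M: "cseq M a" "null_composites M a" "exact_seq M a" "holonomy u M a 0"
  using cM by (auto simp: in_class_def)
 have N: "cseq N b" "null_composites N b" "exact_seq N b" "holonomy u N b 0"
  using cN by (auto simp: in_class_def)
 note MD = cseqD[OF M(1)] and ND = cseqD[OF N(1)] and PD = cseqD[OF P]
 note i1D = homD[OF cmorD(1)[OF i1]] and i2D = homD[OF cmorD(1)[OF i2]] and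
  p1D = homD[OF cmorD(1)[OF p1]] and p2D = homD[OF cmorD(1)[OF p2]] and cD = homD[OF PD(3)]
 have dec: "z = i1 k (p1 k z) \<oplus>\<^bsub>P k\<^esub> i2 k (p2 k z)" if "z \<in> U (P k)" for k z
  using bp[of k] that by (simp add: bip_def)
 have "null_composites P c" unfolding null_composites_def
 proof (intro allI ballI)
  fix k x assume x: "x \<in> U (P k)"
  let ?z = "c (Suc k) (c k x)"
  have z: "?z \<in> U (P (Suc (Suc k)))" and cx: "c k x \<in> U (P (Suc k))" using x cD(1) by auto
  have "p1 (Suc (Suc k)) ?z = \<zero>\<^bsub>M (Suc (Suc k))\<^esub>" "p2 (Suc (Suc k)) ?z = \<zero>\<^bsub>N (Suc (Suc k))\<^esub>"
   using x cx p1D(1) p2D(1) by (simp_all add: cmorD(3)[OF p1] cmorD(3)[OF p2] null_compositesD[OF M(2)] null_compositesD[OF N(2)])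
  then show "?z = \<zero>\<^bsub>P (Suc (Suc k))\<^esub>" using dec[OF z] MD(2) ND(2) PD(2) by (simp add: i1D i2D mod_norm)
 qed
 moreover have "exact_seq P c" unfolding exact_seq_def
 proof (intro allI ballI impI)
  fix k x assume x: "x \<in> U (P (Suc k))" and e: "c (Suc k) x = \<zero>\<^bsub>P (Suc (Suc k))\<^esub>"
  have "a (Suc k) (p1 (Suc k) x) = \<zero>\<^bsub>M (Suc (Suc k))\<^esub>" "b (Suc k) (p2 (Suc k) x) = \<zero>\<^bsub>N (Suc (Suc k))\<^esub>"
   using e MD(2) ND(2) PD(2) cmorD(3)[OF p1 x] cmorD(3)[OF p2 x] by (simp_all add: p1D p2D)
  then obtain y z where y: "y \<in> U (M k)" "p1 (Suc k) x = a k y" and z: "z \<in> U (N k)" "p2 (Suc k) x = b k z"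
   using exact_seqE[OF M(3) p1D(1)[OF x]] exact_seqE[OF N(3) p2D(1)[OF x]] by metis
  have "x = c k (i1 k y \<oplus>\<^bsub>P k\<^esub> i2 k z)"
   using dec[OF x] y z i1D(1) i2D(1) by (simp add: cD cmorD(3)[OF i1] cmorD(3)[OF i2])
  then show "\<exists>y\<in>U (P k). x = c k y"
   using i1D(1)[OF y(1)] i2D(1)[OF z(1)] PD(2)[of k] by (intro bexI[of _ "i1 k y \<oplus>\<^bsub>P k\<^esub> i2 k z"]) simp_all
 qed
 moreover have "holonomy u P c 0" unfolding holonomy_def
 proof (intro allI impI)
  fix x assume x: "chain P c S1 x"
  let ?z = "x n \<ominus>\<^bsub>P S1\<^esub> u \<odot>\<^bsub>P S1\<^esub> x 0"
  have m: "x 0 \<in> U (P S1)" "x n \<in> U (P S1)"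
   using chainD(1)[OF x, of 0] chainD(1)[OF x, of n] PD(8) by simp_all
  then have mem: "?z \<in> U (P S1)" using u PD(2) by simp
  have "i1 S1 (p1 S1 ?z) \<in> bnd P c 0" "i2 S1 (p2 S1 ?z) \<in> bnd P c 0"
   using bnd_cmor[OF M(1) P i1 holonomy_cmor[OF P M(1) p1 u M(4) x]]
    bnd_cmor[OF N(1) P i2 holonomy_cmor[OF P N(1) p2 u N(4) x]] .
  then show "?z \<in> bnd P c 0" using dec[OF mem] bndD(4)[OF P] by metis
 qed
 ultimately show ?thesis using P by (simp add: in_class_def)
qed

lemma in_class_contractible:
 assumes M: "cseq M a" and nc: "null_composites M a" and \<theta>: "contraction M a \<theta>" and u: "u \<in> U R"
 shows "in_class u M a"
proof -
 note MD = cseqD[OF M] and aD = homD[OF cseqD(3)[OF M]]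
 have \<theta>h: "\<theta> i \<in> Lin (M (Suc i)) (M i)" and
  \<theta>e: "\<And>x. x \<in> U (M (Suc i)) ==> x = \<theta> (Suc i) (a (Suc i) x) \<oplus>\<^bsub>M (Suc i)\<^esub> a i (\<theta> i x)" for i
  using \<theta> by (auto simp: contraction_def)
 note \<theta>D = homD[OF \<theta>h]
 have ex: "exact_seq M a" unfolding exact_seq_def
 proof (intro allI ballI impI)
  fix i x assume x: "x \<in> U (M (Suc i))" and e: "a (Suc i) x = \<zero>\<^bsub>M (Suc (Suc i))\<^esub>"
  have "x = a i (\<theta> i x)"
   using \<theta>e[OF x] e MD(2) aD(1)[OF \<theta>D(1)[OF x]] by (simp add: \<theta>D(4) mod_l_zero)
  then show "\<exists>y\<in>U (M i). x = a i y" using \<theta>D(1)[OF x] by blast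
 qed
 have cyc: "x \<in> bnd M a i" if x: "x \<in> U (M (Suc i))" "y \<in> U (M (Suc (Suc i)))"
  and e: "a (Suc i) x = p \<odot>\<^bsub>M (Suc (Suc i))\<^esub> y" for i x y
 proof -
  have "x = p \<odot>\<^bsub>M (Suc i)\<^esub> \<theta> (Suc i) y \<oplus>\<^bsub>M (Suc i)\<^esub> a i (\<theta> i x)"
   using \<theta>e[OF x(1)] e x(2) by (simp add: \<theta>D)
  then show ?thesis
   using bndD(4)[OF M bnd_p[OF M \<theta>D(1)[OF x(2)]] bnd_im[OF M \<theta>D(1)[OF x(1)]]] by simp
 qed
 have "holonomy u M a 0" unfolding holonomy_def
 proof (intro allI impI)
  fix x assume x: "chain M a S1 x"
  note m = chain_first[OF x]
  have xn: "x n \<in> U (M S1)" using chainD(1)[OF x, of n] MD(8) by simp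
  obtain y where y: "y \<in> U (M S2)" "a S1 (x n) = p \<odot>\<^bsub>M S2\<^esub> y"
   using chain_end[OF M nc x] .
  have "x n \<in> bnd M a 0" "x 0 \<in> bnd M a 0" using cyc[OF xn y] cyc[OF m] by auto
  then show "x n \<ominus>\<^bsub>M S1\<^esub> u \<odot>\<^bsub>M S1\<^esub> x 0 \<in> bnd M a 0"
   using bndD(5)[OF M u] bndD(6)[OF M] by blast
 qed
 then show ?thesis using M nc ex by (simp add: in_class_def)
qed

definition fp :: "'a => ('a, 'm) module => nat => 'm => 'm"
 where "fp u F i = (\<lambda>x\<in>U F. (if cyc i = 1 then u \<otimes> p else p) \<odot>\<^bsub>F\<^esub> x)"

lemma Fp_seq_eq: "Fp_seq R n p u F = mk (\<lambda>_. F) (fp u F)"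
 unfolding Fp_seq_mk by (simp add: fp_def[abs_def])

lemma fp_cseq: "u \<in> U R ==> Free F ==> cseq (\<lambda>_. F) (fp u F)"
 using Fp_cseq by (simp add: fp_def[abs_def])

lemma fp_first: "x \<in> U F ==> module R F ==> u \<in> U R ==> fp u F S1 x = u \<odot>\<^bsub>F\<^esub> (p \<odot>\<^bsub>F\<^esub> x)"
 using n_ge by (simp add: fp_def cyc_index_self mod_smult_assoc)

lemma fp_other: "x \<in> U F ==> i \<in> {2..n} ==> fp u F i x = p \<odot>\<^bsub>F\<^esub> x"
 by (simp add: fp_def cyc_index_self)

lemma in_class_fp:
 assumes u: "u \<in> Units R" and F: "Free F"
 shows "in_class u (\<lambda>_. F) (fp u F)"
proof -
 have uR: "u \<in> U R" using u by auto
 note FM = fg_freeD[OF F]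
 note c = fp_cseq[OF uR F]
 have val: "\<exists>r\<in>Units R. \<forall>x\<in>U F. fp u F i x = r \<odot>\<^bsub>F\<^esub> (p \<odot>\<^bsub>F\<^esub> x)" for i
 proof (cases "cyc i = 1")
  case True
  then show ?thesis using u uR FM by (intro bexI[of _ u]) (auto simp: fp_def mod_smult_assoc)
 next
  case False
  then show ?thesis using FM by (intro bexI[of _ \<one>]) (auto simp: fp_def mod_smult_one)
 qed
 have "null_composites (\<lambda>_. F) (fp u F)" unfolding null_composites_def
 proof (intro allI ballI)
  fix i x assume x: "x \<in> U F"
  obtain r where r: "r \<in> Units R" "\<forall>x\<in>U F. fp u F i x = r \<odot>\<^bsub>F\<^esub> (p \<odot>\<^bsub>F\<^esub> x)" using val by blast
  obtain s where s: "s \<in> Units R" "\<forall>x\<in>U F. fp u F (Suc i) x = s \<odot>\<^bsub>F\<^esub> (p \<odot>\<^bsub>F\<^esub> x)" using val by blast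
  have "fp u F (Suc i) (fp u F i x) = s \<odot>\<^bsub>F\<^esub> (p \<odot>\<^bsub>F\<^esub> (r \<odot>\<^bsub>F\<^esub> (p \<odot>\<^bsub>F\<^esub> x)))" using x r s Units_closed FM by simp
  also have "\<dots> = \<zero>\<^bsub>F\<^esub>" using x r s Units_closed FM by (simp add: mod_scale_comm[of F p r])
  finally show "fp u F (Suc i) (fp u F i x) = \<zero>\<^bsub>F\<^esub>" .
 qed
 moreover have "exact_seq (\<lambda>_. F) (fp u F)" unfolding exact_seq_def
 proof (intro allI ballI impI)
  fix i x assume x: "x \<in> U F" and e: "fp u F (Suc i) x = \<zero>\<^bsub>F\<^esub>"
  obtain r where r: "r \<in> Units R" "\<forall>x\<in>U F. fp u F i x = r \<odot>\<^bsub>F\<^esub> (p \<odot>\<^bsub>F\<^esub> x)" using val by blast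
  obtain s where s: "s \<in> Units R" "\<forall>x\<in>U F. fp u F (Suc i) x = s \<odot>\<^bsub>F\<^esub> (p \<odot>\<^bsub>F\<^esub> x)" using val by blast
  have "p \<odot>\<^bsub>F\<^esub> x = inv s \<odot>\<^bsub>F\<^esub> (s \<odot>\<^bsub>F\<^esub> (p \<odot>\<^bsub>F\<^esub> x))"
   using s x FM Units_closed by (simp add: mod_smult_assoc[symmetric] m_assoc[symmetric])
  also have "\<dots> = \<zero>\<^bsub>F\<^esub>" using e s x FM by simp
  finally obtain y where y: "y \<in> U F" "x = p \<odot>\<^bsub>F\<^esub> y" using p_annihilated[OF F x] by blast
  have "x = r \<odot>\<^bsub>F\<^esub> (p \<odot>\<^bsub>F\<^esub> (inv r \<odot>\<^bsub>F\<^esub> y))"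
   using r y FM Units_closed by (simp add: mod_scale_comm[of F p "inv r"]) (simp add: mod_smult_assoc[symmetric] m_assoc[symmetric])
  then show "\<exists>y\<in>U F. x = fp u F i y" using r y FM by (intro bexI[of _ "inv r \<odot>\<^bsub>F\<^esub> y"]) auto
 qed
 moreover have "holonomy u (\<lambda>_. F) (fp u F) 0" unfolding holonomy_def
 proof (intro allI impI)
  fix x assume x: "chain (\<lambda>_. F) (fp u F) S1 x"
  have m: "x j \<in> U F" if "j \<le> n" for j using x that by (auto simp: chain_def)
  have st: "fp u F (Suc j) (x j) = p \<odot>\<^bsub>F\<^esub> x (Suc j)" if "j < n" for j using x that by (auto simp: chain_def)
  have "p \<odot>\<^bsub>F\<^esub> x (Suc j) = u \<odot>\<^bsub>F\<^esub> (p \<odot>\<^bsub>F\<^esub> x 0)" if "j < n" for j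
   using that
  proof (induction j)
   case 0
   then show ?case using st[of 0] fp_first[OF m[of 0] FM uR] by simp
  next
   case (Suc j)
   then show ?case using st[of "Suc j"] fp_other[OF m[of "Suc j"], of "Suc (Suc j)" u] by simp
  qed
  from this[of "n - 1"] have "p \<odot>\<^bsub>F\<^esub> x n = u \<odot>\<^bsub>F\<^esub> (p \<odot>\<^bsub>F\<^esub> x 0)" using n_ge by simp
  then have "p \<odot>\<^bsub>F\<^esub> (x n \<ominus>\<^bsub>F\<^esub> u \<odot>\<^bsub>F\<^esub> x 0) = \<zero>\<^bsub>F\<^esub>"
   using m[of n] m[of 0] FM uR by (simp add: mod_norm mod_scale_comm[of F p u])
  then obtain w where "w \<in> U F" "x n \<ominus>\<^bsub>F\<^esub> u \<odot>\<^bsub>F\<^esub> x 0 = p \<odot>\<^bsub>F\<^esub> w"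
   using p_annihilated[OF F] m[of n] m[of 0] FM uR by (metis mod_closed(4,5) le_refl zero_le)
  then show "x n \<ominus>\<^bsub>F\<^esub> u \<odot>\<^bsub>F\<^esub> x 0 \<in> bnd (\<lambda>_. F) (fp u F) 0" using bnd_p[OF c] by simp
 qed
 ultimately show ?thesis using c by (simp add: in_class_def)
qed

end

section \<open>Deformation onto a minimal sequence\<close>

context angulation_setting
begin

text \<open>
 Maps given on one period and compatible around the corner extend to a periodic morphism.
\<close>

lemma cmor_from_fundamental_domain:
 assumes M: "cseq M a" and N: "cseq N b"
  and f: "\<And>m. m \<in> {1..n} ==> f m \<in> Lin (M m) (N m)"
  and sq: "\<And>m x. m \<in> {1..n} ==> m < n ==> x \<in> U (M m) ==> f (Suc m) (a m x) = b m (f m x)"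
  and last: "\<And>x. x \<in> U (M n) ==> f 1 (a n x) = b n (f n x)"
 shows "cmor M a N b (\<lambda>m. f (cyc m))"
proof -
 define g where "g m = f (cyc m)" for m
 have per: "g (m + n) = g m" for m by (simp add: g_def)
 have g: "g m = f m" if "m \<in> {1..n}" for m using that by (simp add: g_def cyc_index_self)
 have "g (Suc n) = f 1" using per[of 1] g[of 1] n_ge by simp
 then have gS: "g (Suc m) = (if m < n then f (Suc m) else f 1)" if "m \<in> {1..n}" for m
  using that g[of "Suc m"] by (cases "m = n") auto
 have "cmor M a N b g" unfolding cmor_def
 proof (rule allI, rule all_periodic)
  fix i
  note pc = periodic_cyc_index[of n _ i] and pS = periodic_cyc_index_Suc(1)[of n _ i]
  show "(g (cyc i) \<in> Lin (M (cyc i)) (N (cyc i)) \<and>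
    g (cyc i + n) = g (cyc i) \<and>
    (\<forall>x\<in>U (M (cyc i)). g (Suc (cyc i)) (a (cyc i) x) = b (cyc i) (g (cyc i) x))) =
   (g i \<in> Lin (M i) (N i) \<and> g (i + n) = g i \<and>
    (\<forall>x\<in>U (M i). g (Suc i) (a i x) = b i (g i x)))"
   using pc[of g] pc[of M] pc[of N] pc[of a] pc[of b] pS[of g] per cseqD(4,5)[OF M] cseqD(4,5)[OF N] by simp
 next
  fix i assume i: "i \<in> {1..n}"
  then show "g i \<in> Lin (M i) (N i) \<and> g (i + n) = g i \<and>
    (\<forall>x\<in>U (M i). g (Suc i) (a i x) = b i (g i x))"
   using f[OF i] sq[OF i] last per[of i] unfolding g[OF i] gS[OF i] by (cases "i = n") auto
 qed
 then show ?thesis by (simp add: g_def[abs_def])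
qed

lemma idempotent_image_free:
 fixes A :: "('a, 'm) module"
 assumes A: "Free A" and e: "e \<in> Lin A A" and idem: "\<And>x. x \<in> U A ==> e (e x) = e x"
 defines "F \<equiv> A\<lparr>carrier := {a \<in> U A. e a = a}\<rparr>"
 shows "Free F" and "(\<lambda>x\<in>U F. x) \<in> Lin F A" and "(\<lambda>x\<in>U A. e x) \<in> Lin A F"
proof -
 note AM = fg_freeD[OF A] and eD = homD[OF e]
 define X where "X = A\<lparr>carrier := {a \<in> U A. e a = \<zero>\<^bsub>A\<^esub>}\<rparr>"
 have Xc: "U X = {a \<in> U A. e a = \<zero>\<^bsub>A\<^esub>}" and Xop: "add X = add A" "smult X = smult A" "zero X = zero A"
  by (simp_all add: X_def)
 have "submodule {a \<in> U A. e a = \<zero>\<^bsub>A\<^esub>} R A"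
  using AM by (intro submodI) (auto simp: eD mod_norm)
 then have X: "module R X" unfolding X_def by (rule submodule.submodule_is_module[OF _ AM])
 have s: "(\<lambda>x\<in>U X. x) \<in> Lin X A"
  using X by (intro homI) (auto simp: Xc Xop)
 have r: "(\<lambda>x\<in>U A. x \<ominus>\<^bsub>A\<^esub> e x) \<in> Lin A X"
 proof (rule homI)
  fix x assume "x \<in> U A"
  then show "x \<ominus>\<^bsub>A\<^esub> e x \<in> U X" using AM by (simp add: Xc eD idem) (simp add: mod_norm eD)
 next
  fix x y assume "x \<in> U A" "y \<in> U A"
  then show "(x \<oplus>\<^bsub>A\<^esub> y) \<ominus>\<^bsub>A\<^esub> e (x \<oplus>\<^bsub>A\<^esub> y) = (x \<ominus>\<^bsub>A\<^esub> e x) \<oplus>\<^bsub>X\<^esub> (y \<ominus>\<^bsub>A\<^esub> e y)"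
   using AM by (simp add: Xop eD) (simp add: mod_norm eD)
 next
  fix c x assume "c \<in> U R" "x \<in> U A"
  then show "c \<odot>\<^bsub>A\<^esub> x \<ominus>\<^bsub>A\<^esub> e (c \<odot>\<^bsub>A\<^esub> x) = c \<odot>\<^bsub>X\<^esub> (x \<ominus>\<^bsub>A\<^esub> e x)"
   using AM by (simp add: Xop eD) (simp add: mod_norm eD)
 qed (rule AM)
 have eq: "{a \<in> U A. (\<lambda>x\<in>U A. x \<ominus>\<^bsub>A\<^esub> e x) a = \<zero>\<^bsub>X\<^esub>} = {a \<in> U A. e a = a}"
 proof -
  have "x \<ominus>\<^bsub>A\<^esub> e x = \<zero>\<^bsub>A\<^esub> \<longleftrightarrow> e x = x" if x: "x \<in> U A" for x
   using mod_eq_sub_iff[OF AM x eD(1)[OF x], of "\<zero>\<^bsub>A\<^esub>"] AM eD(1)[OF x] by (auto simp: mod_r_zero)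
  then show ?thesis by (auto simp: Xop)
 qed
 have "(\<lambda>x\<in>U A. x \<ominus>\<^bsub>A\<^esub> e x) ((\<lambda>x\<in>U X. x) x) = x" if "x \<in> U X" for x
  using that AM by (simp add: Xc mod_norm)
 from retract_complement(1)[OF A X s r this] show F: "Free F"
  unfolding eq F_def by simp
 show "(\<lambda>x\<in>U F. x) \<in> Lin F A"
  using fg_freeD[OF F] by (intro homI) (auto simp: F_def)
 show "(\<lambda>x\<in>U A. e x) \<in> Lin A F"
  using AM by (intro homI) (auto simp: F_def eD idem)
qed

text \<open>
 A deformation retraction of \<open>(M, a)\<close> onto the minimal sequence \<open>F(p)\<close>: \<open>q \<circ> i = id\<close>, and the
 homotopy \<open>\<theta>\<close> joins \<open>i \<circ> q\<close> to the identity.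
\<close>

definition sdr :: "'a => (nat => ('a, 'm) module) => (nat => 'm => 'm) => ('a, 'm) module =>
  (nat => 'm => 'm) => (nat => 'm => 'm) => (nat => 'm => 'm) => bool"
 where "sdr u M a F i q \<theta> \<longleftrightarrow> Free F \<and> cmor (\<lambda>_. F) (fp u F) M a i \<and> cmor M a (\<lambda>_. F) (fp u F) q \<and>
  (\<forall>k. \<forall>x\<in>U F. q k (i k x) = x) \<and>
  (\<forall>k. \<theta> k \<in> Lin (M (Suc k)) (M k) \<and> \<theta> (k + n) = \<theta> k \<and>
   (\<forall>y\<in>U (M (Suc k)). y = i (Suc k) (q (Suc k) y) \<oplus>\<^bsub>M (Suc k)\<^esub>
    (\<theta> (Suc k) (a (Suc k) y) \<oplus>\<^bsub>M (Suc k)\<^esub> a k (\<theta> k y))))"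

lemma periodic_choice:
 assumes "\<And>i. \<exists>x. P i x" "\<And>i. P (i + n) = P i"
 obtains f where "\<And>i. P i (f i)" "\<And>i. f (i + n) = f i"
proof -
 obtain g where g: "\<And>i. P i (g i)" using assms(1) by metis
 have "P i (g (cyc i))" for i
  using g[of "cyc i"] periodic_cyc_index[of n P i] assms(2) by simp
 then show thesis using that[of "\<lambda>i. g (cyc i)"] by simp
qed

text \<open>
 Choose generalized inverses \<open>h\<close> of the differentials modulo \<open>p\<close>. The projections \<open>\<pi>\<close> onto the
 complement of \<open>im h \<oplus> im (a h)\<close> commute with the differentials, and on their images the
 differentials are multiples of \<open>p\<close>. Division by \<open>p\<close> gives maps \<open>T\<^sub>k\<close> from the image \<open>F\<close> of the
 first projection to the other images, which exactness makes bijective. After one round the map is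
 multiplication by \<open>u\<close> modulo \<open>p\<close>, by the holonomy; this accounts for the factor \<open>u\<close> in \<open>F(p)\<close>.
\<close>

lemma sdr_exists:
 assumes c: "in_class u M a" and u: "u \<in> Units R"
 obtains F i q \<theta> where "sdr u M a F i q \<theta>"
proof -
 have M: "cseq M a" and nc: "null_composites M a" and ex: "exact_seq M a" and hol: "holonomy u M a 0"
  using c by (auto simp: in_class_def)
 note MD = cseqD[OF M] and aD = homD[OF cseqD(3)[OF M]] and ncD = null_compositesD[OF nc]
 have uR: "u \<in> U R" using u by auto
 \<comment> \<open>Generalized inverses of the differentials modulo \<open>p\<close>.\<close>
 let ?P = "\<lambda>k h. h \<in> Lin (M (Suc k)) (M k) \<and> (\<forall>y\<in>U (M (Suc k)). h (a k (h y)) = h y) \<and>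
   (\<forall>x\<in>U (M k). a k x \<ominus>\<^bsub>M (Suc k)\<^esub> a k (h (a k x)) \<in> multiples p (M (Suc k)))"
 have P_ex: "\<exists>h. ?P k h" for k
 proof -
  obtain X s t where X: "Free X" "s \<in> Lin X (M k)" "t \<in> Lin (M (Suc k)) X"
   "\<And>x. x \<in> U X ==> t (a k (s x)) = x"
   "\<And>x. x \<in> U (M k) ==> a k x \<ominus>\<^bsub>M (Suc k)\<^esub> a k (s (t (a k x))) \<in> multiples p (M (Suc k))"
   by (rule rank_factorization[OF MD(1) MD(1) MD(3), of k]) blast
  have "(\<lambda>y\<in>U (M (Suc k)). s (t y)) \<in> Lin (M (Suc k)) (M k)"
   using hom_comp[OF MD(2) X(3,2)] .
  then show ?thesis using X(4,5) aD(1) hom_closed[OF X(2)] hom_closed[OF X(3)]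
   by (intro exI[of _ "\<lambda>y\<in>U (M (Suc k)). s (t y)"]) simp
 qed
 have P_per: "?P (k + n) = ?P k" for k by (simp add: MD(4,5,6))
 obtain h where h: "\<And>k. ?P k (h k)" and h_per: "\<And>k. h (k + n) = h k"
  using periodic_choice[of ?P, OF P_ex P_per] by blast
 have hh: "h k \<in> Lin (M (Suc k)) (M k)" for k using h by blast
 note hD = homD[OF hh]
 have hah: "h k (a k (h k y)) = h k y" if "y \<in> U (M (Suc k))" for k y using h that by blast
 have aha: "a k x \<ominus>\<^bsub>M (Suc k)\<^esub> a k (h k (a k x)) \<in> multiples p (M (Suc k))" if "x \<in> U (M k)" for k x using h that by blast
 define g where "g k y = y \<ominus>\<^bsub>M (Suc k)\<^esub> h (Suc k) (a (Suc k) y)" for k y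
 define \<theta> where "\<theta> k = (\<lambda>y\<in>U (M (Suc k)). h k (g k y))" for k
 define \<pi> where "\<pi> k = (\<lambda>y\<in>U (M (Suc k)). g k y \<ominus>\<^bsub>M (Suc k)\<^esub> a k (h k (g k y)))" for k
 have M_per: "M (Suc (Suc (k + n))) = M (Suc (Suc k))" "a (Suc (k + n)) = a (Suc k)" "h (Suc (k + n)) = h (Suc k)" for k
  using MD(4)[of "Suc (Suc k)"] MD(5)[of "Suc k"] h_per[of "Suc k"] by simp_all
 have per: "g (k + n) = g k" "\<theta> (k + n) = \<theta> k" "\<pi> (k + n) = \<pi> k" for k
  using MD(4,5,6) h_per M_per by (auto simp: g_def \<theta>_def \<pi>_def fun_eq_iff)
 have ha: "h (Suc k) (a (Suc k) y) \<in> U (M (Suc k))" if "y \<in> U (M (Suc k))" for k y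
  using that aD(1) hD(1) by simp
 have gc: "g k y \<in> U (M (Suc k))" if "y \<in> U (M (Suc k))" for k y
  using ha[OF that] that MD(2) by (simp add: g_def)
 have g_hom: "(\<lambda>y\<in>U (M (Suc k)). g k y) \<in> Lin (M (Suc k)) (M (Suc k))" for k
  unfolding g_def
 proof (rule homI)
  fix x y assume xy: "x \<in> U (M (Suc k))" "y \<in> U (M (Suc k))"
  then show "x \<oplus>\<^bsub>M (Suc k)\<^esub> y \<ominus>\<^bsub>M (Suc k)\<^esub> h (Suc k) (a (Suc k) (x \<oplus>\<^bsub>M (Suc k)\<^esub> y)) =
   x \<ominus>\<^bsub>M (Suc k)\<^esub> h (Suc k) (a (Suc k) x) \<oplus>\<^bsub>M (Suc k)\<^esub> (y \<ominus>\<^bsub>M (Suc k)\<^esub> h (Suc k) (a (Suc k) y))"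
   using MD(2) by (simp add: aD hD) (simp add: mod_norm ha)
 next
  fix r x assume "r \<in> U R" "x \<in> U (M (Suc k))"
  then show "r \<odot>\<^bsub>M (Suc k)\<^esub> x \<ominus>\<^bsub>M (Suc k)\<^esub> h (Suc k) (a (Suc k) (r \<odot>\<^bsub>M (Suc k)\<^esub> x)) =
    r \<odot>\<^bsub>M (Suc k)\<^esub> (x \<ominus>\<^bsub>M (Suc k)\<^esub> h (Suc k) (a (Suc k) x))"
   using MD(2) by (simp add: aD hD) (simp add: mod_norm ha)
 qed (use ha MD(2) in auto)
 have \<theta>h: "\<theta> k \<in> Lin (M (Suc k)) (M k)" for k
  using hom_comp[OF MD(2) g_hom hh, of k] by (simp add: \<theta>_def cong: restrict_cong)
 have \<pi>h: "\<pi> k \<in> Lin (M (Suc k)) (M (Suc k))" for k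
  using hom_diff[OF MD(2) MD(2) g_hom hom_comp[OF MD(2) \<theta>h MD(3)], of k]
  by (simp add: \<theta>_def \<pi>_def cong: restrict_cong)
 note \<theta>D = homD[OF \<theta>h] and \<pi>D = homD[OF \<pi>h]
 have \<theta>a: "\<theta> (Suc k) (a (Suc k) y) = h (Suc k) (a (Suc k) y)" if y: "y \<in> U (M (Suc k))" for k y
 proof -
  have "g (Suc k) (a (Suc k) y) = a (Suc k) y"
   using y MD(2) aD(1) by (simp add: g_def ncD hD(4)) (simp add: mod_norm aD(1))
  then show ?thesis using y aD(1) by (simp add: \<theta>_def)
 qed
 have decomp: "y = \<pi> k y \<oplus>\<^bsub>M (Suc k)\<^esub> (\<theta> (Suc k) (a (Suc k) y) \<oplus>\<^bsub>M (Suc k)\<^esub> a k (\<theta> k y))"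
  if y: "y \<in> U (M (Suc k))" for k y
 proof -
  define H where "H = h (Suc k) (a (Suc k) y)"
  define T where "T = a k (h k (g k y))"
  have m: "H \<in> U (M (Suc k))" "T \<in> U (M (Suc k))"
   using y ha gc hD(1) aD(1) by (simp_all add: H_def T_def)
  have "\<pi> k y = (y \<ominus>\<^bsub>M (Suc k)\<^esub> H) \<ominus>\<^bsub>M (Suc k)\<^esub> T" "\<theta> (Suc k) (a (Suc k) y) = H" "a k (\<theta> k y) = T"
   using y by (simp_all add: \<pi>_def \<theta>a H_def T_def g_def \<theta>_def[of k])
  moreover have "y = ((y \<ominus>\<^bsub>M (Suc k)\<^esub> H) \<ominus>\<^bsub>M (Suc k)\<^esub> T) \<oplus>\<^bsub>M (Suc k)\<^esub> (H \<oplus>\<^bsub>M (Suc k)\<^esub> T)"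
  proof -
   have "module R (M (Suc k))" by (rule MD(2))
   then show ?thesis using y m by algebra
  qed
  ultimately show ?thesis by simp
 qed
 have a\<pi>: "a (Suc k) (\<pi> k y) = a (Suc k) y \<ominus>\<^bsub>M (Suc (Suc k))\<^esub> a (Suc k) (h (Suc k) (a (Suc k) y))"
  if y: "y \<in> U (M (Suc k))" for k y
 proof -
  have ag: "a (Suc k) (g k y) \<in> U (M (Suc (Suc k)))" using aD(1) gc[OF y] .
  have "a (Suc k) (\<pi> k y) = a (Suc k) (g k y) \<ominus>\<^bsub>M (Suc (Suc k))\<^esub> \<zero>\<^bsub>M (Suc (Suc k))\<^esub>"
   using y gc[OF y] hD(1) MD(2) aD(1) by (simp add: \<pi>_def aD(6) ncD)
  also have "\<dots> = a (Suc k) (g k y)" using ag MD(2) by (simp add: mod_norm)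
  also have "\<dots> = a (Suc k) y \<ominus>\<^bsub>M (Suc (Suc k))\<^esub> a (Suc k) (h (Suc k) (a (Suc k) y))"
   using y ha[OF y] MD(2) by (simp add: g_def aD(6))
  finally show ?thesis .
 qed
 have \<pi>a: "\<pi> k (a k x) = a k x \<ominus>\<^bsub>M (Suc k)\<^esub> a k (h k (a k x))" if x: "x \<in> U (M k)" for k x
 proof -
  have "g k (a k x) = a k x"
   using x MD(2) aD(1) by (simp add: g_def ncD hD(4)) (simp add: mod_norm aD(1))
  then show ?thesis using x aD(1) by (simp add: \<pi>_def)
 qed
 have comm: "\<pi> (Suc k) (a (Suc k) y) = a (Suc k) (\<pi> k y)" if "y \<in> U (M (Suc k))" for k y
  using that by (simp add: a\<pi> \<pi>a)
 have a\<pi>p: "a (Suc k) (\<pi> k y) \<in> multiples p (M (Suc (Suc k)))" if "y \<in> U (M (Suc k))" for k y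
  using that aha by (simp add: a\<pi>)
 have \<pi>ap: "\<pi> k (a k x) \<in> multiples p (M (Suc k))" if "x \<in> U (M k)" for k x
  using that aha by (simp add: \<pi>a)
 have idem: "\<pi> k (\<pi> k y) = \<pi> k y" if y: "y \<in> U (M (Suc k))" for k y
 proof -
  have py: "\<pi> k y \<in> U (M (Suc k))" using \<pi>D(1) y .
  have "h (Suc k) (a (Suc k) (\<pi> k y)) = \<zero>\<^bsub>M (Suc k)\<^esub>"
   using y aD(1) ha MD(2) by (simp add: a\<pi> hD(6) hah) (simp add: mod_norm ha)
  then have gp: "g k (\<pi> k y) = \<pi> k y" using py MD(2) by (simp add: g_def mod_norm)
  have "h k (\<pi> k y) = \<zero>\<^bsub>M k\<^esub>"
   using y gc[OF y] hD(1) aD(1) MD(2) by (simp add: \<pi>_def hD(6) hah) (simp add: mod_norm hD(1))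
  then have "g k (\<pi> k y) \<ominus>\<^bsub>M (Suc k)\<^esub> a k (h k (g k (\<pi> k y))) = \<pi> k y"
   using py MD(2) by (simp add: gp aD(4) mod_norm)
  then show ?thesis using py by (simp add: \<pi>_def[of k])
 qed
 \<comment> \<open>The minimal part at position 1.\<close>
 define F where "F = M S1\<lparr>carrier := {y \<in> U (M S1). \<pi> 0 y = y}\<rparr>"
 have F: "Free F" and incl: "(\<lambda>x\<in>U F. x) \<in> Lin F (M S1)"
  and projF: "(\<lambda>x\<in>U (M S1). \<pi> 0 x) \<in> Lin (M S1) F"
  using idempotent_image_free[OF MD(1) \<pi>h idem] unfolding F_def by auto
 note FM = fg_freeD[OF F]
 have Fc: "U F = {y \<in> U (M S1). \<pi> 0 y = y}" and Fop: "smult F = smult (M S1)"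
  by (simp_all add: F_def)
 define Q where "Q k T \<longleftrightarrow> T \<in> Lin F (M (Suc k)) \<and> (\<forall>x\<in>U F. \<pi> k (T x) = T x)" for k T
 have "\<exists>T. \<forall>k. (Q k (T k) \<and> (k = 0 \<longrightarrow> T k = (\<lambda>x\<in>U F. x))) \<and>
   (\<forall>x\<in>U F. a (Suc k) (T k x) = p \<odot>\<^bsub>M (Suc (Suc k))\<^esub> T (Suc k) x)"
 proof (rule dependent_nat_choice)
  show "\<exists>T. Q 0 T \<and> (0 = 0 \<longrightarrow> T = (\<lambda>x\<in>U F. x))"
   using incl by (auto simp: Q_def Fc)
  fix T k assume T: "Q k T \<and> (k = 0 \<longrightarrow> T = (\<lambda>x\<in>U F. x))"
  then have TH: "T \<in> Lin F (M (Suc k))" and Tpi: "\<And>x. x \<in> U F ==> \<pi> k (T x) = T x" by (auto simp: Q_def)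
  have aT: "(\<lambda>x\<in>U F. a (Suc k) (T x)) \<in> Lin F (M (Suc (Suc k)))" using hom_comp[OF FM TH MD(3)] .
  have "(\<lambda>x\<in>U F. a (Suc k) (T x)) x \<in> multiples p (M (Suc (Suc k)))" if x: "x \<in> U F" for x
   using a\<pi>p[OF hom_closed[OF TH x]] Tpi[OF x] x by simp
  then obtain T' where T': "T' \<in> Lin F (M (Suc (Suc k)))"
   "\<And>x. x \<in> U F ==> (\<lambda>x\<in>U F. a (Suc k) (T x)) x = p \<odot>\<^bsub>M (Suc (Suc k))\<^esub> T' x"
   using projective_scale[OF F MD(2) aT p_carr] by blast
  let ?T = "\<lambda>x\<in>U F. \<pi> (Suc k) (T' x)"
  have "Q (Suc k) ?T" unfolding Q_def using hom_comp[OF FM T'(1) \<pi>h] idem hom_closed[OF T'(1)] by auto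
  moreover have "a (Suc k) (T x) = p \<odot>\<^bsub>M (Suc (Suc k))\<^esub> ?T x" if x: "x \<in> U F" for x
  proof -
   have Tx: "T x \<in> U (M (Suc k))" using hom_closed[OF TH x] .
   have "a (Suc k) (T x) = \<pi> (Suc k) (a (Suc k) (T x))" using comm[OF Tx] Tpi[OF x] by simp
   also have "\<dots> = p \<odot>\<^bsub>M (Suc (Suc k))\<^esub> \<pi> (Suc k) (T' x)"
    using T'(2)[OF x] x hom_closed[OF T'(1) x] by (simp add: \<pi>D)
   finally show ?thesis using x by simp
  qed
  ultimately show "\<exists>T'. (Q (Suc k) T' \<and> (Suc k = 0 \<longrightarrow> T' = (\<lambda>x\<in>U F. x))) \<and>
   (\<forall>x\<in>U F. a (Suc k) (T x) = p \<odot>\<^bsub>M (Suc (Suc k))\<^esub> T' x)" by blast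
 qed
 then obtain T where TQ: "\<And>k. Q k (T k)" and T0: "T 0 = (\<lambda>x\<in>U F. x)"
  and aT: "\<And>k x. x \<in> U F ==> a (Suc k) (T k x) = p \<odot>\<^bsub>M (Suc (Suc k))\<^esub> T (Suc k) x" by blast
 have Th: "T k \<in> Lin F (M (Suc k))" and \<pi>T: "\<And>x. x \<in> U F ==> \<pi> k (T k x) = T k x" for k
  using TQ[of k] by (auto simp: Q_def)
 note TD = homD[OF Th]
 have Tp: "x \<in> multiples p F" if "x \<in> U F" "T k x \<in> multiples p (M (Suc k))" for k x
  using that
 proof (induction k)
  case 0
  then obtain w where w: "w \<in> U (M S1)" "x = p \<odot>\<^bsub>M S1\<^esub> w" by (auto simp: T0 multiples_def)
  have "x = \<pi> 0 x" using 0 by (simp add: Fc)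
  also have "\<dots> = p \<odot>\<^bsub>F\<^esub> \<pi> 0 w" using w by (simp add: \<pi>D Fop)
  finally show ?case using hom_closed[OF projF w(1)] w(1) by (auto simp: multiples_def)
 next
  case (Suc k)
  have Tx: "T k x \<in> U (M (Suc k))" using TD(1) Suc.prems by simp
  have "a (Suc k) (T k x) = \<zero>\<^bsub>M (Suc (Suc k))\<^esub>"
   using Suc.prems aT[OF Suc.prems(1)] MD(2) by (auto simp: multiples_def)
  then obtain v where v: "v \<in> U (M k)" "T k x = a k v" using exact_seqE[OF ex Tx] by blast
  then have "T k x \<in> multiples p (M (Suc k))" using \<pi>ap[OF v(1)] \<pi>T[OF Suc.prems(1), of k] by simp
  then show ?case using Suc by blast
 qed
 have Tinj: "x = y" if xy: "x \<in> U F" "y \<in> U F" "T k x = T k y" for k x y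
 proof -
  have "T k (x \<ominus>\<^bsub>F\<^esub> y) = \<zero>\<^bsub>M (Suc k)\<^esub>"
   using xy FM MD(2) TD(1) by (simp add: TD(6)) (simp add: mod_norm TD(1))
  then have "x \<ominus>\<^bsub>F\<^esub> y \<in> multiples p F"
   using Tp[of "x \<ominus>\<^bsub>F\<^esub> y" k] xy FM submodD(2)[OF MD(2) multiples_submodule[OF MD(2) p_carr]] by simp
  then obtain w where w: "w \<in> U F" "x \<ominus>\<^bsub>F\<^esub> y = p \<odot>\<^bsub>F\<^esub> w" by (auto simp: multiples_def)
  then have "p \<odot>\<^bsub>M (Suc k)\<^esub> T k w = \<zero>\<^bsub>M (Suc k)\<^esub>" using \<open>T k (x \<ominus>\<^bsub>F\<^esub> y) = \<zero>\<^bsub>M (Suc k)\<^esub>\<close> by (simp add: TD)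
  then have "T k w \<in> multiples p (M (Suc k))" using p_annihilated[OF MD(1) TD(1)[OF w(1)]] by (auto simp: multiples_def)
  then have "w \<in> multiples p F" using Tp w(1) by blast
  then have "x \<ominus>\<^bsub>F\<^esub> y = \<zero>\<^bsub>F\<^esub>" using w(2) FM by (auto simp: multiples_def)
  then show ?thesis using mod_eq_sub_iff[OF FM xy(1,2), of "\<zero>\<^bsub>F\<^esub>"] FM xy by (simp add: mod_r_zero)
 qed
 have Tsurj: "\<exists>x\<in>U F. y = T k x" if "y \<in> U (M (Suc k))" "\<pi> k y = y" for k y
  using that
 proof (induction k arbitrary: y)
  case 0
  then show ?case by (intro bexI[of _ y]) (auto simp: T0 Fc)
 next
  case (Suc k)
  let ?M = "M (Suc (Suc k))"
  \<comment> \<open>Surjectivity modulo \<open>p\<close>; applied twice it gives surjectivity.\<close>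
  have mod_p: "\<exists>x\<in>U F. \<exists>w\<in>U ?M. y = T (Suc k) x \<oplus>\<^bsub>?M\<^esub> p \<odot>\<^bsub>?M\<^esub> w \<and> \<pi> (Suc k) w = w"
   if y: "y \<in> U ?M" "\<pi> (Suc k) y = y" for y
  proof -
   have "a (Suc (Suc k)) (p \<odot>\<^bsub>?M\<^esub> y) = \<zero>\<^bsub>M (Suc (Suc (Suc k)))\<^esub>"
    using a\<pi>p[OF y(1)] y MD(2) by (auto simp: aD multiples_def)
   then obtain v where v: "v \<in> U (M (Suc k))" "p \<odot>\<^bsub>?M\<^esub> y = a (Suc k) v"
    using exact_seqE[OF ex] y(1) MD(2) by (metis mod_closed(5) p_carr)
   have "p \<odot>\<^bsub>?M\<^esub> y = \<pi> (Suc k) (p \<odot>\<^bsub>?M\<^esub> y)" using y by (simp add: \<pi>D)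
   also have "\<dots> = a (Suc k) (\<pi> k v)" using v comm by simp
   finally have py: "p \<odot>\<^bsub>?M\<^esub> y = a (Suc k) (\<pi> k v)" .
   obtain x where x: "x \<in> U F" "\<pi> k v = T k x"
    using Suc.IH[OF \<pi>D(1)[OF v(1)] idem[OF v(1)]] by blast
   have Tx: "T (Suc k) x \<in> U ?M" using TD(1) x(1) .
   have "p \<odot>\<^bsub>?M\<^esub> (y \<ominus>\<^bsub>?M\<^esub> T (Suc k) x) = \<zero>\<^bsub>?M\<^esub>"
    using py x aT[OF x(1), of k] y(1) Tx MD(2) by (simp add: mod_norm)
   then obtain w where w: "w \<in> U ?M" "y \<ominus>\<^bsub>?M\<^esub> T (Suc k) x = p \<odot>\<^bsub>?M\<^esub> w"
    using p_annihilated[OF MD(1)] y(1) Tx MD(2) by (metis mod_closed(4))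
   have "y \<ominus>\<^bsub>?M\<^esub> T (Suc k) x = \<pi> (Suc k) (y \<ominus>\<^bsub>?M\<^esub> T (Suc k) x)"
    using y Tx MD(2) \<pi>T[OF x(1), of "Suc k"] by (simp add: \<pi>D)
   also have "\<dots> = p \<odot>\<^bsub>?M\<^esub> \<pi> (Suc k) w" using w by (simp add: \<pi>D)
   finally have "y = T (Suc k) x \<oplus>\<^bsub>?M\<^esub> p \<odot>\<^bsub>?M\<^esub> \<pi> (Suc k) w"
    using y(1) Tx MD(2) \<pi>D(1)[OF w(1)] by (subst mod_eq_sub_iff) auto
   then show ?thesis using x(1) \<pi>D(1)[OF w(1)] idem[OF w(1)] by blast
  qed
  obtain x w where x: "x \<in> U F" "w \<in> U ?M" "y = T (Suc k) x \<oplus>\<^bsub>?M\<^esub> p \<odot>\<^bsub>?M\<^esub> w" "\<pi> (Suc k) w = w"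
   using mod_p[OF Suc.prems] by blast
  obtain x' w' where x': "x' \<in> U F" "w' \<in> U ?M" "w = T (Suc k) x' \<oplus>\<^bsub>?M\<^esub> p \<odot>\<^bsub>?M\<^esub> w'"
   using mod_p[OF x(2,4)] by blast
  have Tx': "T (Suc k) x' \<in> U ?M" using TD(1) x'(1) .
  have "p \<odot>\<^bsub>?M\<^esub> w = p \<odot>\<^bsub>?M\<^esub> T (Suc k) x'"
   unfolding x'(3) using Tx' x'(2) MD(2) by (simp add: mod_smult_radd mod_r_zero)
  then have "y = T (Suc k) (x \<oplus>\<^bsub>F\<^esub> p \<odot>\<^bsub>F\<^esub> x')" using x(1,3) x'(1) FM by (simp add: TD)
  then show ?case using x(1) x'(1) FM by (intro bexI[of _ "x \<oplus>\<^bsub>F\<^esub> p \<odot>\<^bsub>F\<^esub> x'"]) auto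
 qed
 \<comment> \<open>The holonomy of the minimal part is multiplication by \<open>u\<close>.\<close>
 have around: "p \<odot>\<^bsub>M S1\<^esub> T n x = u \<odot>\<^bsub>M S1\<^esub> (p \<odot>\<^bsub>M S1\<^esub> x)" if x: "x \<in> U F" for x
 proof -
  let ?M = "M S1"
  have "chain M a S1 (\<lambda>j. T j x)" unfolding chain_def using aT[OF x] TD(1)[OF x] by simp
  then have "T n x \<ominus>\<^bsub>?M\<^esub> u \<odot>\<^bsub>?M\<^esub> T 0 x \<in> bnd M a 0"
   using hol[unfolded holonomy_def, rule_format, of "\<lambda>j. T j x"] by simp
  then have b: "T n x \<ominus>\<^bsub>?M\<^esub> u \<odot>\<^bsub>?M\<^esub> x \<in> bnd M a 0" using x by (simp add: T0)
  have xM: "x \<in> U ?M" "\<pi> 0 x = x" using x by (auto simp: Fc)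
  have Tn: "T n x \<in> U ?M" "\<pi> 0 (T n x) = T n x"
   using TD(1)[OF x, of n] \<pi>T[OF x, of n] per(3)[of 0] MD(8) by simp_all
  obtain y w where y: "y \<in> U (M 0)" "w \<in> U ?M" "T n x \<ominus>\<^bsub>?M\<^esub> u \<odot>\<^bsub>?M\<^esub> x = a 0 y \<oplus>\<^bsub>?M\<^esub> p \<odot>\<^bsub>?M\<^esub> w"
   using b by (rule bndE)
  have "T n x \<ominus>\<^bsub>?M\<^esub> u \<odot>\<^bsub>?M\<^esub> x = \<pi> 0 (T n x \<ominus>\<^bsub>?M\<^esub> u \<odot>\<^bsub>?M\<^esub> x)"
   using Tn xM uR MD(2) by (simp add: \<pi>D)
  also have "\<dots> = \<pi> 0 (a 0 y) \<oplus>\<^bsub>?M\<^esub> p \<odot>\<^bsub>?M\<^esub> \<pi> 0 w" using y aD(1) MD(2) by (simp add: \<pi>D)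
  finally have "p \<odot>\<^bsub>?M\<^esub> (T n x \<ominus>\<^bsub>?M\<^esub> u \<odot>\<^bsub>?M\<^esub> x) = \<zero>\<^bsub>?M\<^esub>"
   using \<pi>ap[OF y(1)] \<pi>D(1)[OF y(2)] MD(2) by (auto simp: multiples_def mod_smult_radd mod_r_zero)
  then have "p \<odot>\<^bsub>?M\<^esub> T n x \<ominus>\<^bsub>?M\<^esub> p \<odot>\<^bsub>?M\<^esub> (u \<odot>\<^bsub>?M\<^esub> x) = \<zero>\<^bsub>?M\<^esub>"
   using Tn xM uR MD(2) by (simp add: mod_norm)
  then have "p \<odot>\<^bsub>?M\<^esub> T n x = p \<odot>\<^bsub>?M\<^esub> (u \<odot>\<^bsub>?M\<^esub> x) \<oplus>\<^bsub>?M\<^esub> \<zero>\<^bsub>?M\<^esub>"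
   using Tn xM uR MD(2) by (subst mod_eq_sub_iff) auto
  then show ?thesis using xM uR MD(2) by (simp add: mod_r_zero mod_scale_comm[of ?M p u])
 qed
 define I where "I m = (\<lambda>x\<in>U F. if m = 1 then u \<odot>\<^bsub>M m\<^esub> T (m - 1) x else T (m - 1) x)" for m
 have I1: "I S1 x = u \<odot>\<^bsub>M S1\<^esub> x" if "x \<in> U F" for x using that by (simp add: I_def T0)
 have I2: "I m x = T (m - 1) x" if "x \<in> U F" "m \<noteq> 1" for m x using that by (simp add: I_def)
 have Ih: "I m \<in> Lin F (M m)" if "m \<in> {1..n}" for m
 proof -
  have "M m = M (Suc (m - 1))" using that by simp
  then have T': "T (m - 1) \<in> Lin F (M m)" using Th[of "m - 1"] by simp
  have "(\<lambda>x\<in>U F. u \<odot>\<^bsub>M m\<^esub> T (m - 1) x) \<in> Lin F (M m)"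
   using hom_comp[OF FM T' hom_scale[OF MD(2) uR]] hom_closed[OF T'] by (simp cong: restrict_cong)
  moreover have "(\<lambda>x\<in>U F. T (m - 1) x) = T (m - 1)"
   using T' unfolding module_hom_def by (intro PiE_restrict) auto
  ultimately show ?thesis using T' by (cases "m = 1") (auto simp: I_def)
 qed
 have Ipi: "\<pi> (m - 1) (I m x) = I m x" if "m \<in> {1..n}" "x \<in> U F" for m x
  using that \<pi>T uR TD(1)[OF that(2), of "m - 1"] by (auto simp: I_def \<pi>D)
 have Ibij: "\<exists>!x. x \<in> U F \<and> y = I m x" if m: "m \<in> {1..n}" and y: "y \<in> U (M m)" "\<pi> (m - 1) y = y" for m y
 proof -
  have mm: "Suc (m - 1) = m" using m by simp
  show ?thesis
  proof (cases "m = 1")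
   case True
   have yF: "y \<in> U F" using y True by (simp add: Fc)
   have uF: "inv u \<odot>\<^bsub>F\<^esub> y \<in> U F" using yF u FM by simp
   have e: "y = I 1 (inv u \<odot>\<^bsub>F\<^esub> y)"
    using yF uF u uR FM by (simp add: I1 Fop[symmetric] mod_smult_assoc[symmetric] mod_smult_one)
   have "x = inv u \<odot>\<^bsub>F\<^esub> y" if "x \<in> U F" "y = I 1 x" for x
    using that u uR FM by (simp add: I1 Fop[symmetric] mod_smult_assoc[symmetric] mod_smult_one)
   then show ?thesis using True uF e by blast
  next
   case False
   obtain x where "x \<in> U F" "y = T (m - 1) x" using Tsurj[of y "m - 1"] y mm by auto
   then show ?thesis using Tinj I2 False by (intro ex1I[of _ x]) auto
  qed
 qed
 have i_mor: "cmor (\<lambda>_. F) (fp u F) M a (\<lambda>m. I (cyc m))"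
 proof (rule cmor_from_fundamental_domain[OF fp_cseq[OF uR F] M Ih])
  fix m x assume m: "m \<in> {1..n}" "m < n" and x: "x \<in> U F"
  show "I (Suc m) (fp u F m x) = a m (I m x)"
  proof (cases "m = 1")
   case True
   have xM: "x \<in> U (M S1)" using x by (simp add: Fc)
   have "I 2 (fp u F 1 x) = u \<odot>\<^bsub>M 2\<^esub> (p \<odot>\<^bsub>M 2\<^esub> T 1 x)"
    using x uR FM TD(1)[OF x, of 1] by (simp add: fp_first I2 TD numeral_2_eq_2)
   also have "\<dots> = a 1 (u \<odot>\<^bsub>M S1\<^esub> x)"
    using aT[OF x, of 0] x uR xM by (simp add: aD T0 numeral_2_eq_2)
   finally show ?thesis using True x by (simp add: I1 numeral_2_eq_2)
  next
   case False
   then obtain k where k: "m = Suc (Suc k)" using le_Suc_ex[of 2 m] m by auto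
   have "I (Suc m) (fp u F m x) = T m (p \<odot>\<^bsub>F\<^esub> x)" using x m False FM by (simp add: fp_other I2)
   also have "\<dots> = p \<odot>\<^bsub>M (Suc m)\<^esub> T m x" using x by (simp add: TD)
   also have "\<dots> = a m (T (Suc k) x)" using aT[OF x, of "Suc k"] k by simp
   finally show ?thesis using x False k by (simp add: I2)
  qed
 next
  fix x assume x: "x \<in> U F"
  obtain k where k: "n = Suc (Suc k)" using le_Suc_ex[of 2 n] n_ge by auto
  have xM: "x \<in> U (M S1)" using x by (simp add: Fc)
  have "I 1 (fp u F n x) = u \<odot>\<^bsub>M S1\<^esub> (p \<odot>\<^bsub>M S1\<^esub> x)"
   using x n_ge fp_other[OF x, of n u] mod_closed(5)[OF FM p_carr x] by (simp add: I1 Fop)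
  also have "\<dots> = p \<odot>\<^bsub>M (Suc n)\<^esub> T n x" using around[OF x] MD(8) by simp
  also have "\<dots> = a n (T (n - 1) x)" using aT[OF x, of "Suc k"] k by simp
  finally show "I 1 (fp u F n x) = a n (I n x)" using x n_ge by (simp add: I2)
 qed
 define q where "q m = (\<lambda>y\<in>U (M m). THE x. x \<in> U F \<and> \<pi> (m - 1) y = I m x)" for m
 have qv: "q m y \<in> U F \<and> \<pi> (m - 1) y = I m (q m y)" if m: "m \<in> {1..n}" and y: "y \<in> U (M m)" for m y
 proof -
  have mm: "Suc (m - 1) = m" using m by simp
  have "\<exists>!x. x \<in> U F \<and> \<pi> (m - 1) y = I m x"
   using Ibij[OF m, of "\<pi> (m - 1) y"] \<pi>D(1)[of y "m - 1"] idem[of y "m - 1"] y mm by simp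
  from theI'[OF this] show ?thesis unfolding q_def using y by (simp only: restrict_apply' if_True)
 qed
 have Iinj: "x = y" if "m \<in> {1..n}" "x \<in> U F" "y \<in> U F" "I m x = I m y" for m x y
 proof -
  have "\<exists>!z. z \<in> U F \<and> I m x = I m z"
   using Ibij[OF that(1) hom_closed[OF Ih[OF that(1)] that(2)] Ipi[OF that(1,2)]] .
  then obtain z where z: "\<And>w. w \<in> U F \<and> I m x = I m w ==> w = z" by (elim ex1E) blast
  have "x = z" by (rule z) (simp add: that(2))
  moreover have "y = z" by (rule z) (simp add: that(3,4))
  ultimately show ?thesis by simp
 qed
 have qI: "q m (I m x) = x" if m: "m \<in> {1..n}" and x: "x \<in> U F" for m x
  using qv[OF m hom_closed[OF Ih[OF m] x]] Iinj[OF m _ x] Ipi[OF m x] by simp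
 have qh: "q m \<in> Lin (M m) F" if m: "m \<in> {1..n}" for m
 proof -
  have mm: "Suc (m - 1) = m" using m by simp
  note ID = homD[OF Ih[OF m]] and pD = homD[OF \<pi>h[of "m - 1", unfolded mm]]
  have "(\<lambda>y\<in>U (M m). q m y) \<in> Lin (M m) F"
  proof (rule homI)
   fix x y assume xy: "x \<in> U (M m)" "y \<in> U (M m)"
   show "q m (x \<oplus>\<^bsub>M m\<^esub> y) = q m x \<oplus>\<^bsub>F\<^esub> q m y"
   proof (rule Iinj[OF m])
    note v = qv[OF m xy(1)] qv[OF m xy(2)] qv[OF m mod_closed(3)[OF MD(2) xy]]
    show "q m (x \<oplus>\<^bsub>M m\<^esub> y) \<in> U F" "q m x \<oplus>\<^bsub>F\<^esub> q m y \<in> U F" using v FM by auto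
    have "I m (q m (x \<oplus>\<^bsub>M m\<^esub> y)) = \<pi> (m - 1) (x \<oplus>\<^bsub>M m\<^esub> y)" using v(3) by simp
    also have "\<dots> = \<pi> (m - 1) x \<oplus>\<^bsub>M m\<^esub> \<pi> (m - 1) y" using pD(2)[OF xy] .
    also have "\<dots> = I m (q m x \<oplus>\<^bsub>F\<^esub> q m y)" using v(1,2) by (simp add: ID(2))
    finally show "I m (q m (x \<oplus>\<^bsub>M m\<^esub> y)) = I m (q m x \<oplus>\<^bsub>F\<^esub> q m y)" .
   qed
  next
   fix r x assume rx: "r \<in> U R" "x \<in> U (M m)"
   show "q m (r \<odot>\<^bsub>M m\<^esub> x) = r \<odot>\<^bsub>F\<^esub> q m x"
   proof (rule Iinj[OF m])
    note v = qv[OF m rx(2)] qv[OF m mod_closed(5)[OF MD(2) rx]]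
    show "q m (r \<odot>\<^bsub>M m\<^esub> x) \<in> U F" "r \<odot>\<^bsub>F\<^esub> q m x \<in> U F" using v FM rx by auto
    have "I m (q m (r \<odot>\<^bsub>M m\<^esub> x)) = \<pi> (m - 1) (r \<odot>\<^bsub>M m\<^esub> x)" using v(2) by simp
    also have "\<dots> = r \<odot>\<^bsub>M m\<^esub> \<pi> (m - 1) x" using pD(3)[OF rx] .
    also have "\<dots> = I m (r \<odot>\<^bsub>F\<^esub> q m x)" using v(1) rx by (simp add: ID(3))
    finally show "I m (q m (r \<odot>\<^bsub>M m\<^esub> x)) = I m (r \<odot>\<^bsub>F\<^esub> q m x)" .
   qed
  qed (use qv[OF m] MD(2) in auto)
  then show ?thesis by (simp add: q_def cong: restrict_cong)
 qed
 have fph: "fp u F m \<in> Lin F F" for m using cseqD(3)[OF fp_cseq[OF uR F]] .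
 have q_mor: "cmor M a (\<lambda>_. F) (fp u F) (\<lambda>m. q (cyc m))"
 proof (rule cmor_from_fundamental_domain[OF M fp_cseq[OF uR F] qh])
  fix m x assume m: "m \<in> {1..n}" "m < n" and x: "x \<in> U (M m)"
  obtain k where k: "m = Suc k" using m by (cases m) auto
  have ax: "a m x \<in> U (M (Suc m))" using aD(1) x .
  have Sm: "Suc m \<in> {1..n}" using m by simp
  have "I (Suc m) (q (Suc m) (a m x)) = \<pi> m (a m x)" using qv[OF Sm ax] by simp
  also have "\<dots> = a m (\<pi> (m - 1) x)" using comm[of x k] x k by simp
  also have "\<dots> = a m (I m (q m x))" using qv[OF m(1) x] by simp
  also have "\<dots> = I (Suc m) (fp u F m (q m x))"
   using cmorD(3)[OF i_mor, of "q m x" m] qv[OF m(1) x] m Sm by (simp add: cyc_index_self)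
  finally show "q (Suc m) (a m x) = fp u F m (q m x)"
   using Iinj[OF Sm] qv[OF Sm ax] hom_closed[OF fph] qv[OF m(1) x] by blast
 next
  fix x assume x: "x \<in> U (M n)"
  obtain k where k: "n = Suc k" using n_ge by (cases n) auto
  have n1: "n \<in> {1..n}" "(1::nat) \<in> {1..n}" using n_ge by auto
  have ax: "a n x \<in> U (M 1)" using aD(1)[OF x] MD(8) by simp
  have "I 1 (q 1 (a n x)) = \<pi> 0 (a n x)" using qv[OF n1(2) ax] by simp
  also have "\<dots> = \<pi> n (a n x)" using per(3)[of 0] by simp
  also have "\<dots> = a n (\<pi> (n - 1) x)" using comm[of x k] x k by simp
  also have "\<dots> = a n (I n (q n x))" using qv[OF n1(1) x] by simp
  also have "\<dots> = I 1 (fp u F n (q n x))"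
   using cmorD(3)[OF i_mor, of "q n x" n] qv[OF n1(1) x] n1 cyc_index_add[of n 1] by (simp add: cyc_index_self)
  finally show "q 1 (a n x) = fp u F n (q n x)"
   using Iinj[OF n1(2)] qv[OF n1(2) ax] hom_closed[OF fph] qv[OF n1(1) x] by blast
 qed
 have dec': "\<forall>y\<in>U (M (Suc k)). y = I (cyc (Suc k)) (q (cyc (Suc k)) y) \<oplus>\<^bsub>M (Suc k)\<^esub>
    (\<theta> (Suc k) (a (Suc k) y) \<oplus>\<^bsub>M (Suc k)\<^esub> a k (\<theta> k y))" for k
 proof
  fix y assume y: "y \<in> U (M (Suc k))"
  let ?m = "cyc (Suc k)"
  have m: "?m \<in> {1..n}" by (rule cyc_index_range[OF n_pos])
  have Mm: "M ?m = M (Suc k)" using periodic_cyc_index[of n M "Suc k"] MD(4) by simp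
  have "\<pi> (?m - 1) = \<pi> k"
  proof -
   have "?m - 1 = (k + n) mod n" by (simp add: cyc_index_def)
   then have "k + n = (?m - 1) + n * ((k + n) div n)" using mod_mult_div_eq[of "k + n" n] by simp
   then show ?thesis using periodic_mult[of \<pi> n "?m - 1" "(k + n) div n"] per(3) by metis
  qed
  then have "I ?m (q ?m y) = \<pi> k y" using qv[OF m, of y] y Mm by simp
  then show "y = I ?m (q ?m y) \<oplus>\<^bsub>M (Suc k)\<^esub> (\<theta> (Suc k) (a (Suc k) y) \<oplus>\<^bsub>M (Suc k)\<^esub> a k (\<theta> k y))"
   using decomp[OF y] by simp
 qed
 have "sdr u M a F (\<lambda>m. I (cyc m)) (\<lambda>m. q (cyc m)) \<theta>"
  unfolding sdr_def using F i_mor q_mor qI[OF cyc_index_range[OF n_pos]] \<theta>h per(2) dec' by blast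
 then show thesis using that by blast
qed

end

section \<open>Holonomy characterizes the collections\<close>

context angulation_setting
begin

lemma bipD:
 assumes "bip X Y P i1 i2 p1 p2"
 shows "i1 \<in> Lin X P" "i2 \<in> Lin Y P" "p1 \<in> Lin P X" "p2 \<in> Lin P Y"
  "x \<in> U X ==> p1 (i1 x) = x" "x \<in> U X ==> p2 (i1 x) = \<zero>\<^bsub>Y\<^esub>"
  "y \<in> U Y ==> p2 (i2 y) = y" "y \<in> U Y ==> p1 (i2 y) = \<zero>\<^bsub>X\<^esub>"
  "z \<in> U P ==> i1 (p1 z) \<oplus>\<^bsub>P\<^esub> i2 (p2 z) = z"
 using assms by (auto simp: bip_def)

lemma bip_sym:
 assumes "bip X Y P i1 i2 p1 p2" "module R P"
 shows "bip Y X P i2 i1 p2 p1"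
proof -
 note B = bipD[OF assms(1)]
 have "i2 (p2 z) \<oplus>\<^bsub>P\<^esub> i1 (p1 z) = z" if z: "z \<in> U P" for z
  using B(9)[OF z] mod_comm[OF assms(2) hom_closed[OF B(1) hom_closed[OF B(3) z]] hom_closed[OF B(2) hom_closed[OF B(4) z]]] by simp
 then show ?thesis using assms(1) by (simp add: bip_def)
qed

lemma retract_bip:
 fixes A X :: "('a, 'm) module"
 assumes A: "Free A" and X: "Free X"
  and s: "s \<in> Lin X A" and r: "r \<in> Lin A X" and rs: "\<And>x. x \<in> U X ==> r (s x) = x"
 defines "K \<equiv> A\<lparr>carrier := {a \<in> U A. r a = \<zero>\<^bsub>X\<^esub>}\<rparr>"
 shows "Free K"
  and "bip X K A s (\<lambda>x\<in>U K. x) r (\<lambda>a\<in>U A. a \<ominus>\<^bsub>A\<^esub> s (r a))"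
proof -
 note AM = fg_freeD[OF A] and XM = fg_freeD[OF X] and sD = homD[OF s] and rD = homD[OF r]
 note rc = retract_complement[OF A XM s r rs, folded K_def]
 show "Free K" using rc(1) by simp
 have Kc: "U K = {a \<in> U A. r a = \<zero>\<^bsub>X\<^esub>}" and K0: "\<zero>\<^bsub>K\<^esub> = \<zero>\<^bsub>A\<^esub>" by (simp_all add: K_def)
 show "bip X K A s (\<lambda>x\<in>U K. x) r (\<lambda>a\<in>U A. a \<ominus>\<^bsub>A\<^esub> s (r a))"
  unfolding bip_def
 proof (intro conjI ballI)
  fix x assume x: "x \<in> U X"
  show "r (s x) = x" using rs[OF x] .
  show "(\<lambda>a\<in>U A. a \<ominus>\<^bsub>A\<^esub> s (r a)) (s x) = \<zero>\<^bsub>K\<^esub>"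
   using x sD(1)[OF x] AM by (simp add: rs K0 mod_norm)
 next
  fix y assume y: "y \<in> U K"
  then have yA: "y \<in> U A" "r y = \<zero>\<^bsub>X\<^esub>" by (auto simp: Kc)
  show "(\<lambda>a\<in>U A. a \<ominus>\<^bsub>A\<^esub> s (r a)) ((\<lambda>x\<in>U K. x) y) = y"
   using y yA AM XM by (simp add: sD(4) mod_norm)
  show "r ((\<lambda>x\<in>U K. x) y) = \<zero>\<^bsub>X\<^esub>" using y yA by simp
 next
  fix z assume z: "z \<in> U A"
  have kz: "z \<ominus>\<^bsub>A\<^esub> s (r z) \<in> U K" using rc(3) hom_closed[OF rc(3), of z] z by simp
  have srz: "s (r z) \<in> U A" using z sD(1) rD(1) by simp
  have "s (r z) \<oplus>\<^bsub>A\<^esub> (z \<ominus>\<^bsub>A\<^esub> s (r z)) = z" using AM z srz by algebra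
  then show "s (r z) \<oplus>\<^bsub>A\<^esub> (\<lambda>x\<in>U K. x) ((\<lambda>a\<in>U A. a \<ominus>\<^bsub>A\<^esub> s (r a)) z) = z"
   using z kz by simp
 qed (use s r rc in auto)
qed

text \<open>
 The kernel of \<open>q\<close> is a complementary subcomplex.
\<close>

lemma retract_splits:
 assumes M: "cseq M a" and N: "cseq N b" and i: "cmor N b M a i" and q: "cmor M a N b q"
  and qi: "\<And>k x. x \<in> U (N k) ==> q k (i k x) = x"
 obtains K c j r where "cseq K c" "cmor K c M a j" "cmor M a K c r"
  "\<And>k. bip (N k) (K k) (M k) (i k) (j k) (q k) (r k)"
proof -
 note MD = cseqD[OF M] and ND = cseqD[OF N] and iD = homD[OF cmorD(1)[OF i]] and qD = homD[OF cmorD(1)[OF q]]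
  and aD = homD[OF cseqD(3)[OF M]]
 define K where "K k = (M k)\<lparr>carrier := {x \<in> U (M k). q k x = \<zero>\<^bsub>N k\<^esub>}\<rparr>" for k
 define c where "c k = (\<lambda>x\<in>U (K k). a k x)" for k
 define j where "j k = (\<lambda>x\<in>U (K k). x)" for k
 define r where "r k = (\<lambda>x\<in>U (M k). x \<ominus>\<^bsub>M k\<^esub> i k (q k x))" for k
 have rb: "Free (K k)" "bip (N k) (K k) (M k) (i k) (j k) (q k) (r k)" for k
  using retract_bip[OF MD(1) ND(1) cmorD(1)[OF i] cmorD(1)[OF q] qi, of k] by (simp_all add: K_def j_def r_def)
 have Kc: "U (K k) = {x \<in> U (M k). q k x = \<zero>\<^bsub>N k\<^esub>}"
  and Kop: "add (K k) = add (M k)" "smult (K k) = smult (M k)" for k by (simp_all add: K_def)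
 have aK: "a k x \<in> U (K (Suc k))" if "x \<in> U (K k)" for k x
  using that aD(1) ND(2) cmorD(3)[OF q] by (auto simp: Kc hom_zero[OF ND(3)])
 have ch: "c k \<in> Lin (K k) (K (Suc k))" for k
  unfolding c_def using aK fg_freeD[OF rb(1)] by (intro homI) (auto simp: Kc Kop aD)
 have per: "K (k + n) = K k" for k using MD(4) ND(4) cmorD(2)[OF q] by (simp add: K_def)
 have K: "cseq K c" unfolding cseq_def using rb(1) ch per MD(5) by (auto simp: c_def)
 have "cmor K c M a j" unfolding cmor_def
  using bipD(2)[OF rb(2)] per aK by (auto simp: j_def c_def)
 moreover have "cmor M a K c r" unfolding cmor_def
 proof (intro allI conjI ballI)
  fix k x assume x: "x \<in> U (M k)"
  have m: "i k (q k x) \<in> U (M k)" using iD(1) qD(1) x by simp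
  have rx: "r k x \<in> U (K k)" using hom_closed[OF bipD(4)[OF rb(2)] x] .
  have "r (Suc k) (a k x) = a k x \<ominus>\<^bsub>M (Suc k)\<^esub> a k (i k (q k x))"
   using x aD(1)[OF x] qD(1)[OF x] by (simp add: r_def cmorD(3)[OF q] cmorD(3)[OF i])
  also have "\<dots> = a k (r k x)" using x m MD(2) by (simp add: r_def aD)
  finally show "r (Suc k) (a k x) = c k (r k x)" using rx by (simp add: c_def)
 qed (use bipD(4)[OF rb(2)] MD(4) cmorD(2)[OF i] cmorD(2)[OF q] in \<open>auto simp: r_def\<close>)
 ultimately show thesis using that K rb(2) by blast
qed

text \<open>
 Transport of a homotopy along a retraction. The homotopy is needed only on the image of \<open>j\<close>; so
 \<open>M\<close> itself may fail to be contractible.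
\<close>

lemma contraction_retract:
 assumes M: "cseq M a" and \<theta>h: "\<And>k. \<theta> k \<in> Lin (M (Suc k)) (M k)" and \<theta>p: "\<And>k. \<theta> (k + n) = \<theta> k" and K: "cseq K c" and j: "cmor K c M a j" and r: "cmor M a K c r"
  and rj: "\<And>k x. x \<in> U (K k) ==> r k (j k x) = x"
  and dec: "\<And>k x. x \<in> U (K (Suc k)) ==>
   j (Suc k) x = \<theta> (Suc k) (a (Suc k) (j (Suc k) x)) \<oplus>\<^bsub>M (Suc k)\<^esub> a k (\<theta> k (j (Suc k) x))"
 shows "contraction K c (\<lambda>k. \<lambda>x\<in>U (K (Suc k)). r k (\<theta> k (j (Suc k) x)))"
 unfolding contraction_def
proof (intro allI conjI ballI)
 note MD = cseqD[OF M] and KD = cseqD[OF K] and jD = homD[OF cmorD(1)[OF j]] and rD = homD[OF cmorD(1)[OF r]]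
  and aD = homD[OF cseqD(3)[OF M]]
 note \<theta>D = homD[OF \<theta>h]
 fix k
 have "(\<lambda>x\<in>U (K (Suc k)). \<theta> k (j (Suc k) x)) \<in> Lin (K (Suc k)) (M k)"
  using hom_comp[OF KD(2) cmorD(1)[OF j] \<theta>h] .
 from hom_comp[OF KD(2) this cmorD(1)[OF r]]
 show "(\<lambda>x\<in>U (K (Suc k)). r k (\<theta> k (j (Suc k) x))) \<in> Lin (K (Suc k)) (K k)"
  by (simp cong: restrict_cong)
 show "(\<lambda>x\<in>U (K (Suc (k + n))). r (k + n) (\<theta> (k + n) (j (Suc (k + n)) x))) =
   (\<lambda>x\<in>U (K (Suc k)). r k (\<theta> k (j (Suc k) x)))"
  using KD(6) cmorD(2)[OF r] \<theta>p cmorD(2)[OF j, of "Suc k"] by simp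
 fix x assume x: "x \<in> U (K (Suc k))"
 let ?y = "j (Suc k) x"
 have y: "?y \<in> U (M (Suc k))" using jD(1) x .
 have cx: "c (Suc k) x \<in> U (K (Suc (Suc k)))" using hom_closed[OF KD(3) x] .
 have t: "\<theta> (Suc k) (a (Suc k) ?y) \<in> U (M (Suc k))" "a k (\<theta> k ?y) \<in> U (M (Suc k))" "\<theta> k ?y \<in> U (M k)"
  using y aD(1) \<theta>D(1) by simp_all
 have "r (Suc k) ?y = r (Suc k) (\<theta> (Suc k) (a (Suc k) ?y) \<oplus>\<^bsub>M (Suc k)\<^esub> a k (\<theta> k ?y))" using dec[OF x] by simp
 then have "x = r (Suc k) (\<theta> (Suc k) (a (Suc k) ?y)) \<oplus>\<^bsub>K (Suc k)\<^esub> c k (r k (\<theta> k ?y))"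
  using t rj[OF x] by (simp add: rD(2) cmorD(3)[OF r])
 then show "x = (\<lambda>x\<in>U (K (Suc (Suc k))). r (Suc k) (\<theta> (Suc k) (j (Suc (Suc k)) x))) (c (Suc k) x) \<oplus>\<^bsub>K (Suc k)\<^esub>
   c k ((\<lambda>x\<in>U (K (Suc k)). r k (\<theta> k (j (Suc k) x))) x)"
  using x cx cmorD(3)[OF j x] by simp
qed

text \<open>
 On the complement of \<open>F(p)\<close> the map \<open>i \<circ> q\<close> vanishes, so there \<open>\<theta>\<close> is a contraction.
\<close>

lemma sdr_complement_contractible:
 assumes M: "cseq M a" and sd: "sdr u M a F i q \<theta>" and u: "u \<in> U R" and K: "cseq K c" and j: "cmor K c M a j" and r: "cmor M a K c r"
  and bp: "\<And>k. bip F (K k) (M k) (i k) (j k) (q k) (r k)"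
 shows "contraction K c (\<lambda>k. \<lambda>x\<in>U (K (Suc k)). r k (\<theta> k (j (Suc k) x)))"
proof (rule contraction_retract[OF M _ _ K j r])
 note MD = cseqD[OF M] and jD = homD[OF cmorD(1)[OF j]] and aD = homD[OF cseqD(3)[OF M]]
 have F: "Free F" "cmor (\<lambda>_. F) (fp u F) M a i" using sd by (auto simp: sdr_def)
 show \<theta>h: "\<theta> k \<in> Lin (M (Suc k)) (M k)" and "\<theta> (k + n) = \<theta> k" for k using sd by (auto simp: sdr_def)
 have dec: "y = i (Suc k) (q (Suc k) y) \<oplus>\<^bsub>M (Suc k)\<^esub> (\<theta> (Suc k) (a (Suc k) y) \<oplus>\<^bsub>M (Suc k)\<^esub> a k (\<theta> k y))"
  if "y \<in> U (M (Suc k))" for k y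
  using sd that by (auto simp: sdr_def)
 note \<theta>D = homD[OF \<theta>h]
 show "r k (j k x) = x" if "x \<in> U (K k)" for k x using bipD(7)[OF bp that] .
 fix k x assume x: "x \<in> U (K (Suc k))"
 let ?y = "j (Suc k) x"
 have y: "?y \<in> U (M (Suc k))" using jD(1) x .
 have "i (Suc k) (q (Suc k) ?y) = \<zero>\<^bsub>M (Suc k)\<^esub>"
  using bipD(8)[OF bp x] F(1) MD(2) by (simp add: hom_zero[OF cmorD(1)[OF F(2)]] fg_freeD)
 moreover have "\<theta> (Suc k) (a (Suc k) ?y) \<in> U (M (Suc k))" "a k (\<theta> k ?y) \<in> U (M (Suc k))"
  using y aD(1) \<theta>D(1) by simp_all
 ultimately show "?y = \<theta> (Suc k) (a (Suc k) ?y) \<oplus>\<^bsub>M (Suc k)\<^esub> a k (\<theta> k ?y)"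
  using dec[OF y] MD(2) by (simp add: mod_l_zero)
qed

text \<open>
 Contractible sequences and \<open>F(p)\<close> have the required holonomy, hence so have their sums.
 Conversely, a deformation retraction onto \<open>F(p)\<close> splits off \<open>F(p)\<close> with contractible complement.
\<close>

theorem N_coll_eq:
 assumes u: "u \<in> Units R"
 shows "(N_coll R n p u :: (nat => ('a, 'm) mod_arrow) set) = {mk M a |M a. in_class u M a}"
proof (intro Set.equalityI subsetI)
 have uR: "u \<in> U R" using u by auto
 fix \<alpha> :: "nat => ('a, 'm) mod_arrow" assume "\<alpha> \<in> N_coll R n p u"
 then obtain \<gamma> F \<sigma> where \<alpha>: "\<alpha> \<in> n_sequences C n" and \<sigma>: "\<sigma> \<in> n_sequences C n"
  and \<gamma>: "candidate C n \<gamma>" "contractible C n \<gamma>" and F: "Free F"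
  and ds: "seq_direct_sum C n \<gamma> (Fp_seq R n p u F) \<sigma>" and iso: "seq_iso C n \<alpha> \<sigma>"
  by (auto simp: N_coll_def)
 obtain M a where M: "cseq M a" "\<alpha> = mk M a" using n_sequences_mk[OF \<alpha>] .
 obtain P d where P: "cseq P d" "\<sigma> = mk P d" using n_sequences_mk[OF \<sigma>] .
 obtain K c where K: "cseq K c" "\<gamma> = mk K c" using n_sequences_mk[of \<gamma>] \<gamma>(1) by (auto simp: candidate_def)
 obtain \<theta> where \<theta>: "contraction K c \<theta>" using \<gamma>(2) contractible_mk[OF K(1)] K(2) by auto
 have cK: "in_class u K c"
  using in_class_contractible[OF K(1) _ \<theta> uR] \<gamma>(1) candidate_mk[OF K(1)] K(2) by simp
 obtain i1 i2 p1 p2 where "cmor K c P d i1" "cmor (\<lambda>_. F) (fp u F) P d i2" "cmor P d K c p1" "cmor P d (\<lambda>_. F) (fp u F) p2"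
  "\<And>k. bip (K k) F (P k) (i1 k) (i2 k) (p1 k) (p2 k)"
  using ds unfolding Fp_seq_eq K(2) P(2) seq_direct_sum_mk[OF K(1) fp_cseq[OF uR F] P(1)] by blast
 then have cP: "in_class u P d" using in_class_direct_sum[OF cK in_class_fp[OF u F] uR P(1)] by blast
 obtain f g where "cmor M a P d f" "cmor P d M a g" "\<And>i x. x \<in> U (M i) ==> g i (f i x) = x"
  using seq_iso_mkD[OF M(1) P(1)] iso M(2) P(2) by metis
 then have "in_class u M a" using in_class_retract[OF cP uR M(1)] by blast
 then show "\<alpha> \<in> {mk M a |M a. in_class u M a}" using M(2) by blast
next
 have uR: "u \<in> U R" using u by auto
 fix \<alpha> :: "nat => ('a, 'm) mod_arrow" assume "\<alpha> \<in> {mk M a |M a. in_class u M a}"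
 then obtain M a where \<alpha>: "\<alpha> = mk M a" and c: "in_class u M a" by blast
 then have M: "cseq M a" by (simp add: in_class_def)
 obtain F i q \<theta> where sd: "sdr u M a F i q \<theta>" using sdr_exists[OF c u] .
 then have F: "Free F" and i: "cmor (\<lambda>_. F) (fp u F) M a i" and q: "cmor M a (\<lambda>_. F) (fp u F) q"
  and qi: "\<And>k x. x \<in> U F ==> q k (i k x) = x" by (auto simp: sdr_def)
 note N = fp_cseq[OF uR F]
 obtain K d j r where K: "cseq K d" "cmor K d M a j" "cmor M a K d r" "\<And>k. bip F (K k) (M k) (i k) (j k) (q k) (r k)"
  by (rule retract_splits[OF M N i q qi], assumption) (rule that)
 have bs: "bip (K k) F (M k) (j k) (i k) (r k) (q k)" for k
  using bip_sym[OF K(4) cseqD(2)[OF M]] .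
 have cK: "in_class u K d" using in_class_retract[OF c uR K(1,2,3) bipD(5)[OF bs]] .
 show "\<alpha> \<in> N_coll R n p u" unfolding N_coll_def
 proof (intro CollectI conjI exI bexI)
  show "\<alpha> \<in> n_sequences C n" "mk M a \<in> n_sequences C n" using mk_in_n_sequences[OF M] \<alpha> by simp_all
  show "candidate C n (mk K d)" using candidate_mk[OF K(1)] cK by (simp add: in_class_def)
  show "contractible C n (mk K d)"
   using contractible_mk[OF K(1)] sdr_complement_contractible[OF M sd uR K] by blast
  show "Free F" by (rule F)
  show "seq_direct_sum C n (mk K d) (Fp_seq R n p u F) (mk M a)"
   unfolding Fp_seq_eq seq_direct_sum_mk[OF K(1) N M] using K(2,3) i q bs by blast
  show "seq_iso C n \<alpha> (mk M a)" using seq_iso_refl[OF M] \<alpha> by simp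
 qed
qed

lemma cyc_index_Suc: "cyc (Suc i) = (if cyc i = n then 1 else Suc (cyc i))"
proof -
 have "(i + n) mod n = Suc (i + n - 1) mod n" using n_ge by simp
 also have "\<dots> = (if Suc ((i + n - 1) mod n) = n then 0 else Suc ((i + n - 1) mod n))" by (rule mod_Suc)
 finally show ?thesis by (simp add: cyc_index_def)
qed

text \<open>
 The elementary contractible sequence: the identity of \<open>X\<close> from position \<open>k\<close> to the next position,
 and zero modules \<open>Z\<close> elsewhere.
\<close>

definition T_obj :: "nat => ('a, 'm) module => ('a, 'm) module => nat => ('a, 'm) module"
 where "T_obj k Z X i = (if cyc i = k \<or> cyc i = (if k = n then 1 else Suc k) then X else Z)"

definition T_map :: "nat => ('a, 'm) module => ('a, 'm) module => nat => 'm => 'm"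
 where "T_map k Z X i = (if cyc i = k then (\<lambda>x\<in>U X. x)
  else (\<lambda>x\<in>U (T_obj k Z X i). \<zero>\<^bsub>T_obj k Z X (Suc i)\<^esub>))"

definition zero_mod :: "('a, 'm) module => bool"
 where "zero_mod Z \<longleftrightarrow> Free Z \<and> U Z = {\<zero>\<^bsub>Z\<^esub>}"

lemma zero_object_iff: "zero_object C Z \<longleftrightarrow> zero_mod Z"
 using mod_closed(1)[OF fg_freeD] by (auto simp: zero_object_def zero_mod_def restrict_eq_iff)

lemma zero_mod_exists: obtains Z where "zero_mod Z"
proof -
 obtain Z :: "('a, 'm) module" and e :: "nat => 'm" where Z: "Free Z" "basis_family Z {} e"
  using free_of_rank[of "{} :: nat set"] by auto
 then have "U Z = {\<zero>\<^bsub>Z\<^esub>}" using fg_freeD[OF Z(1)] by (auto simp: basis_family_def)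
 then show thesis using that Z by (simp add: zero_mod_def)
qed

context
 fixes k :: nat and Z X :: "('a, 'm) module"
 assumes k: "k \<in> {1..n}" and Z: "zero_mod Z" and X: "Free X"
begin

lemma T_obj_free: "Free (T_obj k Z X i)"
 using Z X by (simp add: T_obj_def zero_mod_def)

lemma T_obj_at: "cyc i = k ==> T_obj k Z X i = X" "cyc i = k ==> T_obj k Z X (Suc i) = X"
 by (auto simp: T_obj_def cyc_index_Suc)

lemma T_obj_off: "cyc i \<noteq> k ==> cyc (Suc i) \<noteq> k ==> T_obj k Z X (Suc i) = Z"
 using cyc_index_range[OF n_pos, of i] k by (auto simp: T_obj_def cyc_index_Suc split: if_splits)

lemma T_not_twice: "cyc i = k ==> cyc (Suc i) \<noteq> k"
 using k n_ge by (auto simp: cyc_index_Suc)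

lemma T_cseq: "cseq (T_obj k Z X) (T_map k Z X)"
 unfolding cseq_def
proof (intro allI conjI)
 fix i
 show "Free (T_obj k Z X i)" by (rule T_obj_free)
 show "T_map k Z X i \<in> Lin (T_obj k Z X i) (T_obj k Z X (Suc i))"
  using fg_freeD[OF T_obj_free] T_obj_at[of i] fg_freeD[OF X] by (auto simp: T_map_def intro!: hom_id hom_null)
 have o: "T_obj k Z X (j + n) = T_obj k Z X j" for j by (simp add: T_obj_def)
 show "T_obj k Z X (i + n) = T_obj k Z X i" by (rule o)
 show "T_map k Z X (i + n) = T_map k Z X i" using o[of i] o[of "Suc i"] by (simp add: T_map_def)
qed

lemma T_null_composites: "null_composites (T_obj k Z X) (T_map k Z X)"
 unfolding null_composites_def
proof (intro allI ballI)
 fix i x assume x: "x \<in> U (T_obj k Z X i)"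
 note D = cseqD[OF T_cseq]
 have m: "T_map k Z X i x \<in> U (T_obj k Z X (Suc i))" using hom_closed[OF D(3) x] .
 show "T_map k Z X (Suc i) (T_map k Z X i x) = \<zero>\<^bsub>T_obj k Z X (Suc (Suc i))\<^esub>"
 proof (cases "cyc i = k")
  case True
  then show ?thesis using T_not_twice[OF True] m by (simp add: T_map_def[of k Z X "Suc i"])
 next
  case False
  then have "T_map k Z X i x = \<zero>\<^bsub>T_obj k Z X (Suc i)\<^esub>" using x by (simp add: T_map_def)
  then show ?thesis using hom_zero[OF D(3) D(2) D(2)] by simp
 qed
qed

lemma T_contraction:
 "contraction (T_obj k Z X) (T_map k Z X)
  (\<lambda>i. if cyc i = k then (\<lambda>x\<in>U X. x) else (\<lambda>x\<in>U (T_obj k Z X (Suc i)). \<zero>\<^bsub>T_obj k Z X i\<^esub>))"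
 (is "contraction _ _ ?\<theta>")
 unfolding contraction_def
proof (intro allI conjI ballI)
 fix i
 note D = cseqD[OF T_cseq]
 have XM: "module R X" using fg_freeD[OF X] .
 show "?\<theta> i \<in> Lin (T_obj k Z X (Suc i)) (T_obj k Z X i)"
  using D(2) T_obj_at[of i] XM by (auto intro!: hom_id hom_null)
 show "?\<theta> (i + n) = ?\<theta> i" using D(4)[of i] D(6)[of i] by simp
 fix x assume x: "x \<in> U (T_obj k Z X (Suc i))"
 consider "cyc i = k" | "cyc (Suc i) = k" "cyc i \<noteq> k" | "cyc i \<noteq> k" "cyc (Suc i) \<noteq> k" by blast
 then show "x = ?\<theta> (Suc i) (T_map k Z X (Suc i) x) \<oplus>\<^bsub>T_obj k Z X (Suc i)\<^esub> T_map k Z X i (?\<theta> i x)"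
 proof cases
  case 1
  then show ?thesis using x T_not_twice[OF 1] T_obj_at[OF 1] hom_closed[OF D(3) x] XM
   by (simp add: T_map_def[of k Z X i] mod_norm)
 next
  case 2
  then show ?thesis using x T_obj_at(1)[OF 2(1)] XM D(2)[of i]
   by (simp add: T_map_def mod_norm)
 next
  case 3
  have Z0: "T_obj k Z X (Suc i) = Z" using T_obj_off[OF 3] .
  have ZM: "module R Z" "x = \<zero>\<^bsub>Z\<^esub>" using Z x Z0 fg_freeD by (auto simp: zero_mod_def)
  have "?\<theta> (Suc i) (T_map k Z X (Suc i) x) = \<zero>\<^bsub>Z\<^esub>" using 3 x Z0 hom_closed[OF D(3) x] by simp
  moreover have "T_map k Z X i (?\<theta> i x) = \<zero>\<^bsub>Z\<^esub>" using 3 x Z0 D(2)[of i] by (simp add: T_map_def)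
  ultimately show ?thesis unfolding Z0 using ZM by (simp add: mod_norm)
 qed
qed

lemma T_in_class: "u \<in> U R ==> in_class u (T_obj k Z X) (T_map k Z X)"
 using in_class_contractible[OF T_cseq T_null_composites T_contraction] .

end

lemma trivial_seq_mk:
 assumes Z: "zero_mod Z" and X: "Free X"
 shows "trivial_seq C n Z X = mk (T_obj 1 Z X) (T_map 1 Z X)"
proof
 fix i
 show "trivial_seq C n Z X i = mk (T_obj 1 Z X) (T_map 1 Z X) i"
 proof (cases "i \<in> {1..n}")
  case True
  then have ci: "cyc i = i" by (rule cyc_index_self)
  have cS: "cyc (Suc i) = (if i = n then 1 else Suc i)" by (simp add: cyc_index_Suc ci)
  consider "i = 1" | "i = 2" | "2 < i" "i < n" | "i = n" using True n_ge by fastforce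
  then show ?thesis
   using True ci cS n_ge by cases (auto simp: trivial_seq_def mk_def T_obj_def T_map_def)
 next
  case False
  then show ?thesis unfolding trivial_seq_def mk_def by (simp only: restrict_apply if_False)
 qed
qed

text \<open>
 A free module over the disjoint sum of two bases.
\<close>

lemma biproduct_exists:
 fixes X Y :: "('a, 'm) module"
 assumes X: "Free X" and Y: "Free Y"
 obtains P i1 i2 p1 p2 where "Free P" "bip X Y P i1 i2 p1 p2"
proof -
 note XM = fg_freeD[OF X] and YM = fg_freeD[OF Y]
 obtain I where I: "basis_family X I (\<lambda>b. b)" using fg_free_basis[OF X] .
 obtain J where J: "basis_family Y J (\<lambda>b. b)" using fg_free_basis[OF Y] .
 have fin: "finite I" "I \<subseteq> U X" "finite J" "J \<subseteq> U Y" using I J by (auto simp: basis_family_def)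
 obtain P :: "('a, 'm) module" and e where P: "Free P" "basis_family P (I <+> J) e"
  using free_of_rank[of "I <+> J"] fin by auto
 note PM = fg_freeD[OF P(1)]
 have e: "e \<in> I <+> J \<rightarrow> U P" using P(2) by (simp add: basis_family_def)
 obtain i1 where i1: "i1 \<in> Lin X P" "\<And>b. b \<in> I ==> i1 b = e (Inl b)"
  using linear_extension[OF XM PM I, of "\<lambda>b. e (Inl b)"] e by auto
 obtain i2 where i2: "i2 \<in> Lin Y P" "\<And>b. b \<in> J ==> i2 b = e (Inr b)"
  using linear_extension[OF YM PM J, of "\<lambda>b. e (Inr b)"] e by auto
 have cs: "case_sum (\<lambda>b. b) (\<lambda>_. \<zero>\<^bsub>X\<^esub>) \<in> I <+> J \<rightarrow> U X" "case_sum (\<lambda>_. \<zero>\<^bsub>Y\<^esub>) (\<lambda>b. b) \<in> I <+> J \<rightarrow> U Y"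
  using fin XM YM by auto
 obtain p1 where p1: "p1 \<in> Lin P X" "\<And>b. b \<in> I <+> J ==> p1 (e b) = case_sum (\<lambda>b. b) (\<lambda>_. \<zero>\<^bsub>X\<^esub>) b"
  using linear_extension[OF PM XM P(2) cs(1)] by blast
 obtain p2 where p2: "p2 \<in> Lin P Y" "\<And>b. b \<in> I <+> J ==> p2 (e b) = case_sum (\<lambda>_. \<zero>\<^bsub>Y\<^esub>) (\<lambda>b. b) b"
  using linear_extension[OF PM YM P(2) cs(2)] by blast
 note D = homD[OF i1(1)] and D2 = homD[OF i2(1)] and E = homD[OF p1(1)] and E2 = homD[OF p2(1)]
 have v: "b \<in> I ==> p1 (i1 b) = b" "b \<in> I ==> p2 (i1 b) = \<zero>\<^bsub>Y\<^esub>" "b \<in> I ==> b \<in> U X"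
  "b' \<in> J ==> p2 (i2 b') = b'" "b' \<in> J ==> p1 (i2 b') = \<zero>\<^bsub>X\<^esub>" "b' \<in> J ==> b' \<in> U Y" for b b'
  using p1(2)[of "Inl b"] p2(2)[of "Inl b"] p1(2)[of "Inr b'"] p2(2)[of "Inr b'"] i1(2)[of b] i2(2)[of b'] fin by auto
 have "p1 (i1 x) = x" if x: "x \<in> U X" for x
 proof -
  have "(\<lambda>x\<in>U X. p1 (i1 x)) x = (\<lambda>x\<in>U X. x) x"
   by (rule hom_eq_on_basis[OF XM XM I hom_comp[OF XM i1(1) p1(1)] hom_id[OF XM] _ x]) (simp add: v)
  then show ?thesis using x by simp
 qed
 moreover have "p2 (i1 x) = \<zero>\<^bsub>Y\<^esub>" if x: "x \<in> U X" for x
 proof -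
  have "(\<lambda>x\<in>U X. p2 (i1 x)) x = (\<lambda>x\<in>U X. \<zero>\<^bsub>Y\<^esub>) x"
   by (rule hom_eq_on_basis[OF XM YM I hom_comp[OF XM i1(1) p2(1)] hom_null[OF XM YM] _ x]) (simp add: v)
  then show ?thesis using x by simp
 qed
 moreover have "p2 (i2 y) = y" if y: "y \<in> U Y" for y
 proof -
  have "(\<lambda>x\<in>U Y. p2 (i2 x)) y = (\<lambda>x\<in>U Y. x) y"
   by (rule hom_eq_on_basis[OF YM YM J hom_comp[OF YM i2(1) p2(1)] hom_id[OF YM] _ y]) (simp add: v)
  then show ?thesis using y by simp
 qed
 moreover have "p1 (i2 y) = \<zero>\<^bsub>X\<^esub>" if y: "y \<in> U Y" for y
 proof -
  have "(\<lambda>x\<in>U Y. p1 (i2 x)) y = (\<lambda>x\<in>U Y. \<zero>\<^bsub>X\<^esub>) y"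
   by (rule hom_eq_on_basis[OF YM XM J hom_comp[OF YM i2(1) p1(1)] hom_null[OF YM XM] _ y]) (simp add: v)
  then show ?thesis using y by simp
 qed
 moreover have "i1 (p1 z) \<oplus>\<^bsub>P\<^esub> i2 (p2 z) = z" if z: "z \<in> U P" for z
 proof -
  let ?h = "\<lambda>z\<in>U P. (\<lambda>z\<in>U P. i1 (p1 z)) z \<oplus>\<^bsub>P\<^esub> (\<lambda>z\<in>U P. i2 (p2 z)) z"
  have h: "?h \<in> Lin P P" using hom_sum[OF PM PM hom_comp[OF PM p1(1) i1(1)] hom_comp[OF PM p2(1) i2(1)]] .
  have "?h z = (\<lambda>z\<in>U P. z) z"
  proof (rule hom_eq_on_basis[OF PM PM P(2) h hom_id[OF PM] _ z])
   fix b assume b: "b \<in> I <+> J"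
   then have "e b \<in> U P" using e by auto
   then show "?h (e b) = (\<lambda>z\<in>U P. z) (e b)"
    using b p1(2)[OF b] p2(2)[OF b] i1(2) i2(2) XM YM PM D(4) D2(4) by (auto simp: mod_norm)
  qed
  then show ?thesis using z by simp
 qed
 ultimately have "bip X Y P i1 i2 p1 p2" unfolding bip_def using i1(1) i2(1) p1(1) p2(1) by blast
 then show thesis using that P(1) by blast
qed

lemma direct_sum_of_bips:
 assumes M: "cseq M a" and N: "cseq N b"
  and P: "\<And>k. Free (P k)" "\<And>k. bip (M k) (N k) (P k) (i1 k) (i2 k) (p1 k) (p2 k)"
  and per: "\<And>k. P (k + n) = P k" "\<And>k. i1 (k + n) = i1 k" "\<And>k. i2 (k + n) = i2 k" "\<And>k. p1 (k + n) = p1 k" "\<And>k. p2 (k + n) = p2 k"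
 defines "c \<equiv> \<lambda>k. \<lambda>z\<in>U (P k). i1 (Suc k) (a k (p1 k z)) \<oplus>\<^bsub>P (Suc k)\<^esub> i2 (Suc k) (b k (p2 k z))"
 shows "cseq P c" "cmor M a P c i1" "cmor N b P c i2" "cmor P c M a p1" "cmor P c N b p2"
proof -
 note MD = cseqD[OF M] and ND = cseqD[OF N] and aD = homD[OF cseqD(3)[OF M]] and bD = homD[OF cseqD(3)[OF N]]
 note B = bipD[OF P(2)]
 note i1D = homD[OF B(1)] and i2D = homD[OF B(2)] and p1D = homD[OF B(3)] and p2D = homD[OF B(4)]
 have PM: "module R (P k)" for k using fg_freeD[OF P(1)] .
 have ch: "c k \<in> Lin (P k) (P (Suc k))" for k
 proof -
  have "(\<lambda>z\<in>U (P k). a k (p1 k z)) \<in> Lin (P k) (M (Suc k))" using hom_comp[OF PM B(3) MD(3)] .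
  from hom_comp[OF PM this B(1)]
  have 1: "(\<lambda>z\<in>U (P k). i1 (Suc k) (a k (p1 k z))) \<in> Lin (P k) (P (Suc k))" by (simp cong: restrict_cong)
  have "(\<lambda>z\<in>U (P k). b k (p2 k z)) \<in> Lin (P k) (N (Suc k))" using hom_comp[OF PM B(4) ND(3)] .
  from hom_comp[OF PM this B(2)]
  have 2: "(\<lambda>z\<in>U (P k). i2 (Suc k) (b k (p2 k z))) \<in> Lin (P k) (P (Suc k))" by (simp cong: restrict_cong)
  show ?thesis using hom_sum[OF PM PM 1 2] by (simp add: c_def cong: restrict_cong)
 qed
 show "cseq P c" unfolding cseq_def
 proof (intro allI conjI)
  fix k
  show "c (k + n) = c k"
   using per(1)[of k] per(1)[of "Suc k"] per(2)[of "Suc k"] per(3)[of "Suc k"] per(4)[of k] per(5)[of k] MD(5) ND(5)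
   by (simp add: c_def)
 qed (use P(1) ch per in auto)
 have am: "p1 k z \<in> U (M k)" "p2 k z \<in> U (N k)" "a k (p1 k z) \<in> U (M (Suc k))" "b k (p2 k z) \<in> U (N (Suc k))"
  "i1 (Suc k) (a k (p1 k z)) \<in> U (P (Suc k))" "i2 (Suc k) (b k (p2 k z)) \<in> U (P (Suc k))"
  if "z \<in> U (P k)" for k z
  using that p1D(1) p2D(1) aD(1) bD(1) i1D(1) i2D(1) by simp_all
 show "cmor M a P c i1" unfolding cmor_def
  using B(1,5,6) per(2) i1D(1) aD(1) ND(2) PM by (auto simp: c_def bD(4) i2D(4) mod_norm)
 show "cmor N b P c i2" unfolding cmor_def
  using B(2,7,8) per(3) i2D(1) bD(1) MD(2) PM by (auto simp: c_def aD(4) i1D(4) mod_norm)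
 show "cmor P c M a p1" unfolding cmor_def
  using B(3,5,8) per(4) am MD(2) by (auto simp: c_def p1D(2) mod_norm)
 show "cmor P c N b p2" unfolding cmor_def
  using B(4,6,7) per(5) am ND(2) by (auto simp: c_def p2D(2) mod_norm)
qed

definition extends :: "'a => ('a, 'm) module => ('m => 'm) => ('a, 'm) module => bool"
 where "extends u A f B \<longleftrightarrow> (\<exists>M a. in_class u M a \<and> M S1 = A \<and> M S2 = B \<and> a S1 = f)"

lemma extends_sum:
 assumes u: "u \<in> U R" and e1: "extends u A1 f1 B1" and e2: "extends u A2 f2 B2"
  and A: "Free A" and B: "Free B" and f: "f \<in> Lin A B"
  and bA: "bip A1 A2 A i1 i2 p1 p2" and bB: "bip B1 B2 B j1 j2 q1 q2"
  and q1: "\<And>x. x \<in> U A ==> q1 (f x) = f1 (p1 x)" and q2: "\<And>x. x \<in> U A ==> q2 (f x) = f2 (p2 x)"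
 shows "extends u A f B"
proof -
 obtain M a where M: "in_class u M a" "M S1 = A1" "M S2 = B1" "a S1 = f1" using e1 by (auto simp: extends_def)
 obtain N b where N: "in_class u N b" "N S1 = A2" "N S2 = B2" "b S1 = f2" using e2 by (auto simp: extends_def)
 have Mc: "cseq M a" and Nc: "cseq N b" using M(1) N(1) by (simp_all add: in_class_def)
 note MD = cseqD[OF Mc] and ND = cseqD[OF Nc]
 let ?Q = "\<lambda>k (P, i1', i2', p1', p2'). Free P \<and> bip (M k) (N k) P i1' i2' p1' p2' \<and>
   (cyc k = 1 \<longrightarrow> (P, i1', i2', p1', p2') = (A, i1, i2, p1, p2)) \<and>
   (cyc k = 2 \<longrightarrow> (P, i1', i2', p1', p2') = (B, j1, j2, q1, q2))"
 have ci: "M (cyc k) = M k" "N (cyc k) = N k" for k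
  using periodic_cyc_index[of n M k] periodic_cyc_index[of n N k] MD(4) ND(4) by simp_all
 have ex: "\<exists>t. ?Q k t" for k
 proof -
  consider "cyc k = 1" | "cyc k = 2" | "cyc k \<noteq> 1" "cyc k \<noteq> 2" by blast
  then show ?thesis
  proof cases
   case 1
   then have "M k = A1" "N k = A2" using ci[of k] M(2) N(2) by simp_all
   then show ?thesis using 1 A bA by (intro exI[of _ "(A, i1, i2, p1, p2)"]) simp
  next
   case 2
   then have "M k = B1" "N k = B2" using ci[of k] M(3) N(3) by (simp_all add: numeral_2_eq_2)
   then show ?thesis using 2 B bB by (intro exI[of _ "(B, j1, j2, q1, q2)"]) simp
  next
   case 3
   obtain P i1' i2' p1' p2' where "Free P" "bip (M k) (N k) P i1' i2' p1' p2'"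
    using biproduct_exists[OF MD(1) ND(1)] .
   then show ?thesis using 3 by (intro exI[of _ "(P, i1', i2', p1', p2')"]) simp
  qed
 qed
 have pr: "?Q (k + n) = ?Q k" for k by (simp add: MD(4) ND(4))
 obtain t where t: "\<And>k. ?Q k (t k)" and tp: "\<And>k. t (k + n) = t k" using periodic_choice[of ?Q, OF ex pr] by blast
 define P where "P k = fst (t k)" for k
 define I1 where "I1 k = fst (snd (t k))" for k
 define I2 where "I2 k = fst (snd (snd (t k)))" for k
 define P1 where "P1 k = fst (snd (snd (snd (t k))))" for k
 define P2 where "P2 k = snd (snd (snd (snd (t k))))" for k
 have tt: "t k = (P k, I1 k, I2 k, P1 k, P2 k)" for k by (simp add: P_def I1_def I2_def P1_def P2_def)
 have Q: "Free (P k)" "bip (M k) (N k) (P k) (I1 k) (I2 k) (P1 k) (P2 k)" for k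
  using t[of k] by (simp_all add: tt)
 have t1: "P S1 = A" "P1 S1 = p1" "P2 S1 = p2"
  using t[of S1] cyc_index_self[of S1 n] n_ge by (simp_all add: tt)
 have t2: "P S2 = B" "I1 S2 = j1" "I2 S2 = j2"
  using t[of S2] cyc_index_self[of S2 n] n_ge by (simp_all add: tt)
 have per: "P (k + n) = P k" "I1 (k + n) = I1 k" "I2 (k + n) = I2 k" "P1 (k + n) = P1 k" "P2 (k + n) = P2 k" for k
  using tp[of k] by (simp_all add: tt)
 define c where "c = (\<lambda>k. \<lambda>z\<in>U (P k). I1 (Suc k) (a k (P1 k z)) \<oplus>\<^bsub>P (Suc k)\<^esub> I2 (Suc k) (b k (P2 k z)))"
 note ds = direct_sum_of_bips[where P = P and ?i1.0 = I1 and ?i2.0 = I2 and ?p1.0 = P1 and ?p2.0 = P2,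
   OF Mc Nc Q per, folded c_def]
 have cl: "in_class u P c" using in_class_direct_sum[OF M(1) N(1) u ds Q(2)] .
 have "c S1 = f"
 proof (rule hom_eqI)
  show "c S1 \<in> Lin A B" using cseqD(3)[OF ds(1), of S1] t1 t2 by simp
  show "f \<in> Lin A B" by (rule f)
  fix x assume x: "x \<in> U A"
  have "c S1 x = j1 (f1 (p1 x)) \<oplus>\<^bsub>B\<^esub> j2 (f2 (p2 x))" using x t1 t2 M(4) N(4) by (simp add: c_def)
  also have "\<dots> = j1 (q1 (f x)) \<oplus>\<^bsub>B\<^esub> j2 (q2 (f x))" using q1[OF x] q2[OF x] by simp
  also have "\<dots> = f x" using bipD(9)[OF bB hom_closed[OF f x]] .
  finally show "c S1 x = f x" .
 qed
 then show ?thesis unfolding extends_def using cl t1(1) t2(1) by blast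
qed

lemma bip_zero:
 assumes Z: "zero_mod Z" and X: "Free X"
 shows "bip X Z X (\<lambda>x\<in>U X. x) (\<lambda>z\<in>U Z. \<zero>\<^bsub>X\<^esub>) (\<lambda>x\<in>U X. x) (\<lambda>x\<in>U X. \<zero>\<^bsub>Z\<^esub>)"
proof -
 have ZM: "module R Z" "U Z = {\<zero>\<^bsub>Z\<^esub>}" and XM: "module R X" using Z X fg_freeD by (auto simp: zero_mod_def)
 show ?thesis unfolding bip_def
  using ZM(2) hom_id[OF XM] hom_null[OF ZM(1) XM] hom_null[OF XM ZM(1)] XM by (auto simp: mod_norm)
qed

lemma extends_zero:
 assumes u: "u \<in> U R" and A: "Free A" and B: "Free B"
 shows "extends u A (\<lambda>x\<in>U A. \<zero>\<^bsub>B\<^esub>) B"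
proof -
 obtain Z where Z: "zero_mod Z" using zero_mod_exists .
 have ZM: "module R Z" "Free Z" "U Z = {\<zero>\<^bsub>Z\<^esub>}" using Z fg_freeD by (auto simp: zero_mod_def)
 have c1: "cyc S1 = S1" and c2: "cyc S2 = S2"
  using n_ge by (auto simp: cyc_index_self)
 have 1: "extends u A (\<lambda>x\<in>U A. \<zero>\<^bsub>Z\<^esub>) Z" unfolding extends_def
 proof (intro exI conjI)
  show "in_class u (T_obj n Z A) (T_map n Z A)" using n_ge by (intro T_in_class[OF _ Z A u]) simp
 qed (use n_ge in \<open>auto simp: T_obj_def T_map_def c1 c2\<close>)
 have 2: "extends u Z (\<lambda>x\<in>U Z. \<zero>\<^bsub>B\<^esub>) B" unfolding extends_def
 proof (intro exI conjI)
  show "in_class u (T_obj 2 Z B) (T_map 2 Z B)" using n_ge by (intro T_in_class[OF _ Z B u]) simp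
 qed (use n_ge in \<open>auto simp: T_obj_def T_map_def c1 c2\<close>)
 note AM = fg_freeD[OF A] and BM = fg_freeD[OF B]
 show ?thesis
  using extends_sum[OF u 1 2 A B hom_null[OF AM BM] bip_zero[OF Z A] bip_sym[OF bip_zero[OF Z B] BM]] BM ZM
  by simp
qed

text \<open>
 Such a map is \<open>u p g\<close>, and it depends on \<open>g\<close> only modulo \<open>p\<close>. Splitting \<open>g\<close> modulo \<open>p\<close> into an
 isomorphism and zero makes it a sum of the first map of some \<open>F(p)\<close> and a zero map.
\<close>

lemma extends_multiple:
 assumes u: "u \<in> Units R" and A: "Free A" and B: "Free B" and f: "f \<in> Lin A B"
  and fp: "\<And>x. x \<in> U A ==> f x \<in> multiples p B"
 shows "extends u A f B"
proof -
 note AM = fg_freeD[OF A] and BM = fg_freeD[OF B]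
 have uR: "u \<in> U R" using u by auto
 have "f x \<in> multiples (u \<otimes> p) B" if x: "x \<in> U A" for x
 proof -
  obtain y where y: "y \<in> U B" "f x = p \<odot>\<^bsub>B\<^esub> y" using fp[OF x] by (auto simp: multiples_def)
  have "(u \<otimes> p) \<otimes> inv u = p" using u uR m_comm[of u p] by (simp add: m_assoc)
  then have "p \<odot>\<^bsub>B\<^esub> y = (u \<otimes> p) \<odot>\<^bsub>B\<^esub> (inv u \<odot>\<^bsub>B\<^esub> y)" using y(1) u uR BM by (simp add: mod_smult_assoc[symmetric])
  then show ?thesis using y u BM by (auto simp: multiples_def)
 qed
 then obtain g where g: "g \<in> Lin A B" "\<And>x. x \<in> U A ==> f x = (u \<otimes> p) \<odot>\<^bsub>B\<^esub> g x"
  using projective_scale[OF A BM f m_closed[OF uR p_carr]] by blast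
 note gD = homD[OF g(1)]
 obtain X s t where X: "Free X" "s \<in> Lin X A" "t \<in> Lin B X"
  "\<And>x. x \<in> U X ==> t (g (s x)) = x" "\<And>x. x \<in> U A ==> g x \<ominus>\<^bsub>B\<^esub> g (s (t (g x))) \<in> multiples p B"
  by (rule rank_factorization[OF A B g(1)]) blast
 note XM = fg_freeD[OF X(1)] and sD = homD[OF X(2)] and tD = homD[OF X(3)]
 let ?r = "\<lambda>x\<in>U A. t (g x)" and ?s = "\<lambda>x\<in>U X. g (s x)"
 have r: "?r \<in> Lin A X" and s': "?s \<in> Lin X B"
  using hom_comp[OF AM g(1) X(3)] hom_comp[OF XM X(2) g(1)] .
 obtain K j k where K: "Free K" "bip X K A s j ?r k"
  using retract_bip[OF A X(1) X(2) r] X(4) sD(1) by auto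
 obtain L j' k' where L: "Free L" "bip X L B ?s j' t k'"
  using retract_bip[OF B X(1) s' X(3)] X(4) by auto
 note k'D = homD[OF bipD(4)[OF L(2)]] and LM = fg_freeD[OF L(1)]
 have e1: "extends u X (fp u X S1) X" unfolding extends_def using in_class_fp[OF u X(1)] by blast
 show ?thesis
 proof (rule extends_sum[OF uR e1 extends_zero[OF uR K(1) L(1)] A B f K(2) L(2)])
  fix x assume x: "x \<in> U A"
  have tg: "t (g x) \<in> U X" using x gD tD by simp
  show "t (f x) = fp u X S1 (?r x)"
   using x tg gD(1)[OF x] uR XM by (simp add: g(2) tD fp_first mod_smult_assoc)
  have gx: "g x \<in> U B" "g (s (t (g x))) \<in> U B" using x gD(1) sD(1) tD(1) by simp_all
  have "k' (g x \<ominus>\<^bsub>B\<^esub> g (s (t (g x)))) = k' (g x) \<ominus>\<^bsub>L\<^esub> k' (?s (t (g x)))"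
   using gx tg BM LM by (simp add: k'D)
  also have "\<dots> = k' (g x)" using bipD(6)[OF L(2) tg] k'D(1)[OF gx(1)] LM by (simp add: mod_norm)
  finally have "k' (g x) \<in> multiples p L"
   using multiples_hom[OF bipD(4)[OF L(2)] p_carr X(5)[OF x]] by simp
  then obtain y where y: "y \<in> U L" "k' (g x) = p \<odot>\<^bsub>L\<^esub> y" by (auto simp: multiples_def)
  have "k' (f x) = u \<odot>\<^bsub>L\<^esub> (p \<odot>\<^bsub>L\<^esub> (p \<odot>\<^bsub>L\<^esub> y))"
   using x gx uR y LM by (simp add: g(2) k'D mod_smult_assoc)
  also have "\<dots> = \<zero>\<^bsub>L\<^esub>" using y(1) uR LM by simp
  finally show "k' (f x) = (\<lambda>x\<in>U K. \<zero>\<^bsub>L\<^esub>) (k x)" using hom_closed[OF bipD(4)[OF K(2)] x] by simp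
 qed
qed

text \<open>
 Modulo \<open>p\<close> the map is an isomorphism of summands plus zero; splitting off the isomorphism leaves a
 map with image in \<open>p B\<close>.
\<close>

lemma extends_every_map:
 assumes u: "u \<in> Units R" and A: "Free A" and B: "Free B" and f: "f \<in> Lin A B"
 shows "extends u A f B"
proof -
 note AM = fg_freeD[OF A] and BM = fg_freeD[OF B]
 have uR: "u \<in> U R" using u by auto
 note fD = homD[OF f]
 obtain X s t where X: "Free X" "s \<in> Lin X A" "t \<in> Lin B X"
  "\<And>x. x \<in> U X ==> t (f (s x)) = x" "\<And>x. x \<in> U A ==> f x \<ominus>\<^bsub>B\<^esub> f (s (t (f x))) \<in> multiples p B"
  by (rule rank_factorization[OF A B f]) blast
 note XM = fg_freeD[OF X(1)] and sD = homD[OF X(2)] and tD = homD[OF X(3)]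
 let ?r = "\<lambda>x\<in>U A. t (f x)" and ?s = "\<lambda>x\<in>U X. f (s x)"
 have r: "?r \<in> Lin A X" and s': "?s \<in> Lin X B"
  using hom_comp[OF AM f X(3)] hom_comp[OF XM X(2) f] .
 obtain K j k where K: "Free K" "bip X K A s j ?r k"
  using retract_bip[OF A X(1) X(2) r] X(4) sD(1) by auto
 obtain L j' k' where L: "Free L" "bip X L B ?s j' t k'"
  using retract_bip[OF B X(1) s' X(3)] X(4) by auto
 note k'D = homD[OF bipD(4)[OF L(2)]] and LM = fg_freeD[OF L(1)] and KM = fg_freeD[OF K(1)]
  and jD = homD[OF bipD(2)[OF K(2)]] and kD = homD[OF bipD(4)[OF K(2)]]
 obtain Z where Z: "zero_mod Z" using zero_mod_exists .
 have e1: "extends u X (\<lambda>x\<in>U X. x) X" unfolding extends_def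
 proof (intro exI conjI)
  show "in_class u (T_obj 1 Z X) (T_map 1 Z X)" using n_ge by (intro T_in_class[OF _ Z X(1) uR]) simp
 qed (use n_ge in \<open>auto simp: T_obj_def T_map_def cyc_index_self\<close>)
 have k'p: "k' (f x) \<in> multiples p L" if x: "x \<in> U A" for x
 proof -
  have tg: "t (f x) \<in> U X" using x fD tD by simp
  have gx: "f x \<in> U B" "f (s (t (f x))) \<in> U B" using x fD(1) sD(1) tD(1) by simp_all
  have "k' (f x \<ominus>\<^bsub>B\<^esub> f (s (t (f x)))) = k' (f x) \<ominus>\<^bsub>L\<^esub> k' (?s (t (f x)))"
   using gx tg BM LM by (simp add: k'D)
  also have "\<dots> = k' (f x)" using bipD(6)[OF L(2) tg] k'D(1)[OF gx(1)] LM by (simp add: mod_norm)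
  finally show ?thesis using multiples_hom[OF bipD(4)[OF L(2)] p_carr X(5)[OF x]] by simp
 qed
 let ?f2 = "\<lambda>x\<in>U K. k' (f (j x))"
 have f2: "?f2 \<in> Lin K L"
  using hom_comp[OF KM hom_comp[OF KM bipD(2)[OF K(2)] f] bipD(4)[OF L(2)]] by (simp cong: restrict_cong)
 have e2: "extends u K ?f2 L"
  using k'p jD(1) by (intro extends_multiple[OF u K(1) L(1) f2]) simp
 show ?thesis
 proof (rule extends_sum[OF uR e1 e2 A B f K(2) L(2)])
  fix x assume x: "x \<in> U A"
  have tg: "t (f x) \<in> U X" using x fD tD by simp
  show "t (f x) = (\<lambda>x\<in>U X. x) (?r x)" using x tg by simp
  have kx: "k x \<in> U K" "j (k x) \<in> U A" "s (t (f x)) \<in> U A" using kD(1) jD(1) x sD(1) tg by simp_all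
  have "x = s (t (f x)) \<oplus>\<^bsub>A\<^esub> j (k x)" using bipD(9)[OF K(2) x] x by simp
  then have "k' (f x) = k' (f (s (t (f x)) \<oplus>\<^bsub>A\<^esub> j (k x)))" by simp
  also have "\<dots> = k' (?s (t (f x))) \<oplus>\<^bsub>L\<^esub> k' (f (j (k x)))" using kx tg fD(1) by (simp add: fD(2) k'D(2))
  also have "\<dots> = k' (f (j (k x)))" using bipD(6)[OF L(2) tg] k'D(1) fD(1) kx LM by (simp add: mod_l_zero)
  finally show "k' (f x) = ?f2 (k x)" using kx by simp
 qed
qed

end

section \<open>Morphisms of minimal sequences\<close>

context angulation_setting
begin

lemma fp_val:
 assumes "u \<in> U R" "module R F" "x \<in> U F"
 shows "fp u F i x = (if cyc i = 1 then u \<odot>\<^bsub>F\<^esub> (p \<odot>\<^bsub>F\<^esub> x) else p \<odot>\<^bsub>F\<^esub> x)"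
 using assms by (simp add: fp_def mod_smult_assoc)

lemma p_scale_eqD:
 assumes F: "Free F" and x: "x \<in> U F" "y \<in> U F" and e: "p \<odot>\<^bsub>F\<^esub> x = p \<odot>\<^bsub>F\<^esub> y"
 obtains w where "w \<in> U F" "x = y \<oplus>\<^bsub>F\<^esub> p \<odot>\<^bsub>F\<^esub> w"
proof -
 note FM = fg_freeD[OF F]
 have "p \<odot>\<^bsub>F\<^esub> (x \<ominus>\<^bsub>F\<^esub> y) = \<zero>\<^bsub>F\<^esub>" using x e FM by (simp add: mod_norm)
 then obtain w where w: "w \<in> U F" "x \<ominus>\<^bsub>F\<^esub> y = p \<odot>\<^bsub>F\<^esub> w"
  using p_annihilated[OF F] x FM by (metis mod_closed(4))
 then have "x = y \<oplus>\<^bsub>F\<^esub> p \<odot>\<^bsub>F\<^esub> w" using x FM by (subst mod_eq_sub_iff) auto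
 then show thesis using that w(1) by blast
qed

text \<open>
 The chains in the mapping cone of a morphism \<open>f : F(p) \<rightarrow> G(p)\<close> with components \<open>A\<close> and \<open>B\<close>,
 starting at the second position of \<open>F(p)\<close> and the first of \<open>G(p)\<close>.
\<close>

definition cone_chain :: "'a => ('a, 'm) module => ('a, 'm) module => (nat => 'm => 'm) => (nat => 'm) => (nat => 'm) => bool"
 where "cone_chain u F G f A B \<longleftrightarrow> (\<forall>j\<le>n. A j \<in> U F \<and> B j \<in> U G) \<and>
  (\<forall>j<n. fp u F (Suc (Suc j)) (A j) = \<ominus>\<^bsub>F\<^esub> (p \<odot>\<^bsub>F\<^esub> A (Suc j)) \<and>
   f (Suc (Suc j)) (A j) \<oplus>\<^bsub>G\<^esub> fp u G (Suc j) (B j) = p \<odot>\<^bsub>G\<^esub> B (Suc j))"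

text \<open>
 All components agree modulo \<open>p\<close>. The components at the positions \<open>3, \<dots>, n-1\<close> are taken to be
 \<open>f2\<close>. Along a chain of the cone the first coordinate alternates in sign modulo \<open>p\<close>, so that the
 contributions of the components to \<open>p B\<^sub>n\<close> cancel in pairs. For even \<open>n\<close> the components at \<open>n\<close> and
 \<open>n + 1\<close> are both \<open>f1\<close> and cancel too. For odd \<open>n\<close> the last component must cancel \<open>f2\<close>, and the
 contribution of \<open>f1\<close> is left over; the correction \<open>\<epsilon>\<close>, the part of \<open>f1\<close> that vanishes modulo
 \<open>p\<close>, reduces it to a value of \<open>p f1\<close>. Such a value is a boundary in the cone.
\<close>

lemma model_morphism:
 fixes F G :: "('a, 'm) module"
 assumes u: "u \<in> Units R" and F: "Free F" and G: "Free G"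
  and f1: "f1 \<in> Lin F G" and f2: "f2 \<in> Lin F G"
  and eq: "\<And>x. x \<in> U F ==> p \<odot>\<^bsub>G\<^esub> f1 x = p \<odot>\<^bsub>G\<^esub> f2 x"
 obtains f where "cmor (\<lambda>_. F) (fp u F) (\<lambda>_. G) (fp u G) f" "f S1 = f1" "f S2 = f2"
  "\<And>A B. cone_chain u F G f A B ==> p \<odot>\<^bsub>F\<^esub> A n = u \<odot>\<^bsub>F\<^esub> (p \<odot>\<^bsub>F\<^esub> A 0) \<and> p \<odot>\<^bsub>G\<^esub> f1 (A 0) = \<zero>\<^bsub>G\<^esub> \<and>
   (\<exists>e\<in>U F. p \<odot>\<^bsub>G\<^esub> B n = u \<odot>\<^bsub>G\<^esub> (p \<odot>\<^bsub>G\<^esub> B 0) \<oplus>\<^bsub>G\<^esub> p \<odot>\<^bsub>G\<^esub> f1 e)"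
proof -
 note FM = fg_freeD[OF F] and GM = fg_freeD[OF G] and f1D = homD[OF f1] and f2D = homD[OF f2]
 have uR: "u \<in> U R" using u by auto
 obtain X s t where X: "Free X" "s \<in> Lin X F" "t \<in> Lin G X"
  "\<And>x. x \<in> U X ==> t (f1 (s x)) = x" "\<And>x. x \<in> U F ==> f1 x \<ominus>\<^bsub>G\<^esub> f1 (s (t (f1 x))) \<in> multiples p G"
  by (rule rank_factorization[OF F G f1]) blast
 note XM = fg_freeD[OF X(1)] and sD = homD[OF X(2)] and tD = homD[OF X(3)]
 define h where "h = (\<lambda>x\<in>U F. f1 (s (t (f1 x))))"
 define \<epsilon> where "\<epsilon> = (\<lambda>x\<in>U F. f1 x \<ominus>\<^bsub>G\<^esub> h x)"
 have hh: "h \<in> Lin F G" unfolding h_def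
  by (rule homI) (auto simp: f1D sD tD FM)
 have \<epsilon>h: "\<epsilon> \<in> Lin F G" unfolding \<epsilon>_def by (rule hom_diff[OF FM GM f1 hh])
 note hD = homD[OF hh] and \<epsilon>D = homD[OF \<epsilon>h]
 have \<epsilon>p: "p \<odot>\<^bsub>G\<^esub> \<epsilon> x = \<zero>\<^bsub>G\<^esub>" if "x \<in> U F" for x
 proof -
  have "\<epsilon> x \<in> multiples p G" using X(5)[OF that] that by (simp add: \<epsilon>_def h_def)
  then show ?thesis using GM by (auto simp: multiples_def)
 qed
 define l where "l = (if even n then f1 else (\<lambda>x\<in>U F. f2 x \<oplus>\<^bsub>G\<^esub> \<epsilon> x))"
 have lh: "l \<in> Lin F G" using f1 hom_sum[OF FM GM f2 \<epsilon>h] by (simp add: l_def)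
 define f where "f m = (if cyc m = 1 then f1 else if cyc m = n then l else f2)" for m
 have fh: "f m \<in> Lin F G" for m using f1 f2 lh by (simp add: f_def)
 note fD = homD[OF fh]
 have pf: "p \<odot>\<^bsub>G\<^esub> f m x = p \<odot>\<^bsub>G\<^esub> f1 x" if x: "x \<in> U F" for m x
  using x eq[OF x] \<epsilon>p[OF x] GM f2D(1)[OF x] \<epsilon>D(1)[OF x]
  by (simp add: f_def l_def mod_smult_radd mod_r_zero)
 have cm: "cmor (\<lambda>_. F) (fp u F) (\<lambda>_. G) (fp u G) f" unfolding cmor_def
 proof (intro allI conjI ballI)
  fix i x assume x: "x \<in> U F"
  have "f (Suc i) (p \<odot>\<^bsub>F\<^esub> x) = p \<odot>\<^bsub>G\<^esub> f i x" using x pf[OF x] by (simp add: fD)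
  then show "f (Suc i) (fp u F i x) = fp u G i (f i x)"
   using x uR FM GM fD(1)[OF x] by (simp add: fp_val fD)
 qed (use fh in \<open>auto simp: f_def\<close>)
 have c1: "cyc S1 = 1" "cyc S2 = 2" using n_ge by (auto simp: cyc_index_self)
 have fv: "f S1 = f1" "f S2 = f2" "f n = l" "f (Suc n) = f1"
  using n_ge c1 cyc_index_add[of n 1] by (auto simp: f_def cyc_index_self)
 have fm: "f m = f2" if "2 \<le> m" "m < n" for m using that by (simp add: f_def cyc_index_self)
 have main: "p \<odot>\<^bsub>F\<^esub> A n = u \<odot>\<^bsub>F\<^esub> (p \<odot>\<^bsub>F\<^esub> A 0) \<and> p \<odot>\<^bsub>G\<^esub> f1 (A 0) = \<zero>\<^bsub>G\<^esub> \<and>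
   (\<exists>e\<in>U F. p \<odot>\<^bsub>G\<^esub> B n = u \<odot>\<^bsub>G\<^esub> (p \<odot>\<^bsub>G\<^esub> B 0) \<oplus>\<^bsub>G\<^esub> p \<odot>\<^bsub>G\<^esub> f1 e)"
  if ch: "cone_chain u F G f A B" for A B
 proof -
  have A: "A j \<in> U F" and B: "B j \<in> U G" if "j \<le> n" for j using ch that by (auto simp: cone_chain_def)
  have stA: "fp u F (Suc (Suc j)) (A j) = \<ominus>\<^bsub>F\<^esub> (p \<odot>\<^bsub>F\<^esub> A (Suc j))"
   and stB: "f (Suc (Suc j)) (A j) \<oplus>\<^bsub>G\<^esub> fp u G (Suc j) (B j) = p \<odot>\<^bsub>G\<^esub> B (Suc j)" if "j < n" for j
   using ch that by (auto simp: cone_chain_def)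
  have A0: "A 0 \<in> U F" and B0: "B 0 \<in> U G" using A B by auto
  have stA': "p \<odot>\<^bsub>F\<^esub> A (Suc j) = \<ominus>\<^bsub>F\<^esub> (p \<odot>\<^bsub>F\<^esub> A j)" if j: "Suc j < n" for j
  proof -
   have "cyc (Suc (Suc j)) \<noteq> 1" using j by (simp add: cyc_index_self)
   then have "p \<odot>\<^bsub>F\<^esub> A j = \<ominus>\<^bsub>F\<^esub> (p \<odot>\<^bsub>F\<^esub> A (Suc j))" using stA[of j] j A[of j] uR FM by (simp add: fp_val)
   then show ?thesis using A[of "Suc j"] j FM by (simp add: mod_neg_neg)
  qed
  have sgn: "p \<odot>\<^bsub>F\<^esub> A j = (if even j then p \<odot>\<^bsub>F\<^esub> A 0 else \<ominus>\<^bsub>F\<^esub> (p \<odot>\<^bsub>F\<^esub> A 0))" if "j < n" for j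
   using that
  proof (induction j)
   case (Suc j)
   then show ?case using stA'[of j] A0 FM by (auto simp: mod_neg_neg)
  qed simp
  have val_even: "\<exists>w\<in>U F. \<forall>g\<in>Lin F G. g (A j) = g (A 0) \<oplus>\<^bsub>G\<^esub> p \<odot>\<^bsub>G\<^esub> g w" if j: "j < n" "even j" for j
  proof -
   obtain w where w: "w \<in> U F" "A j = A 0 \<oplus>\<^bsub>F\<^esub> p \<odot>\<^bsub>F\<^esub> w"
    using p_scale_eqD[OF F, of "A j" "A 0"] sgn[OF j(1)] j A[of j] A0 by auto
   then show ?thesis using A0 FM by (intro bexI[of _ w]) (auto simp: homD)
  qed
  have val_odd: "\<exists>w\<in>U F. \<forall>g\<in>Lin F G. g (A j) = \<ominus>\<^bsub>G\<^esub> g (A 0) \<oplus>\<^bsub>G\<^esub> p \<odot>\<^bsub>G\<^esub> g w" if j: "j < n" "odd j" for j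
  proof -
   have "p \<odot>\<^bsub>F\<^esub> A j = p \<odot>\<^bsub>F\<^esub> (\<ominus>\<^bsub>F\<^esub> A 0)" using sgn[OF j(1)] j(2) A0 FM by (simp add: mod_smult_rneg)
   then obtain w where w: "w \<in> U F" "A j = \<ominus>\<^bsub>F\<^esub> A 0 \<oplus>\<^bsub>F\<^esub> p \<odot>\<^bsub>F\<^esub> w"
    using p_scale_eqD[OF F, of "A j" "\<ominus>\<^bsub>F\<^esub> A 0"] j(1) A[of j] A0 FM by auto
   then show ?thesis using A0 FM GM by (intro bexI[of _ w]) (auto simp: homD)
  qed
  let ?b = "u \<odot>\<^bsub>G\<^esub> (p \<odot>\<^bsub>G\<^esub> B 0)"
  have b: "?b \<in> U G" using B0 uR GM by simp
  have B1: "p \<odot>\<^bsub>G\<^esub> B S1 = f2 (A 0) \<oplus>\<^bsub>G\<^esub> ?b"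
   using stB[of 0] n_ge c1 fv B0 uR GM by (simp add: fp_val)
  have stB': "p \<odot>\<^bsub>G\<^esub> B (Suc j) = f (Suc (Suc j)) (A j) \<oplus>\<^bsub>G\<^esub> p \<odot>\<^bsub>G\<^esub> B j" if j: "0 < j" "j < n" for j
  proof -
   have "cyc (Suc j) \<noteq> 1" using j by (simp add: cyc_index_self)
   then show ?thesis using stB[OF j(2)] B[of j] j uR GM by (simp add: fp_val)
  qed
  have f2A0: "p \<odot>\<^bsub>G\<^esub> f2 (A 0) = \<zero>\<^bsub>G\<^esub>"
  proof -
   have B1c: "B S1 \<in> U G" using B[of S1] n_ge by simp
   have "f2 (A 0) = p \<odot>\<^bsub>G\<^esub> B S1 \<ominus>\<^bsub>G\<^esub> ?b"
    unfolding B1 using f2D(1)[OF A0] b GM by algebra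
   then show ?thesis using B1c b B0 uR GM by (simp add: mod_norm mod_scale_comm[of G p u])
  qed
  then have f1A0: "p \<odot>\<^bsub>G\<^esub> f1 (A 0) = \<zero>\<^bsub>G\<^esub>" using eq[OF A0] by simp
  have partial: "\<exists>e\<in>U F. p \<odot>\<^bsub>G\<^esub> B (Suc k) =
    (if even k then ?b \<oplus>\<^bsub>G\<^esub> (f2 (A 0) \<oplus>\<^bsub>G\<^esub> p \<odot>\<^bsub>G\<^esub> f1 e) else ?b \<oplus>\<^bsub>G\<^esub> p \<odot>\<^bsub>G\<^esub> f1 e)" if "k + 3 \<le> n" for k
   using that
  proof (induction k)
   case 0
   have "f2 (A 0) \<oplus>\<^bsub>G\<^esub> ?b = ?b \<oplus>\<^bsub>G\<^esub> (f2 (A 0) \<oplus>\<^bsub>G\<^esub> p \<odot>\<^bsub>G\<^esub> f1 \<zero>\<^bsub>F\<^esub>)"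
    using f2D(1)[OF A0] b FM GM by (simp add: f1D(4)) (simp add: mod_norm)
   then show ?case using B1 FM by (intro bexI[of _ "\<zero>\<^bsub>F\<^esub>"]) auto
  next
   case (Suc k)
   then obtain e where e: "e \<in> U F" "p \<odot>\<^bsub>G\<^esub> B (Suc k) =
    (if even k then ?b \<oplus>\<^bsub>G\<^esub> (f2 (A 0) \<oplus>\<^bsub>G\<^esub> p \<odot>\<^bsub>G\<^esub> f1 e) else ?b \<oplus>\<^bsub>G\<^esub> p \<odot>\<^bsub>G\<^esub> f1 e)" by auto
   have st: "p \<odot>\<^bsub>G\<^esub> B (Suc (Suc k)) = f2 (A (Suc k)) \<oplus>\<^bsub>G\<^esub> p \<odot>\<^bsub>G\<^esub> B (Suc k)"
    using stB'[of "Suc k"] fm[of "Suc (Suc (Suc k))"] Suc.prems by simp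
   show ?case
   proof (cases "even k")
    case True
    then obtain w where w: "w \<in> U F" "f2 (A (Suc k)) = \<ominus>\<^bsub>G\<^esub> f2 (A 0) \<oplus>\<^bsub>G\<^esub> p \<odot>\<^bsub>G\<^esub> f2 w"
     using val_odd[of "Suc k"] f2 Suc.prems by auto
    have "p \<odot>\<^bsub>G\<^esub> B (Suc (Suc k)) = (\<ominus>\<^bsub>G\<^esub> f2 (A 0) \<oplus>\<^bsub>G\<^esub> p \<odot>\<^bsub>G\<^esub> f1 w) \<oplus>\<^bsub>G\<^esub> (?b \<oplus>\<^bsub>G\<^esub> (f2 (A 0) \<oplus>\<^bsub>G\<^esub> p \<odot>\<^bsub>G\<^esub> f1 e))"
     unfolding st w(2) using e(2) True eq[OF w(1)] by simp
    also have "\<dots> = ?b \<oplus>\<^bsub>G\<^esub> p \<odot>\<^bsub>G\<^esub> (f1 w \<oplus>\<^bsub>G\<^esub> f1 e)"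
     using f2D(1)[OF A0] f1D(1)[OF w(1)] f1D(1)[OF e(1)] b GM p_carr by algebra
    also have "\<dots> = ?b \<oplus>\<^bsub>G\<^esub> p \<odot>\<^bsub>G\<^esub> f1 (w \<oplus>\<^bsub>F\<^esub> e)" using w(1) e(1) by (simp add: f1D(2))
    finally show ?thesis using True w(1) e(1) FM by (intro bexI[of _ "w \<oplus>\<^bsub>F\<^esub> e"]) auto
   next
    case False
    then obtain w where w: "w \<in> U F" "f2 (A (Suc k)) = f2 (A 0) \<oplus>\<^bsub>G\<^esub> p \<odot>\<^bsub>G\<^esub> f2 w"
     using val_even[of "Suc k"] f2 Suc.prems by auto
    have "p \<odot>\<^bsub>G\<^esub> B (Suc (Suc k)) = (f2 (A 0) \<oplus>\<^bsub>G\<^esub> p \<odot>\<^bsub>G\<^esub> f1 w) \<oplus>\<^bsub>G\<^esub> (?b \<oplus>\<^bsub>G\<^esub> p \<odot>\<^bsub>G\<^esub> f1 e)"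
     unfolding st w(2) using e(2) False eq[OF w(1)] by simp
    also have "\<dots> = ?b \<oplus>\<^bsub>G\<^esub> (f2 (A 0) \<oplus>\<^bsub>G\<^esub> p \<odot>\<^bsub>G\<^esub> (f1 w \<oplus>\<^bsub>G\<^esub> f1 e))"
     using f2D(1)[OF A0] f1D(1)[OF w(1)] f1D(1)[OF e(1)] b GM p_carr by algebra
    also have "\<dots> = ?b \<oplus>\<^bsub>G\<^esub> (f2 (A 0) \<oplus>\<^bsub>G\<^esub> p \<odot>\<^bsub>G\<^esub> f1 (w \<oplus>\<^bsub>F\<^esub> e))" using w(1) e(1) by (simp add: f1D(2))
    finally show ?thesis using False w(1) e(1) FM by (intro bexI[of _ "w \<oplus>\<^bsub>F\<^esub> e"]) auto
   qed
  qed
  obtain k where k: "n = k + 3" using n_ge le_Suc_ex by (metis add.commute)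
  have st1: "p \<odot>\<^bsub>G\<^esub> B (Suc (Suc k)) = l (A (Suc k)) \<oplus>\<^bsub>G\<^esub> p \<odot>\<^bsub>G\<^esub> B (Suc k)"
   using stB'[of "Suc k"] fv(3) k by (simp add: numeral_3_eq_3)
  have st2: "p \<odot>\<^bsub>G\<^esub> B n = f1 (A (Suc (Suc k))) \<oplus>\<^bsub>G\<^esub> p \<odot>\<^bsub>G\<^esub> B (Suc (Suc k))"
   using stB'[of "Suc (Suc k)"] fv(4) k by (simp add: numeral_3_eq_3)
  obtain e where e: "e \<in> U F" "p \<odot>\<^bsub>G\<^esub> B (Suc k) =
    (if even k then ?b \<oplus>\<^bsub>G\<^esub> (f2 (A 0) \<oplus>\<^bsub>G\<^esub> p \<odot>\<^bsub>G\<^esub> f1 e) else ?b \<oplus>\<^bsub>G\<^esub> p \<odot>\<^bsub>G\<^esub> f1 e)"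
   using partial[of k] k by auto
  have ks: "Suc k < n" "Suc (Suc k) < n" using k by auto
  have last: "\<exists>e\<in>U F. p \<odot>\<^bsub>G\<^esub> B n = ?b \<oplus>\<^bsub>G\<^esub> p \<odot>\<^bsub>G\<^esub> f1 e"
  proof (cases "even n")
   case True
   then have ko: "odd k" "l = f1" using k by (auto simp: l_def)
   obtain w where w: "w \<in> U F" "f1 (A (Suc k)) = f1 (A 0) \<oplus>\<^bsub>G\<^esub> p \<odot>\<^bsub>G\<^esub> f1 w"
    using val_even[OF ks(1)] ko f1 by auto
   obtain w' where w': "w' \<in> U F" "f1 (A (Suc (Suc k))) = \<ominus>\<^bsub>G\<^esub> f1 (A 0) \<oplus>\<^bsub>G\<^esub> p \<odot>\<^bsub>G\<^esub> f1 w'"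
    using val_odd[OF ks(2)] ko f1 by auto
   have "p \<odot>\<^bsub>G\<^esub> B n = (\<ominus>\<^bsub>G\<^esub> f1 (A 0) \<oplus>\<^bsub>G\<^esub> p \<odot>\<^bsub>G\<^esub> f1 w') \<oplus>\<^bsub>G\<^esub> ((f1 (A 0) \<oplus>\<^bsub>G\<^esub> p \<odot>\<^bsub>G\<^esub> f1 w) \<oplus>\<^bsub>G\<^esub> (?b \<oplus>\<^bsub>G\<^esub> p \<odot>\<^bsub>G\<^esub> f1 e))"
    unfolding st2 st1 ko(2) w(2) w'(2) using e(2) ko(1) by simp
   also have "\<dots> = ?b \<oplus>\<^bsub>G\<^esub> p \<odot>\<^bsub>G\<^esub> (f1 w' \<oplus>\<^bsub>G\<^esub> (f1 w \<oplus>\<^bsub>G\<^esub> f1 e))"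
    using f1D(1)[OF A0] f1D(1)[OF w(1)] f1D(1)[OF w'(1)] f1D(1)[OF e(1)] b GM p_carr by algebra
   also have "\<dots> = ?b \<oplus>\<^bsub>G\<^esub> p \<odot>\<^bsub>G\<^esub> f1 (w' \<oplus>\<^bsub>F\<^esub> (w \<oplus>\<^bsub>F\<^esub> e))" using w(1) w'(1) e(1) FM by (simp add: f1D(2))
   finally show ?thesis using w(1) w'(1) e(1) FM by (intro bexI[of _ "w' \<oplus>\<^bsub>F\<^esub> (w \<oplus>\<^bsub>F\<^esub> e)"]) auto
  next
   case False
   then have ko: "even k" using k by auto
   have Ac: "A (Suc k) \<in> U F" using A[of "Suc k"] ks by simp
   obtain w where w: "w \<in> U F" and wg: "\<forall>g\<in>Lin F G. g (A (Suc k)) = \<ominus>\<^bsub>G\<^esub> g (A 0) \<oplus>\<^bsub>G\<^esub> p \<odot>\<^bsub>G\<^esub> g w"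
    using val_odd[OF ks(1)] ko by auto
   obtain w' where w': "w' \<in> U F" "f1 (A (Suc (Suc k))) = f1 (A 0) \<oplus>\<^bsub>G\<^esub> p \<odot>\<^bsub>G\<^esub> f1 w'"
    using val_even[OF ks(2)] ko f1 by auto
   have lA: "l (A (Suc k)) = (\<ominus>\<^bsub>G\<^esub> f2 (A 0) \<oplus>\<^bsub>G\<^esub> p \<odot>\<^bsub>G\<^esub> f1 w) \<oplus>\<^bsub>G\<^esub> \<ominus>\<^bsub>G\<^esub> \<epsilon> (A 0)"
   proof -
    have "\<epsilon> (A (Suc k)) = \<ominus>\<^bsub>G\<^esub> \<epsilon> (A 0)"
     using bspec[OF wg \<epsilon>h] \<epsilon>p[OF w] \<epsilon>D(1)[OF A0] GM by (simp add: mod_r_zero)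
    moreover have "f2 (A (Suc k)) = \<ominus>\<^bsub>G\<^esub> f2 (A 0) \<oplus>\<^bsub>G\<^esub> p \<odot>\<^bsub>G\<^esub> f1 w"
     using bspec[OF wg f2] eq[OF w] by simp
    ultimately show ?thesis using False Ac by (simp add: l_def)
   qed
   obtain y where y: "y \<in> U G" "f1 (A 0) = p \<odot>\<^bsub>G\<^esub> y" using p_annihilated[OF G f1D(1)[OF A0] f1A0] .
   have ty: "s (t y) \<in> U F" using sD(1) tD(1) y(1) by simp
   have "h (A 0) = p \<odot>\<^bsub>G\<^esub> f1 (s (t y))" using A0 y tD(1)[OF y(1)] ty by (simp add: h_def tD(3) sD(3) f1D(3))
   then have \<epsilon>A: "\<epsilon> (A 0) = f1 (A 0) \<ominus>\<^bsub>G\<^esub> p \<odot>\<^bsub>G\<^esub> f1 (s (t y))" using A0 by (simp add: \<epsilon>_def)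
   have "p \<odot>\<^bsub>G\<^esub> B n = (f1 (A 0) \<oplus>\<^bsub>G\<^esub> p \<odot>\<^bsub>G\<^esub> f1 w') \<oplus>\<^bsub>G\<^esub>
     (((\<ominus>\<^bsub>G\<^esub> f2 (A 0) \<oplus>\<^bsub>G\<^esub> p \<odot>\<^bsub>G\<^esub> f1 w) \<oplus>\<^bsub>G\<^esub> \<ominus>\<^bsub>G\<^esub> (f1 (A 0) \<ominus>\<^bsub>G\<^esub> p \<odot>\<^bsub>G\<^esub> f1 (s (t y)))) \<oplus>\<^bsub>G\<^esub>
      (?b \<oplus>\<^bsub>G\<^esub> (f2 (A 0) \<oplus>\<^bsub>G\<^esub> p \<odot>\<^bsub>G\<^esub> f1 e)))"
    unfolding st2 st1 lA \<epsilon>A w'(2) using e(2) ko by simp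
   also have "\<dots> = ?b \<oplus>\<^bsub>G\<^esub> p \<odot>\<^bsub>G\<^esub> (f1 w' \<oplus>\<^bsub>G\<^esub> (f1 w \<oplus>\<^bsub>G\<^esub> (f1 (s (t y)) \<oplus>\<^bsub>G\<^esub> f1 e)))"
   proof -
    define a1 where "a1 = f1 (A 0)"
    define a2 where "a2 = f2 (A 0)"
    define x1 where "x1 = p \<odot>\<^bsub>G\<^esub> f1 w'"
    define x2 where "x2 = p \<odot>\<^bsub>G\<^esub> f1 w"
    define x3 where "x3 = p \<odot>\<^bsub>G\<^esub> f1 (s (t y))"
    define x4 where "x4 = p \<odot>\<^bsub>G\<^esub> f1 e"
    have m: "a1 \<in> U G" "a2 \<in> U G" "x1 \<in> U G" "x2 \<in> U G" "x3 \<in> U G" "x4 \<in> U G"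
     using A0 w w'(1) e(1) ty f1D(1) f2D(1) GM by (simp_all add: a1_def a2_def x1_def x2_def x3_def x4_def)
    have "(a1 \<oplus>\<^bsub>G\<^esub> x1) \<oplus>\<^bsub>G\<^esub> (((\<ominus>\<^bsub>G\<^esub> a2 \<oplus>\<^bsub>G\<^esub> x2) \<oplus>\<^bsub>G\<^esub> \<ominus>\<^bsub>G\<^esub> (a1 \<ominus>\<^bsub>G\<^esub> x3)) \<oplus>\<^bsub>G\<^esub> (?b \<oplus>\<^bsub>G\<^esub> (a2 \<oplus>\<^bsub>G\<^esub> x4)))
      = ?b \<oplus>\<^bsub>G\<^esub> (x1 \<oplus>\<^bsub>G\<^esub> (x2 \<oplus>\<^bsub>G\<^esub> (x3 \<oplus>\<^bsub>G\<^esub> x4)))"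
    proof -
     define c where "c = ?b"
     have c: "c \<in> U G" using b by (simp add: c_def)
     have "(a1 \<oplus>\<^bsub>G\<^esub> x1) \<oplus>\<^bsub>G\<^esub> (((\<ominus>\<^bsub>G\<^esub> a2 \<oplus>\<^bsub>G\<^esub> x2) \<oplus>\<^bsub>G\<^esub> \<ominus>\<^bsub>G\<^esub> (a1 \<ominus>\<^bsub>G\<^esub> x3)) \<oplus>\<^bsub>G\<^esub> (c \<oplus>\<^bsub>G\<^esub> (a2 \<oplus>\<^bsub>G\<^esub> x4)))
      = (a1 \<oplus>\<^bsub>G\<^esub> \<ominus>\<^bsub>G\<^esub> a1) \<oplus>\<^bsub>G\<^esub> ((a2 \<oplus>\<^bsub>G\<^esub> \<ominus>\<^bsub>G\<^esub> a2) \<oplus>\<^bsub>G\<^esub> (c \<oplus>\<^bsub>G\<^esub> (x1 \<oplus>\<^bsub>G\<^esub> (x2 \<oplus>\<^bsub>G\<^esub> (x3 \<oplus>\<^bsub>G\<^esub> x4)))))"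
      using m c GM by (simp add: a_minus_def mod_minus_add mod_neg_neg mod_ac)
     then show ?thesis using m c GM by (simp add: mod_r_neg mod_l_zero c_def[symmetric])
    qed
    then show ?thesis
     using w w'(1) e(1) ty f1D(1) GM by (simp add: a1_def a2_def x1_def x2_def x3_def x4_def mod_smult_radd)
   qed
   also have "\<dots> = ?b \<oplus>\<^bsub>G\<^esub> p \<odot>\<^bsub>G\<^esub> f1 (w' \<oplus>\<^bsub>F\<^esub> (w \<oplus>\<^bsub>F\<^esub> (s (t y) \<oplus>\<^bsub>F\<^esub> e)))"
    using w w'(1) e(1) ty FM by (simp add: f1D(2))
   finally show ?thesis using w w'(1) e(1) ty FM by (intro bexI[of _ "w' \<oplus>\<^bsub>F\<^esub> (w \<oplus>\<^bsub>F\<^esub> (s (t y) \<oplus>\<^bsub>F\<^esub> e))"]) auto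
  qed
  have "p \<odot>\<^bsub>F\<^esub> A n = u \<odot>\<^bsub>F\<^esub> (p \<odot>\<^bsub>F\<^esub> A 0)"
  proof -
   have Ac: "A (Suc (Suc k)) \<in> U F" "A n \<in> U F" using A ks by simp_all
   have idx: "Suc (Suc (Suc k)) = n" using k by simp
   have c: "cyc (Suc n) = 1" using cyc_index_add[of n 1] c1 by simp
   have "u \<odot>\<^bsub>F\<^esub> (p \<odot>\<^bsub>F\<^esub> A (Suc (Suc k))) = \<ominus>\<^bsub>F\<^esub> (p \<odot>\<^bsub>F\<^esub> A n)"
    using stA[OF ks(2), unfolded idx] Ac uR FM c by (simp add: fp_val)
   then have e1: "p \<odot>\<^bsub>F\<^esub> A n = \<ominus>\<^bsub>F\<^esub> (u \<odot>\<^bsub>F\<^esub> (p \<odot>\<^bsub>F\<^esub> A (Suc (Suc k))))" using Ac FM by (simp add: mod_neg_neg)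
   show ?thesis
   proof (cases "even n")
    case True
    then have "p \<odot>\<^bsub>F\<^esub> A (Suc (Suc k)) = \<ominus>\<^bsub>F\<^esub> (p \<odot>\<^bsub>F\<^esub> A 0)" using sgn[OF ks(2)] k by simp
    then show ?thesis using e1 A0 uR FM by (simp add: mod_smult_rneg mod_neg_neg)
   next
    case False
    then have pp: "p \<oplus> p = \<zero>" using parity by simp
    have "p \<odot>\<^bsub>F\<^esub> A (Suc (Suc k)) = p \<odot>\<^bsub>F\<^esub> A 0" using sgn[OF ks(2)] k False by simp
    then have "p \<odot>\<^bsub>F\<^esub> A n = u \<odot>\<^bsub>F\<^esub> (\<ominus>\<^bsub>F\<^esub> (p \<odot>\<^bsub>F\<^esub> A 0))" using e1 A0 uR FM by (simp add: mod_smult_rneg)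
    then show ?thesis using p_neg[OF pp FM A0] by simp
   qed
  qed
  then show ?thesis using f1A0 last by blast
 qed
 show thesis using that[OF cm fv(1,2) main] .
qed

lemma cmor_comp:
 assumes M: "cseq M a" and f: "cmor M a N b f" and g: "cmor N b K c g"
 shows "cmor M a K c (\<lambda>k. \<lambda>x\<in>U (M k). g k (f k x))"
 unfolding cmor_def
proof (intro allI conjI ballI)
 fix i
 show "(\<lambda>x\<in>U (M i). g i (f i x)) \<in> Lin (M i) (K i)"
  using hom_comp[OF cseqD(2)[OF M] cmorD(1)[OF f] cmorD(1)[OF g]] .
 show "(\<lambda>x\<in>U (M (i + n)). g (i + n) (f (i + n) x)) = (\<lambda>x\<in>U (M i). g i (f i x))"
  using cmorD(2)[OF f] cmorD(2)[OF g] cseqD(4)[OF M] by simp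
 fix x assume x: "x \<in> U (M i)"
 then show "(\<lambda>x\<in>U (M (Suc i)). g (Suc i) (f (Suc i) x)) (a i x) = c i ((\<lambda>x\<in>U (M i). g i (f i x)) x)"
  using hom_closed[OF cseqD(3)[OF M] x] hom_closed[OF cmorD(1)[OF f] x] cmorD(3)[OF f x] cmorD(3)[OF g] by simp
qed

lemma periodic_pred: "(\<And>i. f (i + n) = f i) ==> f (cyc (Suc k) - 1) = f k"
proof -
 assume per: "\<And>i. f (i + n) = f i"
 have "cyc (Suc k) - 1 = (k + n) mod n" by (simp add: cyc_index_def)
 then have "k + n = (cyc (Suc k) - 1) + n * ((k + n) div n)" using mod_mult_div_eq[of "k + n" n] by simp
 then show ?thesis using periodic_mult[of f n "cyc (Suc k) - 1" "(k + n) div n"] per by metis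
qed

text \<open>
 Adding \<open>\<xi> a + b \<xi>\<close> to a morphism gives a morphism.
\<close>

lemma homotopic_morphism:
 assumes M: "cseq M a" and N: "cseq N b" and nM: "null_composites M a" and nN: "null_composites N b"
  and \<psi>: "cmor M a N b \<psi>" and \<xi>: "\<And>k. \<xi> k \<in> Lin (M (Suc k)) (N k)" and \<xi>p: "\<And>k. \<xi> (k + n) = \<xi> k"
 obtains \<phi> where "cmor M a N b \<phi>" "\<And>k x. x \<in> U (M (Suc k)) ==>
  \<phi> (Suc k) x = \<psi> (Suc k) x \<oplus>\<^bsub>N (Suc k)\<^esub> (\<xi> (Suc k) (a (Suc k) x) \<oplus>\<^bsub>N (Suc k)\<^esub> b k (\<xi> k x))"
proof -
 note MD = cseqD[OF M] and ND = cseqD[OF N] and aD = homD[OF cseqD(3)[OF M]] and bD = homD[OF cseqD(3)[OF N]]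
  and \<psi>D = homD[OF cmorD(1)[OF \<psi>]] and \<xi>D = homD[OF \<xi>]
 define \<Phi> where "\<Phi> k = (\<lambda>x\<in>U (M (Suc k)). \<psi> (Suc k) x \<oplus>\<^bsub>N (Suc k)\<^esub> (\<xi> (Suc k) (a (Suc k) x) \<oplus>\<^bsub>N (Suc k)\<^esub> b k (\<xi> k x)))" for k
 have per: "\<Phi> (k + n) = \<Phi> k" for k
  using MD(6) ND(6) MD(5)[of "Suc k"] ND(5) \<xi>p[of k] \<xi>p[of "Suc k"] cmorD(2)[OF \<psi>, of "Suc k"] by (simp add: \<Phi>_def)
 have h: "\<Phi> k \<in> Lin (M (Suc k)) (N (Suc k))" for k
  using hom_sum[OF MD(2) ND(2) cmorD(1)[OF \<psi>] hom_sum[OF MD(2) ND(2) hom_comp[OF MD(2) MD(3) \<xi>] hom_comp[OF MD(2) \<xi> ND(3)]]]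
  by (simp add: \<Phi>_def cong: restrict_cong)
 have cm: "\<Phi> (Suc k) (a (Suc k) x) = b (Suc k) (\<Phi> k x)" if x: "x \<in> U (M (Suc k))" for k x
 proof -
  have m: "a (Suc k) x \<in> U (M (Suc (Suc k)))" "\<xi> (Suc k) (a (Suc k) x) \<in> U (N (Suc k))" "\<xi> k x \<in> U (N k)"
   "b k (\<xi> k x) \<in> U (N (Suc k))" "\<psi> (Suc k) x \<in> U (N (Suc k))"
   using x aD(1) \<xi>D(1) bD(1) \<psi>D(1) by simp_all
  show ?thesis using x m MD(2) ND(2) bD(1)
   by (simp add: \<Phi>_def bD(2) cmorD(3)[OF \<psi>] null_compositesD[OF nM] null_compositesD[OF nN] \<xi>D(4) mod_l_zero mod_r_zero)
 qed
 have pc: "\<Phi> (cyc (Suc k) - 1) = \<Phi> k" for k using periodic_pred[of \<Phi> k] per by blast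
 define \<phi> where "\<phi> m = \<Phi> (cyc m - 1)" for m
 have \<phi>S: "\<phi> (Suc k) = \<Phi> k" for k using pc by (simp add: \<phi>_def)
 have \<phi>p: "\<phi> (m + n) = \<phi> m" for m by (simp add: \<phi>_def)
 have ne: "m + n = Suc (m + n - 1)" for m using n_ge by simp
 have "cmor M a N b \<phi>" unfolding cmor_def
 proof (intro allI conjI ballI)
  fix m
  show "\<phi> (m + n) = \<phi> m" by (rule \<phi>p)
  have "\<phi> (Suc (m + n - 1)) \<in> Lin (M (Suc (m + n - 1))) (N (Suc (m + n - 1)))" unfolding \<phi>S by (rule h)
  then show "\<phi> m \<in> Lin (M m) (N m)" using \<phi>p MD(4) ND(4) by (simp add: ne[symmetric])
  fix x assume x: "x \<in> U (M m)"
  have "\<phi> (Suc (Suc (m + n - 1))) (a (Suc (m + n - 1)) x) = b (Suc (m + n - 1)) (\<phi> (Suc (m + n - 1)) x)"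
   unfolding \<phi>S using x MD(4)[of m] by (intro cm) (simp add: ne[symmetric])
  then show "\<phi> (Suc m) (a m x) = b m (\<phi> m x)"
   unfolding ne[symmetric] using \<phi>p[of m] \<phi>p[of "Suc m"] MD(5)[of m] ND(5)[of m] by simp
 qed
 then show thesis using that[of \<phi>] by (simp add: \<phi>S \<Phi>_def)
qed

end

section \<open>Homotopies and mapping cones\<close>

context angulation_setting
begin

lemma sdrD:
 assumes "sdr u M a F i q \<theta>"
 shows "Free F" "cmor (\<lambda>_. F) (fp u F) M a i" "cmor M a (\<lambda>_. F) (fp u F) q"
  "x \<in> U F ==> q k (i k x) = x" "\<theta> k \<in> Lin (M (Suc k)) (M k)" "\<theta> (k + n) = \<theta> k"
  "y \<in> U (M (Suc k)) ==> y = i (Suc k) (q (Suc k) y) \<oplus>\<^bsub>M (Suc k)\<^esub>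
    (\<theta> (Suc k) (a (Suc k) y) \<oplus>\<^bsub>M (Suc k)\<^esub> a k (\<theta> k y))"
 using assms unfolding sdr_def by blast+

text \<open>
 Two maps that form a commutative square with the first differentials and induce zero on the
 minimal parts are null-homotopic as far as they are given. Exactness of \<open>N\<close> continues the square
 one step to the left, by \<open>dn\<close>; the deformation retraction of \<open>M\<close> continues it one step to the
 right, by \<open>d3\<close>. The components of the homotopy are then \<open>\<eta> d + j r d \<theta>\<close>.
\<close>

lemma null_homotopy:
 assumes u: "u \<in> Units R" and cM: "in_class u M a" and cN: "in_class u N b"
  and sM: "sdr u M a F i q \<theta>" and sN: "sdr u N b G j r \<eta>"
  and d1: "d1 \<in> Lin (M S1) (N S1)" and d2: "d2 \<in> Lin (M S2) (N S2)"
  and sq: "\<And>x. x \<in> U (M S1) ==> d2 (a S1 x) = b S1 (d1 x)"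
  and n1: "\<And>x. x \<in> U F ==> r S1 (d1 (i S1 x)) = \<zero>\<^bsub>G\<^esub>"
  and n2: "\<And>x. x \<in> U F ==> r S2 (d2 (i S2 x)) = \<zero>\<^bsub>G\<^esub>"
 obtains \<xi> where "\<And>k. \<xi> k \<in> Lin (M (Suc k)) (N k)" "\<And>k. \<xi> (k + n) = \<xi> k"
  "\<And>x. x \<in> U (M S1) ==> d1 x = \<xi> S1 (a S1 x) \<oplus>\<^bsub>N S1\<^esub> b 0 (\<xi> 0 x)"
  "\<And>x. x \<in> U (M S2) ==> d2 x = \<xi> S2 (a S2 x) \<oplus>\<^bsub>N S2\<^esub> b S1 (\<xi> S1 x)"
proof -
 have uR: "u \<in> U R" using u by auto
 have M: "cseq M a" "null_composites M a" and N: "cseq N b" "null_composites N b" "exact_seq N b"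
  using cM cN by (auto simp: in_class_def)
 note MD = cseqD[OF M(1)] and ND = cseqD[OF N(1)] and aD = homD[OF cseqD(3)[OF M(1)]] and bD = homD[OF cseqD(3)[OF N(1)]]
 note F = sdrD(1)[OF sM] and i = sdrD(2)[OF sM] and q = sdrD(3)[OF sM] and \<theta>h = sdrD(5)[OF sM] and dM = sdrD(7)[OF sM]
 note G = sdrD(1)[OF sN] and j = sdrD(2)[OF sN] and r = sdrD(3)[OF sN] and \<eta>h = sdrD(5)[OF sN] and dN = sdrD(7)[OF sN]
 note FM = fg_freeD[OF F] and GM = fg_freeD[OF G]
 note iD = homD[OF cmorD(1)[OF i]] and qD = homD[OF cmorD(1)[OF q]] and \<theta>D = homD[OF \<theta>h]
 note jD = homD[OF cmorD(1)[OF j]] and rD = homD[OF cmorD(1)[OF r]] and \<eta>D = homD[OF \<eta>h]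
 note d1D = homD[OF d1] and d2D = homD[OF d2]
 let ?M1 = "M S1" and ?M2 = "M S2" and ?M3 = "M S3"
 let ?N1 = "N S1" and ?N2 = "N S2" and ?N3 = "N S3"
 \<comment> \<open>Factorization of \<open>d1 a\<close> through the differential of \<open>N\<close>.\<close>
 have "\<exists>y\<in>U (N 0). (\<lambda>x\<in>U (M 0). d1 (a 0 x)) x = b 0 y" if x: "x \<in> U (M 0)" for x
 proof -
  have ax: "a 0 x \<in> U ?M1" using aD(1) x .
  have "b S1 (d1 (a 0 x)) = \<zero>\<^bsub>?N2\<^esub>"
   using sq[OF ax] null_compositesD[OF M(2) x] MD(2) ND(2) by (simp add: d2D(4))
  then obtain y where "y \<in> U (N 0)" "d1 (a 0 x) = b 0 y" using exact_seqE[OF N(3) d1D(1)[OF ax]] by blast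
  then show ?thesis using x by auto
 qed
 then obtain dn where dn: "dn \<in> Lin (M 0) (N 0)" "\<And>x. x \<in> U (M 0) ==> (\<lambda>x\<in>U (M 0). d1 (a 0 x)) x = b 0 (dn x)"
  using projective[OF MD(1) ND(2) ND(2) hom_comp[OF MD(2) MD(3) d1] ND(3)] by blast
 have dn': "d1 (a 0 x) = b 0 (dn x)" if "x \<in> U (M 0)" for x using dn(2)[OF that] that by simp
 note dnD = homD[OF dn(1)]
 \<comment> \<open>Factorization of \<open>b d2\<close> through the differential of \<open>M\<close>.\<close>
 have b2h: "(\<lambda>x\<in>U ?M2. b S2 (d2 x)) \<in> Lin ?M2 ?N3" using hom_comp[OF MD(2) d2 ND(3)] .
 have bi: "(\<lambda>y\<in>U F. b S2 (d2 (i S2 y))) \<in> Lin F ?N3"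
  using hom_comp[OF FM cmorD(1)[OF i] b2h] iD(1) by (simp cong: restrict_cong)
 have "(\<lambda>y\<in>U F. b S2 (d2 (i S2 y))) y \<in> multiples p ?N3" if y: "y \<in> U F" for y
 proof -
  let ?z = "b S2 (d2 (i S2 y))"
  have z: "?z \<in> U ?N3" using y iD(1) d2D(1) bD(1) by simp
  have iy: "i S1 y \<in> U ?M1" "i S2 y \<in> U ?M2" using iD(1) y by simp_all
  have "u \<odot>\<^bsub>?N3\<^esub> (p \<odot>\<^bsub>?N3\<^esub> ?z) = b S2 (d2 (i S2 (fp u F S1 y)))"
   using y iy FM MD(2) ND(2) uR d2D(1) by (simp add: fp_first iD d2D bD)
  also have "\<dots> = b S2 (b S1 (d1 (i S1 y)))" using cmorD(3)[OF i y, of S1] sq[OF iy(1)] by simp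
  also have "\<dots> = \<zero>\<^bsub>?N3\<^esub>" using null_compositesD[OF N(2) d1D(1)[OF iy(1)]] .
  finally have "inv u \<odot>\<^bsub>?N3\<^esub> (u \<odot>\<^bsub>?N3\<^esub> (p \<odot>\<^bsub>?N3\<^esub> ?z)) = \<zero>\<^bsub>?N3\<^esub>" using u ND(2) by simp
  then have "p \<odot>\<^bsub>?N3\<^esub> ?z = \<zero>\<^bsub>?N3\<^esub>"
   using u uR z ND(2) by (simp add: mod_smult_assoc[symmetric] m_assoc[symmetric])
  then show ?thesis using p_annihilated[OF ND(1) z] y by (auto simp: multiples_def)
 qed
 then obtain g where g: "g \<in> Lin F ?N3"
  "\<And>y. y \<in> U F ==> (\<lambda>y\<in>U F. b S2 (d2 (i S2 y))) y = p \<odot>\<^bsub>?N3\<^esub> g y"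
  using projective_scale[OF F ND(2) bi p_carr] by blast
 have g': "b S2 (d2 (i S2 y)) = p \<odot>\<^bsub>?N3\<^esub> g y" if "y \<in> U F" for y using g(2)[OF that] that by simp
 note gD = homD[OF g(1)]
 define d3 where "d3 = (\<lambda>x\<in>U ?M3. g (q S3 x) \<oplus>\<^bsub>?N3\<^esub> b S2 (d2 (\<theta> S2 x)))"
 have d3h: "d3 \<in> Lin ?M3 ?N3"
  using hom_sum[OF MD(2) ND(2) hom_comp[OF MD(2) cmorD(1)[OF q] g(1)] hom_comp[OF MD(2) \<theta>h b2h]] \<theta>D(1)
  by (simp add: d3_def cong: restrict_cong)
 note d3D = homD[OF d3h]
 have fpo: "fp u F S2 y = p \<odot>\<^bsub>F\<^esub> y" if "y \<in> U F" for y
  using fp_other[OF that, of S2 u] n_ge by simp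
 have d3: "b S2 (d2 x) = d3 (a S2 x)" if x: "x \<in> U ?M2" for x
 proof -
  have ax: "a S2 x \<in> U ?M3" using aD(1) x .
  have qx: "q S2 x \<in> U F" "\<theta> S1 x \<in> U ?M1" "\<theta> S2 (a S2 x) \<in> U ?M2"
   "i S2 (q S2 x) \<in> U ?M2" "a S1 (\<theta> S1 x) \<in> U ?M2"
   using qD(1) \<theta>D(1) iD(1) aD(1) x ax by simp_all
  have z: "b S2 (d2 (a S1 (\<theta> S1 x))) = \<zero>\<^bsub>?N3\<^esub>"
   using sq[OF qx(2)] null_compositesD[OF N(2) d1D(1)[OF qx(2)]] by simp
  have "b S2 (d2 x) = b S2 (d2 (i S2 (q S2 x) \<oplus>\<^bsub>?M2\<^esub>
    (\<theta> S2 (a S2 x) \<oplus>\<^bsub>?M2\<^esub> a S1 (\<theta> S1 x))))"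
   using dM[OF x] by simp
  also have "\<dots> = p \<odot>\<^bsub>?N3\<^esub> g (q S2 x) \<oplus>\<^bsub>?N3\<^esub> b S2 (d2 (\<theta> S2 (a S2 x)))"
   using qx MD(2) ND(2) d2D(1) bD(1) by (simp add: d2D(2) bD(2) g' z mod_r_zero)
  also have "p \<odot>\<^bsub>?N3\<^esub> g (q S2 x) = g (q S3 (a S2 x))"
   using qx(1) cmorD(3)[OF q x] fpo[OF qx(1)] by (simp add: gD)
  finally show ?thesis using ax by (simp add: d3_def)
 qed
 have jrh: "(\<lambda>x\<in>U (N k). j k (r k x)) \<in> Lin (N k) (N k)" for k
  using hom_comp[OF ND(2) cmorD(1)[OF r] cmorD(1)[OF j]] .
 have jrb: "j (Suc k) (r (Suc k) (b k x)) = b k (j k (r k x))" if "x \<in> U (N k)" for k x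
  using cmorD(3)[OF r that] cmorD(3)[OF j rD(1)[OF that]] by simp
 \<comment> \<open>The formula for a component of the homotopy, and the identity it satisfies for any square.\<close>
 define H where "H k e g = (\<lambda>x\<in>U (M (Suc k)). \<eta> k (e x) \<oplus>\<^bsub>N k\<^esub> j k (r k (g (\<theta> k x))))" for k e g
 have Hh: "H k e g \<in> Lin (M (Suc k)) (N k)"
  if e: "e \<in> Lin (M (Suc k)) (N (Suc k))" and g: "g \<in> Lin (M k) (N k)" for k e g
  unfolding H_def
  by (rule homI) (use MD(2) ND(2) in \<open>auto simp: \<eta>D jD rD homD[OF e] homD[OF g] \<theta>D GM mod_ac mod_smult_radd\<close>)
 have key: "g x = H (Suc k) e g (a (Suc k) x) \<oplus>\<^bsub>N (Suc k)\<^esub> b k (H k g h x)"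
  if e: "e \<in> Lin (M (Suc (Suc k))) (N (Suc (Suc k)))" and g: "g \<in> Lin (M (Suc k)) (N (Suc k))"
   and h: "h \<in> Lin (M k) (N k)"
   and eg: "\<And>x. x \<in> U (M (Suc k)) ==> e (a (Suc k) x) = b (Suc k) (g x)"
   and gh: "\<And>x. x \<in> U (M k) ==> g (a k x) = b k (h x)"
   and n: "\<And>x. x \<in> U F ==> r (Suc k) (g (i (Suc k) x)) = \<zero>\<^bsub>G\<^esub>"
   and x: "x \<in> U (M (Suc k))" for k e g h x
 proof -
  note eD = homD[OF e] and gD = homD[OF g] and hD = homD[OF h]
  let ?M = "M (Suc k)" and ?N = "N (Suc k)"
  have ax: "a (Suc k) x \<in> U (M (Suc (Suc k)))" using aD(1) x .
  have m: "q (Suc k) x \<in> U F" "i (Suc k) (q (Suc k) x) \<in> U ?M" "\<theta> (Suc k) (a (Suc k) x) \<in> U ?M"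
   "\<theta> k x \<in> U (M k)" "a k (\<theta> k x) \<in> U ?M"
   using qD(1) \<theta>D(1) iD(1) aD(1) x ax by simp_all
  have y: "g x \<in> U ?N" and hx: "h (\<theta> k x) \<in> U (N k)" using gD(1) x hD(1) m by simp_all
  have "r (Suc k) (g x) = r (Suc k) (g (i (Suc k) (q (Suc k) x) \<oplus>\<^bsub>?M\<^esub> (\<theta> (Suc k) (a (Suc k) x) \<oplus>\<^bsub>?M\<^esub> a k (\<theta> k x))))"
   using dM[OF x] by simp
  also have "\<dots> = r (Suc k) (g (\<theta> (Suc k) (a (Suc k) x))) \<oplus>\<^bsub>G\<^esub> r (Suc k) (b k (h (\<theta> k x)))"
   using m MD(2) ND(2) GM gD(1) rD(1) hx bD(1) by (simp add: gD(2) rD(2) n gh mod_l_zero)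
  finally have jr: "j (Suc k) (r (Suc k) (g x)) =
    j (Suc k) (r (Suc k) (g (\<theta> (Suc k) (a (Suc k) x)))) \<oplus>\<^bsub>?N\<^esub> b k (j k (r k (h (\<theta> k x))))"
   using m gD(1) rD(1) hx bD(1) by (simp add: jD(2) jrb)
  define A where "A = j (Suc k) (r (Suc k) (g (\<theta> (Suc k) (a (Suc k) x))))"
  define B where "B = b k (j k (r k (h (\<theta> k x))))"
  define C' where "C' = \<eta> (Suc k) (e (a (Suc k) x))"
  define D where "D = b k (\<eta> k (g x))"
  have mm: "A \<in> U ?N" "B \<in> U ?N" "C' \<in> U ?N" "D \<in> U ?N"
   using m ax y gD(1) eD(1) rD(1) jD(1) hx bD(1) \<eta>D(1) by (simp_all add: A_def B_def C'_def D_def)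
  have "g x = (A \<oplus>\<^bsub>?N\<^esub> B) \<oplus>\<^bsub>?N\<^esub> (C' \<oplus>\<^bsub>?N\<^esub> D)"
   using dN[OF y] jr eg[OF x] by (simp add: A_def B_def C'_def D_def)
  also have "\<dots> = (C' \<oplus>\<^bsub>?N\<^esub> A) \<oplus>\<^bsub>?N\<^esub> (D \<oplus>\<^bsub>?N\<^esub> B)" using mm ND(2)[of "Suc k"] by (simp add: mod_ac)
  also have "D \<oplus>\<^bsub>?N\<^esub> B = b k (H k g h x)"
   using x m y \<eta>D(1) jD(1) rD(1) hx by (simp add: H_def B_def D_def bD(2))
  finally show ?thesis using ax by (simp add: H_def A_def C'_def)
 qed
 define x0 where "x0 = H 0 d1 dn"
 define x1 where "x1 = H S1 d2 d1"
 define x2 where "x2 = H S2 d3 d2"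
 have x0h: "x0 \<in> Lin ?M1 (N 0)" and x1h: "x1 \<in> Lin ?M2 ?N1" and x2h: "x2 \<in> Lin ?M3 ?N2"
  unfolding x0_def x1_def x2_def by (rule Hh[OF d1 dn(1)], rule Hh[OF d2 d1], rule Hh[OF d3h d2])
 have e1: "d1 x = x1 (a S1 x) \<oplus>\<^bsub>?N1\<^esub> b 0 (x0 x)" if "x \<in> U ?M1" for x
  unfolding x0_def x1_def by (rule key[OF d2 d1 dn(1) sq dn' n1 that])
 have e2: "d2 x = x2 (a S2 x) \<oplus>\<^bsub>?N2\<^esub> b S1 (x1 x)" if "x \<in> U ?M2" for x
  unfolding x1_def x2_def by (rule key[OF d3h d2 d1 d3[symmetric] sq n2 that])
 define \<xi>0 where "\<xi>0 k = (if k = 1 then x1 else if k = 2 then x2 else if k = n then x0 else (\<lambda>x\<in>U (M (Suc k)). \<zero>\<^bsub>N k\<^esub>))" for k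
 define \<xi> where "\<xi> k = \<xi>0 (cyc k)" for k
 have \<xi>p: "\<xi> (k + n) = \<xi> k" for k by (simp add: \<xi>_def)
 have h0: "\<xi>0 k \<in> Lin (M (Suc k)) (N k)" if "k \<in> {1..n}" for k
  using x1h x2h x0h hom_null[OF MD(2) ND(2)] MD(8) ND(7) n_ge by (auto simp: \<xi>0_def numeral_2_eq_2)
 have \<xi>h: "\<xi> k \<in> Lin (M (Suc k)) (N k)" for k
  using h0[OF cyc_index_range[OF n_pos, of k]] periodic_cyc_index[of n N k] periodic_cyc_index_Suc(1)[of n M k] MD(4) ND(4)
  by (simp add: \<xi>_def)
 have \<xi>v: "\<xi> S1 = x1" "\<xi> S2 = x2" "\<xi> 0 = x0"
  using n_ge cyc_index_self[of S1 n] cyc_index_self[of S2 n] cyc_index_self[of n n] cyc_index_add[of n 0]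
  by (auto simp: \<xi>_def \<xi>0_def numeral_2_eq_2)
 show thesis using that[of \<xi>] \<xi>h \<xi>p e1 e2 unfolding \<xi>v by blast
qed

lemma cone_construct:
 assumes M: "cseq M a" and N: "cseq N b" and f: "cmor M a N b f"
 obtains P D i1 i2 p1 p2 where "cseq P D"
  "\<And>k. bip (M (Suc k)) (N k) (P k) (i1 k) (i2 k) (p1 k) (p2 k)"
  "\<And>k. i1 (k + n) = i1 k" "\<And>k. i2 (k + n) = i2 k" "\<And>k. p1 (k + n) = p1 k" "\<And>k. p2 (k + n) = p2 k"
  "\<And>k z. z \<in> U (P k) ==> D k z = i1 (Suc k) (\<ominus>\<^bsub>M (Suc (Suc k))\<^esub> a (Suc k) (p1 k z)) \<oplus>\<^bsub>P (Suc k)\<^esub>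
    i2 (Suc k) (f (Suc k) (p1 k z)) \<oplus>\<^bsub>P (Suc k)\<^esub> i2 (Suc k) (b k (p2 k z))"
  "\<And>k z. z \<in> U (P k) ==> p1 (Suc k) (D k z) = \<ominus>\<^bsub>M (Suc (Suc k))\<^esub> a (Suc k) (p1 k z)"
  "\<And>k z. z \<in> U (P k) ==> p2 (Suc k) (D k z) = f (Suc k) (p1 k z) \<oplus>\<^bsub>N (Suc k)\<^esub> b k (p2 k z)"
proof -
 note MD = cseqD[OF M] and ND = cseqD[OF N] and aD = homD[OF cseqD(3)[OF M]] and bD = homD[OF cseqD(3)[OF N]]
  and fD = homD[OF cmorD(1)[OF f]]
 let ?Q = "\<lambda>k (P, i1, i2, p1, p2). Free P \<and> bip (M (Suc k)) (N k) P i1 i2 p1 p2"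
 have ex: "\<exists>t. ?Q k t" for k
 proof -
  obtain P i1 i2 p1 p2 where "Free P" "bip (M (Suc k)) (N k) P i1 i2 p1 p2"
   using biproduct_exists[OF MD(1) ND(1)] .
  then show ?thesis by (intro exI[of _ "(P, i1, i2, p1, p2)"]) simp
 qed
 have pr: "?Q (k + n) = ?Q k" for k by (simp add: MD(6) ND(4))
 obtain t where t: "\<And>k. ?Q k (t k)" and tp: "\<And>k. t (k + n) = t k" using periodic_choice[of ?Q, OF ex pr] by blast
 define P where "P k = fst (t k)" for k
 define i1 where "i1 k = fst (snd (t k))" for k
 define i2 where "i2 k = fst (snd (snd (t k)))" for k
 define p1 where "p1 k = fst (snd (snd (snd (t k))))" for k
 define p2 where "p2 k = snd (snd (snd (snd (t k))))" for k
 have tt: "t k = (P k, i1 k, i2 k, p1 k, p2 k)" for k by (simp add: P_def i1_def i2_def p1_def p2_def)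
 have PF: "Free (P k)" and B: "bip (M (Suc k)) (N k) (P k) (i1 k) (i2 k) (p1 k) (p2 k)" for k
  using t[of k] by (simp_all add: tt)
 have per: "P (k + n) = P k" "i1 (k + n) = i1 k" "i2 (k + n) = i2 k" "p1 (k + n) = p1 k" "p2 (k + n) = p2 k" for k
  using tp[of k] by (simp_all add: tt)
 note PM = fg_freeD[OF PF] and BD = bipD[OF B]
 note i1D = homD[OF BD(1)] and i2D = homD[OF BD(2)] and p1D = homD[OF BD(3)] and p2D = homD[OF BD(4)]
 define D where "D k = (\<lambda>z\<in>U (P k). i1 (Suc k) (\<ominus>\<^bsub>M (Suc (Suc k))\<^esub> a (Suc k) (p1 k z)) \<oplus>\<^bsub>P (Suc k)\<^esub>
    i2 (Suc k) (f (Suc k) (p1 k z)) \<oplus>\<^bsub>P (Suc k)\<^esub> i2 (Suc k) (b k (p2 k z)))" for k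
 have mem: "p1 k z \<in> U (M (Suc k))" "p2 k z \<in> U (N k)" "a (Suc k) (p1 k z) \<in> U (M (Suc (Suc k)))"
  "f (Suc k) (p1 k z) \<in> U (N (Suc k))" "b k (p2 k z) \<in> U (N (Suc k))" if "z \<in> U (P k)" for k z
  using that p1D(1) p2D(1) aD(1) fD(1) bD(1) by simp_all
 have Dh: "D k \<in> Lin (P k) (P (Suc k))" for k
 proof -
  have 1: "(\<lambda>z\<in>U (P k). a (Suc k) (p1 k z)) \<in> Lin (P k) (M (Suc (Suc k)))"
   using hom_comp[OF PM BD(3) MD(3)] .
  from hom_comp[OF PM hom_opp[OF PM MD(2) 1] BD(1)]
  have 1: "(\<lambda>z\<in>U (P k). i1 (Suc k) (\<ominus>\<^bsub>M (Suc (Suc k))\<^esub> a (Suc k) (p1 k z))) \<in> Lin (P k) (P (Suc k))"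
   by (simp cong: restrict_cong)
  from hom_comp[OF PM hom_comp[OF PM BD(3) cmorD(1)[OF f]] BD(2)]
  have 2: "(\<lambda>z\<in>U (P k). i2 (Suc k) (f (Suc k) (p1 k z))) \<in> Lin (P k) (P (Suc k))"
   by (simp cong: restrict_cong)
  from hom_comp[OF PM hom_comp[OF PM BD(4) ND(3)] BD(2)]
  have 3: "(\<lambda>z\<in>U (P k). i2 (Suc k) (b k (p2 k z))) \<in> Lin (P k) (P (Suc k))"
   by (simp cong: restrict_cong)
  show ?thesis using hom_sum[OF PM PM hom_sum[OF PM PM 1 2] 3] by (simp add: D_def cong: restrict_cong)
 qed
 have "cseq P D" unfolding cseq_def
 proof (intro allI conjI)
  fix k
  show "D (k + n) = D k"
   using per(1)[of k] per(1)[of "Suc k"] per(2)[of "Suc k"] per(3)[of "Suc k"] per(4)[of k] per(5)[of k]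
    MD(4)[of "Suc (Suc k)"] MD(5)[of "Suc k"] ND(5)[of k] cmorD(2)[OF f, of "Suc k"] by (simp add: D_def)
 qed (use PF Dh per in auto)
 moreover have "p1 (Suc k) (D k z) = \<ominus>\<^bsub>M (Suc (Suc k))\<^esub> a (Suc k) (p1 k z)"
  "p2 (Suc k) (D k z) = f (Suc k) (p1 k z) \<oplus>\<^bsub>N (Suc k)\<^esub> b k (p2 k z)" if z: "z \<in> U (P k)" for k z
  using z mem[OF z] PM MD(2) ND(2) i1D(1) i2D(1)
  by (simp_all add: D_def p1D(2) p2D(2) BD(5-8) mod_r_zero mod_l_zero)
 ultimately show thesis using that[of P D i1 i2 p1 p2] B per(2-5) by (simp add: D_def)
qed

text \<open>
 The usual diagram chase.
\<close>

lemma cone_exact: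
 assumes M: "cseq M a" "null_composites M a" "exact_seq M a" and N: "cseq N b" "null_composites N b" "exact_seq N b"
  and f: "cmor M a N b f" and P: "cseq P D"
  and B: "\<And>k. bip (M (Suc k)) (N k) (P k) (i1 k) (i2 k) (p1 k) (p2 k)"
  and D1: "\<And>k z. z \<in> U (P k) ==> p1 (Suc k) (D k z) = \<ominus>\<^bsub>M (Suc (Suc k))\<^esub> a (Suc k) (p1 k z)"
  and D2: "\<And>k z. z \<in> U (P k) ==> p2 (Suc k) (D k z) = f (Suc k) (p1 k z) \<oplus>\<^bsub>N (Suc k)\<^esub> b k (p2 k z)"
 shows "null_composites P D" "exact_seq P D"
proof -
 note MD = cseqD[OF M(1)] and ND = cseqD[OF N(1)] and PD = cseqD[OF P] and aD = homD[OF cseqD(3)[OF M(1)]]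
  and bD = homD[OF cseqD(3)[OF N(1)]] and fD = homD[OF cmorD(1)[OF f]] and DD = homD[OF cseqD(3)[OF P]]
 note BD = bipD[OF B]
 note i1D = homD[OF BD(1)] and i2D = homD[OF BD(2)] and p1D = homD[OF BD(3)] and p2D = homD[OF BD(4)]
 have eqI: "x = y" if "x \<in> U (P k)" "y \<in> U (P k)" "p1 k x = p1 k y" "p2 k x = p2 k y" for k x y
 proof -
  have "x = i1 k (p1 k x) \<oplus>\<^bsub>P k\<^esub> i2 k (p2 k x)" by (rule BD(9)[OF that(1), symmetric])
  also have "\<dots> = i1 k (p1 k y) \<oplus>\<^bsub>P k\<^esub> i2 k (p2 k y)" unfolding that(3,4) ..
  also have "\<dots> = y" by (rule BD(9)[OF that(2)])
  finally show ?thesis .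
 qed
 have zero: "p1 k \<zero>\<^bsub>P k\<^esub> = \<zero>\<^bsub>M (Suc k)\<^esub>" "p2 k \<zero>\<^bsub>P k\<^esub> = \<zero>\<^bsub>N k\<^esub>" for k
  using p1D(4) p2D(4) MD(2) ND(2) PD(2) by simp_all
 show "null_composites P D" unfolding null_composites_def
 proof (intro allI ballI)
  fix k z assume z: "z \<in> U (P k)"
  have m: "p1 k z \<in> U (M (Suc k))" "p2 k z \<in> U (N k)" "D k z \<in> U (P (Suc k))"
   using z p1D(1) p2D(1) DD(1) by simp_all
  have am: "a (Suc k) (p1 k z) \<in> U (M (Suc (Suc k)))" "f (Suc k) (p1 k z) \<in> U (N (Suc k))" "b k (p2 k z) \<in> U (N (Suc k))"
   using m aD(1) fD(1) bD(1) by simp_all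
  show "D (Suc k) (D k z) = \<zero>\<^bsub>P (Suc (Suc k))\<^esub>"
  proof (rule eqI)
   show "p1 (Suc (Suc k)) (D (Suc k) (D k z)) = p1 (Suc (Suc k)) \<zero>\<^bsub>P (Suc (Suc k))\<^esub>"
    using z m am MD(2) by (simp add: D1 zero aD(5) null_compositesD[OF M(2)])
   have "f (Suc (Suc k)) (\<ominus>\<^bsub>M (Suc (Suc k))\<^esub> a (Suc k) (p1 k z)) = \<ominus>\<^bsub>N (Suc (Suc k))\<^esub> b (Suc k) (f (Suc k) (p1 k z))"
    using am m MD(2) ND(2) by (simp add: fD(5) cmorD(3)[OF f])
   moreover have "b (Suc k) (f (Suc k) (p1 k z) \<oplus>\<^bsub>N (Suc k)\<^esub> b k (p2 k z)) = b (Suc k) (f (Suc k) (p1 k z))"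
    using am m ND(2) bD(1) by (simp add: bD(2) null_compositesD[OF N(2)] mod_r_zero)
   ultimately show "p2 (Suc (Suc k)) (D (Suc k) (D k z)) = p2 (Suc (Suc k)) \<zero>\<^bsub>P (Suc (Suc k))\<^esub>"
    using z m am ND(2) bD(1) by (simp add: D1 D2 zero mod_l_neg)
  qed (use m DD(1) PD(2) in auto)
 qed
 show "exact_seq P D" unfolding exact_seq_def
 proof (intro allI ballI impI)
  fix k z assume z: "z \<in> U (P (Suc k))" and e: "D (Suc k) z = \<zero>\<^bsub>P (Suc (Suc k))\<^esub>"
  let ?x = "p1 (Suc k) z" and ?y = "p2 (Suc k) z"
  have m: "?x \<in> U (M (Suc (Suc k)))" "?y \<in> U (N (Suc k))" using z p1D(1) p2D(1) by simp_all
  have "\<ominus>\<^bsub>M (Suc (Suc (Suc k)))\<^esub> a (Suc (Suc k)) ?x = \<zero>\<^bsub>M (Suc (Suc (Suc k)))\<^esub>" using D1[OF z] e zero by simp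
  then have "a (Suc (Suc k)) ?x = \<zero>\<^bsub>M (Suc (Suc (Suc k)))\<^esub>"
   using mod_neg_neg[OF MD(2) aD(1)[OF m(1)]] MD(2) by simp
  then obtain v where v: "v \<in> U (M (Suc k))" "?x = a (Suc k) v" using exact_seqE[OF M(3) m(1)] by blast
  have fv: "f (Suc k) v \<in> U (N (Suc k))" using fD(1) v(1) .
  have "f (Suc (Suc k)) ?x \<oplus>\<^bsub>N (Suc (Suc k))\<^esub> b (Suc k) ?y = \<zero>\<^bsub>N (Suc (Suc k))\<^esub>" using D2[OF z] e zero by simp
  then have "b (Suc k) (f (Suc k) v \<oplus>\<^bsub>N (Suc k)\<^esub> ?y) = \<zero>\<^bsub>N (Suc (Suc k))\<^esub>"
   using v fv m by (simp add: cmorD(3)[OF f] bD(2))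
  then obtain w where w: "w \<in> U (N k)" "f (Suc k) v \<oplus>\<^bsub>N (Suc k)\<^esub> ?y = b k w"
   using exact_seqE[OF N(3)] fv m(2) ND(2) by (metis mod_closed(3))
  let ?t = "i1 k (\<ominus>\<^bsub>M (Suc k)\<^esub> v) \<oplus>\<^bsub>P k\<^esub> i2 k w"
  have t: "?t \<in> U (P k)" using v w i1D(1) i2D(1) MD(2) PD(2) by simp
  have pt: "p1 k ?t = \<ominus>\<^bsub>M (Suc k)\<^esub> v" "p2 k ?t = w"
   using v w i1D(1) i2D(1) MD(2) ND(2) PD(2) by (simp_all add: p1D(2) p2D(2) BD(5-8) mod_r_zero mod_l_zero)
  have "z = D k ?t"
  proof (rule eqI[OF z])
   show "D k ?t \<in> U (P (Suc k))" using DD(1) t .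
   show "?x = p1 (Suc k) (D k ?t)" using v aD(1) MD(2) by (simp add: D1[OF t] pt aD(5) mod_neg_neg)
   have "\<ominus>\<^bsub>N (Suc k)\<^esub> f (Suc k) v \<oplus>\<^bsub>N (Suc k)\<^esub> (f (Suc k) v \<oplus>\<^bsub>N (Suc k)\<^esub> ?y) = ?y"
    using fv m(2) ND(2) by (simp add: mod_r_neg1)
   then show "?y = p2 (Suc k) (D k ?t)" using v w(2) MD(2) ND(2) by (simp add: D2[OF t] pt fD(5))
  qed
  then show "\<exists>y\<in>U (P k). z = D k y" using t by blast
 qed
qed

end

section \<open>The holonomy of a mapping cone\<close>

context angulation_setting
begin

text \<open>
 A chain of the cone has coordinates \<open>x\<close> in \<open>M\<close> and \<open>y\<close> in \<open>N\<close>. After the coordinate change that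
 removes \<open>\<xi>\<close>, the projections to \<open>F\<close> and \<open>G\<close> form a chain of the cone of \<open>f\<close>. What is known there
 about the defect lifts along the deformation retractions: the defect of \<open>x\<close> is a boundary modulo
 \<open>p\<close>, and the defect of \<open>y\<close> is a boundary plus \<open>j (f e)\<close>. An element of \<open>M \<oplus> N\<close> whose first
 coordinate projects to \<open>e\<close> accounts for both at once.
\<close>

lemma cone_holonomy:
 assumes u: "u \<in> Units R" and cM: "in_class u M a" and cN: "in_class u N b"
  and sM: "sdr u M a F i q \<theta>" and sN: "sdr u N b G j r \<eta>"
  and f: "cmor (\<lambda>_. F) (fp u F) (\<lambda>_. G) (fp u G) f"
  and fc: "\<And>A B. cone_chain u F G f A B ==> p \<odot>\<^bsub>F\<^esub> A n = u \<odot>\<^bsub>F\<^esub> (p \<odot>\<^bsub>F\<^esub> A 0) \<and>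
   (\<exists>e\<in>U F. p \<odot>\<^bsub>G\<^esub> B n = u \<odot>\<^bsub>G\<^esub> (p \<odot>\<^bsub>G\<^esub> B 0) \<oplus>\<^bsub>G\<^esub> p \<odot>\<^bsub>G\<^esub> f S1 e)"
  and \<xi>: "\<And>k. \<xi> k \<in> Lin (M (Suc k)) (N k)" and \<xi>p: "\<And>k. \<xi> (k + n) = \<xi> k"
  and \<phi>: "cmor M a N b \<phi>"
  and \<phi>v: "\<And>k x. x \<in> U (M (Suc k)) ==> \<phi> (Suc k) x = j (Suc k) (f (Suc k) (q (Suc k) x)) \<oplus>\<^bsub>N (Suc k)\<^esub>
    (\<xi> (Suc k) (a (Suc k) x) \<oplus>\<^bsub>N (Suc k)\<^esub> b k (\<xi> k x))"
  and P: "cseq P D"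
  and B: "\<And>k. bip (M (Suc k)) (N k) (P k) (i1 k) (i2 k) (p1 k) (p2 k)"
  and Bp: "\<And>k. i1 (k + n) = i1 k" "\<And>k. i2 (k + n) = i2 k" "\<And>k. p1 (k + n) = p1 k" "\<And>k. p2 (k + n) = p2 k"
  and D1: "\<And>k z. z \<in> U (P k) ==> p1 (Suc k) (D k z) = \<ominus>\<^bsub>M (Suc (Suc k))\<^esub> a (Suc k) (p1 k z)"
  and D2: "\<And>k z. z \<in> U (P k) ==> p2 (Suc k) (D k z) = \<phi> (Suc k) (p1 k z) \<oplus>\<^bsub>N (Suc k)\<^esub> b k (p2 k z)"
 shows "holonomy u P D 0"
 unfolding holonomy_def
proof (intro allI impI)
 fix z assume z: "chain P D S1 z"
 have uR: "u \<in> U R" using u by auto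
 have M: "cseq M a" "null_composites M a" and N: "cseq N b" "null_composites N b"
  using cM cN by (auto simp: in_class_def)
 note MD = cseqD[OF M(1)] and ND = cseqD[OF N(1)] and PD = cseqD[OF P] and aD = homD[OF cseqD(3)[OF M(1)]]
  and bD = homD[OF cseqD(3)[OF N(1)]] and DD = homD[OF cseqD(3)[OF P]]
 note F = sdrD(1)[OF sM] and i = sdrD(2)[OF sM] and q = sdrD(3)[OF sM] and \<theta>h = sdrD(5)[OF sM] and dM = sdrD(7)[OF sM]
 note G = sdrD(1)[OF sN] and j = sdrD(2)[OF sN] and r = sdrD(3)[OF sN] and \<eta>h = sdrD(5)[OF sN] and dN = sdrD(7)[OF sN]
 note FM = fg_freeD[OF F] and GM = fg_freeD[OF G]
 note iD = homD[OF cmorD(1)[OF i]] and qD = homD[OF cmorD(1)[OF q]] and \<theta>D = homD[OF \<theta>h]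
 note jD = homD[OF cmorD(1)[OF j]] and rD = homD[OF cmorD(1)[OF r]] and \<eta>D = homD[OF \<eta>h] and \<xi>D = homD[OF \<xi>]
 note fD = homD[OF cmorD(1)[OF f]] and \<phi>D = homD[OF cmorD(1)[OF \<phi>]]
 note BD = bipD[OF B]
 note i1D = homD[OF BD(1)] and i2D = homD[OF BD(2)] and p1D = homD[OF BD(3)] and p2D = homD[OF BD(4)]
 let ?M1 = "M S1" and ?M2 = "M S2" and ?N1 = "N S1" and ?N2 = "N S2" and ?P1 = "P S1"
 have zc: "z k \<in> U (P (Suc k))" if "k \<le> n" for k using chainD(1)[OF z that] by simp
 have zs: "D (Suc k) (z k) = p \<odot>\<^bsub>P (Suc (Suc k))\<^esub> z (Suc k)" if "k < n" for k using chainD(3)[OF z that] by simp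
 define x where "x k = p1 (Suc k) (z k)" for k
 define y0 where "y0 k = p2 (Suc k) (z k)" for k
 define y where "y k = y0 k \<oplus>\<^bsub>N (Suc k)\<^esub> \<xi> (Suc k) (x k)" for k
 \<comment> \<open>The homotopy \<open>\<xi>\<close> is absorbed by a change of coordinates.\<close>
 define \<psi> where "\<psi> k v = j k (f k (q k v))" for k v
 have xc: "x k \<in> U (M (Suc (Suc k)))" and y0c: "y0 k \<in> U (N (Suc k))" if "k \<le> n" for k
  using zc[OF that] p1D(1) p2D(1) by (simp_all add: x_def y0_def)
 have yc: "y k \<in> U (N (Suc k))" if "k \<le> n" for k
  using xc[OF that] y0c[OF that] \<xi>D(1) ND(2) by (simp add: y_def)
 have \<psi>c: "\<psi> k v \<in> U (N k)" if "v \<in> U (M k)" for k v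
  using that qD(1) fD(1) jD(1) by (simp add: \<psi>_def)
 have xs: "a (Suc (Suc k)) (x k) = \<ominus>\<^bsub>M (Suc (Suc (Suc k)))\<^esub> (p \<odot>\<^bsub>M (Suc (Suc (Suc k)))\<^esub> x (Suc k))" if k: "k < n" for k
 proof -
  have c: "z k \<in> U (P (Suc k))" "z (Suc k) \<in> U (P (Suc (Suc k)))" "a (Suc (Suc k)) (x k) \<in> U (M (Suc (Suc (Suc k))))"
   using zc[of k] zc[of "Suc k"] xc[of k] k aD(1) by simp_all
  have "\<ominus>\<^bsub>M (Suc (Suc (Suc k)))\<^esub> a (Suc (Suc k)) (x k) = p \<odot>\<^bsub>M (Suc (Suc (Suc k)))\<^esub> x (Suc k)"
   using D1[OF c(1)] zs[OF k] c(2) by (simp add: x_def p1D(3))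
  then show ?thesis using mod_neg_neg[OF MD(2) c(3)] by simp
 qed
 have ys: "p \<odot>\<^bsub>N (Suc (Suc k))\<^esub> y (Suc k) = \<psi> (Suc (Suc k)) (x k) \<oplus>\<^bsub>N (Suc (Suc k))\<^esub> b (Suc k) (y k)" if k: "k < n" for k
 proof -
  let ?N = "N (Suc (Suc k))"
  have c: "z k \<in> U (P (Suc k))" "z (Suc k) \<in> U (P (Suc (Suc k)))" "x k \<in> U (M (Suc (Suc k)))"
   "x (Suc k) \<in> U (M (Suc (Suc (Suc k))))" "y0 k \<in> U (N (Suc k))" "y0 (Suc k) \<in> U ?N"
   using zc[of k] zc[of "Suc k"] xc[of k] xc[of "Suc k"] y0c[of k] y0c[of "Suc k"] k by simp_all
  have e: "p \<odot>\<^bsub>?N\<^esub> y0 (Suc k) = \<phi> (Suc (Suc k)) (x k) \<oplus>\<^bsub>?N\<^esub> b (Suc k) (y0 k)"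
   using D2[OF c(1)] zs[OF k] c(2) by (simp add: x_def y0_def p2D(3))
  define s1 where "s1 = \<psi> (Suc (Suc k)) (x k)"
  define s2 where "s2 = \<xi> (Suc (Suc k)) (a (Suc (Suc k)) (x k))"
  define s3 where "s3 = b (Suc k) (\<xi> (Suc k) (x k))"
  define s4 where "s4 = b (Suc k) (y0 k)"
  define s5 where "s5 = p \<odot>\<^bsub>?N\<^esub> y0 (Suc k)"
  define s6 where "s6 = p \<odot>\<^bsub>?N\<^esub> \<xi> (Suc (Suc k)) (x (Suc k))"
  have m: "s1 \<in> U ?N" "s2 \<in> U ?N" "s3 \<in> U ?N" "s4 \<in> U ?N" "s5 \<in> U ?N" "s6 \<in> U ?N"
   using c \<psi>c \<xi>D(1) bD(1) aD(1) ND(2) by (simp_all add: s1_def s2_def s3_def s4_def s5_def s6_def)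
  have "s2 = \<ominus>\<^bsub>?N\<^esub> s6" using xs[OF k] c \<xi>D MD(2) ND(2) by (simp add: s2_def s6_def)
  moreover have "s5 = (s1 \<oplus>\<^bsub>?N\<^esub> (s2 \<oplus>\<^bsub>?N\<^esub> s3)) \<oplus>\<^bsub>?N\<^esub> s4"
   using e \<phi>v[OF c(3)] by (simp add: s1_def s2_def s3_def s4_def s5_def \<psi>_def)
  ultimately have "s5 \<oplus>\<^bsub>?N\<^esub> s6 = s1 \<oplus>\<^bsub>?N\<^esub> (s4 \<oplus>\<^bsub>?N\<^esub> s3)" using m ND(2) by algebra
  then show ?thesis using c \<xi>D(1) ND(2)
   by (simp add: y_def bD(2) mod_smult_radd s1_def s3_def s4_def s5_def s6_def)
 qed
 have cc: "cone_chain u F G f (\<lambda>k. q (Suc (Suc k)) (x k)) (\<lambda>k. r (Suc k) (y k))"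
  unfolding cone_chain_def
 proof (intro conjI allI impI)
  fix k
  show "k \<le> n ==> q (Suc (Suc k)) (x k) \<in> U F" "k \<le> n ==> r (Suc k) (y k) \<in> U G"
   using xc yc qD(1) rD(1) by simp_all
  assume k: "k < n"
  have c: "x k \<in> U (M (Suc (Suc k)))" "x (Suc k) \<in> U (M (Suc (Suc (Suc k))))" "y k \<in> U (N (Suc k))" "y (Suc k) \<in> U (N (Suc (Suc k)))"
   using xc[of k] xc[of "Suc k"] yc[of k] yc[of "Suc k"] k by simp_all
  show "fp u F (Suc (Suc k)) (q (Suc (Suc k)) (x k)) = \<ominus>\<^bsub>F\<^esub> (p \<odot>\<^bsub>F\<^esub> q (Suc (Suc (Suc k))) (x (Suc k)))"
   using cmorD(3)[OF q c(1)] xs[OF k] c MD(2) FM by (simp add: qD)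
  have "p \<odot>\<^bsub>G\<^esub> r (Suc (Suc k)) (y (Suc k)) = r (Suc (Suc k)) (\<psi> (Suc (Suc k)) (x k) \<oplus>\<^bsub>N (Suc (Suc k))\<^esub> b (Suc k) (y k))"
   using ys[OF k] c by (simp add: rD(3)[symmetric])
  also have "\<dots> = f (Suc (Suc k)) (q (Suc (Suc k)) (x k)) \<oplus>\<^bsub>G\<^esub> fp u G (Suc k) (r (Suc k) (y k))"
   using c \<psi>c bD(1) qD(1) fD(1) cmorD(3)[OF r c(3)] by (simp add: rD(2) \<psi>_def sdrD(4)[OF sN])
  finally show "f (Suc (Suc k)) (q (Suc (Suc k)) (x k)) \<oplus>\<^bsub>G\<^esub> fp u G (Suc k) (r (Suc k) (y k)) = p \<odot>\<^bsub>G\<^esub> r (Suc (Suc k)) (y (Suc k))" ..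
 qed
 have per: "q (Suc (Suc n)) = q S2" "r (Suc n) = r S1" "M (Suc (Suc n)) = ?M2" "N (Suc n) = ?N1" "P (Suc n) = ?P1"
  "a (Suc n) = a S1" "b n = b 0" "\<xi> (Suc n) = \<xi> S1" "p1 (Suc n) = p1 S1" "p2 (Suc n) = p2 S1" "M (Suc n) = ?M1" "N n = N 0"
  "j (Suc n) = j S1" "f (Suc n) = f S1" "q (Suc n) = q S1"
  using cmorD(2)[OF q, of S2] cmorD(2)[OF r, of S1] MD(4)[of S2] ND(8) PD(8) MD(5)[of S1] ND(5)[of 0]
   \<xi>p[of S1] Bp(3,4)[of S1] MD(8) ND(7) cmorD(2)[OF j, of S1] cmorD(2)[OF f, of S1] cmorD(2)[OF q, of S1] by simp_all
 obtain e where e: "e \<in> U F" "p \<odot>\<^bsub>G\<^esub> r S1 (y n) = u \<odot>\<^bsub>G\<^esub> (p \<odot>\<^bsub>G\<^esub> r S1 (y 0)) \<oplus>\<^bsub>G\<^esub> p \<odot>\<^bsub>G\<^esub> f S1 e"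
  and eq: "p \<odot>\<^bsub>F\<^esub> q S2 (x n) = u \<odot>\<^bsub>F\<^esub> (p \<odot>\<^bsub>F\<^esub> q S2 (x 0))"
  using fc[OF cc] per(1,2) by auto
 have last: "n - 1 < n" "Suc (n - 1) = n" using n_ge by auto
 have c: "x 0 \<in> U ?M2" "x n \<in> U ?M2" "y 0 \<in> U ?N1" "y n \<in> U ?N1" "y0 0 \<in> U ?N1" "y0 n \<in> U ?N1"
  "z 0 \<in> U ?P1" "z n \<in> U ?P1" "x (n - 1) \<in> U ?M1" "y (n - 1) \<in> U (N 0)"
  "x S1 \<in> U (M S3)" "y S1 \<in> U ?N2"
  using xc[of 0] xc[of n] yc[of 0] yc[of n] y0c[of 0] y0c[of n] zc[of 0] zc[of n] xc[of "n - 1"] yc[of "n - 1"]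
   xc[of S1] yc[of S1] last per n_ge by simp_all
 have xl: "a S1 (x (n - 1)) = \<ominus>\<^bsub>?M2\<^esub> (p \<odot>\<^bsub>?M2\<^esub> x n)" using xs[OF last(1)] last(2) per by simp
 have yl: "p \<odot>\<^bsub>?N1\<^esub> y n = \<psi> S1 (x (n - 1)) \<oplus>\<^bsub>?N1\<^esub> b 0 (y (n - 1))" using ys[OF last(1)] last(2) per by (simp add: \<psi>_def)
 note x0 = xs[OF n_pos] and yy0 = ys[OF n_pos]
 define \<Delta>x where "\<Delta>x = x n \<ominus>\<^bsub>?M2\<^esub> u \<odot>\<^bsub>?M2\<^esub> x 0"
 define \<Delta>y where "\<Delta>y = y n \<ominus>\<^bsub>?N1\<^esub> u \<odot>\<^bsub>?N1\<^esub> y 0"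
 have \<Delta>c: "\<Delta>x \<in> U ?M2" "\<Delta>y \<in> U ?N1" using c MD(2) ND(2) uR by (simp_all add: \<Delta>x_def \<Delta>y_def)
 \<comment> \<open>Modulo \<open>p\<close>, the defect of the first coordinate is a boundary of \<open>M\<close>.\<close>
 have q\<Delta>: "p \<odot>\<^bsub>F\<^esub> q S2 \<Delta>x = \<zero>\<^bsub>F\<^esub>"
 proof -
  define v where "v = q S2 (x n)"
  define v0 where "v0 = q S2 (x 0)"
  have m: "v \<in> U F" "v0 \<in> U F" using c qD(1) by (simp_all add: v_def v0_def)
  have "p \<odot>\<^bsub>F\<^esub> (v \<ominus>\<^bsub>F\<^esub> u \<odot>\<^bsub>F\<^esub> v0) = p \<odot>\<^bsub>F\<^esub> v \<ominus>\<^bsub>F\<^esub> u \<odot>\<^bsub>F\<^esub> (p \<odot>\<^bsub>F\<^esub> v0)"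
   using m FM uR by (simp add: a_minus_def mod_smult_radd mod_smult_rneg mod_scale_comm)
  also have "\<dots> = \<zero>\<^bsub>F\<^esub>" using eq m FM uR by (simp add: v_def[symmetric] v0_def[symmetric] a_minus_def mod_r_neg)
  finally show ?thesis using c MD(2) FM uR by (simp add: \<Delta>x_def qD v_def v0_def)
 qed
 obtain w where w: "w \<in> U F" "q S2 \<Delta>x = p \<odot>\<^bsub>F\<^esub> w"
  using p_annihilated[OF F qD(1)[OF \<Delta>c(1)] q\<Delta>] .
 have a\<Delta>: "p \<odot>\<^bsub>M S3\<^esub> a S2 \<Delta>x = \<zero>\<^bsub>M S3\<^esub>"
 proof -
  let ?M = "M S3"
  have "a S2 (p \<odot>\<^bsub>?M2\<^esub> x n) = a S2 (\<ominus>\<^bsub>?M2\<^esub> a S1 (x (n - 1)))"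
   unfolding xl using c MD(2) by (simp add: mod_neg_neg)
  also have "\<dots> = \<zero>\<^bsub>?M\<^esub>" using c aD(1) MD(2) by (simp add: aD(5) null_compositesD[OF M(2)])
  finally have 1: "p \<odot>\<^bsub>?M\<^esub> a S2 (x n) = \<zero>\<^bsub>?M\<^esub>" using c by (simp add: aD(3))
  have 2: "p \<odot>\<^bsub>?M\<^esub> a S2 (x 0) = \<zero>\<^bsub>?M\<^esub>" unfolding x0 using c MD(2) by (simp add: mod_smult_rneg)
  have "p \<odot>\<^bsub>?M\<^esub> a S2 \<Delta>x = p \<odot>\<^bsub>?M\<^esub> a S2 (x n) \<ominus>\<^bsub>?M\<^esub> u \<odot>\<^bsub>?M\<^esub> (p \<odot>\<^bsub>?M\<^esub> a S2 (x 0))"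
   using c MD(2) uR aD(1) by (simp add: \<Delta>x_def aD) (simp add: a_minus_def mod_smult_radd mod_smult_rneg mod_scale_comm[of _ p u] aD(1) bD(1))
  then show ?thesis using 1 2 MD(2) uR by (simp add: a_minus_def mod_l_zero)
 qed
 obtain w' where w': "w' \<in> U (M S3)" "a S2 \<Delta>x = p \<odot>\<^bsub>M S3\<^esub> w'"
  using p_annihilated[OF MD(1) aD(1)[OF \<Delta>c(1)] a\<Delta>] .
 define X where "X = i S2 w \<oplus>\<^bsub>?M2\<^esub> \<theta> S2 w'"
 have X: "X \<in> U ?M2" using w w' iD(1) \<theta>D(1) MD(2) by (simp add: X_def)
 have th: "\<theta> S1 \<Delta>x \<in> U ?M1" "a S1 (\<theta> S1 \<Delta>x) \<in> U ?M2" using \<Delta>c \<theta>D(1) aD(1) by simp_all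
 have \<Delta>x: "\<Delta>x = a S1 (\<theta> S1 \<Delta>x) \<oplus>\<^bsub>?M2\<^esub> p \<odot>\<^bsub>?M2\<^esub> X"
 proof -
  have "\<Delta>x = p \<odot>\<^bsub>?M2\<^esub> i S2 w \<oplus>\<^bsub>?M2\<^esub> (p \<odot>\<^bsub>?M2\<^esub> \<theta> S2 w' \<oplus>\<^bsub>?M2\<^esub> a S1 (\<theta> S1 \<Delta>x))"
   using dM[OF \<Delta>c(1)] w w' by (simp add: iD(3) \<theta>D(3))
  also have "\<dots> = a S1 (\<theta> S1 \<Delta>x) \<oplus>\<^bsub>?M2\<^esub> p \<odot>\<^bsub>?M2\<^esub> X"
   using w(1) w'(1) th iD(1) \<theta>D(1) MD(2) by (simp add: X_def mod_smult_radd mod_ac)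
  finally show ?thesis .
 qed
 \<comment> \<open>Modulo \<open>p\<close>, the defect of the second coordinate is a boundary of \<open>N\<close> up to a value of \<open>f\<close>.\<close>
 have b\<Delta>: "p \<odot>\<^bsub>?N2\<^esub> b S1 \<Delta>y = \<zero>\<^bsub>?N2\<^esub>"
 proof -
  have \<psi>m: "\<psi> S2 (a S1 v) = b S1 (\<psi> S1 v)" if "v \<in> U ?M1" for v
   using cmorD(3)[OF q that] cmorD(3)[OF f qD(1)[OF that]] cmorD(3)[OF j fD(1)[OF qD(1)[OF that]]] by (simp add: \<psi>_def)
  have \<psi>s: "\<psi> k (s \<odot>\<^bsub>M k\<^esub> v) = s \<odot>\<^bsub>N k\<^esub> \<psi> k v" if "v \<in> U (M k)" "s \<in> U R" for k v s
   using that qD(1) fD(1) by (simp add: \<psi>_def qD(3) fD(3) jD(3))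
  have \<psi>neg: "\<psi> k (\<ominus>\<^bsub>M k\<^esub> v) = \<ominus>\<^bsub>N k\<^esub> \<psi> k v" if "v \<in> U (M k)" for k v
   using that qD(1) fD(1) MD(2) ND(2) FM GM by (simp add: \<psi>_def qD(5) fD(5) jD(5))
  have m: "\<psi> S1 (x (n - 1)) \<in> U ?N1" "b 0 (y (n - 1)) \<in> U ?N1" using c \<psi>c bD(1) by simp_all
  have "p \<odot>\<^bsub>?N2\<^esub> b S1 (y n) = b S1 (\<psi> S1 (x (n - 1)) \<oplus>\<^bsub>?N1\<^esub> b 0 (y (n - 1)))"
   unfolding yl[symmetric] using c by (simp add: bD(3))
  also have "\<dots> = \<psi> S2 (a S1 (x (n - 1)))"
   using m c ND(2) bD(1) by (simp add: bD(2) null_compositesD[OF N(2)] \<psi>m mod_r_zero)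
  also have "\<dots> = \<ominus>\<^bsub>?N2\<^esub> (p \<odot>\<^bsub>?N2\<^esub> \<psi> S2 (x n))" unfolding xl using c MD(2) by (simp add: \<psi>neg \<psi>s)
  finally have 1: "p \<odot>\<^bsub>?N2\<^esub> b S1 (y n) = \<ominus>\<^bsub>?N2\<^esub> (p \<odot>\<^bsub>?N2\<^esub> \<psi> S2 (x n))" .
  have m2: "\<psi> S2 (x 0) \<in> U ?N2" "b S1 (y 0) \<in> U ?N2" "b S1 (y n) \<in> U ?N2" "\<psi> S2 (x n) \<in> U ?N2"
   using c \<psi>c bD(1) by simp_all
  have "p \<odot>\<^bsub>?N2\<^esub> (\<psi> S2 (x 0) \<oplus>\<^bsub>?N2\<^esub> b S1 (y 0)) = \<zero>\<^bsub>?N2\<^esub>" unfolding yy0[symmetric] using c ND(2) by simp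
  then have "p \<odot>\<^bsub>?N2\<^esub> \<psi> S2 (x 0) \<oplus>\<^bsub>?N2\<^esub> p \<odot>\<^bsub>?N2\<^esub> b S1 (y 0) = \<zero>\<^bsub>?N2\<^esub>" using m2 ND(2) by (simp add: mod_smult_radd)
  then have 2: "p \<odot>\<^bsub>?N2\<^esub> b S1 (y 0) = \<ominus>\<^bsub>?N2\<^esub> (p \<odot>\<^bsub>?N2\<^esub> \<psi> S2 (x 0))"
   using mod_r_neg1[OF ND(2), of "p \<odot>\<^bsub>?N2\<^esub> \<psi> S2 (x 0)" S2 "p \<odot>\<^bsub>?N2\<^esub> b S1 (y 0)"] m2 ND(2)
   by (simp add: mod_r_zero)
  have 3: "p \<odot>\<^bsub>?N2\<^esub> \<psi> S2 (x n) = u \<odot>\<^bsub>?N2\<^esub> (p \<odot>\<^bsub>?N2\<^esub> \<psi> S2 (x 0))"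
  proof -
   have "j S2 (f S2 (p \<odot>\<^bsub>F\<^esub> q S2 (x n))) = j S2 (f S2 (u \<odot>\<^bsub>F\<^esub> (p \<odot>\<^bsub>F\<^esub> q S2 (x 0))))"
    unfolding eq ..
   then show ?thesis using c qD(1) fD(1) FM GM uR by (simp add: \<psi>_def fD(3) jD(3))
  qed
  have "p \<odot>\<^bsub>?N2\<^esub> b S1 \<Delta>y = p \<odot>\<^bsub>?N2\<^esub> b S1 (y n) \<ominus>\<^bsub>?N2\<^esub> u \<odot>\<^bsub>?N2\<^esub> (p \<odot>\<^bsub>?N2\<^esub> b S1 (y 0))"
   using c ND(2) uR bD(1) by (simp add: \<Delta>y_def bD) (simp add: a_minus_def mod_smult_radd mod_smult_rneg mod_scale_comm[of _ p u] aD(1) bD(1))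
  then show ?thesis unfolding 1 2 3 using m2 ND(2) uR by (simp add: a_minus_def mod_smult_rneg mod_neg_neg mod_l_neg)
 qed
 obtain w1 where w1: "w1 \<in> U ?N2" "b S1 \<Delta>y = p \<odot>\<^bsub>?N2\<^esub> w1" using p_annihilated[OF ND(1) bD(1)[OF \<Delta>c(2)] b\<Delta>] .
 have f1e: "f S1 e \<in> U G" using fD(1) e(1) .
 have "p \<odot>\<^bsub>G\<^esub> r S1 \<Delta>y = p \<odot>\<^bsub>G\<^esub> f S1 e"
 proof -
  define v where "v = r S1 (y n)"
  define v0 where "v0 = r S1 (y 0)"
  have m: "v \<in> U G" "v0 \<in> U G" using c rD(1) by (simp_all add: v_def v0_def)
  have "p \<odot>\<^bsub>G\<^esub> (v \<ominus>\<^bsub>G\<^esub> u \<odot>\<^bsub>G\<^esub> v0) = p \<odot>\<^bsub>G\<^esub> v \<ominus>\<^bsub>G\<^esub> u \<odot>\<^bsub>G\<^esub> (p \<odot>\<^bsub>G\<^esub> v0)"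
   using m GM uR by (simp add: a_minus_def mod_smult_radd mod_smult_rneg mod_scale_comm)
  also have "\<dots> = p \<odot>\<^bsub>G\<^esub> f S1 e"
   using e(2) m GM uR f1e by (simp add: v_def[symmetric] v0_def[symmetric] mod_norm)
  finally show ?thesis using c ND(2) GM uR by (simp add: \<Delta>y_def rD v_def v0_def)
 qed
 then obtain w2 where w2: "w2 \<in> U G" "r S1 \<Delta>y = f S1 e \<oplus>\<^bsub>G\<^esub> p \<odot>\<^bsub>G\<^esub> w2"
  using p_scale_eqD[OF G rD(1)[OF \<Delta>c(2)] f1e] by blast
 define Y where "Y = j S1 w2 \<oplus>\<^bsub>?N1\<^esub> \<eta> S1 w1"
 have Y: "Y \<in> U ?N1" using w1 w2 jD(1) \<eta>D(1) ND(2) by (simp add: Y_def)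
 have et: "\<eta> 0 \<Delta>y \<in> U (N 0)" "b 0 (\<eta> 0 \<Delta>y) \<in> U ?N1" "j S1 (f S1 e) \<in> U ?N1" using \<Delta>c \<eta>D(1) bD(1) jD(1) f1e by simp_all
 have \<Delta>y: "\<Delta>y = j S1 (f S1 e) \<oplus>\<^bsub>?N1\<^esub> (b 0 (\<eta> 0 \<Delta>y) \<oplus>\<^bsub>?N1\<^esub> p \<odot>\<^bsub>?N1\<^esub> Y)"
 proof -
  have "\<Delta>y = (j S1 (f S1 e) \<oplus>\<^bsub>?N1\<^esub> p \<odot>\<^bsub>?N1\<^esub> j S1 w2) \<oplus>\<^bsub>?N1\<^esub> (p \<odot>\<^bsub>?N1\<^esub> \<eta> S1 w1 \<oplus>\<^bsub>?N1\<^esub> b 0 (\<eta> 0 \<Delta>y))"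
   using dN[OF \<Delta>c(2)] w1 w2 f1e GM by (simp add: jD(2,3) \<eta>D(3))
  also have "\<dots> = j S1 (f S1 e) \<oplus>\<^bsub>?N1\<^esub> (b 0 (\<eta> 0 \<Delta>y) \<oplus>\<^bsub>?N1\<^esub> p \<odot>\<^bsub>?N1\<^esub> Y)"
   using w1(1) w2(1) et jD(1) \<eta>D(1) ND(2) by (simp add: Y_def mod_smult_radd mod_ac)
  finally show ?thesis .
 qed
 \<comment> \<open>The element of \<open>P 0\<close> whose boundary is the defect modulo \<open>p\<close>; its first coordinate is
   chosen with prescribed image \<open>e\<close> under \<open>q\<close>.\<close>
 \<comment> \<open>The correction makes \<open>q t = e\<close>.\<close>
 define e' where "e' = e \<oplus>\<^bsub>F\<^esub> q S1 (\<theta> S1 \<Delta>x)"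
 have e': "e' \<in> U F" using e(1) th qD(1) FM by (simp add: e'_def)
 define t where "t = \<ominus>\<^bsub>?M1\<^esub> \<theta> S1 \<Delta>x \<oplus>\<^bsub>?M1\<^esub> i S1 e'"
 have t: "t \<in> U ?M1" using th e' iD(1) MD(2) by (simp add: t_def)
 have qt: "q S1 t = e"
 proof -
  have m: "q S1 (\<theta> S1 \<Delta>x) \<in> U F" using th qD(1) by simp
  have "q S1 t = \<ominus>\<^bsub>F\<^esub> q S1 (\<theta> S1 \<Delta>x) \<oplus>\<^bsub>F\<^esub> e'"
   using th e' iD(1) MD(2) FM by (simp add: t_def qD(2,5) sdrD(4)[OF sM])
  also have "\<dots> = e" unfolding e'_def using e(1) m FM by (simp add: mod_norm)
  finally show ?thesis .
 qed
 define Z where "Z = u \<odot>\<^bsub>?M2\<^esub> i S2 e'"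
 have Z: "Z \<in> U ?M2" using e' uR iD(1) MD(2) by (simp add: Z_def)
 have at: "a S1 t = \<ominus>\<^bsub>?M2\<^esub> a S1 (\<theta> S1 \<Delta>x) \<oplus>\<^bsub>?M2\<^esub> p \<odot>\<^bsub>?M2\<^esub> Z"
 proof -
  have "a S1 (i S1 e') = p \<odot>\<^bsub>?M2\<^esub> Z"
   using cmorD(3)[OF i e', of S1] e' FM uR MD(2) iD(1) by (simp add: fp_first iD(3) Z_def mod_scale_comm)
  then show ?thesis using th e' iD(1) MD(2) by (simp add: t_def aD(2,5))
 qed
 have atc: "a S1 t \<in> U ?M2" using aD(1) t .
 have xa: "\<Delta>x = \<ominus>\<^bsub>?M2\<^esub> a S1 t \<oplus>\<^bsub>?M2\<^esub> p \<odot>\<^bsub>?M2\<^esub> (X \<oplus>\<^bsub>?M2\<^esub> Z)"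
 proof -
  have "\<ominus>\<^bsub>?M2\<^esub> a S1 t \<oplus>\<^bsub>?M2\<^esub> p \<odot>\<^bsub>?M2\<^esub> (X \<oplus>\<^bsub>?M2\<^esub> Z) = a S1 (\<theta> S1 \<Delta>x) \<oplus>\<^bsub>?M2\<^esub> p \<odot>\<^bsub>?M2\<^esub> X"
   unfolding at using th X Z MD(2) by (simp add: mod_norm)
  then show ?thesis using \<Delta>x by simp
 qed
 define s where "s = \<eta> 0 \<Delta>y \<ominus>\<^bsub>N 0\<^esub> \<xi> 0 t"
 have s: "s \<in> U (N 0)" using et \<xi>D(1) t ND(2) by (simp add: s_def)
 define v where "v = i1 0 t \<oplus>\<^bsub>P 0\<^esub> i2 0 s"
 have v: "v \<in> U (P 0)" "p1 0 v = t" "p2 0 v = s"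
  using t s i1D(1) i2D(1) MD(2) ND(2) PD(2) by (simp_all add: v_def p1D(2) p2D(2) BD(5-8) mod_r_zero mod_l_zero)
 define V where "V = Y \<ominus>\<^bsub>?N1\<^esub> \<xi> S1 (X \<oplus>\<^bsub>?M2\<^esub> Z)"
 have XZ: "X \<oplus>\<^bsub>?M2\<^esub> Z \<in> U ?M2" "\<xi> S1 (X \<oplus>\<^bsub>?M2\<^esub> Z) \<in> U ?N1" using X Z MD(2) \<xi>D(1) by simp_all
 have V: "V \<in> U ?N1" using Y XZ ND(2) by (simp add: V_def)
 define W where "W = i1 S1 (X \<oplus>\<^bsub>?M2\<^esub> Z) \<oplus>\<^bsub>?P1\<^esub> i2 S1 V"
 have W: "W \<in> U ?P1" "p1 S1 W = X \<oplus>\<^bsub>?M2\<^esub> Z" "p2 S1 W = V"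
  using XZ V i1D(1) i2D(1) MD(2) ND(2) PD(2) by (simp_all add: W_def p1D(2) p2D(2) BD(5-8) mod_r_zero mod_l_zero)
 define \<Delta>z where "\<Delta>z = z n \<ominus>\<^bsub>?P1\<^esub> u \<odot>\<^bsub>?P1\<^esub> z 0"
 have \<Delta>z: "\<Delta>z \<in> U ?P1" using c PD(2) uR by (simp add: \<Delta>z_def)
 have Dv: "D 0 v \<in> U ?P1" using DD(1) v(1) .
 have "\<Delta>z = D 0 v \<oplus>\<^bsub>?P1\<^esub> p \<odot>\<^bsub>?P1\<^esub> W"
 proof -
  have 1: "p1 S1 \<Delta>z = p1 S1 (D 0 v \<oplus>\<^bsub>?P1\<^esub> p \<odot>\<^bsub>?P1\<^esub> W)"
  proof -
   have "p1 S1 \<Delta>z = \<Delta>x" using c PD(2) MD(2) uR per by (simp add: \<Delta>z_def \<Delta>x_def p1D x_def)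
   moreover have "p1 S1 (D 0 v \<oplus>\<^bsub>?P1\<^esub> p \<odot>\<^bsub>?P1\<^esub> W) = \<ominus>\<^bsub>?M2\<^esub> a S1 t \<oplus>\<^bsub>?M2\<^esub> p \<odot>\<^bsub>?M2\<^esub> (X \<oplus>\<^bsub>?M2\<^esub> Z)"
    using Dv W PD(2) by (simp add: p1D(2,3) D1[OF v(1)] v(2))
   ultimately show ?thesis using xa by simp
  qed
  have 2: "p2 S1 \<Delta>z = p2 S1 (D 0 v \<oplus>\<^bsub>?P1\<^esub> p \<odot>\<^bsub>?P1\<^esub> W)"
  proof -
   define k1 where "k1 = j S1 (f S1 e)"
   define k2 where "k2 = \<xi> S1 (a S1 t)"
   define k3 where "k3 = b 0 (\<xi> 0 t)"
   define k4 where "k4 = b 0 (\<eta> 0 \<Delta>y)"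
   define k5 where "k5 = p \<odot>\<^bsub>?N1\<^esub> \<xi> S1 (X \<oplus>\<^bsub>?M2\<^esub> Z)"
   define k6 where "k6 = p \<odot>\<^bsub>?N1\<^esub> Y"
   have m: "k1 \<in> U ?N1" "k2 \<in> U ?N1" "k3 \<in> U ?N1" "k4 \<in> U ?N1" "k5 \<in> U ?N1" "k6 \<in> U ?N1"
    using et atc t \<xi>D(1) bD(1) XZ Y ND(2) by (simp_all add: k1_def k2_def k3_def k4_def k5_def k6_def)
   have \<xi>x: "\<xi> S1 \<Delta>x = \<ominus>\<^bsub>?N1\<^esub> k2 \<oplus>\<^bsub>?N1\<^esub> k5"
    unfolding xa k2_def k5_def using atc XZ MD(2) ND(2) by (simp add: \<xi>D(2,3,5))
   have "p2 S1 \<Delta>z = y0 n \<ominus>\<^bsub>?N1\<^esub> u \<odot>\<^bsub>?N1\<^esub> y0 0" using c PD(2) ND(2) uR per by (simp add: \<Delta>z_def p2D y0_def)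
   also have "\<dots> = \<Delta>y \<ominus>\<^bsub>?N1\<^esub> \<xi> S1 \<Delta>x"
   proof -
    define g where "g = \<xi> S1 (x n)"
    define g0 where "g0 = \<xi> S1 (x 0)"
    have gm: "g \<in> U ?N1" "g0 \<in> U ?N1" using c \<xi>D(1) by (simp_all add: g_def g0_def)
    have e1: "\<xi> S1 \<Delta>x = g \<ominus>\<^bsub>?N1\<^esub> u \<odot>\<^bsub>?N1\<^esub> g0" using c MD(2) ND(2) uR by (simp add: \<Delta>x_def \<xi>D g_def g0_def)
    have e2: "\<Delta>y = (y0 n \<oplus>\<^bsub>?N1\<^esub> g) \<ominus>\<^bsub>?N1\<^esub> u \<odot>\<^bsub>?N1\<^esub> (y0 0 \<oplus>\<^bsub>?N1\<^esub> g0)" using per by (simp add: \<Delta>y_def y_def g_def g0_def)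
    have "y0 n \<ominus>\<^bsub>?N1\<^esub> u \<odot>\<^bsub>?N1\<^esub> y0 0 = ((y0 n \<oplus>\<^bsub>?N1\<^esub> g) \<ominus>\<^bsub>?N1\<^esub> u \<odot>\<^bsub>?N1\<^esub> (y0 0 \<oplus>\<^bsub>?N1\<^esub> g0)) \<ominus>\<^bsub>?N1\<^esub> (g \<ominus>\<^bsub>?N1\<^esub> u \<odot>\<^bsub>?N1\<^esub> g0)"
     using c(5,6) gm uR ND(2)[of S1] by algebra
    then show ?thesis unfolding e1 e2 .
   qed
   also have "\<dots> = (k1 \<oplus>\<^bsub>?N1\<^esub> (k4 \<oplus>\<^bsub>?N1\<^esub> k6)) \<ominus>\<^bsub>?N1\<^esub> (\<ominus>\<^bsub>?N1\<^esub> k2 \<oplus>\<^bsub>?N1\<^esub> k5)"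
    using \<Delta>y unfolding \<xi>x by (simp add: k1_def k4_def k6_def)
   also have "\<dots> = ((k1 \<oplus>\<^bsub>?N1\<^esub> (k2 \<oplus>\<^bsub>?N1\<^esub> k3)) \<oplus>\<^bsub>?N1\<^esub> (k4 \<ominus>\<^bsub>?N1\<^esub> k3)) \<oplus>\<^bsub>?N1\<^esub> (k6 \<ominus>\<^bsub>?N1\<^esub> k5)"
    using m ND(2)[of S1] by algebra
   also have "k1 \<oplus>\<^bsub>?N1\<^esub> (k2 \<oplus>\<^bsub>?N1\<^esub> k3) = \<phi> S1 t" using \<phi>v[OF t] by (simp add: k1_def k2_def k3_def qt)
   also have "k4 \<ominus>\<^bsub>?N1\<^esub> k3 = b 0 s" using et t \<xi>D(1) ND(2) by (simp add: s_def k4_def k3_def bD(6))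
   also have "k6 \<ominus>\<^bsub>?N1\<^esub> k5 = p \<odot>\<^bsub>?N1\<^esub> V" using Y XZ ND(2) by (simp add: k5_def k6_def V_def a_minus_def mod_smult_radd mod_smult_rneg)
   also have "(\<phi> S1 t \<oplus>\<^bsub>?N1\<^esub> b 0 s) \<oplus>\<^bsub>?N1\<^esub> p \<odot>\<^bsub>?N1\<^esub> V = p2 S1 (D 0 v \<oplus>\<^bsub>?P1\<^esub> p \<odot>\<^bsub>?P1\<^esub> W)"
    using Dv W PD(2) by (simp add: p2D(2,3) D2[OF v(1)] v)
   finally show ?thesis .
  qed
  have DW: "D 0 v \<oplus>\<^bsub>?P1\<^esub> p \<odot>\<^bsub>?P1\<^esub> W \<in> U ?P1" using Dv W(1) PD(2) by simp
  have "\<Delta>z = i1 S1 (p1 S1 \<Delta>z) \<oplus>\<^bsub>?P1\<^esub> i2 S1 (p2 S1 \<Delta>z)" by (rule BD(9)[OF \<Delta>z, symmetric])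
  also have "\<dots> = D 0 v \<oplus>\<^bsub>?P1\<^esub> p \<odot>\<^bsub>?P1\<^esub> W" unfolding 1 2 by (rule BD(9)[OF DW])
  finally show ?thesis .
 qed
 then have "\<Delta>z \<in> bnd P D 0" using bndI[OF v(1) W(1), of D] by simp
 then show "z n \<ominus>\<^bsub>?P1\<^esub> u \<odot>\<^bsub>?P1\<^esub> z 0 \<in> bnd P D 0" by (simp add: \<Delta>z_def)
qed

end

section \<open>The collections are angulations\<close>

context angulation_setting
begin

text \<open>
 The given maps induce a commutative square on the minimal parts. Their difference to the model
 morphism of this square is null-homotopic, so adding the homotopy to the model morphism yields a
 morphism with the prescribed first two components.
\<close>

lemma morphism_with_cone:
 assumes u: "u \<in> Units R" and cM: "in_class u M a" and cN: "in_class u N b"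
  and g1: "g1 \<in> Lin (M S1) (N S1)" and g2: "g2 \<in> Lin (M S2) (N S2)"
  and sq: "\<And>x. x \<in> U (M S1) ==> g2 (a S1 x) = b S1 (g1 x)"
 obtains \<phi> P D i1 i2 p1 p2 where "cmor M a N b \<phi>" "\<phi> S1 = g1" "\<phi> S2 = g2" "in_class u P D"
  "\<And>k. bip (M (Suc k)) (N k) (P k) (i1 k) (i2 k) (p1 k) (p2 k)"
  "\<And>k. i1 (k + n) = i1 k" "\<And>k. i2 (k + n) = i2 k"
  "\<And>k z. z \<in> U (P k) ==> D k z = i1 (Suc k) (\<ominus>\<^bsub>M (Suc (Suc k))\<^esub> a (Suc k) (p1 k z)) \<oplus>\<^bsub>P (Suc k)\<^esub>
    i2 (Suc k) (\<phi> (Suc k) (p1 k z)) \<oplus>\<^bsub>P (Suc k)\<^esub> i2 (Suc k) (b k (p2 k z))"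
proof -
 have uR: "u \<in> U R" using u by auto
 have M: "cseq M a" "null_composites M a" "exact_seq M a" and N: "cseq N b" "null_composites N b" "exact_seq N b"
  using cM cN by (auto simp: in_class_def)
 obtain F i q \<theta> where sM: "sdr u M a F i q \<theta>" using sdr_exists[OF cM u] .
 obtain G j r \<eta> where sN: "sdr u N b G j r \<eta>" using sdr_exists[OF cN u] .
 note MD = cseqD[OF M(1)] and ND = cseqD[OF N(1)] and aD = homD[OF cseqD(3)[OF M(1)]] and bD = homD[OF cseqD(3)[OF N(1)]]
 note F = sdrD(1)[OF sM] and i = sdrD(2)[OF sM] and q = sdrD(3)[OF sM]
 note G = sdrD(1)[OF sN] and j = sdrD(2)[OF sN] and r = sdrD(3)[OF sN]
 note FM = fg_freeD[OF F] and GM = fg_freeD[OF G]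
 note iD = homD[OF cmorD(1)[OF i]] and qD = homD[OF cmorD(1)[OF q]] and jD = homD[OF cmorD(1)[OF j]] and rD = homD[OF cmorD(1)[OF r]]
 note g1D = homD[OF g1] and g2D = homD[OF g2]
 define f1 where "f1 = (\<lambda>x\<in>U F. r S1 (g1 (i S1 x)))"
 define f2 where "f2 = (\<lambda>x\<in>U F. r S2 (g2 (i S2 x)))"
 have f1h: "f1 \<in> Lin F G" and f2h: "f2 \<in> Lin F G"
  using hom_comp[OF FM cmorD(1)[OF i] hom_comp[OF MD(2) g1 cmorD(1)[OF r]]]
   hom_comp[OF FM cmorD(1)[OF i] hom_comp[OF MD(2) g2 cmorD(1)[OF r]]] iD(1)
  by (simp_all add: f1_def f2_def cong: restrict_cong)
 note f1D = homD[OF f1h] and f2D = homD[OF f2h]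
 have eq: "p \<odot>\<^bsub>G\<^esub> f1 x = p \<odot>\<^bsub>G\<^esub> f2 x" if x: "x \<in> U F" for x
 proof -
  have ix: "i S1 x \<in> U (M S1)" "i S2 x \<in> U (M S2)" using x iD(1) by simp_all
  have m: "f1 x \<in> U G" "f2 x \<in> U G" using x f1D(1) f2D(1) by simp_all
  have ux: "u \<odot>\<^bsub>F\<^esub> (p \<odot>\<^bsub>F\<^esub> x) \<in> U F" "p \<odot>\<^bsub>F\<^esub> x \<in> U F" using x uR FM by simp_all
  have ux2: "fp u F S1 x = u \<odot>\<^bsub>F\<^esub> (p \<odot>\<^bsub>F\<^esub> x)" using fp_first[OF x FM uR] .
  have "u \<odot>\<^bsub>G\<^esub> (p \<odot>\<^bsub>G\<^esub> f2 x) = f2 (fp u F S1 x)" using x ux uR by (simp add: ux2 f2D(3))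
  also have "\<dots> = r S2 (g2 (a S1 (i S1 x)))"
   using cmorD(3)[OF i x, of S1] ux by (simp add: f2_def ux2)
  also have "\<dots> = fp u G S1 (f1 x)"
   using sq[OF ix(1)] cmorD(3)[OF r g1D(1)[OF ix(1)]] x by (simp add: f1_def)
  also have "\<dots> = u \<odot>\<^bsub>G\<^esub> (p \<odot>\<^bsub>G\<^esub> f1 x)" using fp_first[OF m(1) GM uR] .
  finally have "inv u \<odot>\<^bsub>G\<^esub> (u \<odot>\<^bsub>G\<^esub> (p \<odot>\<^bsub>G\<^esub> f2 x)) = inv u \<odot>\<^bsub>G\<^esub> (u \<odot>\<^bsub>G\<^esub> (p \<odot>\<^bsub>G\<^esub> f1 x))" by simp
  then show ?thesis using u uR m GM by (simp add: mod_smult_assoc[symmetric] m_assoc[symmetric])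
 qed
 obtain f where f: "cmor (\<lambda>_. F) (fp u F) (\<lambda>_. G) (fp u G) f" "f S1 = f1" "f S2 = f2"
  and fc: "\<And>A B. cone_chain u F G f A B ==> p \<odot>\<^bsub>F\<^esub> A n = u \<odot>\<^bsub>F\<^esub> (p \<odot>\<^bsub>F\<^esub> A 0) \<and> p \<odot>\<^bsub>G\<^esub> f1 (A 0) = \<zero>\<^bsub>G\<^esub> \<and>
   (\<exists>e\<in>U F. p \<odot>\<^bsub>G\<^esub> B n = u \<odot>\<^bsub>G\<^esub> (p \<odot>\<^bsub>G\<^esub> B 0) \<oplus>\<^bsub>G\<^esub> p \<odot>\<^bsub>G\<^esub> f1 e)"
  by (rule model_morphism[OF u F G f1h f2h eq], assumption) (rule that)
 note fD = homD[OF cmorD(1)[OF f(1)]]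
 define \<psi>0 where "\<psi>0 = (\<lambda>k. \<lambda>x\<in>U (M k). f k (q k x))"
 define \<psi> where "\<psi> = (\<lambda>k. \<lambda>x\<in>U (M k). j k (\<psi>0 k x))"
 have \<psi>: "cmor M a N b \<psi>"
  unfolding \<psi>_def \<psi>0_def by (rule cmor_comp[OF M(1) cmor_comp[OF M(1) q f(1)] j])
 have \<psi>v: "\<psi> k x = j k (f k (q k x))" if "x \<in> U (M k)" for k x using that by (simp add: \<psi>_def \<psi>0_def)
 note \<psi>D = homD[OF cmorD(1)[OF \<psi>]]
 define d1 where "d1 = (\<lambda>x\<in>U (M S1). g1 x \<ominus>\<^bsub>N S1\<^esub> \<psi> S1 x)"
 define d2 where "d2 = (\<lambda>x\<in>U (M S2). g2 x \<ominus>\<^bsub>N S2\<^esub> \<psi> S2 x)"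
 have d1h: "d1 \<in> Lin (M S1) (N S1)" unfolding d1_def by (rule hom_diff[OF MD(2) ND(2) g1 cmorD(1)[OF \<psi>]])
 have d2h: "d2 \<in> Lin (M S2) (N S2)" unfolding d2_def by (rule hom_diff[OF MD(2) ND(2) g2 cmorD(1)[OF \<psi>]])
 have dsq: "d2 (a S1 x) = b S1 (d1 x)" if x: "x \<in> U (M S1)" for x
  using x aD(1)[OF x] g1D(1)[OF x] \<psi>D(1)[OF x] ND(2) by (simp add: d1_def d2_def bD(6) sq cmorD(3)[OF \<psi> x])
 have n1: "r S1 (d1 (i S1 x)) = \<zero>\<^bsub>G\<^esub>" if x: "x \<in> U F" for x
 proof -
  have m: "i S1 x \<in> U (M S1)" "f1 x \<in> U G" using x iD(1) f1D(1) by simp_all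
  have "r S1 (d1 (i S1 x)) = f1 x \<ominus>\<^bsub>G\<^esub> f1 x"
   using x m ND(2) GM g1D(1)[OF m(1)] \<psi>D(1)[OF m(1)] jD(1)
   by (simp add: d1_def rD(6) \<psi>v f(2) sdrD(4)[OF sM] sdrD(4)[OF sN]) (simp add: f1_def)
  then show ?thesis using m GM by (simp add: mod_norm)
 qed
 have n2: "r S2 (d2 (i S2 x)) = \<zero>\<^bsub>G\<^esub>" if x: "x \<in> U F" for x
 proof -
  have m: "i S2 x \<in> U (M S2)" "f2 x \<in> U G" using x iD(1) f2D(1) by simp_all
  have "r S2 (d2 (i S2 x)) = f2 x \<ominus>\<^bsub>G\<^esub> f2 x"
   using x m ND(2) GM g2D(1)[OF m(1)] \<psi>D(1)[OF m(1)] jD(1)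
   by (simp add: d2_def rD(6) \<psi>v f(3) sdrD(4)[OF sM] sdrD(4)[OF sN]) (simp add: f2_def)
  then show ?thesis using m GM by (simp add: mod_norm)
 qed
 obtain \<xi> where \<xi>: "\<And>k. \<xi> k \<in> Lin (M (Suc k)) (N k)" "\<And>k. \<xi> (k + n) = \<xi> k"
  and h1: "\<And>x. x \<in> U (M S1) ==> d1 x = \<xi> S1 (a S1 x) \<oplus>\<^bsub>N S1\<^esub> b 0 (\<xi> 0 x)"
  and h2: "\<And>x. x \<in> U (M S2) ==> d2 x = \<xi> S2 (a S2 x) \<oplus>\<^bsub>N S2\<^esub> b S1 (\<xi> S1 x)"
  by (rule null_homotopy[OF u cM cN sM sN d1h d2h dsq n1 n2], assumption, assumption, assumption) (rule that)
 obtain \<phi> where \<phi>: "cmor M a N b \<phi>" and \<phi>v: "\<And>k x. x \<in> U (M (Suc k)) ==>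
  \<phi> (Suc k) x = \<psi> (Suc k) x \<oplus>\<^bsub>N (Suc k)\<^esub> (\<xi> (Suc k) (a (Suc k) x) \<oplus>\<^bsub>N (Suc k)\<^esub> b k (\<xi> k x))"
  by (rule homotopic_morphism[OF M(1) N(1) M(2) N(2) \<psi> \<xi>]) (rule that)
 have p1: "\<phi> S1 = g1"
 proof (rule hom_eqI[OF cmorD(1)[OF \<phi>] g1])
  fix x assume x: "x \<in> U (M S1)"
  have m: "g1 x \<in> U (N S1)" "\<psi> S1 x \<in> U (N S1)" using x g1D(1) \<psi>D(1) by simp_all
  have "\<phi> S1 x = \<psi> S1 x \<oplus>\<^bsub>N S1\<^esub> d1 x" using \<phi>v[OF x] h1[OF x] by simp
  also have "\<dots> = g1 x" using x m ND(2) by (simp add: d1_def mod_norm)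
  finally show "\<phi> S1 x = g1 x" .
 qed
 have p2: "\<phi> S2 = g2"
 proof (rule hom_eqI[OF cmorD(1)[OF \<phi>] g2])
  fix x assume x: "x \<in> U (M S2)"
  have m: "g2 x \<in> U (N S2)" "\<psi> S2 x \<in> U (N S2)" using x g2D(1) \<psi>D(1) by simp_all
  have "\<phi> S2 x = \<psi> S2 x \<oplus>\<^bsub>N S2\<^esub> d2 x" using \<phi>v[OF x] h2[OF x] by simp
  also have "\<dots> = g2 x" using x m ND(2) by (simp add: d2_def mod_norm)
  finally show "\<phi> S2 x = g2 x" .
 qed
 obtain P D i1 i2 pr1 pr2 where P: "cseq P D"
  and B: "\<And>k. bip (M (Suc k)) (N k) (P k) (i1 k) (i2 k) (pr1 k) (pr2 k)"
  and per: "\<And>k. i1 (k + n) = i1 k" "\<And>k. i2 (k + n) = i2 k" "\<And>k. pr1 (k + n) = pr1 k" "\<And>k. pr2 (k + n) = pr2 k"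
  and Dv: "\<And>k z. z \<in> U (P k) ==> D k z = i1 (Suc k) (\<ominus>\<^bsub>M (Suc (Suc k))\<^esub> a (Suc k) (pr1 k z)) \<oplus>\<^bsub>P (Suc k)\<^esub>
    i2 (Suc k) (\<phi> (Suc k) (pr1 k z)) \<oplus>\<^bsub>P (Suc k)\<^esub> i2 (Suc k) (b k (pr2 k z))"
  and D1: "\<And>k z. z \<in> U (P k) ==> pr1 (Suc k) (D k z) = \<ominus>\<^bsub>M (Suc (Suc k))\<^esub> a (Suc k) (pr1 k z)"
  and D2: "\<And>k z. z \<in> U (P k) ==> pr2 (Suc k) (D k z) = \<phi> (Suc k) (pr1 k z) \<oplus>\<^bsub>N (Suc k)\<^esub> b k (pr2 k z)"
  by (rule cone_construct[OF M(1) N(1) \<phi>]) (rule that)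
 note ne = cone_exact[where M=M and a=a and N=N and b=b and f=\<phi> and P=P and D=D and ?i1.0=i1 and ?i2.0=i2 and ?p1.0=pr1 and ?p2.0=pr2, OF M N \<phi> P B D1 D2]
 have fc': "p \<odot>\<^bsub>F\<^esub> A n = u \<odot>\<^bsub>F\<^esub> (p \<odot>\<^bsub>F\<^esub> A 0) \<and> (\<exists>e\<in>U F. p \<odot>\<^bsub>G\<^esub> B n = u \<odot>\<^bsub>G\<^esub> (p \<odot>\<^bsub>G\<^esub> B 0) \<oplus>\<^bsub>G\<^esub> p \<odot>\<^bsub>G\<^esub> f S1 e)"
  if "cone_chain u F G f A B" for A B using fc[OF that] f(2) by simp
 have \<phi>v': "\<phi> (Suc k) x = j (Suc k) (f (Suc k) (q (Suc k) x)) \<oplus>\<^bsub>N (Suc k)\<^esub>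
    (\<xi> (Suc k) (a (Suc k) x) \<oplus>\<^bsub>N (Suc k)\<^esub> b k (\<xi> k x))" if "x \<in> U (M (Suc k))" for k x
  using \<phi>v[OF that] \<psi>v[OF that] by simp
 have "holonomy u P D 0"
  by (rule cone_holonomy[where M=M and a=a and N=N and b=b and F=F and G=G and f=f and \<phi>=\<phi> and \<xi>=\<xi> and P=P and D=D and ?i1.0=i1 and ?i2.0=i2
    and ?p1.0=pr1 and ?p2.0=pr2, OF u cM cN sM sN f(1) fc' \<xi> \<phi> \<phi>v' P B per D1 D2])
 then have "in_class u P D" using P ne by (simp add: in_class_def)
 show thesis by (rule that[OF \<phi> p1 p2 \<open>in_class u P D\<close> B per(1,2) Dv])
qed

lemma mapping_cone_mk:
 assumes M: "cseq M a" and N: "cseq N b" and \<phi>: "cmor M a N b \<phi>" and P: "cseq P D"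
  and B: "\<And>k. bip (M (Suc k)) (N k) (P k) (i1 k) (i2 k) (p1 k) (p2 k)"
  and per: "\<And>k. i1 (k + n) = i1 k" "\<And>k. i2 (k + n) = i2 k"
  and D: "\<And>k z. z \<in> U (P k) ==> D k z = i1 (Suc k) (\<ominus>\<^bsub>M (Suc (Suc k))\<^esub> a (Suc k) (p1 k z)) \<oplus>\<^bsub>P (Suc k)\<^esub>
    i2 (Suc k) (\<phi> (Suc k) (p1 k z)) \<oplus>\<^bsub>P (Suc k)\<^esub> i2 (Suc k) (b k (p2 k z))"
 shows "mapping_cone C n (mk M a) (mk N b) (\<lambda>i. (M i, \<phi> i, N i)) (mk P D)"
 unfolding mapping_cone_def
proof (intro conjI exI ballI)
 note MD = cseqD[OF M] and ND = cseqD[OF N] and PD = cseqD[OF P] and BD = bipD[OF B]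
 show "mk P D \<in> n_sequences C n" using mk_in_n_sequences[OF P] .
 fix i assume i: "i \<in> {1..n}"
 then have o: "obj C n (mk M a) (i + 1) = M (Suc i)" "obj C n (mk N b) i = N i" "obj C n (mk P D) i = P i"
  using obj_mk[OF M, of "i + 1"] obj_mk[OF N, of i] obj_mk[OF P, of i] by auto
 show "biproduct C (obj C n (mk M a) (i + 1)) (obj C n (mk N b) i) (obj C n (mk P D) i)
   (M (Suc i), i1 i, P i) (N i, i2 i, P i) (P i, p1 i, M (Suc i)) (P i, p2 i, N i)"
  unfolding o using biproduct_iff[OF MD(1) ND(1) PD(1)] B by blast
 have ii: "i + 1 \<in> {1..n + 2}" using i by auto
 have c: "cont C n (\<lambda>i. (M (Suc i), i1 i, P i)) (i + 1) = (M (Suc (i + 1)), i1 (i + 1), P (i + 1))"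
  "cont C n (\<lambda>i. (N i, i2 i, P i)) (i + 1) = (N (i + 1), i2 (i + 1), P (i + 1))"
  "cont C n (\<lambda>i. (M i, \<phi> i, N i)) (i + 1) = (M (i + 1), \<phi> (i + 1), N (i + 1))"
  by (rule cont_eq[OF ii]; simp add: per MD(6) MD(4) ND(4) PD(4) cmorD(2)[OF \<phi>])+
 have d: "D i = (\<lambda>z\<in>U (P i). i1 (Suc i) (\<ominus>\<^bsub>M (Suc (Suc i))\<^esub> a (Suc i) (p1 i z)) \<oplus>\<^bsub>P (Suc i)\<^esub>
    i2 (Suc i) (\<phi> (Suc i) (p1 i z)) \<oplus>\<^bsub>P (Suc i)\<^esub> i2 (Suc i) (b i (p2 i z)))"
 proof
  fix z
  have "D i z = undefined" if "z \<notin> U (P i)" using PD(3)[of i] that by (auto simp: module_hom_def PiE_def extensional_def)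
  then show "D i z = (\<lambda>z\<in>U (P i). i1 (Suc i) (\<ominus>\<^bsub>M (Suc (Suc i))\<^esub> a (Suc i) (p1 i z)) \<oplus>\<^bsub>P (Suc i)\<^esub>
    i2 (Suc i) (\<phi> (Suc i) (p1 i z)) \<oplus>\<^bsub>P (Suc i)\<^esub> i2 (Suc i) (b i (p2 i z))) z" using D by simp
 qed
 have p1c: "p1 i z \<in> U (M (Suc i))" if "z \<in> U (P i)" for z using hom_closed[OF BD(3) that] .
 have p2c: "p2 i z \<in> U (N i)" if "z \<in> U (P i)" for z using hom_closed[OF BD(4) that] .
 show "mk P D i = (cont C n (\<lambda>i. (M (Suc i), i1 i, P i)) (i + 1) \<bullet>\<^bsub>C\<^esub> NegArr C (cont C n (mk M a) (i + 1)) \<bullet>\<^bsub>C\<^esub> (P i, p1 i, M (Suc i))) \<boxplus>\<^bsub>C\<^esub>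
   (cont C n (\<lambda>i. (N i, i2 i, P i)) (i + 1) \<bullet>\<^bsub>C\<^esub> cont C n (\<lambda>i. (M i, \<phi> i, N i)) (i + 1) \<bullet>\<^bsub>C\<^esub> (P i, p1 i, M (Suc i))) \<boxplus>\<^bsub>C\<^esub>
   (cont C n (\<lambda>i. (N i, i2 i, P i)) (i + 1) \<bullet>\<^bsub>C\<^esub> mk N b i \<bullet>\<^bsub>C\<^esub> (P i, p2 i, N i))"
  unfolding c cont_mk[OF M ii] mk_eq[OF i] unfolding free_mod_simps Suc_eq_plus1[symmetric]
  by (subst d) (simp add: p1c p2c restrict_eq_iff)
qed

lemma Hom_obj_mk:
 assumes M: "cseq M a" and N: "cseq N b" and i: "i \<in> {1..n + 2}" and f: "f \<in> Hom C (obj C n (mk M a) i) (obj C n (mk N b) i)"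
 obtains g where "f = (M i, g, N i)" "g \<in> Lin (M i) (N i)"
proof -
 have "f \<in> Hom C (M i) (N i)" using f obj_mk[OF M i] obj_mk[OF N i] by simp
 then show thesis using that by (auto simp: Hom_free_mod)
qed

lemma square_mk:
 assumes "cseq M a" "cseq N b" and g: "g1 \<in> Lin (M 1) (N 1)"
  and e: "(M 2, g2, N 2) \<bullet>\<^bsub>C\<^esub> mk M a 1 = mk N b 1 \<bullet>\<^bsub>C\<^esub> (M 1, g1, N 1)" and x: "x \<in> U (M S1)"
 shows "g2 (a S1 x) = b S1 (g1 x)"
proof -
 have o: "(1::nat) \<in> {1..n}" using n_ge by auto
 have "(\<lambda>x\<in>U (M S1). g2 (a S1 x)) = (\<lambda>x\<in>U (M S1). b S1 (g1 x))"
  using e unfolding mk_eq[OF o] by (simp add: numeral_2_eq_2)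
 from fun_cong[OF this, of x] x show ?thesis by simp
qed

lemma N_coll_axiom_N4:
 assumes u: "u \<in> Units R"
 shows "axiom_N4 C n (N_coll R n p u :: (nat => ('a, 'm) mod_arrow) set)"
 unfolding axiom_N4_def
proof (intro ballI impI)
 fix \<alpha> \<beta> :: "nat => ('a, 'm) mod_arrow" and f1 f2
 assume \<alpha>: "\<alpha> \<in> N_coll R n p u" and \<beta>: "\<beta> \<in> N_coll R n p u"
  and f1: "f1 \<in> Hom C (obj C n \<alpha> 1) (obj C n \<beta> 1)" and f2: "f2 \<in> Hom C (obj C n \<alpha> 2) (obj C n \<beta> 2)"
  and e: "f2 \<bullet>\<^bsub>C\<^esub> \<alpha> 1 = \<beta> 1 \<bullet>\<^bsub>C\<^esub> f1"
 obtain M a where cM: "in_class u M a" and [simp]: "\<alpha> = mk M a" using \<alpha> N_coll_eq[OF u] by auto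
 obtain N b where cN: "in_class u N b" and [simp]: "\<beta> = mk N b" using \<beta> N_coll_eq[OF u] by auto
 have M: "cseq M a" and N: "cseq N b" using cM cN by (auto simp: in_class_def)
 obtain g1 where g1: "f1 = (M 1, g1, N 1)" "g1 \<in> Lin (M 1) (N 1)"
  using Hom_obj_mk[OF M N, of 1 f1] f1 by auto
 obtain g2 where g2: "f2 = (M 2, g2, N 2)" "g2 \<in> Lin (M 2) (N 2)"
  using Hom_obj_mk[OF M N, of 2 f2] f2 by auto
 have sq: "g2 (a S1 x) = b S1 (g1 x)" if "x \<in> U (M S1)" for x
  using square_mk[OF M N g1(2) _ that] e g1(1) g2(1) by simp
 have h: "g1 \<in> Lin (M S1) (N S1)" "g2 \<in> Lin (M S2) (N S2)"
  using g1(2) g2(2) by (simp_all add: numeral_2_eq_2)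
 obtain \<phi> P D i1 i2 p1 p2 where \<phi>: "cmor M a N b \<phi>" "\<phi> S1 = g1" "\<phi> S2 = g2" and c: "in_class u P D"
  and B: "\<And>k. bip (M (Suc k)) (N k) (P k) (i1 k) (i2 k) (p1 k) (p2 k)"
  and per: "\<And>k. i1 (k + n) = i1 k" "\<And>k. i2 (k + n) = i2 k"
  and D: "\<And>k z. z \<in> U (P k) ==> D k z = i1 (Suc k) (\<ominus>\<^bsub>M (Suc (Suc k))\<^esub> a (Suc k) (p1 k z)) \<oplus>\<^bsub>P (Suc k)\<^esub>
    i2 (Suc k) (\<phi> (Suc k) (p1 k z)) \<oplus>\<^bsub>P (Suc k)\<^esub> i2 (Suc k) (b k (p2 k z))"
  by (rule morphism_with_cone[OF u cM cN h sq], assumption) (rule that)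
 have P: "cseq P D" using c by (simp add: in_class_def)
 have "seq_morphism C n \<alpha> \<beta> (\<lambda>i. (M i, \<phi> i, N i))" using \<phi>(1) by (auto simp: seq_morphism_mk[OF M N])
 moreover have "mapping_cone C n \<alpha> \<beta> (\<lambda>i. (M i, \<phi> i, N i)) (mk P D)"
  using mapping_cone_mk[OF M N \<phi>(1) P B per D] by simp
 moreover have "mk P D \<in> N_coll R n p u" using c N_coll_eq[OF u] by auto
 ultimately show "\<exists>\<phi>. seq_morphism C n \<alpha> \<beta> \<phi> \<and> \<phi> 1 = f1 \<and> \<phi> 2 = f2 \<and> (\<exists>\<kappa>\<in>N_coll R n p u. mapping_cone C n \<alpha> \<beta> \<phi> \<kappa>)"
  using g1(1) g2(1) \<phi>(2,3) by (intro exI[of _ "\<lambda>i. (M i, \<phi> i, N i)"]) (auto simp: numeral_2_eq_2)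
qed

lemma N4_imp_N3: "axiom_N4 D n \<N> ==> axiom_N3 D n \<N>"
 unfolding axiom_N3_def axiom_N4_def by meson

text \<open>
 All closure properties are instances of closure under direct sums and retracts.
\<close>

lemma N_coll_axiom_N1:
 assumes u: "u \<in> Units R"
 shows "axiom_N1 C n (N_coll R n p u :: (nat => ('a, 'm) mod_arrow) set)"
proof -
 have uR: "u \<in> U R" using u by auto
 note E = N_coll_eq[OF u]
 have I: "mk M a \<in> N_coll R n p u" if "in_class u M a" for M :: "nat => ('a, 'm) module" and a using that E by auto
 have retract: "\<beta> \<in> N_coll R n p u" if "\<alpha> = mk M a" "in_class u M a" "\<beta> = mk N b" "cseq N b"
  "cmor N b M a i" "cmor M a N b q" "\<And>k x. x \<in> U (N k) ==> q k (i k x) = x"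
  for \<alpha> \<beta> :: "nat => ('a, 'm) mod_arrow" and M a N b i q
  unfolding that(3) by (rule I, rule in_class_retract[OF that(2) uR that(4,5,6,7)])
 show ?thesis unfolding axiom_N1_def
 proof (intro conjI ballI allI impI)
  fix \<alpha> \<beta> \<sigma> :: "nat => ('a, 'm) mod_arrow"
  assume "\<alpha> \<in> N_coll R n p u" "\<beta> \<in> N_coll R n p u" "\<sigma> \<in> n_sequences C n" and s: "seq_direct_sum C n \<alpha> \<beta> \<sigma>"
  then obtain M a N b P c where cM: "in_class u M a" "\<alpha> = mk M a" and cN: "in_class u N b" "\<beta> = mk N b" and P: "cseq P c" "\<sigma> = mk P c"
   unfolding E by (auto elim!: n_sequences_mk)
  have M: "cseq M a" and N: "cseq N b" using cM cN by (auto simp: in_class_def)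
  obtain i1 i2 p1 p2 where "cmor M a P c i1" "cmor N b P c i2" "cmor P c M a p1" "cmor P c N b p2"
   and B: "\<forall>i. bip (M i) (N i) (P i) (i1 i) (i2 i) (p1 i) (p2 i)"
   using s seq_direct_sum_mk[OF M N P(1)] by (auto simp: cM(2) cN(2) P(2))
  then show "\<sigma> \<in> N_coll R n p u" unfolding P(2)
   using in_class_direct_sum[OF cM(1) cN(1) uR P(1), of i1 i2 p1 p2] I by simp
 next
  fix \<alpha> \<beta> \<sigma> :: "nat => ('a, 'm) mod_arrow"
  assume "\<alpha> \<in> n_sequences C n" "\<beta> \<in> n_sequences C n" "\<sigma> \<in> N_coll R n p u" and s: "seq_direct_sum C n \<alpha> \<beta> \<sigma>"
  then obtain M a N b P c where M: "cseq M a" "\<alpha> = mk M a" and N: "cseq N b" "\<beta> = mk N b" and P: "in_class u P c" "\<sigma> = mk P c"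
   unfolding E by (auto elim!: n_sequences_mk)
  have Pc: "cseq P c" using P by (auto simp: in_class_def)
  obtain i1 i2 p1 p2 where m: "cmor M a P c i1" "cmor N b P c i2" "cmor P c M a p1" "cmor P c N b p2"
   and B: "\<And>i. bip (M i) (N i) (P i) (i1 i) (i2 i) (p1 i) (p2 i)"
   using s seq_direct_sum_mk[OF M(1) N(1) Pc] by (auto simp: M(2) N(2) P(2))
  note BD = bipD[OF B]
  show "\<alpha> \<in> N_coll R n p u" by (rule retract[OF P(2,1) M(2,1) m(1,3) BD(5)])
  show "\<beta> \<in> N_coll R n p u" by (rule retract[OF P(2,1) N(2,1) m(2,4) BD(7)])
 next
  fix \<alpha> \<beta> :: "nat => ('a, 'm) mod_arrow"
  assume "\<alpha> \<in> N_coll R n p u" "\<beta> \<in> n_sequences C n" and s: "seq_iso C n \<alpha> \<beta>"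
  then obtain M a N b where cM: "in_class u M a" "\<alpha> = mk M a" and N: "cseq N b" "\<beta> = mk N b"
   unfolding E by (auto elim!: n_sequences_mk)
  have M: "cseq M a" using cM by (auto simp: in_class_def)
  obtain f g where fg: "cmor M a N b f" "cmor N b M a g" "\<And>i x. x \<in> U (M i) ==> g i (f i x) = x"
   "\<And>i y. y \<in> U (N i) ==> f i (g i y) = y"
   by (rule seq_iso_mkD[OF M N(1) s[unfolded cM(2) N(2)]]) (rule that)
  show "\<beta> \<in> N_coll R n p u" by (rule retract[OF cM(2,1) N(2,1) fg(2,1,4)])
 next
  fix X Z :: "('a, 'm) module" assume "X \<in> Ob C" "zero_object C Z"
  then have X: "Free X" and Z: "zero_mod Z" by (simp_all add: zero_object_iff)
  have o: "1 \<in> {1..n}" using n_ge by auto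
  show "trivial_seq C n Z X \<in> N_coll R n p u"
   unfolding trivial_seq_mk[OF Z X] by (rule I, rule T_in_class[OF o Z X uR])
 next
  fix f :: "('a, 'm) mod_arrow" assume "f \<in> Arr C"
  then obtain A g B where f: "f = (A, g, B)" "Free A" "Free B" "g \<in> Lin A B" by auto
  obtain M a where c: "in_class u M a" "M S1 = A" "M S2 = B" "a S1 = g"
   using extends_every_map[OF u f(2,3,4)] unfolding extends_def by blast
  have "mk M a 1 = f" using c f n_ge by (simp add: mk_def)
  then show "\<exists>\<alpha>\<in>N_coll R n p u. \<alpha> 1 = f" using I[OF c(1)] by blast
 qed
qed

lemma mk_inject:
 assumes M: "cseq M a" and N: "cseq N b" and e: "mk M a = mk N b"
 shows "N = M" "b = a"
proof -
 note MD = cseqD[OF M] and ND = cseqD[OF N]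
 have "N i = M i \<and> b i = a i" for i
 proof -
  have "mk M a (cyc i) = mk N b (cyc i)" using e by simp
  then have "N (cyc i) = M (cyc i)" "b (cyc i) = a (cyc i)"
   using mk_eq[OF cyc_index_range[OF n_pos, of i]] by auto
  then show ?thesis using periodic_cyc_index[of n N i] periodic_cyc_index[of n M i] periodic_cyc_index[of n b i] periodic_cyc_index[of n a i]
   MD(4,5) ND(4,5) by simp
 qed
 then show "N = M" "b = a" by auto
qed

lemma N_coll_axiom_N2:
 assumes u: "u \<in> Units R"
 shows "axiom_N2 C n (N_coll R n p u :: (nat => ('a, 'm) mod_arrow) set)"
 unfolding axiom_N2_def
proof (intro ballI)
 have uR: "u \<in> U R" using u by auto
 note E = N_coll_eq[OF u]
 fix \<alpha> :: "nat => ('a, 'm) mod_arrow" assume "\<alpha> \<in> n_sequences C n"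
 then obtain M a where M: "cseq M a" and \<alpha>: "\<alpha> = mk M a" by (rule n_sequences_mk)
 show "\<alpha> \<in> N_coll R n p u \<longleftrightarrow> left_rotation C n \<alpha> \<in> N_coll R n p u"
 proof
  assume "\<alpha> \<in> N_coll R n p u"
  then obtain M' a' where c: "in_class u M' a'" and e: "mk M a = mk M' a'" unfolding E \<alpha> by auto
  have "M' = M" "a' = a" using mk_inject[OF M _ e] c by (auto simp: in_class_def)
  then have "in_class u (\<lambda>i. M (Suc i)) (rot_maps M a)" using in_class_rotation[OF M uR] c by simp
  then show "left_rotation C n \<alpha> \<in> N_coll R n p u" unfolding \<alpha> left_rotation_mk[OF M] E by blast
 next
  assume "left_rotation C n \<alpha> \<in> N_coll R n p u"
  then obtain M' a' where c: "in_class u M' a'" and e: "mk (\<lambda>i. M (Suc i)) (rot_maps M a) = mk M' a'"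
   unfolding E \<alpha> left_rotation_mk[OF M] by auto
  have "M' = (\<lambda>i. M (Suc i))" "a' = rot_maps M a" using mk_inject[OF rot_cseq(1)[OF M] _ e] c by (auto simp: in_class_def)
  then have "in_class u M a" using in_class_rotation[OF M uR] c by simp
  then show "\<alpha> \<in> N_coll R n p u" unfolding \<alpha> E by blast
 qed
qed

theorem N_coll_angulation:
 assumes u: "u \<in> Units R"
 shows "n_angulation C n (N_coll R n p u :: (nat => ('a, 'm) mod_arrow) set)"
 unfolding n_angulation_def
 using N_coll_axiom_N1[OF u] N_coll_axiom_N2[OF u] N_coll_axiom_N4[OF u] N4_imp_N3[OF N_coll_axiom_N4[OF u]]
 by (auto simp: N_coll_def)

end

section \<open>The members of an angulation\<close>

context angulation_setting
begin

text \<open>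
 A copy of \<open>R\<close> as a module over itself with U in the given type.
\<close>

lemma rank_one_module:
 obtains L :: "('a, 'm) module" and e where "Free L" "e \<in> U L"
  "\<And>y. y \<in> U L ==> \<exists>c\<in>U R. y = c \<odot>\<^bsub>L\<^esub> e"
  "\<And>c. c \<in> U R ==> c \<odot>\<^bsub>L\<^esub> e = \<zero>\<^bsub>L\<^esub> ==> c = \<zero>"
  "\<And>N x. module R N ==> x \<in> U N ==> \<exists>g\<in>Lin L N. g e = (x :: 'm)"
proof -
 obtain L :: "('a, 'm) module" and f :: "unit => 'm" where L: "Free L" "basis_family L {()} f"
  using free_of_rank[of "{()}"] by auto
 note LM = fg_freeD[OF L(1)]
 have e: "f () \<in> U L" using L(2) by (auto simp: basis_family_def)
 have lin: "lin L {()} f c = c () \<odot>\<^bsub>L\<^esub> f ()" if "c () \<in> U R" for c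
  using lin_insert[OF LM, of "{}" "()" f c] that e LM by (simp add: mod_r_zero)
 have "\<exists>c\<in>U R. y = c \<odot>\<^bsub>L\<^esub> f ()" if y: "y \<in> U L" for y
 proof -
  obtain c where "c \<in> {()} \<rightarrow> U R" "y = lin L {()} f c" using L(2) y unfolding basis_family_def by blast
  then show ?thesis using lin[of c] by auto
 qed
 moreover have "c = \<zero>" if c: "c \<in> U R" "c \<odot>\<^bsub>L\<^esub> f () = \<zero>\<^bsub>L\<^esub>" for c
 proof -
  have "lin L {()} f (\<lambda>_. c) = \<zero>\<^bsub>L\<^esub>" using lin[of "\<lambda>_. c"] c by simp
  moreover have "(\<lambda>_. c) \<in> {()} \<rightarrow> U R" using c by simp
  ultimately show ?thesis using L(2) unfolding basis_family_def by blast
 qed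
 moreover have "\<exists>g\<in>Lin L N. g (f ()) = x" if "module R N" "x \<in> U N" for N and x :: 'm
  using linear_extension[OF LM that(1) L(2), of "\<lambda>_. x"] that(2) by auto
 ultimately show thesis using that[of L "f ()"] L(1) e by blast
qed

lemma chain_exists:
 assumes M: "cseq M a" and nc: "null_composites M a" and x0: "x0 \<in> U (M s)" and x1: "x1 \<in> U (M (Suc s))"
  and e: "a s x0 = p \<odot>\<^bsub>M (Suc s)\<^esub> x1"
 obtains x where "chain M a s x" "x 0 = x0" "x S1 = x1"
proof -
 let ?Q = "\<lambda>j (v, w). v \<in> U (M (s + j)) \<and> w \<in> U (M (Suc (s + j))) \<and> a (s + j) v = p \<odot>\<^bsub>M (Suc (s + j))\<^esub> w"
 have step: "\<exists>t'. ?Q (Suc j) t' \<and> fst t' = snd t" if "?Q j t" for j t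
 proof -
  obtain v w where [simp]: "t = (v, w)" by (cases t)
  have "v \<in> U (M (s + j))" "w \<in> U (M (Suc (s + j)))" "a (s + j) v = p \<odot>\<^bsub>M (Suc (s + j))\<^esub> w" using that by auto
  then obtain y where "y \<in> U (M (Suc (Suc (s + j))))" "a (Suc (s + j)) w = p \<odot>\<^bsub>M (Suc (Suc (s + j)))\<^esub> y"
   using p_image_cycle[OF M nc] by blast
  then show ?thesis using that by (intro exI[of _ "(w, y)"]) simp
 qed
 have base: "?Q 0 (x0, x1)" using x0 x1 e by simp
 have "\<exists>t. \<forall>j. (?Q j (t j) \<and> (j = 0 \<longrightarrow> t j = (x0, x1))) \<and> fst (t (Suc j)) = snd (t j)"
 proof (rule dependent_nat_choice)
  show "\<exists>t. ?Q 0 t \<and> ((0::nat) = 0 \<longrightarrow> t = (x0, x1))" using base by blast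
  fix t j assume "?Q j t \<and> (j = 0 \<longrightarrow> t = (x0, x1))"
  then show "\<exists>t'. (?Q (Suc j) t' \<and> (Suc j = 0 \<longrightarrow> t' = (x0, x1))) \<and> fst t' = snd t" using step[of j t] by blast
 qed
 then obtain t where T: "\<forall>j. (?Q j (t j) \<and> (j = 0 \<longrightarrow> t j = (x0, x1))) \<and> fst (t (Suc j)) = snd (t j)" by (rule exE)
 have t0: "t 0 = (x0, x1)" using spec[OF T, of 0] by simp
 have tQ: "?Q j (t j)" and ts: "fst (t (Suc j)) = snd (t j)" for j
  using spec[OF T, of j] by (rule conjunct1[OF conjunct1]) (rule spec[OF T, THEN conjunct2])
 have "chain M a s (\<lambda>j. fst (t j))" unfolding chain_def
 proof (intro conjI allI impI)
  fix j
  show "fst (t j) \<in> U (M (s + j))" "a (s + j) (fst (t j)) = p \<odot>\<^bsub>M (Suc (s + j))\<^esub> fst (t (Suc j))"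
   using tQ[of j] ts[of j] by (simp_all add: case_prod_beta)
 qed
 then show thesis using that[of "\<lambda>j. fst (t j)"] t0 ts[of 0] by simp
qed

end

locale angulation = angulation_setting R p universe n
 for R :: "('a, 'r) ring_scheme" (structure) and p and universe :: "'m itself" and n +
 fixes \<N> :: "(nat => ('a, 'm) mod_arrow) set"
 assumes ang: "n_angulation (free_mod R) n \<N>"
begin

text \<open>
 Membership in the given \<open>n\<close>-angulation for sequences written as periodic families.
\<close>

definition angle :: "(nat => ('a, 'm) module) => (nat => 'm => 'm) => bool"
 where "angle M a \<longleftrightarrow> cseq M a \<and> mk M a \<in> \<N>"

lemma angle_of_member:
 assumes "\<alpha> \<in> \<N>"
 obtains M a where "angle M a" "\<alpha> = mk M a"
proof -
 have "\<alpha> \<in> n_sequences C n" using ang assms by (auto simp: n_angulation_def)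
 then show thesis using that assms by (auto simp: angle_def elim!: n_sequences_mk)
qed

lemma angle_cseq: "angle M a ==> cseq M a"
 by (simp add: angle_def)

lemma angle_sum:
 assumes N: "angle N b" and K: "angle K c" and M: "cseq M a"
  and m: "cmor N b M a i" "cmor K c M a j" "cmor M a N b q" "cmor M a K c r"
  and B: "\<And>k. bip (N k) (K k) (M k) (i k) (j k) (q k) (r k)"
 shows "angle M a"
proof -
 have "seq_direct_sum C n (mk N b) (mk K c) (mk M a)"
  using seq_direct_sum_mk[OF angle_cseq[OF N] angle_cseq[OF K] M] m B by blast
 then show ?thesis using ang N K M mk_in_n_sequences[OF M]
  unfolding n_angulation_def axiom_N1_def angle_def by blast
qed

lemma angle_retract:
 assumes M: "angle M a" and N: "cseq N b" and i: "cmor N b M a i" and q: "cmor M a N b q"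
  and qi: "\<And>k x. x \<in> U (N k) ==> q k (i k x) = x"
 shows "angle N b"
proof -
 obtain K c j r where K: "cseq K c" "cmor K c M a j" "cmor M a K c r"
  and B: "\<And>k. bip (N k) (K k) (M k) (i k) (j k) (q k) (r k)"
  by (rule retract_splits[OF angle_cseq[OF M] N i q qi], assumption) (rule that)
 have "seq_direct_sum C n (mk N b) (mk K c) (mk M a)"
  using seq_direct_sum_mk[OF N K(1) angle_cseq[OF M]] i q K B by blast
 then show ?thesis using ang M N mk_in_n_sequences[OF N] mk_in_n_sequences[OF K(1)]
  unfolding n_angulation_def axiom_N1_def angle_def by blast
qed

lemma angle_rotate: "cseq M a ==> angle (\<lambda>i. M (Suc i)) (rot_maps M a) \<longleftrightarrow> angle M a"
 using ang mk_in_n_sequences[of M a] left_rotation_mk[of M a] rot_cseq(1)[of M a]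
 unfolding n_angulation_def axiom_N2_def angle_def by auto

lemma angle_extend:
 assumes M: "angle M a" and N: "angle N b"
  and g1: "g1 \<in> Lin (M S1) (N S1)" and g2: "g2 \<in> Lin (M S2) (N S2)"
  and sq: "\<And>x. x \<in> U (M S1) ==> g2 (a S1 x) = b S1 (g1 x)"
 obtains \<phi> where "cmor M a N b \<phi>" "\<phi> S1 = g1" "\<phi> S2 = g2"
proof -
 note cM = angle_cseq[OF M] and cN = angle_cseq[OF N]
 note MD = cseqD[OF cM] and ND = cseqD[OF cN]
 have o: "(1::nat) \<in> {1..n}" "(2::nat) \<in> {1..n}" "(1::nat) \<in> {1..n+2}" "(2::nat) \<in> {1..n+2}" using n_ge by auto
 let ?f1 = "(M 1, g1, N 1)" and ?f2 = "(M 2, g2, N 2)"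
 have g: "g1 \<in> Lin (M 1) (N 1)" "g2 \<in> Lin (M 2) (N 2)" using g1 g2 by (simp_all add: numeral_2_eq_2)
 have f1: "?f1 \<in> Hom C (obj C n (mk M a) 1) (obj C n (mk N b) 1)" and f2: "?f2 \<in> Hom C (obj C n (mk M a) 2) (obj C n (mk N b) 2)"
  using g MD(1) ND(1) unfolding obj_mk[OF cM o(3)] obj_mk[OF cM o(4)] obj_mk[OF cN o(3)] obj_mk[OF cN o(4)] by simp_all
 have e: "?f2 \<bullet>\<^bsub>C\<^esub> mk M a 1 = mk N b 1 \<bullet>\<^bsub>C\<^esub> ?f1"
  unfolding mk_eq[OF o(1)] by (simp add: numeral_2_eq_2 restrict_eq_iff sq)
 have "axiom_N3 C n \<N>" "mk M a \<in> \<N>" "mk N b \<in> \<N>" using ang M N by (auto simp: n_angulation_def angle_def)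
 then obtain \<Phi> where \<Phi>: "seq_morphism C n (mk M a) (mk N b) \<Phi>" "\<Phi> 1 = ?f1" "\<Phi> 2 = ?f2"
  using f1 f2 e unfolding axiom_N3_def by blast
 then obtain f where "cmor M a N b f" "\<forall>i\<in>{1..n}. \<Phi> i = (M i, f i, N i)" using seq_morphism_mk[OF cM cN] by blast
 then show thesis using that[of f] \<Phi>(2,3) o by (auto simp: numeral_2_eq_2)
qed

lemma angle_starting_with:
 assumes "f \<in> Lin A B" "Free A" "Free B"
 obtains M a where "angle M a" "M S1 = A" "M S2 = B" "a S1 = f"
proof -
 have "(A, f, B) \<in> Arr C" using assms by simp
 then obtain \<alpha> where \<alpha>: "\<alpha> \<in> \<N>" "\<alpha> 1 = (A, f, B)"
  using ang unfolding n_angulation_def axiom_N1_def by blast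
 obtain M a where "angle M a" "\<alpha> = mk M a" using angle_of_member[OF \<alpha>(1)] .
 then show thesis using that[of M a] \<alpha>(2) n_ge by (simp add: mk_def)
qed

text \<open>
 The axioms give the case \<open>k = 1\<close>; the others are its rotations backwards, and the sign of a
 rotation falls on a zero map.
\<close>

lemma angle_elementary:
 assumes Z: "zero_mod Z" and X: "Free X" and k: "k \<in> {1..n}"
 shows "angle (T_obj k Z X) (T_map k Z X)"
proof -
 have "angle (T_obj (Suc m) Z X) (T_map (Suc m) Z X)" if "Suc m \<in> {1..n}" for m
  using that
 proof (induction m)
  case 0
  have "X \<in> Ob C" "zero_object C Z" using X Z by (simp_all add: zero_object_iff)
  then have "trivial_seq C n Z X \<in> \<N>" using ang unfolding n_angulation_def axiom_N1_def by blast
  then show ?case using trivial_seq_mk[OF Z X] T_cseq[OF 0 Z X] by (simp add: angle_def)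
 next
  case (Suc m)
  have m: "Suc m \<in> {1..n}" "Suc m < n" using Suc.prems by auto
  have c: "cyc (Suc i) = Suc (Suc m) \<longleftrightarrow> cyc i = Suc m" for i
   using cyc_index_range[OF n_pos, of i] m by (auto simp: cyc_index_Suc)
  have c': "cyc (Suc i) = (if Suc (Suc m) = n then 1 else Suc (Suc (Suc m))) \<longleftrightarrow> cyc i = Suc (Suc m)" for i
   using cyc_index_range[OF n_pos, of i] m by (auto simp: cyc_index_Suc)
  have o: "T_obj (Suc (Suc m)) Z X (Suc i) = T_obj (Suc m) Z X i" for i
   using m unfolding T_obj_def c c' by simp
  have mp: "T_map (Suc (Suc m)) Z X (Suc i) = T_map (Suc m) Z X i" for i unfolding T_map_def c o ..
  have r: "rot_maps (T_obj (Suc (Suc m)) Z X) (T_map (Suc (Suc m)) Z X) i = T_map (Suc m) Z X i" for i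
  proof (cases "odd n \<and> n dvd i")
   case True
   then obtain q where "i = 0 + n * q" by (auto simp: dvd_def)
   then have "cyc i = cyc 0" using periodic_mult[of "cyc" n 0 q] by simp
   then have "cyc i = n" using n_ge by (simp add: cyc_index_def)
   then have "cyc i \<noteq> Suc m" using m by simp
   moreover have "module R (T_obj (Suc m) Z X (Suc i))" using T_cseq[OF m(1) Z X] cseqD(2) by blast
   moreover have "rot_maps (T_obj (Suc (Suc m)) Z X) (T_map (Suc (Suc m)) Z X) i =
     (\<lambda>x\<in>U (T_obj (Suc m) Z X i). \<ominus>\<^bsub>T_obj (Suc m) Z X (Suc i)\<^esub> T_map (Suc m) Z X i x)"
    using True o[of i] o[of "Suc i"] mp[of i] by (simp add: rot_maps_def)
   ultimately show ?thesis by (simp add: T_map_def restrict_eq_iff)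
  next
   case False
   then show ?thesis using mp[of i] by (simp only: rot_maps_def if_False)
  qed
  have "(\<lambda>i. T_obj (Suc (Suc m)) Z X (Suc i)) = T_obj (Suc m) Z X" "rot_maps (T_obj (Suc (Suc m)) Z X) (T_map (Suc (Suc m)) Z X) = T_map (Suc m) Z X"
   using o r by auto
  then show ?case using angle_rotate[OF T_cseq[OF Suc.prems Z X]] Suc.IH[OF m(1)] by simp
 qed
 from this[of "k - 1"] k show ?thesis by simp
qed

text \<open>
 The composite vanishes because the square formed by the identity and \<open>a\<^sub>1\<close> extends to a morphism
 from the elementary sequence that is zero at position 3. A cycle \<open>x\<close> at position 1 is a map
 from a module of rank one; it extends to a morphism from the elementary sequence with the identity
 from position \<open>n\<close> to 1, whose component at \<open>n\<close> provides a preimage.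
\<close>

lemma angle_exact_first:
 assumes M: "angle M a"
 shows "x \<in> U (M S1) ==> a S2 (a S1 x) = \<zero>\<^bsub>M S3\<^esub>"
  and "x \<in> U (M S1) ==> a S1 x = \<zero>\<^bsub>M S2\<^esub> ==> \<exists>y\<in>U (M 0). x = a 0 y"
proof -
 note cM = angle_cseq[OF M]
 note MD = cseqD[OF cM] and aD = homD[OF cseqD(3)[OF cM]]
 obtain Z :: "('a, 'm) module" where Z: "zero_mod Z" using zero_mod_exists .
 have Zf: "Free Z" "\<And>z. z \<in> U Z ==> z = \<zero>\<^bsub>Z\<^esub>" using Z by (auto simp: zero_mod_def)
 have c: "cyc S1 = 1" "cyc S2 = 2" "cyc 0 = n"
  using cyc_index_self[of S1 n] cyc_index_self[of S2 n] cyc_index_self[of n n] cyc_index_add[of n 0] n_ge by auto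
 have c3: "cyc S3 = 3" using cyc_index_self[of S3 n] n_ge by auto
 assume x: "x \<in> U (M S1)"
 show "a S2 (a S1 x) = \<zero>\<^bsub>M S3\<^esub>"
 proof -
  let ?X = "M S1"
  have T: "angle (T_obj 1 Z ?X) (T_map 1 Z ?X)" using angle_elementary[OF Z MD(1)] n_ge by simp
  have o: "T_obj 1 Z ?X S1 = ?X" "T_obj 1 Z ?X S2 = ?X" "T_obj 1 Z ?X S3 = Z"
   using c c3 n_ge by (auto simp: T_obj_def)
  have m: "T_map 1 Z ?X S1 = (\<lambda>x\<in>U ?X. x)" "T_map 1 Z ?X S2 = (\<lambda>x\<in>U ?X. \<zero>\<^bsub>Z\<^esub>)"
   using c o by (auto simp: T_map_def)
  obtain \<phi> where \<phi>: "cmor (T_obj 1 Z ?X) (T_map 1 Z ?X) M a \<phi>" "\<phi> S1 = (\<lambda>x\<in>U ?X. x)" "\<phi> S2 = a S1"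
   using angle_extend[OF T M, of "\<lambda>x\<in>U ?X. x" "a S1"] hom_id[OF MD(2)] MD(3) unfolding o m
   by (metis (no_types, lifting) restrict_apply')
  have "a S2 (\<phi> S2 x) = \<phi> S3 \<zero>\<^bsub>Z\<^esub>"
   using cmorD(3)[OF \<phi>(1), of x S2] x unfolding o m by simp
  also have "\<dots> = \<zero>\<^bsub>M S3\<^esub>"
   using hom_zero[OF cmorD(1)[OF \<phi>(1), of S3]] fg_freeD[OF Zf(1)] MD(2) unfolding o by simp
  finally show ?thesis unfolding \<phi>(3) .
 qed
 assume ax: "a S1 x = \<zero>\<^bsub>M S2\<^esub>"
 obtain L :: "('a, 'm) module" and e where L: "Free L" "e \<in> U L"
  "\<And>y. y \<in> U L ==> \<exists>c\<in>U R. y = c \<odot>\<^bsub>L\<^esub> e"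
  "\<And>N x. module R N ==> x \<in> U N ==> \<exists>g\<in>Lin L N. g e = (x :: 'm)"
  by (rule rank_one_module) (rule that)
 obtain g where g: "g \<in> Lin L (M S1)" "g e = x" using L(4)[OF MD(2) x] by blast
 have T: "angle (T_obj n Z L) (T_map n Z L)" using angle_elementary[OF Z L(1)] n_ge by simp
 have o: "T_obj n Z L 0 = L" "T_obj n Z L S1 = L" "T_obj n Z L S2 = Z"
  using c n_ge by (auto simp: T_obj_def)
 have m: "T_map n Z L 0 = (\<lambda>x\<in>U L. x)" "T_map n Z L S1 = (\<lambda>x\<in>U L. \<zero>\<^bsub>Z\<^esub>)"
  using c o n_ge by (auto simp: T_map_def)
 let ?g2 = "\<lambda>z\<in>U Z. \<zero>\<^bsub>M S2\<^esub>"
 have sq: "?g2 (T_map n Z L S1 y) = a S1 (g y)" if y: "y \<in> U (T_obj n Z L S1)" for y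
 proof -
  have yL: "y \<in> U L" using y o by simp
  obtain d where d: "d \<in> U R" "y = d \<odot>\<^bsub>L\<^esub> e" using L(3)[OF yL] by blast
  have "a S1 (g y) = d \<odot>\<^bsub>M S2\<^esub> a S1 x" using d L(2) x g by (simp add: hom_smult[OF g(1)] aD(3))
  then show ?thesis using ax d yL fg_freeD[OF Zf(1)] MD(2) by (simp add: m)
 qed
 have g2: "?g2 \<in> Lin (T_obj n Z L S2) (M S2)"
  unfolding o by (rule hom_null[OF fg_freeD[OF Zf(1)] MD(2)])
 have g1: "g \<in> Lin (T_obj n Z L S1) (M S1)" unfolding o by (rule g)
 obtain \<phi> where \<phi>: "cmor (T_obj n Z L) (T_map n Z L) M a \<phi>" "\<phi> S1 = g"
  by (rule angle_extend[OF T M g1 g2 sq], assumption) (rule that)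
 have e0: "e \<in> U (T_obj n Z L 0)" using L(2) unfolding o .
 have "x = a 0 (\<phi> 0 e)" using cmorD(3)[OF \<phi>(1) e0] L(2) \<phi>(2) g(2) unfolding m by simp
 moreover have "\<phi> 0 e \<in> U (M 0)" using hom_closed[OF cmorD(1)[OF \<phi>(1)] e0] .
 ultimately show "\<exists>y\<in>U (M 0). x = a 0 y" by blast
qed

text \<open>
 By rotation from position 1; signs do not affect kernels and images.
\<close>

lemma angle_exact_at:
 assumes "angle M a"
 shows "(\<forall>x\<in>U (M (Suc k)). a (Suc (Suc k)) (a (Suc k) x) = \<zero>\<^bsub>M (Suc (Suc (Suc k)))\<^esub>) \<and>
  (\<forall>x\<in>U (M (Suc k)). a (Suc k) x = \<zero>\<^bsub>M (Suc (Suc k))\<^esub> \<longrightarrow> (\<exists>y\<in>U (M k). x = a k y))"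
 using assms
proof (induction k arbitrary: M a)
 case 0
 then show ?case using angle_exact_first by blast
next
 case (Suc k)
 note cM = angle_cseq[OF Suc.prems]
 note MD = cseqD[OF cM] and aD = homD[OF cseqD(3)[OF cM]]
 have v: "rot_maps M a i x = a (Suc i) x \<or> rot_maps M a i x = \<ominus>\<^bsub>M (Suc (Suc i))\<^esub> a (Suc i) x" if "x \<in> U (M (Suc i))" for i x
  using that by (simp add: rot_maps_def)
 have neg: "\<ominus>\<^bsub>M i\<^esub> y = \<zero>\<^bsub>M i\<^esub> \<longleftrightarrow> y = \<zero>\<^bsub>M i\<^esub>" if "y \<in> U (M i)" for i y
  using mod_neg_neg[OF MD(2) that] MD(2)[of i] by (metis mod_neg_zero')
 have "angle (\<lambda>i. M (Suc i)) (rot_maps M a)" using angle_rotate[OF cM] Suc.prems by simp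
 note IH = Suc.IH[OF this]
 have "a (Suc (Suc (Suc k))) (a (Suc (Suc k)) x) = \<zero>\<^bsub>M (Suc (Suc (Suc (Suc k))))\<^esub>" if x: "x \<in> U (M (Suc (Suc k)))" for x
 proof -
  have ax: "a (Suc (Suc k)) x \<in> U (M (Suc (Suc (Suc k))))" using aD(1) x .
  have nax: "\<ominus>\<^bsub>M (Suc (Suc (Suc k)))\<^esub> a (Suc (Suc k)) x \<in> U (M (Suc (Suc (Suc k))))" using ax MD(2) by simp
  have aax: "a (Suc (Suc (Suc k))) (a (Suc (Suc k)) x) \<in> U (M (Suc (Suc (Suc (Suc k)))))" using aD(1) ax .
  have "rot_maps M a (Suc (Suc k)) (rot_maps M a (Suc k) x) = \<zero>\<^bsub>M (Suc (Suc (Suc (Suc k))))\<^esub>" using IH x by simp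
  then show ?thesis using v[OF x] v[OF ax] v[OF nax] ax aax MD(2) by (auto simp: aD(5) neg mod_neg_neg)
 qed
 moreover have "\<exists>y\<in>U (M (Suc k)). x = a (Suc k) y" if x: "x \<in> U (M (Suc (Suc k)))" and e: "a (Suc (Suc k)) x = \<zero>\<^bsub>M (Suc (Suc (Suc k)))\<^esub>" for x
 proof -
  have "rot_maps M a (Suc k) x = \<zero>\<^bsub>M (Suc (Suc (Suc k)))\<^esub>" using v[OF x] e MD(2) by auto
  then obtain y where y: "y \<in> U (M (Suc k))" "x = rot_maps M a k y" using IH x by blast
  then have "x = a (Suc k) y \<or> x = a (Suc k) (\<ominus>\<^bsub>M (Suc k)\<^esub> y)" using v[OF y(1)] MD(2) by (auto simp: aD(5))
  then show ?thesis using y(1) MD(2) by (metis mod_closed(2))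
 qed
 ultimately show ?case by blast
qed

lemma angle_exact:
 assumes M: "angle M a"
 shows "null_composites M a" "exact_seq M a"
proof -
 note MD = cseqD[OF angle_cseq[OF M]]
 note E = angle_exact_at[OF M]
 show "null_composites M a" unfolding null_composites_def
 proof (intro allI ballI)
  fix i x assume "x \<in> U (M i)"
  moreover have "i + n = Suc (i + n - 1)" using n_ge by simp
  ultimately show "a (Suc i) (a i x) = \<zero>\<^bsub>M (Suc (Suc i))\<^esub>"
   using E[of "i + n - 1"] MD(4)[of i] MD(5)[of i] MD(5)[of "Suc i"] MD(4)[of "Suc (Suc i)"] by simp
 qed
 show "exact_seq M a" unfolding exact_seq_def using E by blast
qed

text \<open>
 Take a member starting with \<open>p : L \<rightarrow> L\<close> for \<open>L\<close> of rank one with generator \<open>e\<close>, and a chain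
 \<open>e, e, \<dots>, u e\<close> in it. If \<open>u\<close> were not a unit, \<open>u e\<close> would be a boundary modulo \<open>p\<close>, hence also
 \<open>e\<close>, but \<open>p e \<noteq> 0\<close>. In any member, a chain \<open>z\<close> defines a map of first squares by \<open>e \<mapsto> z\<^sub>0\<close> and
 \<open>e \<mapsto> z\<^sub>1\<close>. The image of the first chain under an extension of it ends in \<open>u z\<^sub>0\<close>, and
 differs from \<open>z\<close> by boundaries modulo \<open>p\<close>.
\<close>

lemma angles_have_common_holonomy:
 obtains u where "u \<in> Units R" "\<And>M a. angle M a ==> in_class u M a"
proof -
 obtain L :: "('a, 'm) module" and e where L: "Free L" "e \<in> U L"
  "\<And>y. y \<in> U L ==> \<exists>c\<in>U R. y = c \<odot>\<^bsub>L\<^esub> e"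
  "\<And>c. c \<in> U R ==> c \<odot>\<^bsub>L\<^esub> e = \<zero>\<^bsub>L\<^esub> ==> c = \<zero>"
  "\<And>N x. module R N ==> x \<in> U N ==> \<exists>g\<in>Lin L N. g e = (x :: 'm)"
  by (rule rank_one_module) (rule that)
 note LM = fg_freeD[OF L(1)]
 obtain M a where M: "angle M a" and M12: "M S1 = L" "M S2 = L" "a S1 = (\<lambda>x\<in>U L. p \<odot>\<^bsub>L\<^esub> x)"
  using angle_starting_with[OF hom_scale[OF LM p_carr] L(1) L(1)] .
 note cM = angle_cseq[OF M] and nM = angle_exact[OF M]
 note MD = cseqD[OF cM] and aD = homD[OF cseqD(3)[OF cM]]
 obtain x where x: "chain M a S1 x" "x 0 = e" "x S1 = e"
  using chain_exists[OF cM nM(1), of e S1 e] L(2) M12 by auto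
 have "x n \<in> U L" using chainD(1)[OF x(1), of n] MD(8) M12 by simp
 then obtain u where u: "u \<in> U R" "x n = u \<odot>\<^bsub>L\<^esub> e" using L(3) by blast
 have bn: "bnd N b n = bnd N b 0" if "cseq N b" for N b
  using cseqD(5)[OF that, of 0] cseqD(7,8)[OF that] by (simp add: bnd_def)
 have pe: "p \<odot>\<^bsub>L\<^esub> e \<noteq> \<zero>\<^bsub>L\<^esub>" using L(4)[OF p_carr] p_nonzero by blast
 have "u \<in> Units R"
 proof (rule ccontr)
  assume "u \<notin> Units R"
  then obtain d where d: "d \<in> U R" "u = p \<otimes> d" using unit_or_multiple[OF u(1)] by blast
  have "x n = p \<odot>\<^bsub>M S1\<^esub> (d \<odot>\<^bsub>L\<^esub> e)" using u d L(2) LM M12 by (simp add: mod_smult_assoc)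
  then have "x n \<in> bnd M a 0" using bnd_p[OF cM, of "d \<odot>\<^bsub>L\<^esub> e" 0] d L(2) LM M12 by simp
  then have "x n \<in> bnd M a (0 + n)" using bn[OF cM] by simp
  from chain_bnd_back[OF cM nM(2) x(1) this, of n] have "e \<in> bnd M a 0" using x by simp
  then obtain y w where y: "y \<in> U (M 0)" "w \<in> U (M S1)" "e = a 0 y \<oplus>\<^bsub>M S1\<^esub> p \<odot>\<^bsub>M S1\<^esub> w"
   by (rule bndE)
  have "a S1 e = \<zero>\<^bsub>M S2\<^esub>"
  proof -
   have w: "w \<in> U (M S2)" "a S1 w = p \<odot>\<^bsub>M S2\<^esub> w" using y(2) M12 by simp_all
   show ?thesis unfolding y(3) using y(1,2) w aD(1)[OF y(1)] MD(2)
    by (simp add: aD(2,3) null_compositesD[OF nM(1)] mod_l_zero)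
  qed
  then show False using pe L(2) M12 by simp
 qed
 moreover have "in_class u N b" if N: "angle N b" for N b
 proof -
  note cN = angle_cseq[OF N] and nN = angle_exact[OF N]
  note ND = cseqD[OF cN] and bD = homD[OF cseqD(3)[OF cN]]
  have "holonomy u N b 0" unfolding holonomy_def
  proof (intro allI impI)
   fix z assume z: "chain N b S1 z"
   note z0 = chain_first[OF z]
   obtain g1 where g1: "g1 \<in> Lin L (N S1)" "g1 e = z 0" using L(5)[OF ND(2) z0(1)] by blast
   obtain g2 where g2: "g2 \<in> Lin L (N S2)" "g2 e = z S1" using L(5)[OF ND(2) z0(2)] by blast
   have sq: "g2 (a S1 y) = b S1 (g1 y)" if y: "y \<in> U (M S1)" for y
   proof -
    obtain d where d: "d \<in> U R" "y = d \<odot>\<^bsub>L\<^esub> e" using L(3) y M12 by auto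
    have "g2 (a S1 y) = p \<odot>\<^bsub>N S2\<^esub> (d \<odot>\<^bsub>N S2\<^esub> z S1)"
     using d L(2) LM M12 g2 by (simp add: homD[OF g2(1)])
    also have "\<dots> = d \<odot>\<^bsub>N S2\<^esub> b S1 (z 0)" using d z0 ND(2) by (simp add: mod_scale_comm)
    also have "\<dots> = b S1 (g1 y)" using d L(2) z0 g1 by (simp add: homD[OF g1(1)] bD(3))
    finally show ?thesis .
   qed
   obtain \<phi> where \<phi>: "cmor M a N b \<phi>" "\<phi> S1 = g1" "\<phi> S2 = g2"
    by (rule angle_extend[OF M N, unfolded M12, OF g1(1) g2(1) sq[unfolded M12]]) (assumption, rule that)
   have ps: "\<phi> (Suc n) = \<phi> S1" using cmorD(2)[OF \<phi>(1), of S1] by simp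
   have w: "chain N b S1 (\<lambda>j. \<phi> (S1 + j) (x j))" using chain_cmor[OF cM cN \<phi>(1) x(1)] .
   have wn: "\<phi> (S1 + n) (x n) = u \<odot>\<^bsub>N S1\<^esub> z 0" using ps \<phi>(2) u L(2) g1 by (simp add: homD[OF g1(1)])
   have d: "chain N b S1 (\<lambda>j. z j \<ominus>\<^bsub>N (S1 + j)\<^esub> \<phi> (S1 + j) (x j))" using chain_diff[OF cN z w] .
   have "z 0 \<ominus>\<^bsub>N S1\<^esub> \<phi> S1 (x 0) = \<zero>\<^bsub>N S1\<^esub>" using \<phi>(2) x(2) g1(2) z0 ND(2) by (simp add: mod_norm)
   then have "z 0 \<ominus>\<^bsub>N (S1 + 0)\<^esub> \<phi> (S1 + 0) (x 0) \<in> bnd N b 0" using bndD(2)[OF cN] by simp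
   from chain_bnd[OF cN nN(1) d this, of n]
   show "z n \<ominus>\<^bsub>N S1\<^esub> u \<odot>\<^bsub>N S1\<^esub> z 0 \<in> bnd N b 0" using wn ND(8) bn[OF cN] by simp
  qed
  then show ?thesis using cN nN by (simp add: in_class_def)
 qed
 ultimately show thesis by (rule that)
qed

end

section \<open>Classification\<close>

context angulation_setting
begin

text \<open>
 A part \<open>X\<close> of \<open>M\<^sub>k\<close> on which the differential is split injective carries an elementary retract.
\<close>

lemma elementary_retract:
 assumes M: "cseq M a" and nc: "null_composites M a" and k: "k \<in> {1..n}" and Z: "zero_mod Z" and X: "Free X"
  and s: "s \<in> Lin X (M k)" and t: "t \<in> Lin (M (Suc k)) X" and ts: "\<And>x. x \<in> U X ==> t (a k (s x)) = x"
 obtains i q where "cmor (T_obj k Z X) (T_map k Z X) M a i" "cmor M a (T_obj k Z X) (T_map k Z X) q"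
  "\<And>l x. x \<in> U (T_obj k Z X l) ==> q l (i l x) = x" "\<And>x. x \<in> U (M k) ==> q k x = t (a k x)"
proof -
 define k' where "k' = (if k = n then 1 else Suc k)"
 note MD = cseqD[OF M] and aD = homD[OF cseqD(3)[OF M]]
 note XM = fg_freeD[OF X]
 have Zf: "Free Z" "\<And>z. z \<in> U Z ==> z = \<zero>\<^bsub>Z\<^esub>" using Z by (auto simp: zero_mod_def)
 note ZM = fg_freeD[OF Zf(1)]
 note sD = homD[OF s] and tD = homD[OF t]
 note T = T_cseq[OF k Z X]
 note TD = cseqD[OF T]
 let ?T = "T_obj k Z X" and ?m = "T_map k Z X"
 have o: "?T i = (if cyc i = k \<or> cyc i = k' then X else Z)" for i by (simp add: T_obj_def k'_def)
 have kk: "k' \<noteq> k" using n_ge by (auto simp: k'_def)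
 have cs: "cyc (Suc i) = k' \<longleftrightarrow> cyc i = k" for i
  using cyc_index_range[OF n_pos, of i] k by (auto simp: cyc_index_Suc k'_def)
 have per: "M (cyc i) = M i" "a (cyc i) = a i" "M (Suc (cyc i)) = M (Suc i)" for i
  using periodic_cyc_index[of n M i] periodic_cyc_index[of n a i] periodic_cyc_index_Suc(1)[of n M i] MD(4,5) by simp_all
 have at: "M i = M k" "a i = a k" "M (Suc i) = M (Suc k)" if "cyc i = k" for i
  using per[of i] that by simp_all
 have k'M: "M k' = M (Suc k)" "a k' = a (Suc k)" using MD(8) MD(5)[of S1] by (auto simp: k'_def)
 have at': "M i = M (Suc k)" "a i = a (Suc k)" if "cyc i = k'" for i
  using per[of i] that k'M by simp_all
 have ah: "a k \<in> Lin (M k) (M (Suc k))" using MD(3) .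
 have ash: "(\<lambda>x\<in>U X. a k (s x)) \<in> Lin X (M (Suc k))" using hom_comp[OF XM s ah] .
 have tah: "(\<lambda>x\<in>U (M k). t (a k x)) \<in> Lin (M k) X" using hom_comp[OF MD(2) ah t] .
 define i where "i l = (if cyc l = k then s else if cyc l = k' then (\<lambda>x\<in>U X. a k (s x))
   else (\<lambda>z\<in>U Z. \<zero>\<^bsub>M l\<^esub>))" for l
 define q where "q l = (if cyc l = k then (\<lambda>x\<in>U (M k). t (a k x)) else if cyc l = k' then t
   else (\<lambda>z\<in>U (M l). \<zero>\<^bsub>Z\<^esub>))" for l
 have ih: "i l \<in> Lin (?T l) (M l)" for l
  using s ash hom_null[OF ZM MD(2)[of l]] at(1)[of l] at'(1)[of l] kk by (auto simp: i_def o)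
 have qh: "q l \<in> Lin (M l) (?T l)" for l
  using t tah hom_null[OF MD(2)[of l] ZM] at(1)[of l] at'(1)[of l] kk by (auto simp: q_def o)
 have 1: "cmor ?T ?m M a i" unfolding cmor_def
 proof (intro allI conjI ballI)
  fix l
  show "i l \<in> Lin (?T l) (M l)" by (rule ih)
  show "i (l + n) = i l" using MD(4) by (simp add: i_def)
  fix x assume x: "x \<in> U (?T l)"
  show "i (Suc l) (?m l x) = a l (i l x)"
  proof (cases "cyc l = k")
   case True
   then have "cyc (Suc l) = k'" "x \<in> U X" using cs x by (simp_all add: o)
   then show ?thesis using True kk at(2)[OF True] by (simp add: T_map_def i_def)
  next
   case False
   have "?m l x = \<zero>\<^bsub>?T (Suc l)\<^esub>" using False x by (simp add: T_map_def)
   then have l: "i (Suc l) (?m l x) = \<zero>\<^bsub>M (Suc l)\<^esub>" using hom_zero[OF ih] TD(2) MD(2) by simp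
   have "a l (i l x) = \<zero>\<^bsub>M (Suc l)\<^esub>"
   proof (cases "cyc l = k'")
    case True
    have xX: "x \<in> U X" using x True by (simp add: o)
    have "M (Suc l) = M (Suc (Suc k))"
     using per(3)[of l] MD(8) MD(4)[of S2] unfolding True by (auto simp: k'_def split: if_splits)
    then show ?thesis using True False at'(2)[OF True] null_compositesD[OF nc sD(1)[OF xX]] xX by (simp add: i_def)
   next
    case False2: False
    then have "x \<in> U Z" using x False by (simp add: o)
    then show ?thesis using False False2 MD(2) by (simp add: i_def aD(4))
   qed
   then show ?thesis using l by simp
  qed
 qed
 have 2: "cmor M a ?T ?m q" unfolding cmor_def
 proof (intro allI conjI ballI)
  fix l
  show "q l \<in> Lin (M l) (?T l)" by (rule qh)
  show "q (l + n) = q l" using MD(4) by (simp add: q_def)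
  fix x assume x: "x \<in> U (M l)"
  have qx: "q l x \<in> U (?T l)" using hom_closed[OF qh x] .
  show "q (Suc l) (a l x) = ?m l (q l x)"
  proof (cases "cyc l = k")
   case True
   then have "cyc (Suc l) = k'" "x \<in> U (M k)" "q l x \<in> U X" using cs x qx at(1) by (simp_all add: o)
   then show ?thesis using True kk at(2)[OF True] by (simp add: T_map_def q_def)
  next
   case False
   have r: "?m l (q l x) = \<zero>\<^bsub>?T (Suc l)\<^esub>" using False qx by (simp add: T_map_def)
   show ?thesis
   proof (cases "cyc (Suc l) = k")
    case True
    have "t (a (Suc l) (a l x)) = \<zero>\<^bsub>X\<^esub>"
     using null_compositesD[OF nc x] at(3)[OF True] hom_zero[OF t] MD(2) XM by simp
    moreover have "a l x \<in> U (M k)" using aD(1)[OF x] at(1)[OF True] by simp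
    ultimately show ?thesis using r True at(2)[OF True] by (simp add: q_def o)
   next
    case False2: False
    have "cyc (Suc l) \<noteq> k'" using cs False by simp
    then show ?thesis using r False2 aD(1)[OF x] by (simp add: q_def o)
   qed
  qed
 qed
 have "q l (i l x) = x" if x: "x \<in> U (?T l)" for l x
 proof -
  consider "cyc l = k" | "cyc l = k'" | "cyc l \<noteq> k" "cyc l \<noteq> k'" by blast
  then show ?thesis
  proof cases
   case 1
   then have "x \<in> U X" using x by (simp add: o)
   then show ?thesis using 1 sD(1) ts by (simp add: q_def i_def)
  next
   case 2
   then have "x \<in> U X" using x by (simp add: o)
   then show ?thesis using 2 kk ts by (simp add: q_def i_def)
  next
   case 3
   then have "x \<in> U Z" using x by (simp add: o)
   then show ?thesis using 3 Zf(2) MD(2) by (simp add: q_def i_def)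
  qed
 qed
 moreover have "q k x = t (a k x)" if "x \<in> U (M k)" for x
  using cyc_index_self[OF k] that by (simp add: q_def)
 ultimately show thesis using that[of i q] 1 2 by blast
qed

end

context angulation
begin

text \<open>
 Induction on the last position \<open>m\<close> with a nonzero differential. Splitting off an elementary
 sequence at this position leaves a contractible complement whose differential \<open>c\<close> there has values
 in \<open>p K\<close>. But \<open>c = c \<theta> c\<close> for a contraction \<open>\<theta>\<close>, and this lies in \<open>p\<^sup>2 K = 0\<close>.
\<close>

lemma angle_contractible_aux:
 assumes "m \<le> n" "cseq M a" "null_composites M a" "contraction M a \<theta>"
  "\<And>i x. m < cyc i ==> x \<in> U (M i) ==> a i x = \<zero>\<^bsub>M (Suc i)\<^esub>"
 shows "angle M a"
 using assms
proof (induction m arbitrary: M a \<theta>)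
 case 0
 note M = 0(2) and \<theta> = 0(4)
 note MD = cseqD[OF M]
 have az: "a i x = \<zero>\<^bsub>M (Suc i)\<^esub>" if "x \<in> U (M i)" for i x
  using 0(5)[OF _ that] cyc_index_range[OF n_pos, of i] by simp
 have \<theta>h: "\<theta> k \<in> Lin (M (Suc k)) (M k)" and
  dec: "\<And>y. y \<in> U (M (Suc k)) ==> y = \<theta> (Suc k) (a (Suc k) y) \<oplus>\<^bsub>M (Suc k)\<^esub> a k (\<theta> k y)" for k
  using \<theta> by (auto simp: contraction_def)
 have z1: "y = \<zero>\<^bsub>M (Suc k)\<^esub>" if y: "y \<in> U (M (Suc k))" for k y
  using dec[OF y] az[OF y] az[OF hom_closed[OF \<theta>h y]] hom_zero[OF \<theta>h] MD(2) by (simp add: mod_l_zero)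
 have z: "y = \<zero>\<^bsub>M k\<^esub>" if y: "y \<in> U (M k)" for k y
  using z1[of y "k + n - 1"] y MD(4)[of k] n_ge by simp
 obtain Z :: "('a, 'm) module" where Z: "zero_mod Z" using zero_mod_exists .
 have Zf: "Free Z" "\<And>z. z \<in> U Z ==> z = \<zero>\<^bsub>Z\<^esub>" using Z by (auto simp: zero_mod_def)
 have k: "1 \<in> {1..n}" using n_ge by simp
 let ?T = "T_obj 1 Z Z" and ?m = "T_map 1 Z Z"
 note T = T_cseq[OF k Z Zf(1)]
 have Tz: "?T i = Z" for i by (simp add: T_obj_def)
 note ZM = fg_freeD[OF Zf(1)]
 note TD = cseqD[OF T, unfolded Tz]
 have mh: "?m i \<zero>\<^bsub>Z\<^esub> = \<zero>\<^bsub>Z\<^esub>" for i using hom_zero[OF TD(3) ZM ZM] .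
 show ?case
 proof (rule angle_retract[OF angle_elementary[OF Z Zf(1) k] M])
  show "cmor M a ?T ?m (\<lambda>i. \<lambda>x\<in>U (M i). \<zero>\<^bsub>Z\<^esub>)" unfolding cmor_def Tz
   using hom_null[OF MD(2) ZM] MD(4) mh hom_closed[OF MD(3)] by simp
  show "cmor ?T ?m M a (\<lambda>i. \<lambda>x\<in>U Z. \<zero>\<^bsub>M i\<^esub>)" unfolding cmor_def Tz
   using hom_null[OF ZM MD(2)] MD(4) hom_zero[OF MD(3)] MD(2) hom_closed[OF TD(3)] by simp
  fix k x assume x: "x \<in> U (M k)"
  then show "(\<lambda>x\<in>U Z. \<zero>\<^bsub>M k\<^esub>) ((\<lambda>x\<in>U (M k). \<zero>\<^bsub>Z\<^esub>) x) = x"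
   using z[OF x] ZM by simp
 qed
next
 case (Suc m)
 note M = Suc.prems(2) and nM = Suc.prems(3) and \<theta> = Suc.prems(4)
 note MD = cseqD[OF M] and aD = homD[OF cseqD(3)[OF M]]
 let ?k = "Suc m"
 have k: "?k \<in> {1..n}" using Suc.prems(1) by simp
 obtain Z :: "('a, 'm) module" where Z: "zero_mod Z" using zero_mod_exists .
 obtain X :: "('a, 'm) module" and s t where X: "Free X" and s: "s \<in> Lin X (M ?k)" and t: "t \<in> Lin (M (Suc ?k)) X"
  and ts: "\<And>x. x \<in> U X ==> t (a ?k (s x)) = x"
  and rank: "\<And>v. v \<in> U (M ?k) ==> a ?k v \<ominus>\<^bsub>M (Suc ?k)\<^esub> a ?k (s (t (a ?k v))) \<in> multiples p (M (Suc ?k))"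
  by (rule rank_factorization[OF MD(1) MD(1) MD(3)]) (rule that)
 obtain i q where i: "cmor (T_obj ?k Z X) (T_map ?k Z X) M a i" and q: "cmor M a (T_obj ?k Z X) (T_map ?k Z X) q"
  and qi: "\<And>l x. x \<in> U (T_obj ?k Z X l) ==> q l (i l x) = x" and qk: "\<And>x. x \<in> U (M ?k) ==> q ?k x = t (a ?k x)"
  by (rule elementary_retract[OF M nM k Z X s t ts], assumption) (rule that)
 obtain K c j r where K: "cseq K c" "cmor K c M a j" "cmor M a K c r"
  and B: "\<And>l. bip (T_obj ?k Z X l) (K l) (M l) (i l) (j l) (q l) (r l)"
  by (rule retract_splits[OF M T_cseq[OF k Z X] i q qi], assumption) (rule that)
 note KD = cseqD[OF K(1)] and cD = homD[OF cseqD(3)[OF K(1)]] and jD = homD[OF cmorD(1)[OF K(2)]] and rD = homD[OF cmorD(1)[OF K(3)]]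
 note rj = bipD(7)[OF B]
 define \<theta>' where "\<theta>' = (\<lambda>l. \<lambda>x\<in>U (K (Suc l)). r l (\<theta> l (j (Suc l) x)))"
 have \<theta>': "contraction K c \<theta>'" unfolding \<theta>'_def
  by (rule contraction_retract[OF M _ _ K rj]) (use \<theta> jD(1) in \<open>auto simp: contraction_def\<close>)
 have nK: "null_composites K c"
  using in_class_retract[OF in_class_contractible[OF M nM \<theta> one_closed] one_closed K rj] by (simp add: in_class_def)
 have \<theta>h: "\<theta>' l \<in> Lin (K (Suc l)) (K l)" and
  dec: "\<And>y. y \<in> U (K (Suc l)) ==> y = \<theta>' (Suc l) (c (Suc l) y) \<oplus>\<^bsub>K (Suc l)\<^esub> c l (\<theta>' l y)" for l
  using \<theta>' by (auto simp: contraction_def)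
 note \<theta>D = homD[OF \<theta>h]
 have ck: "c ?k x = \<zero>\<^bsub>K (Suc ?k)\<^esub>" if x: "x \<in> U (K ?k)" for x
 proof -
  have mult: "c ?k x \<in> multiples p (K (Suc ?k))" if x: "x \<in> U (K ?k)" for x
  proof -
   let ?y = "j ?k x"
   have y: "?y \<in> U (M ?k)" using jD(1) x .
   have To: "T_obj ?k Z X ?k = X" using T_obj_at(1)[OF k Z X cyc_index_self[OF k]] .
   have "t (a ?k ?y) = \<zero>\<^bsub>X\<^esub>" using bipD(8)[OF B x] qk[OF y] To by simp
   then have "a ?k (s (t (a ?k ?y))) = \<zero>\<^bsub>M (Suc ?k)\<^esub>" using hom_zero[OF s] fg_freeD[OF X] MD(2) by (simp add: aD(4))
   then have "a ?k ?y \<in> multiples p (M (Suc ?k))" using rank[OF y] aD(1)[OF y] MD(2) by (simp add: mod_norm)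
   then have "r (Suc ?k) (a ?k ?y) \<in> multiples p (K (Suc ?k))" using multiples_hom[OF cmorD(1)[OF K(3)] p_carr] by blast
   then show ?thesis using cmorD(3)[OF K(3) y] rj[OF x] by simp
  qed
  have cx: "c ?k x \<in> U (K (Suc ?k))" "\<theta>' ?k (c ?k x) \<in> U (K ?k)" using cD(1)[OF x] \<theta>D(1) by simp_all
  have "c ?k x = c ?k (\<theta>' ?k (c ?k x))"
   using dec[OF cx(1)] null_compositesD[OF nK x] cx cD(1) hom_zero[OF \<theta>h] KD(2) by (simp add: mod_l_zero)
  moreover obtain w where w: "w \<in> U (K (Suc ?k))" "c ?k x = p \<odot>\<^bsub>K (Suc ?k)\<^esub> w"
   using mult[OF x] by (auto simp: multiples_def)
  moreover have "\<theta>' ?k w \<in> U (K ?k)" using \<theta>D(1) w(1) .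
  moreover obtain w' where "w' \<in> U (K (Suc ?k))" "c ?k (\<theta>' ?k w) = p \<odot>\<^bsub>K (Suc ?k)\<^esub> w'"
   using mult[OF \<open>\<theta>' ?k w \<in> U (K ?k)\<close>] by (auto simp: multiples_def)
  ultimately show ?thesis using KD(2) by (simp add: \<theta>D(3) cD(3))
 qed
 have cz: "c l x = \<zero>\<^bsub>K (Suc l)\<^esub>" if l: "m < cyc l" and x: "x \<in> U (K l)" for l x
 proof (cases "cyc l = ?k")
  case True
  have "K l = K ?k" "c l = c ?k" "K (Suc l) = K (Suc ?k)"
   using periodic_cyc_index[of n K l] periodic_cyc_index[of n c l] periodic_cyc_index_Suc(1)[of n K l] KD(4,5) True by simp_all
  then show ?thesis using ck x by simp
 next
  case False
  have jx: "j l x \<in> U (M l)" using jD(1) x .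
  have "a l (j l x) = \<zero>\<^bsub>M (Suc l)\<^esub>" by (rule Suc.prems(5)) (use l False jx in auto)
  then have "r (Suc l) (a l (j l x)) = \<zero>\<^bsub>K (Suc l)\<^esub>" using hom_zero[OF cmorD(1)[OF K(3)]] KD(2) MD(2) by simp
  then show ?thesis using cmorD(3)[OF K(3) jx] rj[OF x] by simp
 qed
 have "m \<le> n" using Suc.prems(1) by simp
 from Suc.IH[OF this K(1) nK \<theta>' cz] have "angle K c" .
 then show ?case using angle_sum[OF angle_elementary[OF Z X k] _ M i K(2) q K(3) B] by blast
qed

lemma angle_contractible:
 assumes M: "cseq M a" and nc: "null_composites M a" and \<theta>: "contraction M a \<theta>"
 shows "angle M a"
proof (rule angle_contractible_aux[OF order.refl M nc \<theta>])
 fix i x assume "n < cyc i"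
 then show "a i x = \<zero>\<^bsub>M (Suc i)\<^esub>" using cyc_index_range[OF n_pos, of i] by simp
qed

text \<open>
 Take a member that starts with \<open>u p : F \<rightarrow> F\<close>, and its minimal part \<open>G(p)\<close>. As \<open>u p\<close> vanishes
 modulo \<open>p\<close>, the inclusion of \<open>G\<close> in \<open>F\<close> is an isomorphism modulo \<open>p\<close> and hence an isomorphism. So
 \<open>F(p)\<close> is isomorphic to the summand \<open>G(p)\<close>.
\<close>

lemma angle_fp:
 assumes u: "u \<in> Units R" and all: "\<And>M a. angle M a ==> in_class u M a" and F: "Free F"
 shows "angle (\<lambda>_. F) (fp u F)"
proof -
 have uR: "u \<in> U R" using u by auto
 note FM = fg_freeD[OF F]
 obtain M a where M: "angle M a" and M12: "M S1 = F" "M S2 = F" "a S1 = (\<lambda>x\<in>U F. (u \<otimes> p) \<odot>\<^bsub>F\<^esub> x)"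
  using angle_starting_with[OF hom_scale[OF FM m_closed[OF uR p_carr]] F F] .
 note cM = angle_cseq[OF M] and nM = angle_exact[OF M]
 note MD = cseqD[OF cM] and aD = homD[OF cseqD(3)[OF cM]]
 obtain G i q \<theta> where sd: "sdr u M a G i q \<theta>" using sdr_exists[OF all[OF M] u] .
 note G = sdrD(1)[OF sd] and i = sdrD(2)[OF sd] and q = sdrD(3)[OF sd] and qi = sdrD(4)[OF sd] and \<theta>h = sdrD(5)[OF sd] and dec = sdrD(7)[OF sd]
 note GM = fg_freeD[OF G]
 note iD = homD[OF cmorD(1)[OF i]] and qD = homD[OF cmorD(1)[OF q]] and \<theta>D = homD[OF \<theta>h]
 have i1h: "i S1 \<in> Lin G F" and q1h: "q S1 \<in> Lin F G"
  using cmorD(1)[OF i, of S1] cmorD(1)[OF q, of S1] M12 by simp_all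
 note i1D = homD[OF i1h] and q1D = homD[OF q1h]
 have a1: "a S1 y = p \<odot>\<^bsub>F\<^esub> (u \<odot>\<^bsub>F\<^esub> y)" if "y \<in> U F" for y
  using that FM uR by (simp add: M12 mod_smult_assoc mod_scale_comm)
 have iq: "i S1 (q S1 y) = y" if y: "y \<in> U F" for y
 proof -
  have yM: "y \<in> U (M S1)" using y M12 by simp
  have qy: "q S1 y \<in> U G" "i S1 (q S1 y) \<in> U F" using y q1D(1) i1D(1) by simp_all
  \<comment> \<open>The complementary idempotent has its image in the multiples of \<open>p\<close>.\<close>
  have pz: "\<exists>w\<in>U F. z \<ominus>\<^bsub>F\<^esub> i S1 (q S1 z) = p \<odot>\<^bsub>F\<^esub> w" if z: "z \<in> U F" for z
  proof -
   have zM: "z \<in> U (M S1)" using z M12 by simp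
   have qz: "i S1 (q S1 z) \<in> U F" using z q1D(1) i1D(1) by simp
   have \<theta>1: "\<theta> S1 \<in> Lin F F" using \<theta>h[of S1] M12 by simp
   let ?v = "a 0 (\<theta> 0 z)"
   have v: "?v \<in> U F" using aD(1)[OF \<theta>D(1)[OF zM]] M12 by simp
   have "a S1 ?v = \<zero>\<^bsub>F\<^esub>" using null_compositesD[OF nM(1) \<theta>D(1)[OF zM]] M12 by simp
   then have "p \<odot>\<^bsub>F\<^esub> (u \<odot>\<^bsub>F\<^esub> ?v) = \<zero>\<^bsub>F\<^esub>" using a1[OF v] by simp
   then have "inv u \<odot>\<^bsub>F\<^esub> (u \<odot>\<^bsub>F\<^esub> (p \<odot>\<^bsub>F\<^esub> ?v)) = \<zero>\<^bsub>F\<^esub>" using v FM u uR by (simp add: mod_scale_comm[of F p u])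
   then have "p \<odot>\<^bsub>F\<^esub> ?v = \<zero>\<^bsub>F\<^esub>" using u uR v FM by (simp add: mod_smult_assoc[symmetric] m_assoc[symmetric])
   then obtain w where w: "w \<in> U F" "?v = p \<odot>\<^bsub>F\<^esub> w" using p_annihilated[OF F v] by blast
   have tz: "\<theta> S1 (a S1 z) = p \<odot>\<^bsub>F\<^esub> \<theta> S1 (u \<odot>\<^bsub>F\<^esub> z)"
    using z uR FM by (simp add: a1 homD[OF \<theta>1])
   have tc: "\<theta> S1 (u \<odot>\<^bsub>F\<^esub> z) \<in> U F" using hom_closed[OF \<theta>1] z uR FM by simp
   have "z = i S1 (q S1 z) \<oplus>\<^bsub>F\<^esub> (p \<odot>\<^bsub>F\<^esub> \<theta> S1 (u \<odot>\<^bsub>F\<^esub> z) \<oplus>\<^bsub>F\<^esub> p \<odot>\<^bsub>F\<^esub> w)"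
    using dec[OF zM] tz w(2) M12 by simp
   then have "z \<ominus>\<^bsub>F\<^esub> i S1 (q S1 z) = p \<odot>\<^bsub>F\<^esub> \<theta> S1 (u \<odot>\<^bsub>F\<^esub> z) \<oplus>\<^bsub>F\<^esub> p \<odot>\<^bsub>F\<^esub> w"
    using mod_eq_sub_iff[OF FM z qz, of "p \<odot>\<^bsub>F\<^esub> \<theta> S1 (u \<odot>\<^bsub>F\<^esub> z) \<oplus>\<^bsub>F\<^esub> p \<odot>\<^bsub>F\<^esub> w"] tc w(1) FM by simp
   also have "\<dots> = p \<odot>\<^bsub>F\<^esub> (\<theta> S1 (u \<odot>\<^bsub>F\<^esub> z) \<oplus>\<^bsub>F\<^esub> w)" using tc w(1) FM by (simp add: mod_smult_radd)
   finally show ?thesis using tc w(1) FM by (intro bexI[of _ "\<theta> S1 (u \<odot>\<^bsub>F\<^esub> z) \<oplus>\<^bsub>F\<^esub> w"]) simp_all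
  qed
  define d where "d = y \<ominus>\<^bsub>F\<^esub> i S1 (q S1 y)"
  obtain w where w: "w \<in> U F" "d = p \<odot>\<^bsub>F\<^esub> w" using pz[OF y] by (auto simp: d_def)
  obtain w' where w': "w' \<in> U F" "w \<ominus>\<^bsub>F\<^esub> i S1 (q S1 w) = p \<odot>\<^bsub>F\<^esub> w'" using pz[OF w(1)] by blast
  have dc: "d \<in> U F" using y qy FM by (simp add: d_def)
  have "q S1 d = \<zero>\<^bsub>G\<^esub>" using y qy FM GM by (simp add: d_def q1D(6) qi) (simp add: mod_norm)
  then have "d = d \<ominus>\<^bsub>F\<^esub> i S1 (q S1 d)" using dc FM GM by (simp add: i1D(4)) (simp add: mod_norm)
  also have "\<dots> = p \<odot>\<^bsub>F\<^esub> (w \<ominus>\<^bsub>F\<^esub> i S1 (q S1 w))"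
   unfolding w(2) using w(1) q1D(1) i1D(1) FM by (simp add: q1D(3) i1D(3)) (simp add: mod_norm i1D(1) q1D(1))
  also have "\<dots> = \<zero>\<^bsub>F\<^esub>" unfolding w'(2) using w'(1) FM by simp
  finally have "y \<ominus>\<^bsub>F\<^esub> i S1 (q S1 y) = \<zero>\<^bsub>F\<^esub>" by (simp add: d_def)
  then have "y = i S1 (q S1 y) \<oplus>\<^bsub>F\<^esub> \<zero>\<^bsub>F\<^esub>" using mod_eq_sub_iff[OF FM y qy(2)] FM by simp
  then show ?thesis using qy FM by (simp add: mod_r_zero)
 qed
 have nat: "g (fp u A k x) = fp u B k (g x)" if "module R A" "module R B" "g \<in> Lin A B" "x \<in> U A" for A B g k x
  using that uR by (simp add: fp_val homD[OF that(3)])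
 have ig: "(\<lambda>k. \<lambda>x\<in>U F. i k (q S1 x)) = (\<lambda>k. \<lambda>x\<in>U F. i k ((\<lambda>_. q S1) k x))" by simp
 have fc: "cseq (\<lambda>_. F) (fp u F)" "cseq (\<lambda>_. G) (fp u G)" using fp_cseq[OF uR] F G by simp_all
 have fper: "fp u A (k + n) = fp u A k" for A k by (simp add: fp_def)
 have c1: "cmor (\<lambda>_. F) (fp u F) (\<lambda>_. G) (fp u G) (\<lambda>_. q S1)" unfolding cmor_def using q1h nat[OF FM GM q1h] by simp
 have c2: "cmor (\<lambda>_. G) (fp u G) (\<lambda>_. F) (fp u F) (\<lambda>_. i S1)" unfolding cmor_def using i1h nat[OF GM FM i1h] by simp
 show ?thesis
 proof (rule angle_retract[OF M fc(1) cmor_comp[OF fc(1) c1 i] cmor_comp[OF cM q c2]])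
  fix k x assume x: "x \<in> U F"
  then show "(\<lambda>x\<in>U (M k). i S1 (q k x)) ((\<lambda>x\<in>U F. i k (q S1 x)) x) = x"
   using q1D(1)[OF x] iD(1) qi iq[OF x] by simp
 qed
qed

theorem angulation_is_N_coll:
 obtains u where "u \<in> Units R" "\<N> = N_coll R n p u"
proof -
 obtain u where u: "u \<in> Units R" and all: "\<And>M a. angle M a ==> in_class u M a"
  by (rule angles_have_common_holonomy) (rule that)
 have uR: "u \<in> U R" using u by auto
 have "angle M a" if c: "in_class u M a" for M a
 proof -
  have M: "cseq M a" and nc: "null_composites M a" using c by (auto simp: in_class_def)
  obtain F i q \<theta> where sd: "sdr u M a F i q \<theta>" using sdr_exists[OF c u] .
  note F = sdrD(1)[OF sd] and i = sdrD(2)[OF sd] and q = sdrD(3)[OF sd] and qi = sdrD(4)[OF sd]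
  have fc: "cseq (\<lambda>_. F) (fp u F)" using fp_cseq[OF uR F] .
  obtain K c j r where K: "cseq K c" "cmor K c M a j" "cmor M a K c r" and B: "\<And>k. bip F (K k) (M k) (i k) (j k) (q k) (r k)"
   by (rule retract_splits[OF M fc i q qi], assumption) (rule that)
  have nK: "null_composites K c" using in_class_retract[OF c uR K bipD(7)[OF B]] by (simp add: in_class_def)
  have "angle K c" by (rule angle_contractible[OF K(1) nK sdr_complement_contractible[OF M sd uR K B]])
  then show ?thesis using angle_sum[OF angle_fp[OF u all F] _ M i K(2) q K(3) B] by blast
 qed
 then have conv: "mk M a \<in> \<N>" if "in_class u M a" for M a using that by (simp add: angle_def)
 have "\<N> = {mk M a |M a. in_class u M a}"
 proof (intro equalityI subsetI)
  fix \<alpha> assume "\<alpha> \<in> \<N>"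
  then obtain M a where "angle M a" "\<alpha> = mk M a" by (rule angle_of_member)
  then show "\<alpha> \<in> {mk M a |M a. in_class u M a}" using all[of M a] by blast
 next
  fix \<alpha> assume "\<alpha> \<in> {mk M a |M a. in_class u M a}"
  then show "\<alpha> \<in> \<N>" using conv by blast
 qed
 then have "\<N> = N_coll R n p u" unfolding N_coll_eq[OF u] .
 then show thesis by (rule that[OF u])
qed

end

lemma equiv_unit_rel: "equiv (Units R) (unit_rel R p)"
 by (rule equivI) (auto simp: unit_rel_def refl_on_def sym_def trans_def)

lemma N_coll_cong: "(u, v) \<in> unit_rel R p ==> N_coll R n p u = N_coll R n p v"
proof -
 assume "(u, v) \<in> unit_rel R p"
 then have e: "u \<otimes>\<^bsub>R\<^esub> p = v \<otimes>\<^bsub>R\<^esub> p" by (simp add: unit_rel_def)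
 show ?thesis unfolding N_coll_def Fp_seq_def e ..
qed

context angulation_setting
begin

text \<open>
 \<open>R(p)\<close> for \<open>u\<close> contains the chain \<open>e, u e, \<dots>, u e\<close>. If it also has holonomy \<open>v\<close>, then
 \<open>(u - v) e\<close> is a boundary modulo \<open>p\<close>; all boundaries of \<open>R(p)\<close> are multiples of \<open>p\<close>.
\<close>

lemma N_coll_determines_class:
 assumes u: "u \<in> Units R" and v: "v \<in> Units R"
  and e: "(N_coll R n p u :: (nat => ('a, 'm) mod_arrow) set) = N_coll R n p v"
 shows "u \<otimes> p = v \<otimes> p"
proof -
 have uR: "u \<in> U R" and vR: "v \<in> U R" using u v by auto
 obtain L :: "('a, 'm) module" and e where L: "Free L" "e \<in> U L"
  "\<And>c. c \<in> U R ==> c \<odot>\<^bsub>L\<^esub> e = \<zero>\<^bsub>L\<^esub> ==> c = \<zero>"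
  by (rule rank_one_module) (rule that)
 note LM = fg_freeD[OF L(1)]
 have "mk (\<lambda>_. L) (fp u L) \<in> N_coll R n p v" using in_class_fp[OF u L(1)] N_coll_eq[OF u] e by blast
 then obtain M a where c: "in_class v M a" "mk (\<lambda>_. L) (fp u L) = mk M a" unfolding N_coll_eq[OF v] by blast
 have "M = (\<lambda>_. L)" "a = fp u L"
  using mk_inject[OF fp_cseq[OF uR L(1)] _ c(2)] c(1) by (auto simp: in_class_def)
 then have h: "holonomy v (\<lambda>_. L) (fp u L) 0" using c(1) by (simp add: in_class_def)
 have ue: "u \<odot>\<^bsub>L\<^esub> e \<in> U L" "v \<odot>\<^bsub>L\<^esub> e \<in> U L" using L(2) LM uR vR by simp_all
 have "chain (\<lambda>_. L) (fp u L) S1 (\<lambda>j. if j = 0 then e else u \<odot>\<^bsub>L\<^esub> e)" unfolding chain_def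
 proof (intro conjI allI impI)
  fix j assume j: "j < n"
  show "fp u L (S1 + j) (if j = 0 then e else u \<odot>\<^bsub>L\<^esub> e) = p \<odot>\<^bsub>L\<^esub> (if Suc j = 0 then e else u \<odot>\<^bsub>L\<^esub> e)"
   using j L(2) ue LM uR fp_first[OF L(2) LM uR] fp_other[OF ue(1), of "Suc j" u] mod_scale_comm[OF LM uR p_carr L(2)] by auto
 qed (use L(2) ue in auto)
 then have "u \<odot>\<^bsub>L\<^esub> e \<ominus>\<^bsub>L\<^esub> v \<odot>\<^bsub>L\<^esub> e \<in> bnd (\<lambda>_. L) (fp u L) 0" using h n_pos unfolding holonomy_def by fastforce
 then obtain y w where y: "y \<in> U L" "w \<in> U L" "u \<odot>\<^bsub>L\<^esub> e \<ominus>\<^bsub>L\<^esub> v \<odot>\<^bsub>L\<^esub> e = fp u L 0 y \<oplus>\<^bsub>L\<^esub> p \<odot>\<^bsub>L\<^esub> w"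
  by (rule bndE)
 have "p \<odot>\<^bsub>L\<^esub> (u \<odot>\<^bsub>L\<^esub> e \<ominus>\<^bsub>L\<^esub> v \<odot>\<^bsub>L\<^esub> e) = \<zero>\<^bsub>L\<^esub>"
  unfolding y(3) using y(1,2) LM uR by (simp add: fp_val mod_smult_radd mod_l_zero mod_scale_comm[of L p u])
 then have "(p \<otimes> (u \<ominus> v)) \<odot>\<^bsub>L\<^esub> e = \<zero>\<^bsub>L\<^esub>"
  using L(2) ue LM uR vR by (simp add: a_minus_def mod_smult_assoc mod_smult_ladd mod_smult_lneg)
 then have "p \<otimes> (u \<ominus> v) = \<zero>" using L(3) uR vR by simp
 then have "p \<otimes> u \<ominus> p \<otimes> v = \<zero>" using uR vR by (simp add: a_minus_def r_distr r_minus)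
 moreover have "p \<otimes> u = (p \<otimes> u \<ominus> p \<otimes> v) \<oplus> p \<otimes> v" using uR vR p_carr by algebra
 ultimately have "p \<otimes> u = p \<otimes> v" using uR vR by simp
 then show ?thesis using uR vR by (simp add: m_comm)
qed

theorem classification:
 "\<exists>\<Phi> :: 'a set => (nat => ('a, 'm) mod_arrow) set.
   (\<forall>u \<in> Units R. \<Phi> (unit_rel R p `` {u}) = N_coll R n p u) \<and>
   bij_betw \<Phi> (Units R // unit_rel R p) {N. n_angulation (free_mod R) n N}"
proof (intro exI conjI ballI)
 let ?\<Phi> = "\<lambda>c. \<Union>u\<in>c. N_coll R n p u :: (nat => ('a, 'm) mod_arrow) set"
 have \<Phi>: "?\<Phi> (unit_rel R p `` {u}) = N_coll R n p u" if u: "u \<in> Units R" for u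
 proof -
  have "u \<in> unit_rel R p `` {u}" using u by (simp add: unit_rel_def)
  moreover have "(N_coll R n p v :: (nat => ('a, 'm) mod_arrow) set) = N_coll R n p u" if "v \<in> unit_rel R p `` {u}" for v
   using N_coll_cong[of u v R p n] that by auto
  ultimately show ?thesis by blast
 qed
 then show "?\<Phi> (unit_rel R p `` {u}) = N_coll R n p u" if "u \<in> Units R" for u using that .
 show "bij_betw ?\<Phi> (Units R // unit_rel R p) {N. n_angulation C n N}" unfolding bij_betw_def
 proof
  show "inj_on ?\<Phi> (Units R // unit_rel R p)"
  proof (rule inj_onI)
   fix c d assume "c \<in> Units R // unit_rel R p" "d \<in> Units R // unit_rel R p" and e: "?\<Phi> c = ?\<Phi> d"
   then obtain u v where u: "u \<in> Units R" "c = unit_rel R p `` {u}" and v: "v \<in> Units R" "d = unit_rel R p `` {v}"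
    by (auto elim!: quotientE)
   have "(N_coll R n p u :: (nat => ('a, 'm) mod_arrow) set) = N_coll R n p v" using e \<Phi>[OF u(1)] \<Phi>[OF v(1)] u(2) v(2) by simp
   then have "u \<otimes> p = v \<otimes> p" by (rule N_coll_determines_class[OF u(1) v(1)])
   then have "(u, v) \<in> unit_rel R p" using u v by (simp add: unit_rel_def)
   then show "c = d" unfolding u(2) v(2) by (rule equiv_class_eq[OF equiv_unit_rel])
  qed
  show "?\<Phi> ` (Units R // unit_rel R p) = {N. n_angulation C n N}"
  proof
   show "?\<Phi> ` (Units R // unit_rel R p) \<subseteq> {N. n_angulation C n N}"
    using N_coll_angulation \<Phi> by (auto elim!: quotientE)
   show "{N. n_angulation C n N} \<subseteq> ?\<Phi> ` (Units R // unit_rel R p)"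
   proof
    fix \<N> :: "(nat => ('a, 'm) mod_arrow) set" assume "\<N> \<in> {N. n_angulation C n N}"
    then interpret A: angulation R p universe n \<N> by unfold_locales simp
    obtain u where u: "u \<in> Units R" "\<N> = N_coll R n p u" by (rule A.angulation_is_N_coll)
    then have "\<N> = ?\<Phi> (unit_rel R p `` {u})" using \<Phi> by simp
    then show "\<N> \<in> ?\<Phi> ` (Units R // unit_rel R p)" using quotientI[OF u(1)] by (rule image_eqI)
   qed
  qed
 qed
qed

end

text \<open>
 An element \<open>a\<close> outside the maximal ideal generates the unit ideal together with it, so that
 \<open>c a = 1 - b p\<close> for some \<open>b\<close> and \<open>c\<close>.
\<close>

lemma square_zero_local_ring:
 fixes R (structure)
 assumes loc: "local_ring_with_maximal_ideal R \<mm>" and p: "p \<in> U R" and \<mm>: "\<mm> = PIdl p"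
  and nz: "\<mm> \<noteq> {\<zero>}" and sq: "\<mm> \<cdot>\<^bsub>R\<^esub> \<mm> = {\<zero>}"
 shows "square_zero_local R p"
proof -
 interpret cring R using loc by (simp add: local_ring_with_maximal_ideal_def)
 interpret mx: maximalideal \<mm> R using loc by (simp add: local_ring_with_maximal_ideal_def)
 have mem: "x \<in> \<mm> \<longleftrightarrow> (\<exists>b\<in>U R. x = b \<otimes> p)" for x unfolding \<mm> cgenideal_def by blast
 have pm: "p \<in> \<mm>" unfolding \<mm> by (rule cgenideal_self[OF p])
 have "p \<otimes> p \<in> \<mm> \<cdot>\<^bsub>R\<^esub> \<mm>" using pm pm by (rule ideal_prod.prod)
 then have pp: "p \<otimes> p = \<zero>" using sq by simp
 show ?thesis
 proof unfold_locales
  show "p \<in> U R" by (rule p)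
  show "p \<otimes> p = \<zero>" by (rule pp)
  show "p \<noteq> \<zero>"
  proof
   assume p0: "p = \<zero>"
   have "x = \<zero>" if x: "x \<in> \<mm>" for x
   proof -
    obtain b where "b \<in> U R" "x = b \<otimes> p" using x mem by blast
    then show ?thesis using p0 by simp
   qed
   moreover have "\<zero> \<in> \<mm>" by simp
   ultimately show False using nz by blast
  qed
  fix a assume a: "a \<in> U R"
  show "a \<in> Units R \<or> (\<exists>b\<in>U R. a = p \<otimes> b)"
  proof (cases "a \<in> \<mm>")
   case True
   then obtain b where "b \<in> U R" "a = b \<otimes> p" using mem by blast
   then show ?thesis using p by (auto simp: m_comm)
  next
   case False
   let ?J = "\<mm> <+>\<^bsub>R\<^esub> PIdl a"
   have id: "ideal (PIdl a) R" by (rule cgenideal_ideal[OF a])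
   have J: "ideal ?J R" by (rule add_ideals[OF mx.is_ideal id])
   have inJ: "x \<oplus> y \<in> ?J" if "x \<in> \<mm>" "y \<in> PIdl a" for x y using that by (auto simp: set_add_def set_mult_def)
   have "\<mm> \<subseteq> ?J"
   proof
    fix x assume x: "x \<in> \<mm>"
    have "x \<oplus> \<zero> \<in> ?J" using x additive_subgroup.zero_closed[OF ideal.axioms(1)[OF id]] by (rule inJ)
    then show "x \<in> ?J" using mx.Icarr[OF x] by simp
   qed
   moreover have "a \<in> ?J" using inJ[of \<zero> a] cgenideal_self[OF a] a by simp
   ultimately have "?J = U R"
    using mx.I_maximal[OF J] False ideal.axioms(1)[OF J, THEN additive_subgroup.a_subset] by auto
   then have "\<one> \<in> ?J" by simp
   then obtain x y where "x \<in> \<mm>" "y \<in> PIdl a" "\<one> = x \<oplus> y" by (auto simp: set_add_def set_mult_def)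
   moreover obtain b where "b \<in> U R" "x = b \<otimes> p" using \<open>x \<in> \<mm>\<close> mem by blast
   moreover obtain c where "c \<in> U R" "y = c \<otimes> a" using \<open>y \<in> PIdl a\<close> unfolding cgenideal_def by blast
   ultimately obtain b c where bc: "b \<in> U R" "c \<in> U R" "\<one> = b \<otimes> p \<oplus> c \<otimes> a" by blast
   \<comment> \<open>As \<open>p\<close> squares to zero, \<open>1 + bp\<close> is an inverse of \<open>1 - bp = ca\<close>.\<close>
   have ca: "c \<otimes> a = \<one> \<ominus> b \<otimes> p"
   proof -
    have "c \<otimes> a = (b \<otimes> p \<oplus> c \<otimes> a) \<ominus> b \<otimes> p" using bc(1,2) a p by algebra
    then show ?thesis using bc(3) by simp
   qed
   have "a \<otimes> (c \<otimes> (\<one> \<oplus> b \<otimes> p)) = (\<one> \<ominus> b \<otimes> p) \<otimes> (\<one> \<oplus> b \<otimes> p)"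
    unfolding ca[symmetric] using bc(1,2) a p by algebra
   also have "\<dots> = \<one> \<ominus> (b \<otimes> b) \<otimes> (p \<otimes> p)" using bc(1) p by algebra
   also have "\<dots> = \<one>" using bc(1) by (simp add: pp a_minus_def)
   finally have "a \<otimes> (c \<otimes> (\<one> \<oplus> b \<otimes> p)) = \<one>" .
   moreover have "c \<otimes> (\<one> \<oplus> b \<otimes> p) \<in> U R" using bc(1,2) p by simp
   ultimately have "a \<in> Units R" using a m_comm[OF a] unfolding Units_def by auto
   then show ?thesis ..
  qed
 qed
qed

theorem corollary4p2:
 fixes R :: "('a, 'r) ring_scheme" and p :: 'a and \<mm> :: "'a set" and n :: nat
 assumes "local_ring_with_maximal_ideal R \<mm>"
  and "p \<in> carrier R" and "\<mm> = PIdl\<^bsub>R\<^esub> p"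
  and "\<mm> \<noteq> {\<zero>\<^bsub>R\<^esub>}" and "\<mm> \<cdot>\<^bsub>R\<^esub> \<mm> = {\<zero>\<^bsub>R\<^esub>}"
  and "n \<ge> 3"
  and "even n \<or> p \<oplus>\<^bsub>R\<^esub> p = \<zero>\<^bsub>R\<^esub>"
  and "has_free_modules R TYPE('m)"
 shows "equiv (Units R) (unit_rel R p) \<and>
  (\<exists>\<Phi> :: 'a set \<Rightarrow> (nat \<Rightarrow> ('a, 'm) mod_arrow) set.
    (\<forall>u \<in> Units R. \<Phi> (unit_rel R p `` {u}) = N_coll R n p u) \<and>
    bij_betw \<Phi> (Units R // unit_rel R p) {N. n_angulation (free_mod R) n N})"
proof -
 interpret square_zero_local R p by (rule square_zero_local_ring[OF assms(1-5)])
 interpret angulation_setting R p "TYPE('m)" n by unfold_locales (fact assms)+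
 show ?thesis by (rule conjI[OF equiv_unit_rel classification])
qed

end
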